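(* Let $S\subset \mathcal V_k$ be finite and $A \in \mathrm M_n(\mathfrak o_S)$. Let $((f_1,\boldsymbol\lambda_1), \dotsc, (f_e,\boldsymbol\lambda_e))$ be an elementary divisor vector of $A$ over $k$. Write $k_i = k[X]/(f_i)$ and let $\mathfrak o_i$ denote the ring of integers of $k_i$. Then for almost all $v \in \mathcal V_k$, $$\zeta_{A,\mathfrak o_v}(s) = \prod_{i=1}^e\prod_{j=1}^{|\boldsymbol\lambda_i|} \prod_{\substack{w \in \mathcal V_{k_i}\\ w\mid v}} \zeta_{\mathfrak o_{i,w}}\bigl( (\boldsymbol\lambda_i^* )^{-1}(j) \cdot s - j + 1\bigr).$$
   Context: $k$ is a number field. For a number field $k'$, $\mathcal V_{k'}$ is its set of non-Archimedean places. For $v\in\mathcal V_k$, $\mathfrak o_v$ is the valuation ring of the completion $k_v$; similarly $\mathfrak o_{i,w}$ is the valuation ring of the $w$-adic completion of $k_i$. For $S\subset\mathcal V_k$, $\mathfrak o_S=\bigcap_{v\in\mathcal V_k\setminus S}\mathfrak o_v\cap k$. "Almost all" means all but finitely many. Let $n\ge1$. For almost all $v$, $A\in\mathrm M_n(\mathfrak o_v)$, and $\zeta_{A,\mathfrak o_v}(s)=\sum_{m\ge1}a_m m^{-s}$, where $a_m$ is the number of $A$-invariant $\mathfrak o_v$-submodules of $\mathfrak o_v^n$ of index $m$ (matrices act on row vectors by right multiplication). For a ring $R=\mathfrak o_{i,w}$ with residue field size $q_w$, $\zeta_R(s)=\sum_I|R:I|^{-s}=(1-q_w^{-s})^{-1}$,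 the sum over ideals of finite index. A partition $\boldsymbol\lambda=(\lambda_1,\dots,\lambda_r)$ is a non-increasing sequence of positive integers; $|\boldsymbol\lambda|=\sum\lambda_i$; $\boldsymbol\lambda^{-1}(j)=\min\{i: j\le\lambda_1+\dots+\lambda_i\}$ for $1\le j\le|\boldsymbol\lambda|$; the dual partition is $\boldsymbol\lambda^*=(\mu_1,\dots,\mu_{\lambda_1})$ with $\mu_i=\#\{j:\lambda_j\ge i\}$. For monic $f=X^m+a_{m-1}X^{m-1}+\dots+a_0$, $\mathsf C(f)$ is the companion matrix with ones on the superdiagonal, last row $(-a_0,\dots,-a_{m-1})$, and zeros elsewhere. An elementary divisor vector of $A$ over $k$ is $((f_1,\boldsymbol\lambda_1),\dots,(f_e,\boldsymbol\lambda_e))$ with pairwise distinct monic irreducible $f_i\in k[X]$ and partitions $\boldsymbol\lambda_i=(\lambda_{i,1},\lambda_{i,2},\dots)$ of positive integers such that $A$ is similar over $k$ to the block diagonal matrix with blocks $\mathsf C(f_i^{\lambda_{i,j}})$, over all $i$ and all parts $\lambda_{i,j}$ of $\boldsymbol\lambda_i$; it is unique up to reordering. *)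

theory Defs
  imports
    "HOL-Analysis.Analysis"
    "HOL-Algebra.QuotRing"
    "HOL-Algebra.Algebraic_Closure_Type"
    "Jordan_Normal_Form.Matrix"
begin

definition is_number_field :: "'k::field_char_0 itself \<Rightarrow> bool" where
  "is_number_field _ \<longleftrightarrow>
     (\<exists>B::'k set. finite_dimensional_vector_space (\<lambda>(q::rat) x. of_rat q * x) B)"

abbreviation field_ring :: "'k::field_char_0 itself \<Rightarrow> 'k ring" where
  "field_ring _ \<equiv> ring_of_type_algebra"

definition root_field :: "'k::field_char_0 poly \<Rightarrow> 'k poly set ring" where
  "root_field f = ring_of_type_algebra Quot (PIdl\<^bsub>ring_of_type_algebra\<^esub> f)"

definition root_field_emb :: "'k::field_char_0 poly \<Rightarrow> 'k \<Rightarrow> 'k poly set" where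
  "root_field_emb f c = PIdl\<^bsub>ring_of_type_algebra\<^esub> f +>\<^bsub>ring_of_type_algebra\<^esub> [:c:]"

definition nonarch_abs :: "('a, 'b) ring_scheme \<Rightarrow> ('a \<Rightarrow> real) \<Rightarrow> bool" where
  "nonarch_abs F a \<longleftrightarrow>
     (\<forall>x\<in>carrier F. 0 \<le> a x \<and> (a x = 0 \<longleftrightarrow> x = \<zero>\<^bsub>F\<^esub>)) \<and>
     (\<forall>x\<in>carrier F. \<forall>y\<in>carrier F. a (x \<otimes>\<^bsub>F\<^esub> y) = a x * a y) \<and>
     (\<forall>x\<in>carrier F. \<forall>y\<in>carrier F. a (x \<oplus>\<^bsub>F\<^esub> y) \<le> max (a x) (a y)) \<and>
     (\<exists>x\<in>carrier F. x \<noteq> \<zero>\<^bsub>F\<^esub> \<and> a x \<noteq> 1)"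

text \<open>
  A place is an equivalence class of non-trivial absolute values. Values outside the carrier are
  not constrained, so each class contains all variants of its members off the carrier and a place
  is never counted twice.
\<close>

definition nonarch_places :: "('a, 'b) ring_scheme \<Rightarrow> ('a \<Rightarrow> real) set set" where
  "nonarch_places F = {a. nonarch_abs F a} //
     {(a, b). nonarch_abs F a \<and> nonarch_abs F b \<and>
              (\<exists>t>0. \<forall>x\<in>carrier F. b x = a x powr t)}"

definition places_above ::
    "'k::field_char_0 poly \<Rightarrow> ('k \<Rightarrow> real) set \<Rightarrow> ('k poly set \<Rightarrow> real) set set" where
  "places_above f v = {w \<in> nonarch_places (root_field f). \<forall>b\<in>w. b \<circ> root_field_emb f \<in> v}"

definition cauchy_ring :: "('a, 'b) ring_scheme \<Rightarrow> ('a \<Rightarrow> real) \<Rightarrow> (nat \<Rightarrow> 'a) ring" where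
  "cauchy_ring F a =
     \<lparr>carrier = {x. (\<forall>n. x n \<in> carrier F) \<and>
                     (\<forall>\<epsilon>>0. \<exists>N. \<forall>m\<ge>N. \<forall>n\<ge>N. a (x m \<ominus>\<^bsub>F\<^esub> x n) < \<epsilon>)},
      monoid.mult = (\<lambda>x y n. x n \<otimes>\<^bsub>F\<^esub> y n), one = (\<lambda>n. \<one>\<^bsub>F\<^esub>),
      zero = (\<lambda>n. \<zero>\<^bsub>F\<^esub>), add = (\<lambda>x y n. x n \<oplus>\<^bsub>F\<^esub> y n)\<rparr>"

definition null_seqs :: "('a, 'b) ring_scheme \<Rightarrow> ('a \<Rightarrow> real) \<Rightarrow> (nat \<Rightarrow> 'a) set" where
  "null_seqs F a = {x \<in> carrier (cauchy_ring F a). (\<lambda>n. a (x n)) \<longlonglongrightarrow> 0}"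

definition completion :: "('a, 'b) ring_scheme \<Rightarrow> ('a \<Rightarrow> real) \<Rightarrow> (nat \<Rightarrow> 'a) set ring" where
  "completion F a = cauchy_ring F a Quot null_seqs F a"

definition completion_emb :: "('a, 'b) ring_scheme \<Rightarrow> ('a \<Rightarrow> real) \<Rightarrow> 'a \<Rightarrow> (nat \<Rightarrow> 'a) set" where
  "completion_emb F a x = null_seqs F a +>\<^bsub>cauchy_ring F a\<^esub> (\<lambda>n. x)"

definition completion_abs :: "('a \<Rightarrow> real) \<Rightarrow> (nat \<Rightarrow> 'a) set \<Rightarrow> real" where
  "completion_abs a c = (THE r. \<forall>x\<in>c. (\<lambda>n. a (x n)) \<longlonglongrightarrow> r)"

definition valuation_ring :: "('a, 'b) ring_scheme \<Rightarrow> ('a \<Rightarrow> real) \<Rightarrow> (nat \<Rightarrow> 'a) set ring" where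
  "valuation_ring F a =
     (completion F a)\<lparr>carrier := {c \<in> carrier (completion F a). completion_abs a c \<le> 1}\<rparr>"

text \<open>
  The choice of representative below is immaterial: equivalent absolute values have the same
  Cauchy sequences, the same null sequences and the same unit ball, so \<open>place_emb\<close> and
  \<open>place_ring\<close> depend only on the place.
\<close>

definition place_abs :: "('a \<Rightarrow> real) set \<Rightarrow> 'a \<Rightarrow> real" where
  "place_abs v = (SOME a. a \<in> v)"

definition place_emb :: "('a, 'b) ring_scheme \<Rightarrow> ('a \<Rightarrow> real) set \<Rightarrow> 'a \<Rightarrow> (nat \<Rightarrow> 'a) set" where
  "place_emb F v = completion_emb F (place_abs v)"

definition place_ring :: "('a, 'b) ring_scheme \<Rightarrow> ('a \<Rightarrow> real) set \<Rightarrow> (nat \<Rightarrow> 'a) set ring" where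
  "place_ring F v = valuation_ring F (place_abs v)"

definition S_integers :: "('a, 'b) ring_scheme \<Rightarrow> ('a \<Rightarrow> real) set set \<Rightarrow> 'a set" where
  "S_integers F S =
     {x \<in> carrier F. \<forall>v \<in> nonarch_places F - S. place_emb F v x \<in> carrier (place_ring F v)}"

text \<open>
  In both zeta functions, the index of a submodule is the number of its cosets. Since
  \<open>card\<close> of an infinite set is \<open>0\<close>, submodules of infinite index have to be
  excluded; for \<open>inv_submodule_count\<close> this is achieved by only using it with
  \<open>m \<ge> 1\<close>.
\<close>

definition ideal_zeta :: "('a, 'b) ring_scheme \<Rightarrow> complex \<Rightarrow> complex" where
  "ideal_zeta R s =
     (\<Sum>\<^sub>\<infinity> I \<in> {I. ideal I R \<and> finite (a_rcosets\<^bsub>R\<^esub> I)}. of_nat (card (a_rcosets\<^bsub>R\<^esub> I)) powr (- s))"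

text \<open>
  The module $R^n$ of row vectors. The ring multiplication and unit of the \<open>module\<close>
  record are irrelevant, as in \<open>module_vec\<close>.
\<close>

definition row_module :: "('a, 'b) ring_scheme \<Rightarrow> nat \<Rightarrow> ('a, 'a vec) module" where
  "row_module R n =
     \<lparr>carrier = {x \<in> carrier_vec n. \<forall>i<n. x $ i \<in> carrier R},
      monoid.mult = undefined, one = undefined,
      zero = vec n (\<lambda>i. \<zero>\<^bsub>R\<^esub>),
      add = (\<lambda>x y. vec n (\<lambda>i. x $ i \<oplus>\<^bsub>R\<^esub> y $ i)),
      module.smult = (\<lambda>c x. vec n (\<lambda>i. c \<otimes>\<^bsub>R\<^esub> x $ i))\<rparr>"

definition row_mult :: "('a, 'b) ring_scheme \<Rightarrow> nat \<Rightarrow> 'a vec \<Rightarrow> 'a mat \<Rightarrow> 'a vec" where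
  "row_mult R n x A = vec n (\<lambda>j. \<Oplus>\<^bsub>R\<^esub>i\<in>{..<n}. x $ i \<otimes>\<^bsub>R\<^esub> A $$ (i, j))"

definition inv_submodule_count :: "('a, 'b) ring_scheme \<Rightarrow> nat \<Rightarrow> 'a mat \<Rightarrow> nat \<Rightarrow> nat" where
  "inv_submodule_count R n A m =
     card {H. submodule H R (row_module R n) \<and> (\<forall>x\<in>H. row_mult R n x A \<in> H) \<and>
              card (a_rcosets\<^bsub>row_module R n\<^esub> H) = m}"

definition submodule_zeta_term ::
    "('a, 'b) ring_scheme \<Rightarrow> nat \<Rightarrow> 'a mat \<Rightarrow> complex \<Rightarrow> nat \<Rightarrow> complex" where
  "submodule_zeta_term R n A s m = of_nat (inv_submodule_count R n A m) * of_nat m powr (- s)"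

definition submodule_zeta :: "('a, 'b) ring_scheme \<Rightarrow> nat \<Rightarrow> 'a mat \<Rightarrow> complex \<Rightarrow> complex" where
  "submodule_zeta R n A s = (\<Sum>\<^sub>\<infinity> m\<in>{1..}. submodule_zeta_term R n A s m)"

definition is_partition :: "nat list \<Rightarrow> bool" where
  "is_partition ls \<longleftrightarrow> sorted_wrt (\<ge>) ls \<and> 0 \<notin> set ls"

text \<open>$\lambda^{-1}(j)$, counted from $1$, for $1 \le j \le |\lambda|$.\<close>

definition partition_inv :: "nat list \<Rightarrow> nat \<Rightarrow> nat" where
  "partition_inv ls j = (LEAST i. j \<le> sum_list (take i ls))"

definition dual_partition :: "nat list \<Rightarrow> nat list" where
  "dual_partition ls = map (\<lambda>i. card {j. j < length ls \<and> i \<le> ls ! j}) [1..<Suc (hd ls)]"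

definition companion_matrix :: "'k::field_char_0 poly \<Rightarrow> 'k mat" where
  "companion_matrix f = (let m = Polynomial.degree f in
     mat m m (\<lambda>(i, j). if Suc i = m then - Polynomial.coeff f j else if j = Suc i then 1 else 0))"

text \<open>
  The partitions are required to be non-empty; otherwise elementary divisor vectors would not be
  unique up to reordering.
\<close>

definition elementary_divisor_vector ::
    "'k::field_char_0 mat \<Rightarrow> ('k poly \<times> nat list) list \<Rightarrow> bool" where
  "elementary_divisor_vector A ed \<longleftrightarrow>
     distinct (map fst ed) \<and>
     (\<forall>(f, ls)\<in>set ed. Polynomial.lead_coeff f = 1 \<and> Factorial_Ring.irreducible f \<and> is_partition ls \<and> ls \<noteq> []) \<and>
     similar_mat A
       (diag_block_mat (concat (map (\<lambda>(f, ls). map (\<lambda>l. companion_matrix (f ^ l)) ls) ed)))"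

end

theory Submission
  imports Defs "HOL-Library.Function_Algebras"
begin

text \<open>For almost all places \<open>v\<close>, the matrices transforming \<open>A\<close> into its rational canonical form are
  integral at \<open>v\<close>, and the polynomials \<open>f\<^sub>i\<close> are separable and pairwise comaximal over the
  valuation ring \<open>O\<close> of \<open>v\<close> in \<open>k\<close>. Then \<open>O\<^sup>n\<close>, as a module over \<open>R = O[X]\<close> with \<open>X\<close> acting through
  \<open>A\<close>, is the direct sum of the modules \<open>R / (f\<^sub>i\<^sup>\<lambda>)\<close> given by the elementary divisors. The
  submodules \<open>H\<close> of finite index in such a sum \<open>M\<close> are counted by fibring over \<open>H \<inter> f M\<close> with
  \<open>f = f\<^sub>i\<close>: a fibre contributes a product of \<open>m\<close> shifted ideal zeta functions of \<open>R / (f)\<close>, where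
  \<open>m\<close> is the number of summands with \<open>f\<^sub>i = f\<close> and positive exponent, and all
  exponents of \<open>f\<close> drop by one from \<open>M\<close> to \<open>f M\<close>. So the numbers \<open>m\<close> run through the dual partition.
  By separability, \<open>R / (f)\<close> is the intersection of the valuation rings of \<open>k[X] / (f)\<close> above \<open>v\<close>, a
  semilocal principal ideal ring whose ideal zeta function is the product of those of its
  localizations. The completions enter only at the very end: a subgroup of index \<open>m\<close> contains all
  multiples of \<open>m\<close>, so completing does not change the numbers of submodules or ideals.\<close>

section \<open>Index of subgroups\<close>

text \<open>The sum over the fibre above \<open>H1 = H \<inter> f M\<close> depends on more than the
  index of \<open>H1\<close>: it also involves the index of \<open>f (f M) + H1\<close> in
  \<open>f M\<close>. The one-variable sum therefore does not reproduce itself when passing from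
  \<open>M\<close> to \<open>f M\<close>. This is why a second variable \<open>t\<close> is carried
  along, which weights \<open>H\<close> by the index of \<open>f M + H\<close> in \<open>M\<close>.
  Removing a layer with \<open>m\<close> summands sends \<open>(s, t)\<close> to
  \<open>(s, s + t - m)\<close>. Starting from \<open>t = 0\<close>, after \<open>i\<close> layers
  \<open>t\<close> equals \<open>i * s\<close> minus the number of summands met so far, and this
  produces the multiples of \<open>s\<close> and the shifts in the product formula. Each further
  summand lowers the argument by one, because a generator of an ideal of \<open>R / (f)\<close> can
  be lifted in as many ways as there are cosets of the part already chosen. Absolute convergence
  comes from the same recursion at the real parts of \<open>s\<close> and \<open>t\<close>; hence
  the induction hypotheses range over all arguments with given real parts. Quotients such as
  \<open>R / (f)\<close> are handled as subsets of a ring type together with congruence modulo a set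
  \<open>Z\<close>, so that modules and lattices remain plain sets.\<close>

definition subgp :: "'a::ab_group_add set \<Rightarrow> bool" where
  "subgp H \<longleftrightarrow> 0 \<in> H \<and> (\<forall>x\<in>H. \<forall>y\<in>H. x - y \<in> H)"

definition cosets :: "'a::ab_group_add set \<Rightarrow> 'a set \<Rightarrow> 'a set set" where
  "cosets G H = (\<lambda>x. (+) x ` H) ` G"

abbreviation fin_idx :: "'a::ab_group_add set \<Rightarrow> 'a set \<Rightarrow> bool" where
  "fin_idx G H \<equiv> finite (cosets G H)"

text \<open>An infinite index has the value 0 here, so finiteness is tracked separately by
  \<open>fin_idx\<close>.\<close>

definition idx :: "'a::ab_group_add set \<Rightarrow> 'a set \<Rightarrow> nat" where
  "idx G H = card (cosets G H)"

definition set_add :: "'a::ab_group_add set \<Rightarrow> 'a set \<Rightarrow> 'a set" (infixl "[+]" 65) where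
  "A [+] B = {x + y | x y. x \<in> A \<and> y \<in> B}"

lemma subgp_zero: "subgp H \<Longrightarrow> 0 \<in> H"
  and subgp_diff: "subgp H \<Longrightarrow> x \<in> H \<Longrightarrow> y \<in> H \<Longrightarrow> x - y \<in> H"
  by (auto simp: subgp_def)

lemma subgp_neg: "subgp H \<Longrightarrow> x \<in> H \<Longrightarrow> - x \<in> H"
  using subgp_diff[of H 0 x] subgp_zero by force

lemma subgp_add: "subgp H \<Longrightarrow> x \<in> H \<Longrightarrow> y \<in> H \<Longrightarrow> x + y \<in> H"
  using subgp_diff[of H x "- y"] subgp_neg by force

lemma subgp_diff_comm: "subgp H \<Longrightarrow> x - y \<in> H \<longleftrightarrow> y - x \<in> H"
  using subgp_neg[of H "x - y"] subgp_neg[of H "y - x"] by auto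

lemma subgp_sum: "subgp H \<Longrightarrow> (\<And>i. i \<in> I \<Longrightarrow> x i \<in> H) \<Longrightarrow> (\<Sum>i\<in>I. x i) \<in> H"
  by (induction I rule: infinite_finite_induct) (auto intro: subgp_zero subgp_add)

lemma subgp_Int: "subgp H \<Longrightarrow> subgp K \<Longrightarrow> subgp (H \<inter> K)"
  by (auto simp: subgp_def)

lemma subgp_set_add: assumes "subgp H" "subgp K" shows "subgp (H [+] K)"
  unfolding subgp_def
proof (intro conjI ballI)
  show "0 \<in> H [+] K" using assms[THEN subgp_zero] by (force simp: set_add_def)
  fix x y assume "x \<in> H [+] K" "y \<in> H [+] K"
  then obtain a b c d where *: "x = a + b" "y = c + d" "a \<in> H" "c \<in> H" "b \<in> K" "d \<in> K"
    by (auto simp: set_add_def)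
  then have "x - y = (a - c) + (b - d)" by simp
  then show "x - y \<in> H [+] K"
    using * assms subgp_diff unfolding set_add_def by blast
qed

lemma set_addI: "x \<in> A \<Longrightarrow> y \<in> B \<Longrightarrow> x + y \<in> A [+] B"
  by (auto simp: set_add_def)

lemma set_addE: assumes "z \<in> A [+] B" obtains x y where "z = x + y" "x \<in> A" "y \<in> B"
  using assms by (auto simp: set_add_def)

lemma set_add_upper1: "subgp B \<Longrightarrow> A \<subseteq> A [+] B"
  using set_addI[of _ A 0 B] subgp_zero[of B] by force

lemma set_add_upper2: "subgp A \<Longrightarrow> B \<subseteq> A [+] B"
  using set_addI[of 0 A _ B] subgp_zero[of A] by force

lemma set_add_least: "subgp G \<Longrightarrow> A \<subseteq> G \<Longrightarrow> B \<subseteq> G \<Longrightarrow> A [+] B \<subseteq> G"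
  by (auto simp: set_add_def intro!: subgp_add)

lemma set_add_commute: "A [+] B = B [+] A"
  by (auto simp: set_add_def) (metis add.commute)+

text \<open>Brings \<open>N [+] (H [+] C)\<close> into the form needed to compare
  \<open>H [+] N\<close> with \<open>H [+] C\<close> by the second isomorphism theorem
  \<open>idx_set_add\<close>.\<close>

lemma set_add_absorb:
  assumes "subgp N" "subgp C" "C \<subseteq> N" shows "N [+] (H [+] C) = H [+] N"
proof (intro subset_antisym subsetI)
  fix z assume "z \<in> N [+] (H [+] C)"
  then obtain n h c where z: "z = n + (h + c)" "n \<in> N" "h \<in> H" "c \<in> C" by (auto elim!: set_addE)
  then have "z = h + (n + c)" "n + c \<in> N" using assms(1,3) by (auto simp: algebra_simps subgp_add)
  then show "z \<in> H [+] N" using z(3) by (simp add: set_addI)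
next
  fix z assume "z \<in> H [+] N"
  then obtain h n where z: "z = h + n" "n \<in> N" "h \<in> H" by (auto elim!: set_addE)
  then have "z = n + (h + 0)" by (simp add: algebra_simps)
  then show "z \<in> N [+] (H [+] C)" using z subgp_zero[OF assms(2)] by (metis set_addI)
qed

lemma coset_self: "subgp H \<Longrightarrow> x \<in> (+) x ` H"
  using subgp_zero[of H] by force

lemma mem_coset: "y \<in> (+) (x::'a::ab_group_add) ` H \<longleftrightarrow> y - x \<in> H"
proof
  show "y \<in> (+) x ` H" if "y - x \<in> H"
    by (rule image_eqI[where x = "y - x"]) (use that in auto)
qed auto

lemma coset_eq_iff: assumes "subgp H" shows "(+) x ` H = (+) y ` H \<longleftrightarrow> x - y \<in> H"
proof
  assume "(+) x ` H = (+) y ` H"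
  with coset_self[OF assms, of x] show "x - y \<in> H" by (simp add: mem_coset)
next
  assume *: "x - y \<in> H"
  have "z - x \<in> H \<longleftrightarrow> z - y \<in> H" for z
    using subgp_add[OF assms, of "z - x" "x - y"] subgp_diff[OF assms, of "z - y" "x - y"] *
    by (auto simp: algebra_simps)
  then show "(+) x ` H = (+) y ` H" by (auto simp: set_eq_iff mem_coset)
qed

definition crep :: "'a::ab_group_add set \<Rightarrow> 'a set \<Rightarrow> 'a set \<Rightarrow> 'a" where
  "crep G H C = (SOME x. x \<in> G \<and> C = (+) x ` H)"

lemma crep: assumes "C \<in> cosets G H" shows "crep G H C \<in> G" "C = (+) (crep G H C) ` H"
proof -
  have "\<exists>x. x \<in> G \<and> C = (+) x ` H" using assms by (auto simp: cosets_def)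
  from someI_ex[OF this] show "crep G H C \<in> G" "C = (+) (crep G H C) ` H"
    unfolding crep_def by auto
qed

lemma cosetsI: "x \<in> G \<Longrightarrow> (+) x ` H \<in> cosets G H"
  by (auto simp: cosets_def)

lemma crep_coset: assumes "subgp H" "x \<in> G"
  shows "crep G H ((+) x ` H) \<in> G" "crep G H ((+) x ` H) - x \<in> H"
  using crep[OF cosetsI[OF assms(2)], of H] coset_eq_iff[OF assms(1)] by metis+

text \<open>The map \<open>\<phi>\<close> need not be additive: it only has to be a morphism of the two equivalence
  relations ``same coset''.\<close>

lemma cosets_bij:
  assumes H: "subgp H" "subgp H'" and \<phi>: "\<And>x. x \<in> G \<Longrightarrow> \<phi> x \<in> G'"
    and iff: "\<And>x y. x \<in> G \<Longrightarrow> y \<in> G \<Longrightarrow> \<phi> x - \<phi> y \<in> H' \<longleftrightarrow> x - y \<in> H"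
    and surj: "\<And>y. y \<in> G' \<Longrightarrow> \<exists>x\<in>G. y - \<phi> x \<in> H'"
  shows "fin_idx G H \<longleftrightarrow> fin_idx G' H'" "idx G H = idx G' H'"
proof -
  let ?F = "\<lambda>C. (+) (\<phi> (crep G H C)) ` H'"
  have "bij_betw ?F (cosets G H) (cosets G' H')"
  proof (rule bij_betw_imageI)
    show "inj_on ?F (cosets G H)"
    proof (rule inj_onI)
      fix C D assume CD: "C \<in> cosets G H" "D \<in> cosets G H" and "?F C = ?F D"
      then have "crep G H C - crep G H D \<in> H"
        using coset_eq_iff[OF H(2)] iff crep(1) by metis
      then show "C = D" using crep(2)[OF CD(1)] crep(2)[OF CD(2)] coset_eq_iff[OF H(1)] by metis
    qed
    show "?F ` cosets G H = cosets G' H'"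
    proof
      show "?F ` cosets G H \<subseteq> cosets G' H'"
        using crep(1) \<phi> by (auto intro!: cosetsI)
      show "cosets G' H' \<subseteq> ?F ` cosets G H"
      proof
        fix D assume "D \<in> cosets G' H'"
        then obtain y where y: "y \<in> G'" "D = (+) y ` H'" by (auto simp: cosets_def)
        with surj obtain x where x: "x \<in> G" "y - \<phi> x \<in> H'" by blast
        have "\<phi> (crep G H ((+) x ` H)) - \<phi> x \<in> H'"
          using crep_coset[OF H(1) x(1)] iff x(1) by blast
        with x have "y - \<phi> (crep G H ((+) x ` H)) \<in> H'"
          using subgp_diff[OF H(2)] by force
        then have "D = ?F ((+) x ` H)" using y coset_eq_iff[OF H(2)] by blast
        then show "D \<in> ?F ` cosets G H" using x cosetsI by blast
      qed
    qed
  qed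
  then show "fin_idx G H \<longleftrightarrow> fin_idx G' H'" "idx G H = idx G' H'"
    by (auto simp: idx_def bij_betw_finite bij_betw_same_card)
qed

text \<open>Sums of representatives of the two smaller coset spaces represent the cosets of
  \<open>H\<close> in \<open>G\<close>. The product formula includes infinite index, where both
  sides are 0.\<close>

lemma idx_tower:
  assumes "subgp N" "subgp H" "subgp G" "H \<subseteq> N" "N \<subseteq> G"
  shows "fin_idx G H \<longleftrightarrow> fin_idx G N \<and> fin_idx N H" "idx G H = idx G N * idx N H"
proof -
  let ?F = "\<lambda>(C, E). (+) (crep G N C + crep N H E) ` H"
  have "bij_betw ?F (cosets G N \<times> cosets N H) (cosets G H)"
  proof (rule bij_betw_imageI)
    show "inj_on ?F (cosets G N \<times> cosets N H)"
    proof (rule inj_onI, clarify)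
      fix C E D F assume *: "C \<in> cosets G N" "D \<in> cosets G N" "E \<in> cosets N H" "F \<in> cosets N H"
        and eq: "(+) (crep G N C + crep N H E) ` H = (+) (crep G N D + crep N H F) ` H"
      then have 1: "(crep G N C - crep G N D) + (crep N H E - crep N H F) \<in> H"
        unfolding coset_eq_iff[OF assms(2)] by (simp add: algebra_simps)
      moreover have "crep N H E - crep N H F \<in> N" using * crep(1) subgp_diff[OF assms(1)] by metis
      ultimately have "crep G N C - crep G N D \<in> N"
        using assms(4) subgp_diff[OF assms(1)] by fastforce
      then have CD: "C = D" using crep(2)[OF *(1)] crep(2)[OF *(2)] coset_eq_iff[OF assms(1)] by metis
      with 1 have "crep N H E - crep N H F \<in> H" by simp
      then have "E = F" using crep(2)[OF *(3)] crep(2)[OF *(4)] coset_eq_iff[OF assms(2)] by metis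
      with CD show "C = D \<and> E = F" by simp
    qed
    show "?F ` (cosets G N \<times> cosets N H) = cosets G H"
    proof
      show "?F ` (cosets G N \<times> cosets N H) \<subseteq> cosets G H"
        using crep(1) assms(5) by (auto intro!: cosetsI subgp_add[OF assms(3)])
      show "cosets G H \<subseteq> ?F ` (cosets G N \<times> cosets N H)"
      proof
        fix D assume "D \<in> cosets G H"
        then obtain x where x: "x \<in> G" "D = (+) x ` H" by (auto simp: cosets_def)
        define r where "r = crep G N ((+) x ` N)"
        have r: "x - r \<in> N" using crep_coset[OF assms(1) x(1)] subgp_diff_comm[OF assms(1)]
          by (auto simp: r_def)
        define e where "e = crep N H ((+) (x - r) ` H)"
        have "e - (x - r) \<in> H" using crep_coset[OF assms(2) r] by (auto simp: e_def)
        then have "x - (r + e) \<in> H" using subgp_diff_comm[OF assms(2)]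
          by (metis diff_diff_eq)
        then have "D = ?F ((+) x ` N, (+) (x - r) ` H)"
          using x(2) coset_eq_iff[OF assms(2)] by (simp add: r_def e_def)
        then show "D \<in> ?F ` (cosets G N \<times> cosets N H)" using x r cosetsI by blast
      qed
    qed
  qed
  moreover have "cosets G N \<noteq> {}" "cosets N H \<noteq> {}"
    using assms subgp_zero unfolding cosets_def by blast+
  ultimately show "fin_idx G H \<longleftrightarrow> fin_idx G N \<and> fin_idx N H" "idx G H = idx G N * idx N H"
    by (auto simp: idx_def bij_betw_finite[symmetric] finite_cartesian_product_iff
        bij_betw_same_card[symmetric] card_cartesian_product[symmetric])
qed

lemma idx_pos: "subgp G \<Longrightarrow> fin_idx G H \<Longrightarrow> idx G H > 0"
  using subgp_zero[of G] by (auto simp: idx_def card_gt_0_iff cosets_def)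

lemma idx_self: assumes "subgp G" shows "fin_idx G G" "idx G G = 1"
proof -
  have "cosets G G = {(+) 0 ` G}"
    using coset_eq_iff[OF assms, of _ 0] subgp_zero[OF assms] by (auto simp: cosets_def)
  then show "fin_idx G G" "idx G G = 1" by (auto simp: idx_def)
qed

lemma idx_mono_fin: assumes "subgp N" "subgp H" "subgp G" "H \<subseteq> N" "N \<subseteq> G" "fin_idx G H"
  shows "fin_idx G N" "fin_idx N H"
  using assms idx_tower by blast+

text \<open>Second isomorphism theorem: every coset of \<open>B\<close> in \<open>A [+] B\<close>
  meets \<open>A\<close>.\<close>

lemma idx_set_add:
  assumes "subgp A" "subgp B"
  shows "fin_idx (A [+] B) B \<longleftrightarrow> fin_idx A (A \<inter> B)" "idx (A [+] B) B = idx A (A \<inter> B)"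
proof -
  have s: "\<exists>x\<in>A. y - x \<in> B" if "y \<in> A [+] B" for y
    using that by (metis set_addE add_diff_cancel_left')
  have m: "x \<in> A [+] B" if "x \<in> A" for x using set_add_upper1[OF assms(2), of A] that by auto
  have i: "x - y \<in> B \<longleftrightarrow> x - y \<in> A \<inter> B" if "x \<in> A" "y \<in> A" for x y
    using subgp_diff[OF assms(1)] that by auto
  note * = cosets_bij[OF subgp_Int[OF assms] assms(2), of A "\<lambda>x. x", OF m i s]
  show "fin_idx (A [+] B) B \<longleftrightarrow> fin_idx A (A \<inter> B)" "idx (A [+] B) B = idx A (A \<inter> B)"
    using * by auto
qed

text \<open>First isomorphism theorem, with surjectivity only modulo \<open>H'\<close>: approximate
  preimages are enough, and this is how weak approximation enters index computations later.\<close>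

lemma idx_hom:
  assumes "subgp G" "subgp H'"
    and "\<And>x y. x \<in> G \<Longrightarrow> y \<in> G \<Longrightarrow> \<phi> (x - y) = \<phi> x - \<phi> y"
    and "\<And>x. x \<in> G \<Longrightarrow> \<phi> x \<in> G'"
    and "\<And>y. y \<in> G' \<Longrightarrow> \<exists>x\<in>G. y - \<phi> x \<in> H'"
  shows "subgp {x\<in>G. \<phi> x \<in> H'}"
    "fin_idx G {x\<in>G. \<phi> x \<in> H'} \<longleftrightarrow> fin_idx G' H'" "idx G {x\<in>G. \<phi> x \<in> H'} = idx G' H'"
proof -
  have "\<phi> 0 = 0" using assms(3)[of 0 0] subgp_zero[OF assms(1)] by simp
  then show *: "subgp {x\<in>G. \<phi> x \<in> H'}"
    using assms(1-3) unfolding subgp_def by auto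
  have "x - y \<in> {x\<in>G. \<phi> x \<in> H'} \<longleftrightarrow> \<phi> x - \<phi> y \<in> H'" if "x \<in> G" "y \<in> G" for x y
    using that assms(3) subgp_diff[OF assms(1)] by auto
  from cosets_bij[OF * assms(2), of G \<phi> G', OF assms(4) this[symmetric] assms(5)]
  show "fin_idx G {x\<in>G. \<phi> x \<in> H'} \<longleftrightarrow> fin_idx G' H'" "idx G {x\<in>G. \<phi> x \<in> H'} = idx G' H'"
    by auto
qed

lemma idx_eq_1D: assumes "subgp G" "subgp H" "H \<subseteq> G" "idx G H = 1" shows "H = G"
proof -
  obtain C where C: "cosets G H = {C}" using assms(4) card_1_singletonE by (auto simp: idx_def)
  have "x \<in> H" if "x \<in> G" for x
  proof -
    have "(+) x ` H = (+) 0 ` H" using cosetsI[OF that, of H] cosetsI[OF subgp_zero[OF assms(1)], of H] unfolding C by simp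
    then show ?thesis using coset_eq_iff[OF assms(2), of x 0] by simp
  qed
  with assms(3) show ?thesis by auto
qed

lemma fin_idxI:
  assumes "subgp H" "finite F" "\<And>x. x \<in> G \<Longrightarrow> \<exists>y\<in>F. x - y \<in> H"
  shows "fin_idx G H"
proof -
  have "cosets G H \<subseteq> (\<lambda>y. (+) y ` H) ` F"
  proof
    fix C assume "C \<in> cosets G H"
    then obtain x where x: "x \<in> G" "C = (+) x ` H" by (auto simp: cosets_def)
    then obtain y where "y \<in> F" "x - y \<in> H" using assms(3) by blast
    then show "C \<in> (\<lambda>y. (+) y ` H) ` F" using x(2) coset_eq_iff[OF assms(1)] by blast
  qed
  then show ?thesis using assms(2) finite_subset by blast
qed

text \<open>A finite quotient group is killed by its order: sum all elements of the quotient, before and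
  after translation by \<open>x\<close>.\<close>

lemma idx_kills:
  assumes "subgp G" "subgp H" "H \<subseteq> G" "fin_idx G H" "x \<in> G"
  shows "(\<Sum>i<idx G H. x) \<in> H"
proof -
  let ?Q = "cosets G H" and ?r = "crep G H"
  let ?t = "\<lambda>C. (+) (?r C + x) ` H"
  have mem: "?r C + x \<in> G" if "C \<in> ?Q" for C using crep(1)[OF that] assms(5) subgp_add[OF assms(1)] by blast
  have inj: "inj_on ?t ?Q"
  proof (rule inj_onI)
    fix C D assume CD: "C \<in> ?Q" "D \<in> ?Q" "?t C = ?t D"
    then have "?r C - ?r D \<in> H" using coset_eq_iff[OF assms(2)] by (metis add_diff_cancel_right)
    then show "C = D" using crep(2)[OF CD(1)] crep(2)[OF CD(2)] coset_eq_iff[OF assms(2)] by metis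
  qed
  have bij: "bij_betw ?t ?Q ?Q"
    using inj mem assms(4) endo_inj_surj[of ?Q ?t] unfolding bij_betw_def
    by (auto intro!: cosetsI)
  obtain e where e: "bij_betw e {..<idx G H} ?Q"
    using ex_bij_betw_nat_finite[OF assms(4)] by (auto simp: idx_def atLeast0LessThan)
  have "(\<Sum>C\<in>?Q. ?r (?t C)) = (\<Sum>C\<in>?Q. ?r C)"
    by (rule sum.reindex_bij_betw[OF bij])
  moreover have "(\<Sum>C\<in>?Q. ?r (?t C) - (?r C + x)) \<in> H"
    using crep_coset(2)[OF assms(2) mem] by (intro subgp_sum[OF assms(2)]) auto
  ultimately have "- (\<Sum>C\<in>?Q. x) \<in> H"
    by (simp add: sum_subtractf sum.distrib)
  moreover have "(\<Sum>C\<in>?Q. x) = (\<Sum>i<idx G H. x)"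
    using sum.reindex_bij_betw[OF e, of "\<lambda>_. x"] by simp
  ultimately show ?thesis using subgp_neg[OF assms(2)] by fastforce
qed

section \<open>Summation over fibres\<close>

text \<open>Iterated sums determine the total sum only under absolute summability, which
  \<open>norms\<close> supplies fibre by fibre.\<close>

lemma has_sum_fibration:
  fixes g :: "'a \<Rightarrow> complex"
  assumes p: "\<And>a. a \<in> A \<Longrightarrow> p a \<in> P"
    and inner: "\<And>x. x \<in> P \<Longrightarrow> (g has_sum G x) {a\<in>A. p a = x}"
    and outer: "(G has_sum S) P"
    and norms: "\<And>x. x \<in> P \<Longrightarrow> ((\<lambda>a. norm (g a)) has_sum G' x) {a\<in>A. p a = x}" "G' summable_on P"
  shows "(g has_sum S) A"
proof -
  let ?B = "\<lambda>x. {a\<in>A. p a = x}"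
  have "(\<lambda>(x, a). norm (g a)) summable_on Sigma P ?B"
    using norms by (intro summable_on_SigmaI[where g = G']) auto
  then have s: "(\<lambda>(x, a). g a) summable_on Sigma P ?B"
    unfolding summable_on_iff_abs_summable_on_complex by (simp add: case_prod_unfold)
  have "((\<lambda>(x, a). g a) has_sum S) (Sigma P ?B)"
    using inner outer s by (intro has_sum_SigmaI[where g = G]) auto
  moreover have "bij_betw (\<lambda>a. (p a, a)) A (Sigma P ?B)"
    using p by (auto simp: bij_betw_def inj_on_def)
  ultimately show ?thesis
    using has_sum_reindex_bij_betw[of "\<lambda>a. (p a, a)" A _ "\<lambda>(x, a). g a" S] by simp
qed

lemma has_sum_finite_fibres:
  fixes g :: "'b \<Rightarrow> complex"
  assumes p: "\<And>a. a \<in> A \<Longrightarrow> p a \<in> P"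
    and fin: "\<And>x. x \<in> P \<Longrightarrow> finite {a\<in>A. p a = x}"
    and outer: "((\<lambda>x. of_nat (card {a\<in>A. p a = x}) * g x) has_sum S) P"
  shows "((\<lambda>a. g (p a)) has_sum S) A"
proof (rule has_sum_fibration[OF p _ outer])
  fix x assume x: "x \<in> P"
  show "((\<lambda>a. g (p a)) has_sum of_nat (card {a \<in> A. p a = x}) * g x) {a \<in> A. p a = x}"
    using fin[OF x] by (intro has_sum_finiteI) auto
  show "((\<lambda>a. norm (g (p a))) has_sum norm (of_nat (card {a \<in> A. p a = x}) * g x)) {a \<in> A. p a = x}"
    using fin[OF x] by (intro has_sum_finiteI) (auto simp: norm_mult)
next
  show "(\<lambda>x. norm (of_nat (card {a \<in> A. p a = x}) * g x)) summable_on P"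
    using outer unfolding has_sum_iff summable_on_iff_abs_summable_on_complex by blast
qed

text \<open>Passes from a sum over submodules to a Dirichlet series. The coefficients are finite
  because the sum converges.\<close>

lemma has_sum_group_fibres:
  fixes g :: "'b \<Rightarrow> complex"
  assumes sum: "((\<lambda>a. g (p a)) has_sum S) A" and p: "\<And>a. a \<in> A \<Longrightarrow> p a \<in> P" and g: "\<And>x. x \<in> P \<Longrightarrow> g x \<noteq> 0"
  shows "((\<lambda>x. of_nat (card {a\<in>A. p a = x}) * g x) has_sum S) P"
proof -
  have fib: "((\<lambda>a. g (p a)) has_sum of_nat (card {a\<in>A. p a = x}) * g x) {a\<in>A. p a = x}" if x: "x \<in> P" for x
  proof -
    have "(\<lambda>a. g (p a)) summable_on A" using sum unfolding summable_on_def by blast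
    then have "(\<lambda>a. g (p a)) summable_on {a\<in>A. p a = x}" by (rule summable_on_subset_banach) blast
    moreover have "(\<lambda>a. g (p a)) summable_on {a\<in>A. p a = x} \<longleftrightarrow> (\<lambda>_. g x) summable_on {a\<in>A. p a = x}"
      by (rule summable_on_cong) simp
    ultimately have "(\<lambda>_. norm (g x)) summable_on {a\<in>A. p a = x}" by (simp only: summable_on_iff_abs_summable_on_complex)
    \<comment> \<open>A non-zero constant is summable over finite sets only.\<close>
    then have "finite {a\<in>A. p a = x}" using g[OF x] infsum_diverge_constant[of "{a\<in>A. p a = x}" "norm (g x)"] by auto
    then show ?thesis by (intro has_sum_finiteI) auto
  qed
  have "bij_betw (\<lambda>a. (p a, a)) A (Sigma P (\<lambda>x. {a\<in>A. p a = x}))"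
    using p by (intro bij_betwI[where g = snd]) auto
  from has_sum_reindex_bij_betw[OF this, of "\<lambda>(x, a). g x" S]
  have "((\<lambda>(x, a). g x) has_sum S) (Sigma P (\<lambda>x. {a\<in>A. p a = x}))" using sum by simp
  then show ?thesis
  proof (rule has_sum_SigmaD)
    fix x assume "x \<in> P"
    show "((\<lambda>a. case (x, a) of (x, a) \<Rightarrow> g x) has_sum of_nat (card {a\<in>A. p a = x}) * g x) {a\<in>A. p a = x}"
      using fib[OF \<open>x \<in> P\<close>] by (rule has_sum_cong[THEN iffD1, rotated]) auto
  qed
qed

lemma has_sum_Times:
  fixes g :: "'a \<Rightarrow> complex" and h :: "'b \<Rightarrow> complex"
  assumes "(g has_sum S) A" "(h has_sum T) B"
  shows "((\<lambda>(x, y). g x * h y) has_sum S * T) (A \<times> B)"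
proof -
  have n: "(\<lambda>x. norm (g x)) summable_on A" "(\<lambda>x. norm (h x)) summable_on B"
    using assms unfolding has_sum_iff summable_on_iff_abs_summable_on_complex by blast+
  have "(\<lambda>(x, y). norm (g x) * norm (h y)) summable_on A \<times> B"
    using has_sum_cmult_right[OF has_sum_infsum[OF n(2)]] summable_on_cmult_left[OF n(1)]
    by (intro summable_on_SigmaI[where g = "\<lambda>x. norm (g x) * infsum (\<lambda>x. norm (h x)) B"]) auto
  then have "(\<lambda>(x, y). g x * h y) summable_on A \<times> B"
    unfolding summable_on_iff_abs_summable_on_complex by (simp add: case_prod_unfold norm_mult)
  then show ?thesis
    using has_sum_cmult_right[OF assms(2)] has_sum_cmult_left[OF assms(1)]
    by (intro has_sum_SigmaI[where g = "\<lambda>x. g x * T"]) auto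
qed

section \<open>Counting submodules along a flag\<close>

abbreviation npow :: "nat \<Rightarrow> complex \<Rightarrow> complex" where
  "npow n s \<equiv> of_nat n powr (- s)"

lemma npow_mult: "npow (m * n) s = npow m s * npow n s"
  using powr_times_real[of "of_nat m" "of_nat n" "- s"] by simp

lemma npow_add: "n > 0 \<Longrightarrow> npow n (s + t) = npow n s * npow n t"
  using powr_add[of "of_nat n" "-s" "-t"] by simp

text \<open>A fibre of \<open>n ^ k\<close> elements is absorbed by lowering the argument by
  \<open>k\<close>; the shifts in the final formula arise in this way.\<close>

lemma npow_of_nat: "n > 0 \<Longrightarrow> npow n (s - of_nat k) = npow n s * of_nat (n ^ k)"
  using powr_add[of "of_nat n" "-s" "of_nat k"] powr_nat'[of "of_nat n" k]
  by (simp add: algebra_simps)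

text \<open>Reduces absolute convergence at \<open>s\<close> to convergence at the real part of
  \<open>s\<close>.\<close>

lemma norm_npow: "n > 0 \<Longrightarrow> norm (npow n s) = Re (npow n (of_real (Re s)))"
  using norm_powr_real_powr[of "of_nat n" "-s"] powr_of_real[of "real n" "- Re s"]
  by (simp flip: of_real_minus)

lemma npow_real: "npow n (of_real x) \<in> \<real>"
  using powr_of_real[of "real n" "- x"] by (simp flip: of_real_minus)

lemma modular_law:
  assumes "subgp N" "C \<subseteq> N" shows "N \<inter> (H [+] C) = (H \<inter> N) [+] C"
proof
  show "N \<inter> (H [+] C) \<subseteq> (H \<inter> N) [+] C"
  proof
    fix z assume "z \<in> N \<inter> (H [+] C)"
    then obtain x y where z: "z = x + y" "x \<in> H" "y \<in> C" "z \<in> N" by (auto elim: set_addE)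
    then have "z - y \<in> N" using assms subgp_diff by blast
    then show "z \<in> (H \<inter> N) [+] C" using z by (auto intro!: set_addI)
  qed
  show "(H \<inter> N) [+] C \<subseteq> N \<inter> (H [+] C)"
    using assms by (auto elim!: set_addE intro: set_addI subgp_add)
qed

text \<open>Ideals of the quotient of \<open>R\<close> by \<open>R \<inter> Z\<close>, represented
  by their preimages in \<open>R\<close>.\<close>

definition fin_ideals :: "'a::comm_ring_1 set \<Rightarrow> 'a set \<Rightarrow> 'a set set" where
  "fin_ideals R Z = {J. J \<subseteq> R \<and> subgp J \<and> (\<forall>r\<in>R. \<forall>x\<in>J. r * x \<in> J) \<and> R \<inter> Z \<subseteq> J \<and> fin_idx R J}"

text \<open>The two conditions on \<open>R\<close> modulo \<open>Z\<close> used for the counting: ideals of finite index are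
  generated by a non-zero-divisor, and \<open>\<zeta>\<close> is the resulting ideal zeta function.\<close>

definition ideals_principal :: "'a::comm_ring_1 set \<Rightarrow> 'a set \<Rightarrow> bool" where
  "ideals_principal R Z \<longleftrightarrow> (\<forall>J\<in>fin_ideals R Z. \<exists>b\<in>J.
     (\<forall>x\<in>J. \<exists>y\<in>R. x - y * b \<in> Z) \<and> (\<forall>x\<in>R. x * b \<in> Z \<longrightarrow> x \<in> Z))"

definition has_zeta :: "'a::comm_ring_1 set \<Rightarrow> 'a set \<Rightarrow> (complex \<Rightarrow> complex) \<Rightarrow> bool" where
  "has_zeta R Z \<zeta> \<longleftrightarrow> (\<forall>s. Re s > 0 \<longrightarrow> ((\<lambda>J. npow (idx R J) s) has_sum \<zeta> s) (fin_ideals R Z))"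

text \<open>The whole scalar type acts and \<open>R\<close> is a mere subset of it: in the
  application \<open>k[X]\<close> acts on rows over \<open>k\<close>, and \<open>R\<close> is
  \<open>O[X]\<close>.\<close>

locale subring_module = Modules.module scale
  for scale :: "'a::comm_ring_1 \<Rightarrow> 'v::ab_group_add \<Rightarrow> 'v" (infixr "\<bullet>\<^sub>R" 75) +
  fixes R :: "'a set"
  assumes R_subgp: "subgp R" and R_one: "1 \<in> R" and R_mult: "x \<in> R \<Longrightarrow> y \<in> R \<Longrightarrow> x * y \<in> R"
begin

definition smod :: "'v set \<Rightarrow> bool" where
  "smod H \<longleftrightarrow> subgp H \<and> (\<forall>r\<in>R. \<forall>x\<in>H. r \<bullet>\<^sub>R x \<in> H)"

definition cyclic :: "'v \<Rightarrow> 'v set" where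
  "cyclic e = {r \<bullet>\<^sub>R e | r. r \<in> R}"

text \<open>A chain from \<open>C\<close> upwards whose successive quotients are cyclic and
  isomorphic to \<open>R\<close> modulo \<open>Z\<close>. Unlike a decomposition of the top module,
  such a chain restricts well to submodules of finite index, see \<open>flag_Int\<close>.\<close>

inductive flag :: "'a set \<Rightarrow> 'v set \<Rightarrow> nat \<Rightarrow> 'v set \<Rightarrow> bool" for Z C where
  flag_0: "flag Z C 0 C"
| flag_Suc: "flag Z C m N \<Longrightarrow> (\<And>r. r \<in> R \<Longrightarrow> r \<bullet>\<^sub>R e \<in> N \<longleftrightarrow> r \<in> Z) \<Longrightarrow>
    flag Z C (Suc m) (N [+] cyclic e)"

lemma smod_subgp: "smod H \<Longrightarrow> subgp H" and smod_scale: "smod H \<Longrightarrow> r \<in> R \<Longrightarrow> x \<in> H \<Longrightarrow> r \<bullet>\<^sub>R x \<in> H"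
  by (auto simp: smod_def)

lemma smod_Int: "smod H \<Longrightarrow> smod K \<Longrightarrow> smod (H \<inter> K)"
  by (auto simp: smod_def subgp_Int)

lemma smod_set_add: "smod H \<Longrightarrow> smod K \<Longrightarrow> smod (H [+] K)"
  by (auto simp: smod_def subgp_set_add elim!: set_addE)
     (auto simp: scale_right_distrib intro!: set_addI)

lemma cyclicI: "r \<in> R \<Longrightarrow> r \<bullet>\<^sub>R e \<in> cyclic e"
  by (auto simp: cyclic_def)

lemma cyclic_self: "e \<in> cyclic e"
  using cyclicI[OF R_one, of e] by simp

lemma smod_cyclic: "smod (cyclic e)"
  unfolding smod_def subgp_def
proof (intro conjI ballI)
  show "0 \<in> cyclic e" using cyclicI[OF subgp_zero[OF R_subgp], of e] by simp
  show "x - y \<in> cyclic e" if "x \<in> cyclic e" "y \<in> cyclic e" for x y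
    using that subgp_diff[OF R_subgp] by (auto simp: cyclic_def simp flip: scale_left_diff_distrib)
  show "r \<bullet>\<^sub>R x \<in> cyclic e" if "r \<in> R" "x \<in> cyclic e" for r x
    using that R_mult by (auto simp: cyclic_def)
qed

lemma cyclic_least: "smod H \<Longrightarrow> e \<in> H \<Longrightarrow> cyclic e \<subseteq> H"
  by (auto simp: cyclic_def smod_scale)

lemma flag_smod: "flag Z C m K \<Longrightarrow> smod C \<Longrightarrow> smod K \<and> C \<subseteq> K"
proof (induction rule: flag.induct)
  case (flag_Suc m N e)
  then show ?case
    using smod_set_add[OF _ smod_cyclic] set_add_upper1[OF smod_subgp[OF smod_cyclic], of N] by blast
qed auto

text \<open>For \<open>D\<close> of finite index in \<open>C\<close>, this is the fibre over
  \<open>D\<close> of intersecting submodules of finite index in \<open>K\<close> with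
  \<open>C\<close>.\<close>

definition transversals :: "'v set \<Rightarrow> 'v set \<Rightarrow> 'v set \<Rightarrow> 'v set set" where
  "transversals K C D = {H. smod H \<and> H \<subseteq> K \<and> H \<inter> C = D \<and> fin_idx K (H [+] C)}"

text \<open>The coefficients of \<open>e\<close> that occur in \<open>H\<close>, like the pivot of a
  Hermite normal form: the image of \<open>H\<close> in the quotient of
  \<open>N [+] cyclic e\<close> by \<open>N\<close>, which is a copy of \<open>R\<close> modulo
  \<open>Z\<close>.\<close>

definition lead :: "'v set \<Rightarrow> 'v \<Rightarrow> 'v set \<Rightarrow> 'a set" where
  "lead N e H = {r \<in> R. r \<bullet>\<^sub>R e \<in> H [+] N}"

lemma extension_smod:
  assumes "smod N"
  shows "smod (N [+] cyclic e)" "N \<subseteq> N [+] cyclic e" "e \<in> N [+] cyclic e"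
  using smod_set_add[OF assms smod_cyclic] set_add_upper1[OF smod_subgp[OF smod_cyclic]]
    set_add_upper2[OF smod_subgp[OF assms], of "cyclic e"] cyclic_self[of e] by blast+

lemma lead_idx:
  assumes N: "smod N" and H: "smod H" "H \<subseteq> N [+] cyclic e"
  shows "subgp (lead N e H)"
    "fin_idx R (lead N e H) \<longleftrightarrow> fin_idx (N [+] cyclic e) (H [+] N)"
    "idx R (lead N e H) = idx (N [+] cyclic e) (H [+] N)"
proof -
  let ?K = "N [+] cyclic e"
  have sg: "subgp (H [+] N)" using H N smod_subgp subgp_set_add by blast
  have 1: "(x - y) \<bullet>\<^sub>R e = x \<bullet>\<^sub>R e - y \<bullet>\<^sub>R e" for x y by (rule scale_left_diff_distrib)
  have 2: "x \<bullet>\<^sub>R e \<in> ?K" if "x \<in> R" for x using extension_smod[OF N] smod_scale that by blast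
  have 3: "\<exists>x\<in>R. y - x \<bullet>\<^sub>R e \<in> H [+] N" if "y \<in> ?K" for y
  proof -
    from that obtain n z where "y = n + z" "n \<in> N" "z \<in> cyclic e" by (rule set_addE)
    then obtain r where "y = n + r \<bullet>\<^sub>R e" "n \<in> N" "r \<in> R" by (auto simp: cyclic_def)
    then have "y - r \<bullet>\<^sub>R e \<in> H [+] N" using set_add_upper2[OF smod_subgp[OF H(1)]] by auto
    then show ?thesis using \<open>r \<in> R\<close> by blast
  qed
  from idx_hom[OF R_subgp sg, of "\<lambda>r. r \<bullet>\<^sub>R e" ?K, OF 1 2 3]
  show "subgp (lead N e H)" "fin_idx R (lead N e H) \<longleftrightarrow> fin_idx ?K (H [+] N)"
    "idx R (lead N e H) = idx ?K (H [+] N)"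
    unfolding lead_def by auto
qed

lemma lead_ideal:
  assumes N: "smod N" and H: "smod H" "H \<subseteq> N [+] cyclic e" and fin: "fin_idx (N [+] cyclic e) (H [+] N)"
    and e: "\<And>r. r \<in> R \<Longrightarrow> r \<bullet>\<^sub>R e \<in> N \<longleftrightarrow> r \<in> Z"
  shows "lead N e H \<in> fin_ideals R Z"
proof -
  have "r * x \<in> lead N e H" if "r \<in> R" "x \<in> lead N e H" for r x
    using that smod_scale[OF smod_set_add[OF H(1) N] that(1), of "x \<bullet>\<^sub>R e"] R_mult by (auto simp: lead_def)
  moreover have "R \<inter> Z \<subseteq> lead N e H"
    using e set_add_upper2[OF smod_subgp[OF H(1)], of N] by (auto simp: lead_def)
  ultimately show ?thesis
    using lead_idx[OF N H] fin by (auto simp: fin_ideals_def lead_def)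
qed

context
  fixes N C D :: "'v set" and e :: 'v and Z :: "'a set"
  assumes N: "smod N" and C: "smod C" "C \<subseteq> N" and D: "smod D" "D \<subseteq> C" "fin_idx C D"
    and e: "\<And>r. r \<in> R \<Longrightarrow> r \<bullet>\<^sub>R e \<in> N \<longleftrightarrow> r \<in> Z"
    and Z: "\<And>z x. z \<in> R \<Longrightarrow> z \<in> Z \<Longrightarrow> x \<in> N [+] cyclic e \<Longrightarrow> z \<bullet>\<^sub>R x \<in> D"
begin

abbreviation (input) "K' \<equiv> N [+] cyclic e"

text \<open>\<open>H\<close> is cut into its part in \<open>N\<close> and its image modulo
  \<open>N\<close>. The tower over \<open>H [+] N\<close> makes the index the product of both
  contributions.\<close>

lemma trans_split:
  assumes "H \<in> transversals K' C D"
  shows "H \<inter> N \<in> transversals N C D" "lead N e H \<in> fin_ideals R Z"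
    "idx K' (H [+] C) = idx N ((H \<inter> N) [+] C) * idx R (lead N e H)"
proof -
  have H: "smod H" "H \<subseteq> K'" "H \<inter> C = D" "fin_idx K' (H [+] C)"
    using assms by (auto simp: transversals_def)
  note sg = smod_subgp[OF H(1)] smod_subgp[OF N] smod_subgp[OF C(1)] smod_subgp[OF extension_smod(1)[OF N]]
  have sub: "H [+] C \<subseteq> H [+] N" "H [+] N \<subseteq> K'"
    using C(2) set_add_least[OF sg(4) H(2) extension_smod(2)[OF N]] by (auto simp: set_add_def)
  note tw = idx_tower[OF subgp_set_add[OF sg(1,2)] subgp_set_add[OF sg(1,3)] sg(4) sub]
  have eq: "N [+] (H [+] C) = H [+] N" by (rule set_add_absorb[OF sg(2,3) C(2)])
  note sa = idx_set_add[OF sg(2) subgp_set_add[OF sg(1,3)]]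
  note m = modular_law[OF sg(2) C(2), of H]
  show "H \<inter> N \<in> transversals N C D"
    unfolding transversals_def using H smod_Int[OF H(1) N] C(2) tw(1) sa(1)[unfolded eq m] by auto
  show "idx K' (H [+] C) = idx N ((H \<inter> N) [+] C) * idx R (lead N e H)"
    using tw(2) sa(2)[unfolded eq m] lead_idx(3)[OF N H(1,2)] by simp
  show "lead N e H \<in> fin_ideals R Z"
    using lead_ideal[OF N H(1,2) _ e] H(4) tw(1) by blast
qed

text \<open>Let \<open>b\<close> generate \<open>J\<close> modulo \<open>Z\<close>. A member of the
  fibre is \<open>H'\<close> together with one lift \<open>b e + n\<close>, where \<open>n\<close>
  matters only modulo \<open>H'\<close>. Every \<open>n\<close> in \<open>N\<close> is admissible: a
  multiple of the lift that falls into \<open>N\<close> comes from a factor in \<open>Z\<close>, and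
  \<open>Z\<close> maps everything into \<open>D\<close>. So the size of the fibre is the index of
  \<open>H'\<close> in \<open>N\<close>, whatever \<open>J\<close> is.\<close>

lemma trans_fibre:
  assumes H': "H' \<in> transversals N C D" and J: "J \<in> fin_ideals R Z" and pr: "ideals_principal R Z"
  shows "finite {H \<in> transversals K' C D. (H \<inter> N, lead N e H) = (H', J)}" (is "finite ?F")
    and "card {H \<in> transversals K' C D. (H \<inter> N, lead N e H) = (H', J)} = idx C D * idx N (H' [+] C)"
proof -
  obtain b where b: "b \<in> J" "\<And>x. x \<in> J \<Longrightarrow> \<exists>y\<in>R. x - y * b \<in> Z" "\<And>x. x \<in> R \<Longrightarrow> x * b \<in> Z \<Longrightarrow> x \<in> Z"
    using pr J unfolding ideals_principal_def by meson
  have J': "J \<subseteq> R" "subgp J" "\<And>r x. r \<in> R \<Longrightarrow> x \<in> J \<Longrightarrow> r * x \<in> J" "R \<inter> Z \<subseteq> J" "fin_idx R J"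
    using J by (auto simp: fin_ideals_def)
  have bR: "b \<in> R" using b J' by auto
  have H'': "smod H'" "H' \<subseteq> N" "H' \<inter> C = D" "fin_idx N (H' [+] C)" using H' by (auto simp: transversals_def)
  note sg = smod_subgp[OF H''(1)] smod_subgp[OF N] smod_subgp[OF C(1)] smod_subgp[OF extension_smod(1)[OF N]]
  have subH: "H' \<subseteq> H' [+] C" "H' [+] C \<subseteq> N"
    using set_add_upper1[OF sg(3)] set_add_least[OF sg(2) H''(2) C(2)] by auto
  note tw = idx_tower[OF subgp_set_add[OF sg(1,3)] sg(1) sg(2) subH]
  note HC = set_add_commute[of C H']
  have fin: "fin_idx N H'" and idxN: "idx N H' = idx N (H' [+] C) * idx C D"
    using tw idx_set_add[OF sg(3,1)] H''(3,4) D(3) by (auto simp: HC Int_commute)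
  define h where "h n = H' [+] cyclic (b \<bullet>\<^sub>R e + n)" for n
  have beK: "b \<bullet>\<^sub>R e + n \<in> K'" if "n \<in> N" for n
    using that extension_smod[OF N] bR smod_scale subgp_add[OF sg(4)] by blast
  \<comment> \<open>Since \<open>b\<close> is not a zero divisor modulo \<open>Z\<close>, the lift
    has the same annihilator modulo \<open>N\<close> as \<open>e\<close>.\<close>
  have inN: "r \<bullet>\<^sub>R (b \<bullet>\<^sub>R e + n) \<in> N \<longleftrightarrow> r \<in> Z" if "r \<in> R" "n \<in> N" for r n
  proof -
    have "r \<bullet>\<^sub>R (b \<bullet>\<^sub>R e + n) - (r * b) \<bullet>\<^sub>R e \<in> N" using that smod_scale[OF N] by (simp add: scale_right_distrib)
    then have "r \<bullet>\<^sub>R (b \<bullet>\<^sub>R e + n) \<in> N \<longleftrightarrow> (r * b) \<bullet>\<^sub>R e \<in> N"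
      using subgp_diff[OF sg(2)] subgp_add[OF sg(2)] by (metis diff_add_cancel add.commute add_diff_cancel_left' diff_diff_eq2)
    also have "\<dots> \<longleftrightarrow> r * b \<in> Z" using e R_mult[OF that(1) bR] by simp
    also have "\<dots> \<longleftrightarrow> r \<in> Z"
    proof
      assume "r \<in> Z"
      then have "r \<bullet>\<^sub>R e \<in> N" using e that by simp
      then have "(r * b) \<bullet>\<^sub>R e \<in> N" using smod_scale[OF N bR] by (metis scale_scale mult.commute)
      then show "r * b \<in> Z" using e R_mult[OF that(1) bR] by simp
    qed (use b that in auto)
    finally show ?thesis .
  qed
  have hN: "h n \<inter> N = H'" if "n \<in> N" for n
  proof
    show "H' \<subseteq> h n \<inter> N" using H''(2) set_add_upper1[OF smod_subgp[OF smod_cyclic]] by (auto simp: h_def)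
    show "h n \<inter> N \<subseteq> H'"
    proof
      fix x assume "x \<in> h n \<inter> N"
      then obtain y r where x: "x = y + r \<bullet>\<^sub>R (b \<bullet>\<^sub>R e + n)" "y \<in> H'" "r \<in> R" "x \<in> N"
        by (auto simp: h_def set_add_def cyclic_def)
      then have "x - y \<in> N" using H''(2) subgp_diff[OF sg(2)] by blast
      then have "r \<in> Z" using inN[OF x(3) that] x(1) by simp
      then have "r \<bullet>\<^sub>R (b \<bullet>\<^sub>R e + n) \<in> D" using Z[OF x(3)] beK[OF that] by blast
      then show "x \<in> H'" using x H''(3) subgp_add[OF sg(1)] by blast
    qed
  qed
  have mem: "b \<bullet>\<^sub>R e + n \<in> h n" for n
    using set_add_upper2[OF sg(1)] cyclic_self by (auto simp: h_def)
  have sm: "smod (h n)" for n unfolding h_def by (rule smod_set_add[OF H''(1) smod_cyclic])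
  have lead_h: "lead N e (h n) = J" if n: "n \<in> N" for n
  proof
    have shN: "smod (h n [+] N)" by (rule smod_set_add[OF sm N])
    have "(b \<bullet>\<^sub>R e + n) + (- n) \<in> h n [+] N" by (rule set_addI[OF mem subgp_neg[OF sg(2) n]])
    then have be: "b \<bullet>\<^sub>R e \<in> h n [+] N" by simp
    show "J \<subseteq> lead N e (h n)"
    proof
      fix x assume x: "x \<in> J"
      then obtain y where y: "y \<in> R" "x - y * b \<in> Z" using b by blast
      have "x - y * b \<in> R" using subgp_diff[OF R_subgp _ R_mult[OF y(1) bR]] x J'(1) by blast
      then have "(x - y * b) \<bullet>\<^sub>R e \<in> N" using e y by simp
      then have "(x - y * b) \<bullet>\<^sub>R e \<in> h n [+] N" using set_add_upper2[OF smod_subgp[OF sm]] by blast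
      moreover have "(y * b) \<bullet>\<^sub>R e \<in> h n [+] N" using smod_scale[OF shN y(1) be] by simp
      ultimately have "(x - y * b) \<bullet>\<^sub>R e + (y * b) \<bullet>\<^sub>R e \<in> h n [+] N" using subgp_add[OF smod_subgp[OF shN]] by blast
      then show "x \<in> lead N e (h n)" using x J' by (auto simp: lead_def scale_left_diff_distrib)
    qed
    show "lead N e (h n) \<subseteq> J"
    proof
      fix x assume "x \<in> lead N e (h n)"
      then obtain y r m where x: "x \<in> R" "x \<bullet>\<^sub>R e = y + r \<bullet>\<^sub>R (b \<bullet>\<^sub>R e + n) + m" "y \<in> H'" "r \<in> R" "m \<in> N"
        by (auto simp: lead_def h_def set_add_def cyclic_def)
      have "(x - r * b) \<bullet>\<^sub>R e = y + r \<bullet>\<^sub>R n + m" using x(2)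
        by (simp add: scale_left_diff_distrib scale_right_distrib)
      also have "\<dots> \<in> N" using x n H''(2) by (intro subgp_add[OF sg(2)] smod_scale[OF N]) auto
      finally have "(x - r * b) \<bullet>\<^sub>R e \<in> N" .
      moreover have *: "x - r * b \<in> R" using subgp_diff[OF R_subgp x(1) R_mult[OF x(4) bR]] .
      ultimately have "x - r * b \<in> Z" using e by simp
      with * have "x - r * b \<in> J" using J' by blast
      moreover have "r * b \<in> J" using J' x b by blast
      ultimately show "x \<in> J" using subgp_add[OF J'(2)] by force
    qed
  qed
  have hF: "h n \<in> ?F" if n: "n \<in> N" for n
  proof -
    have hK: "h n \<subseteq> K'" unfolding h_def
      by (intro set_add_least[OF sg(4)] cyclic_least[OF extension_smod(1)[OF N] beK[OF n]]
          order_trans[OF H''(2) extension_smod(2)[OF N]])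
    have hC: "h n \<inter> C = D" using hN[OF n] C(2) H''(3) by blast
    note sh = smod_subgp[OF sm[of n]]
    have sub: "h n [+] C \<subseteq> h n [+] N" "h n [+] N \<subseteq> K'"
      using C(2) set_add_least[OF sg(4) hK extension_smod(2)[OF N]] by (auto simp: set_add_def)
    note tw = idx_tower[OF subgp_set_add[OF sh sg(2)] subgp_set_add[OF sh sg(3)] sg(4) sub]
    have eq: "N [+] (h n [+] C) = h n [+] N" by (rule set_add_absorb[OF sg(2,3) C(2)])
    have "fin_idx K' (h n [+] C)"
      using tw(1) idx_set_add(1)[OF sg(2) subgp_set_add[OF sh sg(3)]] modular_law[OF sg(2) C(2), of "h n"]
        hN[OF n] H''(4) lead_idx(2)[OF N sm hK] lead_h[OF n] J'(5) unfolding eq by simp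
    then show ?thesis using sm hK hC hN[OF n] lead_h[OF n] by (auto simp: transversals_def)
  qed
  have surj: "\<exists>n\<in>N. b \<bullet>\<^sub>R e + n \<in> H" if H: "H \<in> ?F" for H
  proof -
    have "b \<bullet>\<^sub>R e \<in> H [+] N" using H b(1) by (auto simp: lead_def)
    then obtain x n where "b \<bullet>\<^sub>R e = x + n" "x \<in> H" "n \<in> N" by (auto elim: set_addE)
    then show ?thesis using subgp_neg[OF sg(2)] by (intro bexI[of _ "- n"]) auto
  qed
  have uniq: "H = h n" if H: "H \<in> ?F" and n: "n \<in> N" "b \<bullet>\<^sub>R e + n \<in> H" for H n
  proof
    have sH: "smod H" "H \<subseteq> K'" "H \<inter> N = H'" "lead N e H = J" using H by (auto simp: transversals_def)
    show "h n \<subseteq> H" unfolding h_def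
      using set_add_least[OF smod_subgp[OF sH(1)]] cyclic_least[OF sH(1) n(2)] sH(3) by blast
    show "H \<subseteq> h n"
    proof
      fix x assume x: "x \<in> H"
      then obtain m r where xr: "x = m + r \<bullet>\<^sub>R e" "m \<in> N" "r \<in> R"
        using sH(2) by (auto simp: set_add_def cyclic_def)
      then have "r \<bullet>\<^sub>R e = x + (- m)" by simp
      then have "r \<bullet>\<^sub>R e \<in> H [+] N" using set_addI[OF x subgp_neg[OF sg(2) xr(2)]] by simp
      then have "r \<in> J" using sH(4) xr(3) by (auto simp: lead_def)
      then obtain y where y: "y \<in> R" "r - y * b \<in> Z" using b(2) by blast
      have "r - y * b \<in> R" using xr(3) y bR R_mult subgp_diff[OF R_subgp] by blast
      then have 1: "(r - y * b) \<bullet>\<^sub>R e \<in> N" using e y by simp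
      have "x - y \<bullet>\<^sub>R (b \<bullet>\<^sub>R e + n) = m + (r - y * b) \<bullet>\<^sub>R e - y \<bullet>\<^sub>R n"
        unfolding xr(1) by (simp add: scale_left_diff_distrib scale_right_distrib)
      also have "\<dots> \<in> N" using 1 xr y n smod_scale[OF N] subgp_add[OF sg(2)] subgp_diff[OF sg(2)] by blast
      finally have "x - y \<bullet>\<^sub>R (b \<bullet>\<^sub>R e + n) \<in> H \<inter> N"
        using subgp_diff[OF smod_subgp[OF sH(1)] x smod_scale[OF sH(1) y(1) n(2)]] by blast
      then have "x - y \<bullet>\<^sub>R (b \<bullet>\<^sub>R e + n) \<in> H'" using sH(3) by simp
      from set_addI[OF this cyclicI[OF y(1), of "b \<bullet>\<^sub>R e + n"]] show "x \<in> h n" by (simp add: h_def)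
    qed
  qed
  have "bij_betw (\<lambda>c. h (crep N H' c)) (cosets N H') ?F"
  proof (rule bij_betw_imageI)
    show "inj_on (\<lambda>c. h (crep N H' c)) (cosets N H')"
    proof (rule inj_onI)
      fix c d assume cd: "c \<in> cosets N H'" "d \<in> cosets N H'" and eq: "h (crep N H' c) = h (crep N H' d)"
      let ?c = "crep N H' c" and ?d = "crep N H' d"
      have "b \<bullet>\<^sub>R e + ?c \<in> h ?d" "b \<bullet>\<^sub>R e + ?d \<in> h ?d" using mem[of ?c] mem[of ?d] eq by auto
      then have "?c - ?d \<in> h ?d" using subgp_diff[OF smod_subgp[OF sm]] by fastforce
      then have "?c - ?d \<in> H'" using hN crep(1)[OF cd(1)] crep(1)[OF cd(2)] subgp_diff[OF sg(2)] by blast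
      then show "c = d" using crep(2)[OF cd(1)] crep(2)[OF cd(2)] coset_eq_iff[OF sg(1)] by metis
    qed
    show "(\<lambda>c. h (crep N H' c)) ` cosets N H' = ?F"
    proof
      show "(\<lambda>c. h (crep N H' c)) ` cosets N H' \<subseteq> ?F" using hF crep(1) by (metis (no_types, lifting) image_subsetI)
      show "?F \<subseteq> (\<lambda>c. h (crep N H' c)) ` cosets N H'"
      proof
        fix H assume H: "H \<in> ?F"
        then obtain n where n: "n \<in> N" "b \<bullet>\<^sub>R e + n \<in> H" using surj by blast
        let ?c = "crep N H' ((+) n ` H')"
        note c = crep_coset[OF sg(1) n(1)]
        have sH: "subgp H" "H' \<subseteq> H" using H smod_subgp by (auto simp: transversals_def)
        then have "(b \<bullet>\<^sub>R e + n) + (?c - n) \<in> H" using n c(2) subgp_add by blast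
        then have "b \<bullet>\<^sub>R e + ?c \<in> H" by simp
        then have "H = h ?c" using uniq[OF H c(1)] by simp
        then show "H \<in> (\<lambda>c. h (crep N H' c)) ` cosets N H'" using cosetsI[OF n(1)] by blast
      qed
    qed
  qed
  note bij = this
  show "finite ?F" using bij_betw_finite[OF bij] fin by simp
  show "card ?F = idx C D * idx N (H' [+] C)"
    using bij_betw_same_card[OF bij] idxN by (simp add: idx_def)
qed

end

text \<open>Each step of the flag multiplies the count by the index of \<open>H' [+] C\<close> in
  \<open>N\<close> and by the constant \<open>idx C D\<close>. The first factor replaces
  \<open>s\<close> by \<open>s - 1\<close> in the rest of the flag; the new ideal contributes
  \<open>\<zeta> s\<close>.\<close>

lemma flag_sum:
  assumes "flag Z C m K" and C: "smod C" and D: "smod D" "D \<subseteq> C" "fin_idx C D"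
    and pr: "ideals_principal R Z" and zeta: "has_zeta R Z \<zeta>"
    and "\<And>z x. z \<in> R \<Longrightarrow> z \<in> Z \<Longrightarrow> x \<in> K \<Longrightarrow> z \<bullet>\<^sub>R x \<in> D"
    and "\<And>j. j < m \<Longrightarrow> Re s > real j"
  shows "((\<lambda>H. npow (idx K (H [+] C)) s) has_sum (of_nat (idx C D) ^ m * (\<Prod>j<m. \<zeta> (s - of_nat j))))
           (transversals K C D)"
  using assms(1,8,9)
proof (induction arbitrary: s rule: flag.induct)
  case flag_0
  have 1: "D [+] C = C"
    using set_add_upper2[OF smod_subgp[OF D(1)], of C] set_add_least[OF smod_subgp[OF C] D(2)] by blast
  have "transversals C C D = {D}"
    using D(1,2) idx_self[OF smod_subgp[OF C]] 1 by (auto simp: transversals_def)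
  then show ?case using idx_self[OF smod_subgp[OF C]] 1 by (simp add: has_sum_finiteI)
next
  case (flag_Suc m N e)
  let ?K = "N [+] cyclic e"
  have N: "smod N" "C \<subseteq> N" using flag_smod[OF flag_Suc.hyps(1) C] by auto
  note ctx = N(1) C N(2) D flag_Suc.hyps(2) flag_Suc.prems(1)
  let ?A = "transversals ?K C D" and ?P = "transversals N C D \<times> fin_ideals R Z"
  let ?g = "\<lambda>(H', J). npow (idx N (H' [+] C)) s * npow (idx R J) s"
  have NK: "N \<subseteq> ?K" by (rule set_add_upper1[OF smod_subgp[OF smod_cyclic]])
  have "((\<lambda>H. npow (idx N (H [+] C)) (s - 1)) has_sum (of_nat (idx C D) ^ m * (\<Prod>j<m. \<zeta> (s - 1 - of_nat j))))
           (transversals N C D)"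
    using flag_Suc.prems NK by (intro flag_Suc.IH) fastforce+
  moreover have "((\<lambda>J. npow (idx R J) s) has_sum \<zeta> s) (fin_ideals R Z)"
    using zeta flag_Suc.prems(2)[of 0] by (simp add: has_zeta_def)
  ultimately have "((\<lambda>(H, J). npow (idx N (H [+] C)) (s - 1) * npow (idx R J) s) has_sum
     (of_nat (idx C D) ^ m * (\<Prod>j<m. \<zeta> (s - 1 - of_nat j))) * \<zeta> s) ?P"
    by (rule has_sum_Times)
  from has_sum_cmult_right[OF this, of "of_nat (idx C D)"]
  have *: "((\<lambda>(H, J). of_nat (idx C D) * (npow (idx N (H [+] C)) (s - 1) * npow (idx R J) s)) has_sum
     of_nat (idx C D) ^ Suc m * (\<Prod>j<Suc m. \<zeta> (s - of_nat j))) ?P"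
    unfolding prod.lessThan_Suc_shift by (simp add: case_prod_unfold algebra_simps)
  have "((\<lambda>x. of_nat (card {H \<in> ?A. (H \<inter> N, lead N e H) = x}) * ?g x) has_sum
     of_nat (idx C D) ^ Suc m * (\<Prod>j<Suc m. \<zeta> (s - of_nat j))) ?P"
  proof (rule iffD1[OF has_sum_cong *], clarify)
    fix H J assume H: "H \<in> transversals N C D" and J: "J \<in> fin_ideals R Z"
    have "idx N (H [+] C) > 0" using H idx_pos smod_subgp[OF N(1)] by (auto simp: transversals_def)
    have c: "card {Ha \<in> ?A. (Ha \<inter> N, lead N e Ha) = (H, J)} = idx C D * idx N (H [+] C)"
      by (rule trans_fibre(2)[OF ctx H J pr])
    from \<open>idx N (H [+] C) > 0\<close> show "of_nat (idx C D) * (npow (idx N (H [+] C)) (s - 1) * npow (idx R J) s) =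
      of_nat (card {Ha \<in> ?A. (Ha \<inter> N, lead N e Ha) = (H, J)}) * (npow (idx N (H [+] C)) s * npow (idx R J) s)"
      unfolding c using npow_of_nat[of "idx N (H [+] C)" s 1] by simp
  qed
  from has_sum_finite_fibres[of ?A "\<lambda>H. (H \<inter> N, lead N e H)" ?P ?g, OF _ _ this]
  have "((\<lambda>H. npow (idx N ((H \<inter> N) [+] C)) s * npow (idx R (lead N e H)) s) has_sum
     of_nat (idx C D) ^ Suc m * (\<Prod>j<Suc m. \<zeta> (s - of_nat j))) ?A"
    using trans_split(1,2)[OF ctx] trans_fibre(1)[OF ctx _ _ pr] by auto
  then show ?case
    by (rule iffD1[OF has_sum_cong, rotated]) (simp add: trans_split(3)[OF ctx] npow_mult del: of_nat_mult)
qed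

end

section \<open>Peeling off one layer: from \<open>M\<close> to \<open>f M\<close>\<close>

context subring_module
begin

definition smods :: "'v set \<Rightarrow> 'v set set" where
  "smods M = {H. smod H \<and> H \<subseteq> M \<and> fin_idx M H}"

definition img :: "'a \<Rightarrow> 'v set \<Rightarrow> 'v set" where
  "img f M = (\<lambda>x. f \<bullet>\<^sub>R x) ` M"

lemma smod_img: assumes "smod M" shows "smod (img f M)"
  unfolding smod_def subgp_def
proof (intro conjI ballI)
  show "0 \<in> img f M" using subgp_zero[OF smod_subgp[OF assms]] by (force simp: img_def)
  show "x - y \<in> img f M" if "x \<in> img f M" "y \<in> img f M" for x y
    using that subgp_diff[OF smod_subgp[OF assms]] by (auto simp: img_def simp flip: scale_right_diff_distrib)
  show "r \<bullet>\<^sub>R x \<in> img f M" if "r \<in> R" "x \<in> img f M" for r x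
  proof -
    from that obtain y where "x = f \<bullet>\<^sub>R y" "y \<in> M" by (auto simp: img_def)
    then have "r \<bullet>\<^sub>R x = f \<bullet>\<^sub>R (r \<bullet>\<^sub>R y)" "r \<bullet>\<^sub>R y \<in> M" using that smod_scale[OF assms] by (auto simp: mult.commute)
    then show ?thesis unfolding img_def by blast
  qed
qed

lemma img_subset: "smod M \<Longrightarrow> f \<in> R \<Longrightarrow> img f M \<subseteq> M"
  by (auto simp: img_def smod_scale)

text \<open>In a step from \<open>N\<close> to \<open>N [+] cyclic e\<close> let \<open>b\<close>
  generate the coefficient ideal of \<open>K\<close>, and write \<open>b e = k + n\<close> with
  \<open>k\<close> in \<open>K\<close>. Then \<open>k\<close> generates the restricted step, and its
  annihilator modulo \<open>N\<close> is still \<open>Z\<close> because \<open>b\<close> is not a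
  zero divisor modulo \<open>Z\<close>. Principality of the ideals is what keeps the shape of the
  flag.\<close>

lemma flag_Int:
  assumes "flag Z C m N" and C: "smod C" and M: "smod M" "N \<subseteq> M" and K: "smod K" "K \<subseteq> M" "fin_idx M K"
    and pr: "ideals_principal R Z"
  shows "flag Z (K \<inter> C) m (K \<inter> N)"
  using assms(1) M(2)
proof (induction rule: flag.induct)
  case flag_0
  show ?case by (rule flag.flag_0)
next
  case (flag_Suc m N e)
  let ?N = "N [+] cyclic e"
  have N: "smod N" using flag_smod[OF flag_Suc.hyps(1) C] by blast
  note ext = extension_smod[OF N, of e]
  note sg = smod_subgp[OF N] smod_subgp[OF ext(1)] smod_subgp[OF K(1)] smod_subgp[OF M(1)]
  define H where "H = K \<inter> ?N"
  have H: "smod H" "H \<subseteq> ?N" unfolding H_def using smod_Int[OF K(1) ext(1)] by auto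
  have "fin_idx (?N [+] K) K"
    using idx_mono_fin(2)[OF subgp_set_add[OF sg(2,3)] sg(3) sg(4) _ _ K(3)]
      set_add_upper2[OF sg(2)] set_add_least[OF sg(4) flag_Suc.prems K(2)] by blast
  then have "fin_idx ?N H" using idx_set_add(1)[OF sg(2,3)] by (simp add: H_def Int_commute)
  then have fin: "fin_idx ?N (H [+] N)"
    using idx_mono_fin(1)[OF subgp_set_add[OF smod_subgp[OF H(1)] sg(1)] smod_subgp[OF H(1)] sg(2)]
      set_add_upper1[OF sg(1)] set_add_least[OF sg(2) H(2) ext(2)] by blast
  have "lead N e H \<in> fin_ideals R Z" by (rule lead_ideal[OF N H fin flag_Suc.hyps(2)])
  then obtain b where b: "b \<in> lead N e H" "\<And>x. x \<in> lead N e H \<Longrightarrow> \<exists>y\<in>R. x - y * b \<in> Z"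
      "\<And>x. x \<in> R \<Longrightarrow> x * b \<in> Z \<Longrightarrow> x \<in> Z"
    using pr unfolding ideals_principal_def by meson
  have bR: "b \<in> R" using b by (simp add: lead_def)
  obtain k n where k: "b \<bullet>\<^sub>R e = k + n" "k \<in> H" "n \<in> N" using b(1) by (auto simp: lead_def elim: set_addE)
  have kK: "k \<in> K" "k \<in> ?N" using k by (auto simp: H_def)
  have kN: "r \<bullet>\<^sub>R k \<in> N \<longleftrightarrow> r \<in> Z" if r: "r \<in> R" for r
  proof -
    have "(r * b) \<bullet>\<^sub>R e = r \<bullet>\<^sub>R k + r \<bullet>\<^sub>R n" using arg_cong[OF k(1), of "\<lambda>x. r \<bullet>\<^sub>R x"]
      by (simp add: scale_right_distrib)
    moreover have "r \<bullet>\<^sub>R n \<in> N" using smod_scale[OF N r k(3)] .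
    ultimately have "r \<bullet>\<^sub>R k \<in> N \<longleftrightarrow> (r * b) \<bullet>\<^sub>R e \<in> N"
      using subgp_add[OF sg(1)] subgp_diff[OF sg(1)] by (metis add_diff_cancel_right')
    also have "\<dots> \<longleftrightarrow> r * b \<in> Z" using flag_Suc.hyps(2) R_mult[OF r bR] by simp
    also have "\<dots> \<longleftrightarrow> r \<in> Z"
    proof
      assume "r \<in> Z"
      then have "b \<bullet>\<^sub>R (r \<bullet>\<^sub>R e) \<in> N" using flag_Suc.hyps(2) r smod_scale[OF N bR] by blast
      then show "r * b \<in> Z" using flag_Suc.hyps(2) R_mult[OF r bR] by (simp add: mult.commute)
    qed (use b r in auto)
    finally show ?thesis .
  qed
  have "flag Z (K \<inter> C) m (K \<inter> N)" using flag_Suc.IH flag_Suc.prems ext(2) by blast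
  then have "flag Z (K \<inter> C) (Suc m) ((K \<inter> N) [+] cyclic k)"
    using kN smod_scale[OF K(1) _ kK(1)] by (intro flag.flag_Suc) auto
  moreover have "(K \<inter> N) [+] cyclic k = K \<inter> ?N"
  proof
    show "(K \<inter> N) [+] cyclic k \<subseteq> K \<inter> ?N"
      by (rule set_add_least[OF subgp_Int[OF sg(3,2)]])
         (use cyclic_least[OF smod_Int[OF K(1) ext(1)], of k] kK ext(2) in blast)+
    show "K \<inter> ?N \<subseteq> (K \<inter> N) [+] cyclic k"
    proof
      fix x assume x: "x \<in> K \<inter> ?N"
      then obtain m r where xr: "x = m + r \<bullet>\<^sub>R e" "m \<in> N" "r \<in> R"
        by (auto simp: set_add_def cyclic_def)
      then have "r \<bullet>\<^sub>R e = x + (- m)" by simp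
      then have "r \<bullet>\<^sub>R e \<in> H [+] N" using set_addI[of x H "- m" N] subgp_neg[OF sg(1) xr(2)] x by (simp add: H_def)
      then have "r \<in> lead N e H" using xr(3) by (auto simp: lead_def)
      then obtain y where y: "y \<in> R" "r - y * b \<in> Z" using b(2) by blast
      have "r - y * b \<in> R" using subgp_diff[OF R_subgp xr(3) R_mult[OF y(1) bR]] .
      then have 1: "(r - y * b) \<bullet>\<^sub>R e \<in> N" using flag_Suc.hyps(2) y by simp
      have "y \<bullet>\<^sub>R k = (y * b) \<bullet>\<^sub>R e - y \<bullet>\<^sub>R n" using arg_cong[OF k(1), of "\<lambda>x. y \<bullet>\<^sub>R x"]
        by (simp add: scale_right_distrib)
      then have "x - y \<bullet>\<^sub>R k = m + (r - y * b) \<bullet>\<^sub>R e + y \<bullet>\<^sub>R n"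
        unfolding xr(1) by (simp add: scale_left_diff_distrib)
      also have "\<dots> \<in> N"
        by (intro subgp_add[OF sg(1)] 1 xr(2) smod_scale[OF N y(1) k(3)])
      finally have "x - y \<bullet>\<^sub>R k \<in> K \<inter> N"
        using x subgp_diff[OF sg(3) _ smod_scale[OF K(1) y(1) kK(1)]] by blast
      from set_addI[OF this cyclicI[OF y(1), of k]] show "x \<in> (K \<inter> N) [+] cyclic k" by simp
    qed
  qed
  ultimately show ?case by simp
qed

context
  fixes M :: "'v set" and f :: 'a and Z :: "'a set" and m :: nat and \<zeta> :: "complex \<Rightarrow> complex"
  assumes M: "smod M" and f: "f \<in> R" and fl: "flag Z (img f M) m M"
    and Z: "\<And>z. z \<in> R \<Longrightarrow> z \<in> Z \<Longrightarrow> \<exists>y\<in>R. z = y * f"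
    and pr: "ideals_principal R Z" and zeta: "has_zeta R Z \<zeta>"
begin

lemma smod_peel: "smod (img f M)" "smod (img f (img f M))" "img f M \<subseteq> M" "img f (img f M) \<subseteq> img f M"
  using smod_img M img_subset f by auto

context
  fixes H1 assumes H1: "H1 \<in> smods (img f M)"
begin

text \<open>A member \<open>H\<close> of the fibre over \<open>H1\<close> satisfies
  \<open>f H \<subseteq> H \<inter> f M = H1\<close>, so it lies in this set. The flag count is run
  inside it, with \<open>C = Kf \<inter> f M\<close> and \<open>D = H1\<close>.\<close>

definition "Kf = {x \<in> M. f \<bullet>\<^sub>R x \<in> H1}"

text \<open>The first index identity says that \<open>f\<close>, acting on the finite group
  \<open>f M / H1\<close>, has kernel and cokernel of the same order. The second is the isomorphism
  from \<open>M / (f M + Kf)\<close> to \<open>f M / (f (f M) + H1)\<close> induced by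
  \<open>f\<close>.\<close>

lemma peel_facts:
  shows "smod Kf" "fin_idx M Kf" "smod (Kf \<inter> img f M)" "H1 \<subseteq> Kf \<inter> img f M" "smod H1" "fin_idx (Kf \<inter> img f M) H1"
    "idx (Kf \<inter> img f M) H1 = idx (img f M) (img f (img f M) [+] H1)"
    "idx M (img f M [+] Kf) = idx (img f M) (img f (img f M) [+] H1)"
proof -
  let ?fM = "img f M" let ?C = "Kf \<inter> ?fM" let ?D = "img f ?fM [+] H1"
  have H: "smod H1" "H1 \<subseteq> ?fM" "fin_idx ?fM H1" using H1 by (auto simp: smods_def)
  show "smod H1" by fact
  note sg = smod_subgp[OF M] smod_subgp[OF H(1)] smod_subgp[OF smod_peel(1)] smod_subgp[OF smod_peel(2)]
  note sD = subgp_set_add[OF sg(4,2)]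
  have lin: "f \<bullet>\<^sub>R (x - y) = f \<bullet>\<^sub>R x - f \<bullet>\<^sub>R y" for x y by (rule scale_right_diff_distrib)
  have onto: "\<exists>x\<in>M. y - f \<bullet>\<^sub>R x \<in> W" if "y \<in> ?fM" "subgp W" for y W
  proof -
    from that(1) obtain x where "x \<in> M" "y = f \<bullet>\<^sub>R x" by (auto simp: img_def)
    then show ?thesis using subgp_zero[OF that(2)] by (intro bexI[of _ x]) auto
  qed
  note h1 = idx_hom[OF sg(1) sg(2), of "\<lambda>x. f \<bullet>\<^sub>R x" ?fM, OF lin _ onto[OF _ sg(2)], folded Kf_def]
  show Ks: "smod Kf" unfolding smod_def
  proof (intro conjI ballI)
    show "subgp Kf" using h1(1) by (auto simp: img_def)
    show "r \<bullet>\<^sub>R x \<in> Kf" if "r \<in> R" "x \<in> Kf" for r x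
    proof -
      have "f \<bullet>\<^sub>R r \<bullet>\<^sub>R x = r \<bullet>\<^sub>R f \<bullet>\<^sub>R x" by (simp add: mult.commute)
      then show ?thesis using that smod_scale[OF M] smod_scale[OF H(1)] by (auto simp: Kf_def simp del: scale_scale)
    qed
  qed
  show "fin_idx M Kf" using h1(2) H(3) by (auto simp: img_def)
  show C: "smod ?C" using smod_Int[OF Ks smod_peel(1)] .
  show H1C: "H1 \<subseteq> ?C" using H smod_peel(3) smod_scale[OF H(1) f] by (auto simp: Kf_def)
  note tw1 = idx_tower[OF smod_subgp[OF C] sg(2,3) H1C, OF Int_lower2]
  show "fin_idx ?C H1" using tw1(1) H(3) by blast
  have sub: "H1 \<subseteq> ?D" "?D \<subseteq> ?fM"
    using set_add_upper2[OF sg(4)] set_add_least[OF sg(3) smod_peel(4) H(2)] by auto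
  note tw2 = idx_tower[OF sD sg(2,3) sub]
  have "idx ?fM {x \<in> ?fM. f \<bullet>\<^sub>R x \<in> H1} = idx ?D H1"
  proof (rule idx_hom(3)[OF sg(3,2) lin])
    show "f \<bullet>\<^sub>R x \<in> ?D" if "x \<in> ?fM" for x using that set_add_upper1[OF sg(2), of "img f ?fM"] by (auto simp: img_def)
    show "\<exists>x\<in>?fM. y - f \<bullet>\<^sub>R x \<in> H1" if "y \<in> ?D" for y
    proof -
      from that obtain u h where "y = u + h" "u \<in> img f ?fM" "h \<in> H1" by (rule set_addE)
      moreover from this obtain w where "u = f \<bullet>\<^sub>R w" "w \<in> ?fM" by (auto simp: img_def)
      ultimately show ?thesis by (intro bexI[of _ w]) auto
    qed
  qed
  moreover have "{x \<in> ?fM. f \<bullet>\<^sub>R x \<in> H1} = ?C" using smod_peel(3) by (auto simp: Kf_def)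
  ultimately have "idx ?fM ?C = idx ?D H1" by simp
  \<comment> \<open>Two towers from \<open>H1\<close> to \<open>f M\<close>, through
    \<open>?C\<close> and through \<open>?D\<close>, have the same total index; the common positive
    factor is then cancelled.\<close>
  then have "idx ?D H1 * idx ?C H1 = idx ?D H1 * idx ?fM ?D" using tw1(2) tw2(2) by (metis mult.commute)
  moreover have "idx ?D H1 > 0" using idx_pos[OF sD] tw2(1) H(3) by blast
  ultimately show "idx ?C H1 = idx ?fM ?D" by simp
  have "{x \<in> M. f \<bullet>\<^sub>R x \<in> ?D} = ?fM [+] Kf"
  proof
    show "{x \<in> M. f \<bullet>\<^sub>R x \<in> ?D} \<subseteq> ?fM [+] Kf"
    proof safe
      fix x assume x: "x \<in> M" "f \<bullet>\<^sub>R x \<in> ?D"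
      obtain u h where *: "f \<bullet>\<^sub>R x = u + h" "u \<in> img f ?fM" "h \<in> H1" using x(2) by (rule set_addE)
      then obtain y where y: "u = f \<bullet>\<^sub>R y" "y \<in> ?fM" by (auto simp: img_def)
      then have "f \<bullet>\<^sub>R (x - y) \<in> H1" using * by (simp add: lin)
      moreover have "x - y \<in> M" using x y smod_peel(3) subgp_diff[OF sg(1)] by blast
      ultimately have "x - y \<in> Kf" by (simp add: Kf_def)
      from set_addI[OF y(2) this] show "x \<in> ?fM [+] Kf" by simp
    qed
    show "?fM [+] Kf \<subseteq> {x \<in> M. f \<bullet>\<^sub>R x \<in> ?D}"
    proof safe
      fix x assume "x \<in> ?fM [+] Kf"
      then obtain y k where *: "x = y + k" "y \<in> ?fM" "k \<in> Kf" by (rule set_addE)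
      then show "x \<in> M" using smod_peel(3) subgp_add[OF sg(1)] by (auto simp: Kf_def)
      have "f \<bullet>\<^sub>R y \<in> img f ?fM" "f \<bullet>\<^sub>R k \<in> H1" using * by (auto simp: img_def Kf_def)
      from set_addI[OF this] show "f \<bullet>\<^sub>R x \<in> ?D" using *(1) by (simp add: scale_right_distrib)
    qed
  qed
  with idx_hom(3)[OF sg(1) sD, of "\<lambda>x. f \<bullet>\<^sub>R x" ?fM, OF lin _ onto[OF _ sD]]
  show "idx M (?fM [+] Kf) = idx ?fM ?D" by (auto simp: img_def)
qed

lemma peel_fibre:
  "{H \<in> smods M. H \<inter> img f M = H1} = transversals Kf (Kf \<inter> img f M) H1" (is "?L = ?T")
proof -
  let ?C = "Kf \<inter> img f M"
  note pf = peel_facts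
  note sg = smod_subgp[OF M] smod_subgp[OF pf(1)] smod_subgp[OF pf(3)]
  have KM: "Kf \<subseteq> M" by (auto simp: Kf_def)
  note HC = set_add_commute[of _ ?C]
  show ?thesis
  proof (intro subset_antisym subsetI)
    fix H assume "H \<in> ?L"
    then have H: "H \<in> smods M" "H1 = H \<inter> img f M" by auto
    then have *: "smod H" "H \<subseteq> M" "fin_idx M H" by (auto simp: smods_def)
    have HK: "H \<subseteq> Kf"
    proof
      fix x assume "x \<in> H"
      then have "f \<bullet>\<^sub>R x \<in> H1" using * smod_scale[OF *(1) f] by (auto simp: img_def H(2))
      then show "x \<in> Kf" using *(2) \<open>x \<in> H\<close> by (auto simp: Kf_def)
    qed
    have "fin_idx Kf H" using idx_mono_fin(2)[OF sg(2) smod_subgp[OF *(1)] sg(1) HK KM *(3)] .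
    then have "fin_idx Kf (H [+] ?C)"
      using idx_mono_fin(1)[OF subgp_set_add[OF smod_subgp[OF *(1)] sg(3)] smod_subgp[OF *(1)] sg(2)]
        set_add_upper1[OF sg(3), of H] set_add_least[OF sg(2) HK, of ?C] by blast
    moreover have "H \<inter> ?C = H1" using HK H(2) by blast
    ultimately show "H \<in> ?T"
      unfolding transversals_def using *(1) HK H(2) by blast
  next
    fix H assume "H \<in> ?T"
    then have *: "smod H" "H \<subseteq> Kf" "H \<inter> ?C = H1" "fin_idx Kf (H [+] ?C)" by (auto simp: transversals_def)
    note sH = smod_subgp[OF *(1)]
    have "fin_idx (H [+] ?C) H"
      using idx_set_add(1)[OF sg(3) sH] pf(6) *(3) HC by (simp add: Int_commute)
    then have "fin_idx Kf H"
      using idx_tower(1)[OF subgp_set_add[OF sH sg(3)] sH sg(2)] *(4)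
        set_add_upper1[OF sg(3), of H] set_add_least[OF sg(2) *(2), of ?C] by blast
    then have "fin_idx M H" using idx_tower(1)[OF sg(2) sH sg(1) *(2) KM] pf(2) by blast
    then have "H \<in> smods M" using * KM by (auto simp: smods_def)
    moreover have "H \<inter> img f M = H1" using * by blast
    ultimately show "H \<in> ?L" by blast
  qed
qed

text \<open>Both statistics of \<open>H\<close> split into a part depending on \<open>H1\<close>
  alone and the index of \<open>H [+] (Kf \<inter> img f M)\<close> in \<open>Kf\<close>, which
  \<open>flag_sum\<close> controls.\<close>

lemma peel_idx:
  assumes "H \<in> smods M" "H \<inter> img f M = H1"
  shows "idx M H = idx M (img f M [+] H) * idx (img f M) H1"
    "idx M (img f M [+] H) = idx (img f M) (img f (img f M) [+] H1) * idx Kf (H [+] (Kf \<inter> img f M))"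
    "idx M H > 0" "idx M (img f M [+] H) > 0"
proof -
  let ?fM = "img f M" let ?C = "Kf \<inter> ?fM"
  note pf = peel_facts
  have *: "smod H" "H \<subseteq> M" "fin_idx M H" using assms(1) by (auto simp: smods_def)
  have HK: "H \<subseteq> Kf" using assms peel_fibre by (auto simp: transversals_def)
  have KM: "Kf \<subseteq> M" by (auto simp: Kf_def)
  note sg = smod_subgp[OF M] smod_subgp[OF pf(1)] smod_subgp[OF pf(3)] smod_subgp[OF *(1)] smod_subgp[OF smod_peel(1)]
  have sub: "H \<subseteq> ?fM [+] H" "?fM [+] H \<subseteq> M"
    using set_add_upper2[OF sg(5)] set_add_least[OF sg(1) smod_peel(3) *(2)] by auto
  note tw = idx_tower[OF subgp_set_add[OF sg(5,4)] sg(4,1) sub]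
  show "idx M H = idx M (?fM [+] H) * idx ?fM H1"
    using tw(2) idx_set_add(2)[OF sg(5,4)] assms(2) by (simp add: Int_commute)
  show "idx M H > 0" "idx M (?fM [+] H) > 0" using *(3) tw(1) by (auto intro!: idx_pos[OF sg(1)])
  have sub2: "?fM [+] H \<subseteq> ?fM [+] Kf" "?fM [+] Kf \<subseteq> M"
    using HK set_add_least[OF sg(1) smod_peel(3) KM] by (auto simp: set_add_def)
  note tw2 = idx_tower[OF subgp_set_add[OF sg(5,2)] subgp_set_add[OF sg(5,4)] sg(1) sub2]
  have eq: "Kf [+] (?fM [+] H) = ?fM [+] Kf" by (rule set_add_absorb[OF sg(2,4) HK])
  have "?fM \<inter> Kf [+] H = H [+] ?C" 
    by (simp add: set_add_commute Int_commute)
  then have "idx (?fM [+] Kf) (?fM [+] H) = idx Kf (H [+] ?C)"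
    using idx_set_add(2)[OF sg(2) subgp_set_add[OF sg(5,4)]] modular_law[OF sg(2) HK, of ?fM]
    unfolding eq by simp
  then show "idx M (?fM [+] H) = idx ?fM (img f ?fM [+] H1) * idx Kf (H [+] ?C)"
    using tw2(2) pf(8) by simp
qed

text \<open>The index handled by \<open>flag_sum\<close> occurs with exponent \<open>s + t\<close>.
  The constant produced there is the \<open>m\<close>-th power of the index of
  \<open>f (f M) + H1\<close> in \<open>f M\<close>, and it lowers the exponent of this very index
  to \<open>s + t - m\<close>.\<close>

lemma peel_inner:
  assumes "\<And>j. j < m \<Longrightarrow> Re (s + t) > real j"
  shows "((\<lambda>H. npow (idx M H) s * npow (idx M (img f M [+] H)) t) has_sum
      npow (idx (img f M) H1) s * npow (idx (img f M) (img f (img f M) [+] H1)) (s + t - of_nat m)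
        * (\<Prod>j<m. \<zeta> (s + t - of_nat j))) {H \<in> smods M. H \<inter> img f M = H1}"
proof -
  let ?fM = "img f M" let ?C = "Kf \<inter> ?fM" let ?c = "idx ?fM (img f ?fM [+] H1)"
  note pf = peel_facts
  have "flag Z ?C m Kf"
    using flag_Int[OF fl smod_peel(1) M order_refl pf(1) _ pf(2) pr] by (auto simp: Kf_def Int_absorb2)
  moreover have "z \<bullet>\<^sub>R x \<in> H1" if "z \<in> R" "z \<in> Z" "x \<in> Kf" for z x
  proof -
    from Z that obtain y where y: "y \<in> R" "z = y * f" by blast
    then have "z \<bullet>\<^sub>R x = y \<bullet>\<^sub>R f \<bullet>\<^sub>R x" by simp
    then show ?thesis using that y smod_scale[OF pf(5)] by (auto simp: Kf_def simp del: scale_scale)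
  qed
  ultimately have *: "((\<lambda>H. npow (idx Kf (H [+] ?C)) (s + t)) has_sum
      (of_nat ?c ^ m * (\<Prod>j<m. \<zeta> (s + t - of_nat j)))) (transversals Kf ?C H1)"
    using flag_sum[OF _ pf(3,5,4,6) pr zeta, of m Kf "s + t"] assms unfolding pf(7) by blast
  have cpos: "?c > 0" using idx_pos[OF smod_subgp[OF pf(3)] pf(6)] pf(7) by simp
  note ** = has_sum_cmult_right[OF *, of "npow (idx ?fM H1) s * npow ?c (s + t)"]
  have ***: "npow (idx ?fM H1) s * npow ?c (s + t - of_nat m) * (\<Prod>j<m. \<zeta> (s + t - of_nat j)) =
     npow (idx ?fM H1) s * npow ?c (s + t) * (of_nat ?c ^ m * (\<Prod>j<m. \<zeta> (s + t - of_nat j)))"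
    using npow_of_nat[OF cpos, of "s + t" m] by simp
  show ?thesis unfolding *** peel_fibre
  proof (rule iffD1[OF has_sum_cong **])
    fix H assume "H \<in> transversals Kf ?C H1"
    then have "H \<in> smods M" "H \<inter> ?fM = H1" using peel_fibre by blast+
    note pi = peel_idx[OF this]
    have "npow (idx M H) s * npow (idx M (?fM [+] H)) t = npow (idx ?fM H1) s * npow (idx M (?fM [+] H)) (s + t)"
      unfolding npow_add[OF pi(4)] pi(1) npow_mult by (simp add: algebra_simps)
    then show "npow (idx ?fM H1) s * npow ?c (s + t) * npow (idx Kf (H [+] ?C)) (s + t) =
      npow (idx M H) s * npow (idx M (?fM [+] H)) t"
      unfolding pi(2) npow_mult by simp
  qed
qed

end

text \<open>The norm of a term at \<open>(s, t)\<close> is the term at the real parts, so absolute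
  summability is the same assertion for real arguments. For this reason \<open>IH\<close> covers all
  arguments with these real parts.\<close>

lemma peel:
  assumes pos: "\<And>j. j < m \<Longrightarrow> Re (s + t) > real j"
    and IH: "\<And>s' t'. Re s' = Re s \<Longrightarrow> Re t' = Re t \<Longrightarrow>
      ((\<lambda>H. npow (idx (img f M) H) s' * npow (idx (img f M) (img f (img f M) [+] H)) (s' + t' - of_nat m))
        has_sum S s' t') (smods (img f M))"
  shows "((\<lambda>H. npow (idx M H) s * npow (idx M (img f M [+] H)) t) has_sum
      (\<Prod>j<m. \<zeta> (s + t - of_nat j)) * S s t) (smods M)"
proof -
  let ?fM = "img f M"
  let ?G = "\<lambda>s t H. npow (idx ?fM H) s * npow (idx ?fM (img f ?fM [+] H)) (s + t - of_nat m)
        * (\<Prod>j<m. \<zeta> (s + t - of_nat j))"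
  let ?s = "of_real (Re s) :: complex" and ?t = "of_real (Re t) :: complex"
  have p: "H \<inter> ?fM \<in> smods ?fM" if "H \<in> smods M" for H
  proof -
    have *: "smod H" "H \<subseteq> M" "fin_idx M H" using that by (auto simp: smods_def)
    note sg = smod_subgp[OF *(1)] smod_subgp[OF smod_peel(1)] smod_subgp[OF M]
    have "fin_idx (?fM [+] H) H"
      using idx_mono_fin(2)[OF subgp_set_add[OF sg(2,1)] sg(1,3) _ _ *(3)]
        set_add_upper2[OF sg(2), of H] set_add_least[OF sg(3) smod_peel(3) *(2)] by blast
    then show ?thesis using idx_set_add(1)[OF sg(2,1)] smod_Int[OF *(1) smod_peel(1)]
      by (simp add: smods_def Int_commute)
  qed
  have outer: "(?G s' t' has_sum (\<Prod>j<m. \<zeta> (s' + t' - of_nat j)) * S s' t') (smods ?fM)"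
    if "Re s' = Re s" "Re t' = Re t" for s' t'
    using has_sum_cmult_left[OF IH[OF that], of "\<Prod>j<m. \<zeta> (s' + t' - of_nat j)"] by (simp add: mult.commute)
  show ?thesis
  proof (rule has_sum_fibration[where p = "\<lambda>H. H \<inter> ?fM" and P = "smods ?fM" and G = "?G s t" and G' = "\<lambda>H. Re (?G ?s ?t H)"])
    show "(\<lambda>H. Re (?G ?s ?t H)) summable_on smods ?fM"
      using has_sum_imp_summable[OF outer, of ?s ?t] by (intro summable_on_Re) simp
    fix H1 assume H1: "H1 \<in> smods ?fM"
    show "((\<lambda>H. npow (idx M H) s * npow (idx M (?fM [+] H)) t) has_sum ?G s t H1) {H \<in> smods M. H \<inter> ?fM = H1}"
      by (rule peel_inner[OF H1 pos])
    have "((\<lambda>H. Re (npow (idx M H) ?s * npow (idx M (?fM [+] H)) ?t)) has_sum Re (?G ?s ?t H1)) {H \<in> smods M. H \<inter> ?fM = H1}"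
      using pos by (intro has_sum_Re peel_inner[OF H1]) auto
    then show "((\<lambda>H. norm (npow (idx M H) s * npow (idx M (?fM [+] H)) t)) has_sum Re (?G ?s ?t H1)) {H \<in> smods M. H \<inter> ?fM = H1}"
    proof (rule iffD1[OF has_sum_cong, rotated])
      fix H assume "H \<in> {H \<in> smods M. H \<inter> ?fM = H1}"
      then have pi: "idx M H > 0" "idx M (?fM [+] H) > 0" using peel_idx(3,4)[OF H1] by blast+
      show "Re (npow (idx M H) ?s * npow (idx M (?fM [+] H)) ?t) = norm (npow (idx M H) s * npow (idx M (?fM [+] H)) t)"
        using norm_npow[OF pi(1), of s] norm_npow[OF pi(2), of t] npow_real[of "idx M H" "Re s"]
        by (simp add: norm_mult complex_is_Real_iff)
    qed
  qed (use p outer in auto)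
qed

end

end

section \<open>Direct sums of cyclic modules\<close>

text \<open>One unfolding corresponds to one layer with \<open>m\<close> summands; \<open>t\<close>
  is the exponent of the index of \<open>f M + H\<close>.\<close>

fun zprod :: "(complex \<Rightarrow> complex) \<Rightarrow> nat list \<Rightarrow> complex \<Rightarrow> complex \<Rightarrow> complex" where
  "zprod \<zeta> [] s t = 1"
| "zprod \<zeta> (m # ms) s t = (\<Prod>j<m. \<zeta> (s + t - of_nat j)) * zprod \<zeta> ms s (s + t - of_nat m)"

text \<open>Keeps all arguments occurring in \<open>zprod\<close> inside the half-plane where
  \<open>has_zeta\<close> applies.\<close>

fun zpos :: "nat list \<Rightarrow> real \<Rightarrow> real \<Rightarrow> bool" where
  "zpos [] s t \<longleftrightarrow> True"
| "zpos (m # ms) s t \<longleftrightarrow> (\<forall>j<m. s + t > real j) \<and> zpos ms s (s + t - real m)"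

locale subring_module_idom = subring_module scale R
  for scale :: "'a::idom \<Rightarrow> 'v::ab_group_add \<Rightarrow> 'v" (infixr "\<bullet>\<^sub>R" 75) and R
begin

text \<open>Internal form of \<open>M\<close> being the direct sum of the quotients of
  \<open>R\<close> by \<open>(p l)\<close>. The generators stay explicit, so that passing to
  \<open>f M\<close> only multiplies them by \<open>f\<close> and adapts \<open>p\<close>.\<close>

definition cyclic_sum :: "'i set \<Rightarrow> ('i \<Rightarrow> 'v) \<Rightarrow> ('i \<Rightarrow> 'a) \<Rightarrow> 'v set \<Rightarrow> bool" where
  "cyclic_sum I e p M \<longleftrightarrow> finite I \<and> M = {\<Sum>l\<in>I. g l \<bullet>\<^sub>R e l | g. \<forall>l\<in>I. g l \<in> R} \<and>
     (\<forall>g. (\<forall>l\<in>I. g l \<in> R) \<longrightarrow> (\<Sum>l\<in>I. g l \<bullet>\<^sub>R e l) = 0 \<longrightarrow> (\<forall>l\<in>I. \<exists>y\<in>R. g l = y * p l)) \<and>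
     (\<forall>l\<in>I. p l \<in> R \<and> p l \<bullet>\<^sub>R e l = 0)"

definition comax :: "'a \<Rightarrow> 'a \<Rightarrow> bool" where
  "comax f p \<longleftrightarrow> (\<exists>u\<in>R. \<exists>w\<in>R. u * f + w * p = 1)"

lemma R_zero: "0 \<in> R" and R_diff: "x \<in> R \<Longrightarrow> y \<in> R \<Longrightarrow> x - y \<in> R" and R_add: "x \<in> R \<Longrightarrow> y \<in> R \<Longrightarrow> x + y \<in> R"
  using R_subgp subgp_zero subgp_diff subgp_add by blast+

lemma R_power: "x \<in> R \<Longrightarrow> x ^ n \<in> R"
  by (induction n) (auto intro: R_one R_mult)

lemma comax_1: "comax f 1"
  unfolding comax_def using R_one R_zero by (intro bexI[of _ 0] bexI[of _ 1]) auto

lemma comax_mult: assumes "comax f p" "comax f q" "f \<in> R" "p \<in> R" "q \<in> R" shows "comax f (p * q)"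
proof -
  obtain u w u' w' where *: "u \<in> R" "w \<in> R" "u' \<in> R" "w' \<in> R" "u * f + w * p = 1" "u' * f + w' * q = 1"
    using assms(1,2) by (auto simp: comax_def)
  have "(u * f + w * p) * (u' * f + w' * q) = 1" using * by simp
  then have "(u * (u' * f) + u * (w' * q) + w * (p * u')) * f + (w * w') * (p * q) = 1"
    by (simp add: algebra_simps)
  moreover have "u * (u' * f) + u * (w' * q) + w * (p * u') \<in> R" "w * w' \<in> R"
    using * assms(3-5) by (auto intro!: R_add R_mult)
  ultimately show ?thesis unfolding comax_def by blast
qed

lemma comax_power: "comax f p \<Longrightarrow> f \<in> R \<Longrightarrow> p \<in> R \<Longrightarrow> comax f (p ^ n)"
  by (induction n) (auto intro: comax_1 comax_mult R_power)

lemma comax_dvd: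
  assumes "comax f p" "f \<in> R" "g \<in> R" "y \<in> R" "f * g = y * p" shows "\<exists>x\<in>R. g = x * p"
proof -
  obtain u w where *: "u \<in> R" "w \<in> R" "u * f + w * p = 1" using assms(1) by (auto simp: comax_def)
  have "g = g * (u * f + w * p)" using * by simp
  also have "\<dots> = u * (f * g) + g * w * p" by (simp add: algebra_simps)
  also have "\<dots> = (u * y + g * w) * p" by (simp add: algebra_simps assms(5))
  finally show ?thesis using * assms by (intro bexI[of _ "u * y + g * w"]) (auto intro!: R_add R_mult)
qed

lemma cyclic_sumD:
  assumes "cyclic_sum I e p M"
  shows "finite I" "M = {\<Sum>l\<in>I. g l \<bullet>\<^sub>R e l | g. \<forall>l\<in>I. g l \<in> R}"
    "\<And>g l. (\<And>l. l \<in> I \<Longrightarrow> g l \<in> R) \<Longrightarrow> (\<Sum>l\<in>I. g l \<bullet>\<^sub>R e l) = 0 \<Longrightarrow> l \<in> I \<Longrightarrow> \<exists>y\<in>R. g l = y * p l"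
    "\<And>l. l \<in> I \<Longrightarrow> p l \<in> R" "\<And>l. l \<in> I \<Longrightarrow> p l \<bullet>\<^sub>R e l = 0"
  using assms unfolding cyclic_sum_def by blast+

lemma cyclic_sum_cong:
  assumes "\<And>l. l \<in> I \<Longrightarrow> p l = q l" shows "cyclic_sum I e p M \<longleftrightarrow> cyclic_sum I e q M"
  unfolding cyclic_sum_def using assms by (intro conj_cong refl all_cong ball_cong imp_cong) auto

lemma smod_cyclic_sum: assumes "cyclic_sum I e p M" shows "smod M"
  unfolding smod_def subgp_def
proof (intro conjI ballI)
  note M = cyclic_sumD(2)[OF assms]
  show "0 \<in> M" unfolding M using R_zero by (force intro!: exI[of _ "\<lambda>_. 0"])
  fix x assume "x \<in> M"
  then obtain g where g: "x = (\<Sum>l\<in>I. g l \<bullet>\<^sub>R e l)" "\<forall>l\<in>I. g l \<in> R" unfolding M by blast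
  show "x - y \<in> M" if "y \<in> M" for y
  proof -
    from that obtain h where h: "y = (\<Sum>l\<in>I. h l \<bullet>\<^sub>R e l)" "\<forall>l\<in>I. h l \<in> R" unfolding M by blast
    then have "x - y = (\<Sum>l\<in>I. (g l - h l) \<bullet>\<^sub>R e l)" "\<forall>l\<in>I. g l - h l \<in> R"
      using g R_diff by (auto simp: scale_left_diff_distrib sum_subtractf)
    then show ?thesis unfolding M by (intro CollectI exI[of _ "\<lambda>l. g l - h l"]) auto
  qed
  show "r \<bullet>\<^sub>R x \<in> M" if "r \<in> R" for r
  proof -
    have "r \<bullet>\<^sub>R x = (\<Sum>l\<in>I. (r * g l) \<bullet>\<^sub>R e l)" "\<forall>l\<in>I. r * g l \<in> R"
      using g that R_mult by (auto simp: scale_sum_right)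
    then show ?thesis unfolding M by (intro CollectI exI[of _ "\<lambda>l. r * g l"]) auto
  qed
qed

context
  fixes I :: "'i set" and e :: "'i \<Rightarrow> 'v" and p :: "'i \<Rightarrow> 'a" and M :: "'v set"
    and f :: 'a and A :: "'i set" and p' :: "'i \<Rightarrow> 'a"
  assumes cyc: "cyclic_sum I e p M" and f: "f \<in> R" "f \<noteq> 0" and A: "A \<subseteq> I"
    and pA: "\<And>l. l \<in> A \<Longrightarrow> p l = f * p' l" "\<And>l. l \<in> A \<Longrightarrow> p' l \<in> R"
    and pB: "\<And>l. l \<in> I - A \<Longrightarrow> p' l = p l" "\<And>l. l \<in> I - A \<Longrightarrow> comax f (p l)"
begin

text \<open>On \<open>A\<close> one factor \<open>f\<close> cancels from the annihilator. Elsewhere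
  \<open>f\<close> is invertible modulo \<open>p l\<close>, and the annihilator stays the
  same.\<close>

lemma cyclic_sum_img: "cyclic_sum I (\<lambda>l. f \<bullet>\<^sub>R e l) p' (img f M)"
  unfolding cyclic_sum_def
proof (intro conjI allI impI ballI)
  note M = cyclic_sumD(2)[OF cyc]
  show "finite I" using cyclic_sumD(1)[OF cyc] .
  have *: "f \<bullet>\<^sub>R (\<Sum>l\<in>I. g l \<bullet>\<^sub>R e l) = (\<Sum>l\<in>I. g l \<bullet>\<^sub>R f \<bullet>\<^sub>R e l)" for g
    by (simp add: scale_sum_right mult.commute)
  show "img f M = {\<Sum>l\<in>I. g l \<bullet>\<^sub>R f \<bullet>\<^sub>R e l |g. \<forall>l\<in>I. g l \<in> R}"
    unfolding M img_def *[symmetric] by blast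
  show "p' l \<in> R" if "l \<in> I" for l using that pA pB cyclic_sumD(4)[OF cyc that] by (cases "l \<in> A") auto
  show "p' l \<bullet>\<^sub>R f \<bullet>\<^sub>R e l = 0" if "l \<in> I" for l
  proof (cases "l \<in> A")
    case True
    then show ?thesis using cyclic_sumD(5)[OF cyc that] pA(1) by (simp add: mult.commute)
  next
    case False
    have "p' l \<bullet>\<^sub>R f \<bullet>\<^sub>R e l = f \<bullet>\<^sub>R p' l \<bullet>\<^sub>R e l" by (simp add: mult.commute)
    with False that show ?thesis using cyclic_sumD(5)[OF cyc that] pB(1) by (simp del: scale_scale)
  qed
  fix g l assume g: "\<forall>l\<in>I. g l \<in> R" "(\<Sum>l\<in>I. g l \<bullet>\<^sub>R f \<bullet>\<^sub>R e l) = 0" and l: "l \<in> I"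
  have "(\<Sum>l\<in>I. (f * g l) \<bullet>\<^sub>R e l) = 0" using g(2) by (simp add: mult.commute)
  then obtain y where y: "y \<in> R" "f * g l = y * p l"
    using cyclic_sumD(3)[OF cyc, of "\<lambda>l. f * g l" l] g(1) l R_mult[OF f(1)] by blast
  show "\<exists>y\<in>R. g l = y * p' l"
  proof (cases "l \<in> A")
    case True
    then have "f * g l = f * (y * p' l)" using y(2) pA(1) by (simp add: mult.left_commute)
    then show ?thesis using f(2) y(1) by auto
  next
    case False
    then show ?thesis using comax_dvd[OF pB(2) f(1) _ y] g(1) l pB(1) by auto
  qed
qed

text \<open>\<open>M / f M\<close> has one summand \<open>R / (f)\<close> for every \<open>l\<close>
  in \<open>A\<close>, and none for the other \<open>l\<close>, where \<open>f\<close> and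
  \<open>p l\<close> generate the unit ideal. Adding these generators one at a time gives the
  flag.\<close>

lemma cyclic_sum_flag:
  assumes Z: "\<And>r. r \<in> R \<Longrightarrow> r \<in> Z \<longleftrightarrow> (\<exists>y\<in>R. r = y * f)"
  shows "flag Z (img f M) (card A) M"
proof -
  note M = cyclic_sumD(2)[OF cyc] and fin = cyclic_sumD(1)[OF cyc]
  \<comment> \<open>The stage at which the generators from \<open>B\<close> have been added: the
    other coefficients on \<open>A\<close> are still divisible by \<open>f\<close>.\<close>
  define N where "N B = {\<Sum>l\<in>I. g l \<bullet>\<^sub>R e l | g. (\<forall>l\<in>I. g l \<in> R) \<and> (\<forall>l\<in>A - B. g l \<in> Z)}" for B
  have NI: "(\<Sum>l\<in>I. g l \<bullet>\<^sub>R e l) \<in> N B" if "\<And>l. l \<in> I \<Longrightarrow> g l \<in> R" "\<And>l. l \<in> A - B \<Longrightarrow> g l \<in> Z" for g B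
    using that unfolding N_def by blast
  have Z0: "0 \<in> Z" using Z[OF R_zero] R_zero by force
  have delta: "(\<Sum>l\<in>I. (if l = b then r else 0) \<bullet>\<^sub>R e l) = r \<bullet>\<^sub>R e b" if "b \<in> I" for r b
    using fin that by (simp add: if_distrib[of "\<lambda>x. x \<bullet>\<^sub>R _"] cong: if_cong)
  have N0: "N {} = img f M"
  proof (intro subset_antisym subsetI)
    fix x assume "x \<in> N {}"
    then obtain g where g: "x = (\<Sum>l\<in>I. g l \<bullet>\<^sub>R e l)" "\<And>l. l \<in> I \<Longrightarrow> g l \<in> R" "\<And>l. l \<in> A \<Longrightarrow> g l \<in> Z"
      unfolding N_def by auto
    have "\<exists>y\<in>R. g l \<bullet>\<^sub>R e l = (y * f) \<bullet>\<^sub>R e l" if l: "l \<in> I" for l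
    proof (cases "l \<in> A")
      case True
      then obtain y where "y \<in> R" "g l = y * f" using Z[OF g(2)[OF l]] g(3) by blast
      then show ?thesis by (intro bexI[of _ y]) auto
    next
      case False
      then obtain u w where *: "u \<in> R" "w \<in> R" "u * f + w * p l = 1" using pB(2)[of l] l unfolding comax_def by blast
      have "(w * p l) \<bullet>\<^sub>R e l = 0" using cyclic_sumD(5)[OF cyc l] by (simp flip: scale_scale)
      then have "e l = (u * f) \<bullet>\<^sub>R e l" using *(3) by (metis add.right_neutral scale_left_distrib scale_one)
      then have "g l \<bullet>\<^sub>R e l = (g l * u * f) \<bullet>\<^sub>R e l" by (metis scale_scale mult.assoc)
      then show ?thesis using R_mult[OF g(2)[OF l] *(1)] by blast
    qed
    then obtain y where y: "\<And>l. l \<in> I \<Longrightarrow> y l \<in> R" "\<And>l. l \<in> I \<Longrightarrow> g l \<bullet>\<^sub>R e l = (y l * f) \<bullet>\<^sub>R e l" by metis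
    have "x = f \<bullet>\<^sub>R (\<Sum>l\<in>I. y l \<bullet>\<^sub>R e l)" using y(2) by (simp add: g(1) scale_sum_right mult.commute)
    moreover have "(\<Sum>l\<in>I. y l \<bullet>\<^sub>R e l) \<in> M" unfolding M using y(1) by blast
    ultimately show "x \<in> img f M" unfolding img_def by blast
  next
    fix x assume "x \<in> img f M"
    then obtain g where g: "x = f \<bullet>\<^sub>R (\<Sum>l\<in>I. g l \<bullet>\<^sub>R e l)" "\<And>l. l \<in> I \<Longrightarrow> g l \<in> R" by (auto simp: img_def M)
    then have "x = (\<Sum>l\<in>I. (g l * f) \<bullet>\<^sub>R e l)" by (simp add: scale_sum_right mult.commute)
    moreover have "g l * f \<in> R" "g l * f \<in> Z" if "l \<in> I" for l using Z R_mult g(2)[OF that] f(1) by auto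
    ultimately show "x \<in> N {}" using NI[of "\<lambda>l. g l * f" "{}"] A by auto
  qed
  note finA = finite_subset[OF A fin]
  have flB: "B \<subseteq> A \<Longrightarrow> flag Z (img f M) (card B) (N B)" if "finite B" for B
    using that
  proof (induction B rule: finite_induct)
    case empty
    show ?case by (simp add: N0 flag.flag_0)
  next
    case (insert b B)
    have b: "b \<in> I" "b \<in> A" using insert.prems A by auto
    have "r \<bullet>\<^sub>R e b \<in> N B \<longleftrightarrow> r \<in> Z" if r: "r \<in> R" for r
    proof
      assume "r \<bullet>\<^sub>R e b \<in> N B"
      then obtain g where g: "r \<bullet>\<^sub>R e b = (\<Sum>l\<in>I. g l \<bullet>\<^sub>R e l)" "\<And>l. l \<in> I \<Longrightarrow> g l \<in> R" "\<And>l. l \<in> A - B \<Longrightarrow> g l \<in> Z"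
        unfolding N_def by auto
      have "(\<Sum>l\<in>I. ((if l = b then r else 0) - g l) \<bullet>\<^sub>R e l) = 0"
        unfolding scale_left_diff_distrib sum_subtractf delta[OF b(1)] g(1) by simp
      moreover have "(if l = b then r else 0) - g l \<in> R" if "l \<in> I" for l
        using R_diff[of _ "g l"] g(2)[OF that] r R_zero by auto
      ultimately obtain y where y: "y \<in> R" "r - g b = y * p b"
        using cyclic_sumD(3)[OF cyc, of "\<lambda>l. (if l = b then r else 0) - g l", OF _ _ b(1)] by auto
      have "g b \<in> Z" using g(3) b insert.hyps(2) by blast
      then obtain y' where y': "y' \<in> R" "g b = y' * f" using Z[OF g(2)[OF b(1)]] by blast
      have "r = y * p b + y' * f" using y(2) y'(2) by (simp add: algebra_simps)
      then have "r = (y * p' b + y') * f" unfolding pA(1)[OF b(2)] by (simp add: algebra_simps)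
      then show "r \<in> Z" using Z[OF r] R_add[OF R_mult[OF y(1) pA(2)[OF b(2)]] y'(1)] by blast
    next
      assume "r \<in> Z"
      then show "r \<bullet>\<^sub>R e b \<in> N B" unfolding delta[OF b(1), symmetric] using r R_zero Z0 by (intro NI) auto
    qed
    then have "flag Z (img f M) (Suc (card B)) (N B [+] cyclic (e b))"
      using insert by (intro flag.flag_Suc) auto
    moreover have "N B [+] cyclic (e b) = N (insert b B)"
    proof (intro subset_antisym subsetI)
      fix x assume "x \<in> N B [+] cyclic (e b)"
      then obtain z r where x: "x = z + r \<bullet>\<^sub>R e b" "z \<in> N B" "r \<in> R" by (auto elim!: set_addE simp: cyclic_def)
      then obtain g where g: "z = (\<Sum>l\<in>I. g l \<bullet>\<^sub>R e l)" "\<And>l. l \<in> I \<Longrightarrow> g l \<in> R" "\<And>l. l \<in> A - B \<Longrightarrow> g l \<in> Z"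
        unfolding N_def by auto
      have "x = (\<Sum>l\<in>I. (g l + (if l = b then r else 0)) \<bullet>\<^sub>R e l)"
        unfolding scale_left_distrib sum.distrib delta[OF b(1)] x(1) g(1) by simp
      also have "\<dots> \<in> N (insert b B)"
      proof (rule NI)
        show "g l + (if l = b then r else 0) \<in> R" if "l \<in> I" for l
          using g(2)[OF that] R_add[OF _ x(3), of "g l"] by (cases "l = b") auto
        show "g l + (if l = b then r else 0) \<in> Z" if "l \<in> A - insert b B" for l
          using g(3) that by simp
      qed
      finally show "x \<in> N (insert b B)" .
    next
      fix x assume "x \<in> N (insert b B)"
      then obtain g where g: "x = (\<Sum>l\<in>I. g l \<bullet>\<^sub>R e l)" "\<And>l. l \<in> I \<Longrightarrow> g l \<in> R" "\<And>l. l \<in> A - insert b B \<Longrightarrow> g l \<in> Z"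
        unfolding N_def by auto
      let ?h = "\<lambda>l. if l = b then 0 else g l"
      have "?h l \<bullet>\<^sub>R e l + (if l = b then g b else 0) \<bullet>\<^sub>R e l = g l \<bullet>\<^sub>R e l" for l by simp
      then have "x = (\<Sum>l\<in>I. ?h l \<bullet>\<^sub>R e l) + (\<Sum>l\<in>I. (if l = b then g b else 0) \<bullet>\<^sub>R e l)"
        unfolding g(1) sum.distrib[symmetric] by simp
      then have "x = (\<Sum>l\<in>I. ?h l \<bullet>\<^sub>R e l) + g b \<bullet>\<^sub>R e b" unfolding delta[OF b(1)] .
      moreover have "(\<Sum>l\<in>I. ?h l \<bullet>\<^sub>R e l) \<in> N B" using g R_zero Z0 by (intro NI) auto
      ultimately show "x \<in> N B [+] cyclic (e b)" using cyclicI[OF g(2)[OF b(1)], of "e b"] by (simp add: set_addI)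
    qed
    ultimately show ?case using insert by simp
  qed
  from flB[OF finA] have "flag Z (img f M) (card A) (N A)" by simp
  moreover have "N A = M" unfolding N_def M by simp
  ultimately show ?thesis by simp
qed

end

lemma smods_pos:
  assumes "smod M" "H \<in> smods M" "smod N" "N \<subseteq> M" shows "idx M (N [+] H) > 0" "idx M H > 0"
proof -
  have H: "smod H" "H \<subseteq> M" "fin_idx M H" using assms by (auto simp: smods_def)
  note sg = smod_subgp[OF H(1)] smod_subgp[OF assms(3)] smod_subgp[OF assms(1)]
  show "idx M (N [+] H) > 0"
    using idx_pos[OF sg(3)] idx_mono_fin(1)[OF subgp_set_add[OF sg(2,1)] sg(1,3) _ _ H(3)]
      set_add_upper2[OF sg(2), of H] set_add_least[OF sg(3) assms(4) H(2)] by blast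
  show "idx M H > 0" using idx_pos[OF sg(3) H(3)] .
qed

text \<open>The exponents of \<open>f\<close> all drop by one when passing from \<open>M\<close> to \<open>f M\<close>, which shifts the dual
  partition by one.\<close>

lemma primary_sum:
  assumes f: "f \<in> R" "f \<noteq> 0" and J: "J \<subseteq> I" and q: "\<And>l. l \<in> I - J \<Longrightarrow> comax f (q l)"
    and Z: "\<And>r. r \<in> R \<Longrightarrow> r \<in> Z \<longleftrightarrow> (\<exists>y\<in>R. r = y * f)"
    and pr: "ideals_principal R Z" and zeta: "has_zeta R Z \<zeta>"
    and rest: "\<And>M e s'. Re s' = Re s \<Longrightarrow> cyclic_sum I e (\<lambda>l. if l \<in> J then 1 else q l) M \<Longrightarrow>
      ((\<lambda>H. npow (idx M H) s') has_sum S s') (smods M)"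
  shows "cyclic_sum I e (\<lambda>l. if l \<in> J then f ^ lam l else q l) M \<Longrightarrow> (\<And>l. l \<in> J \<Longrightarrow> lam l \<le> r) \<Longrightarrow>
    Re s' = Re s \<Longrightarrow> zpos (map (\<lambda>a. card {l\<in>J. a \<le> lam l}) [1..<Suc r]) (Re s') (Re t) \<Longrightarrow>
    ((\<lambda>H. npow (idx M H) s' * npow (idx M (img f M [+] H)) t)
      has_sum zprod \<zeta> (map (\<lambda>a. card {l\<in>J. a \<le> lam l}) [1..<Suc r]) s' t * S s') (smods M)"
proof (induction r arbitrary: M e lam s' t)
  \<comment> \<open>All exponents vanish, so \<open>f\<close> is comaximal to every annihilator. The
    flag from \<open>f M\<close> to \<open>M\<close> then has length 0, and the weight in
    \<open>t\<close> is 1.\<close>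
  case 0
  let ?p = "\<lambda>l. if l \<in> J then f ^ lam l else q l"
  have eq: "?p l = (if l \<in> J then 1 else q l)" for l using "0.prems"(2)[of l] by auto
  have "comax f (?p l)" if "l \<in> I" for l using eq[of l] q[of l] comax_1 that by auto
  note cf = cyclic_sum_flag[OF "0.prems"(1) f, where A = "{}" and p' = ?p, OF _ _ _ _ this Z]
  have "flag Z (img f M) 0 M" using cf by simp
  then have img: "img f M = M" by (cases rule: flag.cases) auto
  have M: "smod M" by (rule smod_cyclic_sum[OF "0.prems"(1)])
  have "npow (idx M H) s' * npow (idx M (img f M [+] H)) t = npow (idx M H) s'" if "H \<in> smods M" for H
  proof -
    have H: "subgp H" "H \<subseteq> M" using that smod_subgp by (auto simp: smods_def)
    have "M [+] H = M" using set_add_upper1[OF H(1)] set_add_least[OF smod_subgp[OF M] order_refl H(2)] by blast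
    then show ?thesis using img idx_self(2)[OF smod_subgp[OF M]] by simp
  qed
  from iffD2[OF has_sum_cong[OF this] rest[OF "0.prems"(3) "0.prems"(1)[unfolded eq]]]
  show ?case by simp
next
  case (Suc r)
  let ?p = "\<lambda>l. if l \<in> J then f ^ lam l else q l"
  let ?A = "{l\<in>J. 1 \<le> lam l}" and ?lam = "\<lambda>l. lam l - 1"
  let ?p' = "\<lambda>l. if l \<in> J then f ^ ?lam l else q l"
  let ?ms = "map (\<lambda>a. card {l\<in>J. a \<le> ?lam l}) [1..<Suc r]"
  have M: "smod M" by (rule smod_cyclic_sum[OF Suc.prems(1)])
  have pA: "?p l = f * ?p' l" "?p' l \<in> R" if "l \<in> ?A" for l
    using that f(1) by (cases "lam l"; auto intro: R_power)+
  have pB: "?p' l = ?p l" "comax f (?p l)" if "l \<in> I - ?A" for l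
    using that q[of l] comax_1 by (auto simp: not_le)
  have AI: "?A \<subseteq> I" using J by auto
  note cyc' = cyclic_sum_img[OF Suc.prems(1) f AI pA pB]
  note fl = cyclic_sum_flag[OF Suc.prems(1) f AI pA pB Z]
  \<comment> \<open>Dropping the first entry of the list of counts amounts to lowering all exponents
    by one; the dropped entry is the number of summands with positive exponent.\<close>
  have upt: "[1..<Suc (Suc r)] = 1 # map Suc [1..<Suc r]"
    using upt_conv_Cons[of 1 "Suc (Suc r)"] by (simp add: map_Suc_upt del: upt_Suc)
  have "card {l \<in> J. Suc a \<le> lam l} = card {l \<in> J. a \<le> ?lam l}" if "a \<ge> 1" for a
    by (rule arg_cong[where f = card]) (use that in auto)
  then have ms: "map (\<lambda>a. card {l\<in>J. a \<le> lam l}) [1..<Suc (Suc r)] = card ?A # ?ms"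
    unfolding upt by auto
  have pos: "Re (s' + t) > real j" if "j < card ?A" for j using Suc.prems(4) that unfolding ms by simp
  have "((\<lambda>H. npow (idx M H) s' * npow (idx M (img f M [+] H)) t) has_sum
      (\<Prod>j<card ?A. \<zeta> (s' + t - of_nat j)) * (zprod \<zeta> ?ms s' (s' + t - of_nat (card ?A)) * S s')) (smods M)"
  proof (rule peel[OF M f(1) fl _ pr zeta pos])
    show "\<exists>y\<in>R. z = y * f" if "z \<in> R" "z \<in> Z" for z using Z that by blast
    fix s'' t' assume *: "Re s'' = Re s'" "Re t' = Re t"
    show "((\<lambda>H. npow (idx (img f M) H) s'' * npow (idx (img f M) (img f (img f M) [+] H)) (s'' + t' - of_nat (card ?A)))
      has_sum zprod \<zeta> ?ms s'' (s'' + t' - of_nat (card ?A)) * S s'') (smods (img f M))"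
      using * Suc.prems(2-4) unfolding ms by (intro Suc.IH[OF cyc']) fastforce+
  qed
  then show ?case unfolding ms by (simp add: mult.assoc)
qed

lemma cyclic_sum_trivial:
  assumes "cyclic_sum I e (\<lambda>_. 1) M"
  shows "((\<lambda>H. npow (idx M H) s) has_sum 1) (smods M)"
proof -
  have "e l = 0" if "l \<in> I" for l using cyclic_sumD(5)[OF assms that] by simp
  then have M: "M = {0}" unfolding cyclic_sumD(2)[OF assms] using R_zero by auto
  have M0: "smod {0}" using smod_cyclic_sum[OF assms] M by simp
  have "smods M = {{0}}" using M0 idx_self(1)[OF smod_subgp[OF M0]] smod_subgp subgp_zero
    unfolding M smods_def by blast
  then show ?thesis using idx_self(2)[OF smod_subgp[OF M0]] by (simp add: M has_sum_finiteI)
qed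

text \<open>The polynomials are used up one at a time. When all exponents of \<open>f k\<close> have
  dropped to 0, its annihilators have become 1, and what remains is a module of the same kind for
  the later polynomials.\<close>

theorem cyclic_sum_zeta:
  fixes c :: "'i \<Rightarrow> nat" and f :: "nat \<Rightarrow> 'a" and N :: nat
  assumes c: "\<And>l. l \<in> I \<Longrightarrow> c l < N"
    and f: "\<And>i. i < N \<Longrightarrow> f i \<in> R" "\<And>i. i < N \<Longrightarrow> f i \<noteq> 0"
    and co: "\<And>i j. i < N \<Longrightarrow> j < N \<Longrightarrow> i \<noteq> j \<Longrightarrow> comax (f i) (f j)"
    and Z: "\<And>i r. i < N \<Longrightarrow> r \<in> R \<Longrightarrow> r \<in> Z i \<longleftrightarrow> (\<exists>y\<in>R. r = y * f i)"
    and pr: "\<And>i. i < N \<Longrightarrow> ideals_principal R (Z i)"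
    and zeta: "\<And>i. i < N \<Longrightarrow> has_zeta R (Z i) (\<zeta> i)"
    and r: "\<And>l. l \<in> I \<Longrightarrow> lam l \<le> r (c l)"
    and ms: "\<And>i. i < N \<Longrightarrow> ms i = map (\<lambda>a. card {l\<in>I. c l = i \<and> a \<le> lam l}) [1..<Suc (r i)]"
    and pos: "\<And>i. i < N \<Longrightarrow> zpos (ms i) (Re s) 0"
    and cyc: "cyclic_sum I e (\<lambda>l. f (c l) ^ lam l) M"
  shows "((\<lambda>H. npow (idx M H) s) has_sum (\<Prod>i<N. zprod (\<zeta> i) (ms i) s 0)) (smods M)"
proof -
  have "cyclic_sum I e (\<lambda>l. if c l < k then 1 else f (c l) ^ lam l) M \<Longrightarrow> Re s' = Re s \<Longrightarrow>
     ((\<lambda>H. npow (idx M H) s') has_sum (\<Prod>i\<in>{k..<N}. zprod (\<zeta> i) (ms i) s' 0)) (smods M)"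
    if "k \<le> N" for k M e s'
    using that
  proof (induction k arbitrary: M e s' rule: inc_induct)
    case base
    have "cyclic_sum I e (\<lambda>_. 1) M" using c by (intro iffD1[OF cyclic_sum_cong base(1)]) auto
    then show ?case using cyclic_sum_trivial by simp
  next
    case (step k)
    let ?J = "{l\<in>I. c l = k}" and ?q = "\<lambda>l. if c l < k then 1 else f (c l) ^ lam l"
    let ?S = "\<lambda>s. \<Prod>i\<in>{Suc k..<N}. zprod (\<zeta> i) (ms i) s 0"
    have 1: "cyclic_sum I e (\<lambda>l. if l \<in> ?J then f k ^ lam l else ?q l) M"
      using step.prems(1) by (rule iffD1[OF cyclic_sum_cong, rotated]) auto
    have 2: "comax (f k) (?q l)" if "l \<in> I - ?J" for l
      using that c[of l] co[OF step.hyps(2), of "c l"] f step.hyps(2) comax_1 comax_power by auto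
    have 3: "((\<lambda>H. npow (idx M H) s') has_sum ?S s') (smods M)"
      if "Re s' = Re s" "cyclic_sum I e (\<lambda>l. if l \<in> ?J then 1 else ?q l) M" for M e s'
    proof (rule step.IH[OF _ that(1)])
      show "cyclic_sum I e (\<lambda>l. if c l < Suc k then 1 else f (c l) ^ lam l) M"
        by (rule iffD1[OF cyclic_sum_cong that(2)]) auto
    qed
    have J: "{l \<in> ?J. a \<le> lam l} = {l \<in> I. c l = k \<and> a \<le> lam l}" for a by auto
    have le: "lam l \<le> r k" if "l \<in> ?J" for l using that r by auto
    have *: "((\<lambda>H. npow (idx M H) s' * npow (idx M (img (f k) M [+] H)) 0)
      has_sum zprod (\<zeta> k) (map (\<lambda>a. card {l\<in>?J. a \<le> lam l}) [1..<Suc (r k)]) s' 0 * ?S s') (smods M)"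
    proof (rule primary_sum[OF _ _ _ 2 Z pr zeta 3 1 le step.prems(2)])
      show "zpos (map (\<lambda>a. card {l \<in> ?J. a \<le> lam l}) [1..<Suc (r k)]) (Re s') (Re 0)"
        using pos[OF step.hyps(2)] step.prems(2) unfolding J ms[OF step.hyps(2), symmetric] by simp
    qed (use f step.hyps(2) in auto)
    have fk: "f k \<in> R" using f step.hyps(2) by blast
    \<comment> \<open>Every polynomial starts with \<open>t = 0\<close>, where the second weight is
      1.\<close>
    have eq: "npow (idx M H) s' = npow (idx M H) s' * npow (idx M (img (f k) M [+] H)) 0" if "H \<in> smods M" for H
      using smods_pos(1)[OF smod_cyclic_sum[OF 1] that smod_img[OF smod_cyclic_sum[OF 1]]
          img_subset[OF smod_cyclic_sum[OF 1] fk]] by simp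
    from iffD2[OF has_sum_cong[OF eq] *] show ?case
      unfolding J ms[OF step.hyps(2), symmetric] using step.hyps(2) by (simp add: prod.atLeast_Suc_lessThan)
  qed
  from this[of 0 e M s] cyc show ?thesis by (simp add: atLeast0LessThan)
qed

end

section \<open>Absolute values with prescribed kernel\<close>

text \<open>A non-Archimedean absolute value of the field of fractions modulo \<open>Z\<close> is handled as a
  multiplicative function on the ring itself with kernel \<open>Z\<close>. In the applications, the ring is
  either a field with \<open>Z = {0}\<close> or a polynomial ring with \<open>Z = (f)\<close>.\<close>

definition val :: "'r::comm_ring_1 set \<Rightarrow> ('r \<Rightarrow> real) \<Rightarrow> bool" where
  "val Z b \<longleftrightarrow> (\<forall>x. 0 \<le> b x \<and> (b x = 0 \<longleftrightarrow> x \<in> Z)) \<and> (\<forall>x y. b (x * y) = b x * b y) \<and>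
     (\<forall>x y. b (x + y) \<le> max (b x) (b y)) \<and> (\<exists>x. x \<notin> Z \<and> b x \<noteq> 1)"

definition veq :: "('r \<Rightarrow> real) \<Rightarrow> ('r \<Rightarrow> real) \<Rightarrow> bool" where
  "veq b b' \<longleftrightarrow> (\<exists>t>0. \<forall>x. b' x = b x powr t)"

definition discrete_val :: "'r::comm_ring_1 set \<Rightarrow> ('r \<Rightarrow> real) \<Rightarrow> bool" where
  "discrete_val Z b \<longleftrightarrow> val Z b \<and> (\<exists>p. 0 < b p \<and> b p < 1 \<and> (\<forall>x. x \<notin> Z \<longrightarrow> (\<exists>k::int. b x = b p powi k)))"

abbreviation vring :: "('r \<Rightarrow> real) \<Rightarrow> 'r set" where "vring b \<equiv> {x. b x \<le> 1}"
abbreviation vmax :: "('r \<Rightarrow> real) \<Rightarrow> 'r set" where "vmax b \<equiv> {x. b x < 1}"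

definition local_val :: "'r::comm_ring_1 set \<Rightarrow> ('r \<Rightarrow> real) \<Rightarrow> bool" where
  "local_val Z b \<longleftrightarrow> discrete_val Z b \<and> fin_idx (vring b) (vmax b)"

locale max_ideal =
  fixes Z :: "'r::comm_ring_1 set"
  assumes Z_subgp: "subgp Z" and Z_mult: "x \<in> Z \<Longrightarrow> r * x \<in> Z" and one_Z: "1 \<notin> Z"
    and Z_inv: "x \<notin> Z \<Longrightarrow> \<exists>y. x * y - 1 \<in> Z"
begin

definition vinv :: "'r \<Rightarrow> 'r" where "vinv x = (SOME y. x * y - 1 \<in> Z)"

lemma vinv: "x \<notin> Z \<Longrightarrow> x * vinv x - 1 \<in> Z"
  unfolding vinv_def using Z_inv by (rule someI_ex)

definition vpow :: "'r \<Rightarrow> int \<Rightarrow> 'r" where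
  "vpow x k = (if k \<ge> 0 then x ^ nat k else vinv x ^ nat (- k))"

context
  fixes b assumes b: "val Z b"
begin

lemma val_nonneg: "0 \<le> b x" and val_eq_0: "b x = 0 \<longleftrightarrow> x \<in> Z" and val_mult: "b (x * y) = b x * b y"
  and val_add: "b (x + y) \<le> max (b x) (b y)"
  using b unfolding val_def by blast+

lemma val_pos: "x \<notin> Z \<Longrightarrow> 0 < b x"
  using val_nonneg[of x] val_eq_0[of x] by linarith

lemma val_one: "b 1 = 1"
  using val_mult[of 1 1] val_eq_0[of 1] one_Z by simp

lemma val_minus: "b (- x) = b x"
proof -
  have "b (- 1) * b (- 1) = 1" using val_mult[of "- 1" "- 1"] val_one by simp
  then have "b (- 1) = 1" using val_nonneg[of "- 1"] by (metis abs_of_nonneg power2_eq_square real_sqrt_abs real_sqrt_one)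
  then show ?thesis using val_mult[of "- 1" x] by simp
qed

lemma val_diff: "b (x - y) \<le> max (b x) (b y)"
  using val_add[of x "- y"] val_minus[of y] by simp

lemma val_power: "b (x ^ n) = b x ^ n"
  by (induction n) (auto simp: val_one val_mult)

lemma val_mult_le_1: "b x \<le> 1 \<Longrightarrow> b y \<le> 1 \<Longrightarrow> b (x * y) \<le> 1"
  using val_nonneg by (simp add: val_mult mult_le_one)

lemma val_mult_less_1: "b x \<le> 1 \<Longrightarrow> b y < 1 \<Longrightarrow> b (x * y) < 1"
  using val_nonneg[of x] val_nonneg[of y] mult_left_le_one_le[of "b y" "b x"] by (simp add: val_mult)

lemma val_dominant: "b x < b y \<Longrightarrow> b (x + y) = b y"
  using val_add[of x y] val_diff[of "x + y" x] by (simp add: max_def split: if_splits)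

lemma val_cong: "x - y \<in> Z \<Longrightarrow> b x = b y"
  using val_dominant[of "x - y" y] val_eq_0[of "x - y"] val_eq_0[of y] val_nonneg[of y] val_add[of "x - y" y]
    val_nonneg[of x] by (cases "b y = 0") auto

lemma val_vinv: "x \<notin> Z \<Longrightarrow> b (vinv x) = inverse (b x)"
  using val_cong[OF vinv] val_mult val_one val_eq_0 by (metis inverse_unique)

lemma val_vpow: "x \<notin> Z \<Longrightarrow> b (vpow x k) = b x powi k"
  by (auto simp: vpow_def power_int_def val_power val_vinv)

lemma val_sum: "(\<And>i. i \<in> I \<Longrightarrow> b (x i) \<le> c) \<Longrightarrow> 0 \<le> c \<Longrightarrow> b (\<Sum>i\<in>I. x i) \<le> c"
proof (induction I rule: infinite_finite_induct)
  case (insert i I)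
  then show ?case using val_add[of "x i" "\<Sum>i\<in>I. x i"] by (force simp: max_def split: if_splits)
qed (use val_eq_0[of 0] subgp_zero[OF Z_subgp] in auto)

lemma val_sum_less: "finite I \<Longrightarrow> (\<And>i. i \<in> I \<Longrightarrow> b (x i) < c) \<Longrightarrow> 0 < c \<Longrightarrow> b (\<Sum>i\<in>I. x i) < c"
proof (induction I rule: finite_induct)
  case (insert i I)
  then show ?case using val_add[of "x i" "\<Sum>i\<in>I. x i"] by (force simp: max_def split: if_splits)
qed (use val_eq_0[of 0] subgp_zero[OF Z_subgp] in auto)

lemma val_of_nat: "b (of_nat n) \<le> 1"
  using val_sum[of "{..<n}" "\<lambda>_. 1" 1] val_one by simp

lemma val_of_int: "b (of_int n) \<le> 1"
  using val_of_nat val_minus by (cases n rule: int_cases2) auto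

lemma subgp_vring: "subgp (vring b)" and subgp_vmax: "subgp (vmax b)"
  using val_diff val_eq_0[of 0] subgp_zero[OF Z_subgp] unfolding subgp_def
  by (auto simp: max_def intro: order_trans le_less_trans split: if_splits) (metis (full_types) order.trans le_less_trans linorder_not_le)+

lemma val_strict: "\<exists>x. 0 < b x \<and> b x < 1"
proof -
  obtain x where x: "x \<notin> Z" "b x \<noteq> 1" using b by (auto simp: val_def)
  show ?thesis
  proof (cases "b x < 1")
    case False
    with x have "b (vinv x) < 1" "0 < b (vinv x)" using val_vinv[OF x(1)] by (auto simp: inverse_less_1_iff)
    then show ?thesis by blast
  qed (use val_pos x in blast)
qed

text \<open>A unique term of maximal value would dominate the sum and keep it out of
  \<open>Z\<close>.\<close>

lemma two_maximal_terms:
  assumes "finite I" "(\<Sum>i\<in>I. y i) \<in> Z" "i0 \<in> I" "y i0 \<notin> Z"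
  shows "\<exists>i\<in>I. \<exists>j\<in>I. i \<noteq> j \<and> b (y i) = b (y j) \<and> b (y i) > 0"
proof (rule ccontr)
  assume *: "\<not> ?thesis"
  have "Max ((\<lambda>i. b (y i)) ` I) \<in> (\<lambda>i. b (y i)) ` I" using assms(1,3) by (intro Max_in) auto
  then obtain i where "i \<in> I" "Max ((\<lambda>i. b (y i)) ` I) = b (y i)" by blast
  then have i: "i \<in> I" "\<And>j. j \<in> I \<Longrightarrow> b (y j) \<le> b (y i)"
    using assms(1) Max_ge[of "(\<lambda>i. b (y i)) ` I"] by (metis finite_imageI imageI)+
  have pos: "b (y i) > 0" using i(2)[OF assms(3)] val_pos[OF assms(4)] by simp
  have "b (\<Sum>j\<in>I - {i}. y j) < b (y i)"
    using assms(1) * i pos by (intro val_sum_less) (auto simp: order_less_le)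
  then have "b ((\<Sum>j\<in>I - {i}. y j) + y i) = b (y i)" by (rule val_dominant)
  then show False using assms(1,2) i(1) pos val_eq_0[of "\<Sum>i\<in>I. y i"] by (simp add: sum.remove add.commute)
qed

end

lemma discrete_valD: assumes "discrete_val Z b"
  shows "val Z b" "\<exists>p. 0 < b p \<and> b p < 1 \<and> (\<forall>x. x \<notin> Z \<longrightarrow> (\<exists>k::int. b x = b p powi k))"
  using assms by (auto simp: discrete_val_def)

text \<open>Let \<open>p\<close> be a uniformizer of \<open>b\<close>. If \<open>b x = 1\<close> but
  \<open>b' x > 1\<close>, then \<open>x ^ n * p\<close> has \<open>b\<close>-value below 1 and, for
  large \<open>n\<close>, \<open>b'\<close>-value above 1. So units go to units; any other element
  is a unit times a power of \<open>p\<close>, and the exponent \<open>t\<close> is read off at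
  \<open>p\<close>.\<close>

lemma veqI:
  assumes b: "discrete_val Z b" and b': "val Z b'" and sub: "\<And>x. b x < 1 \<Longrightarrow> b' x < 1"
  shows "veq b b'"
proof -
  note v = discrete_valD(1)[OF b]
  obtain p where p: "0 < b p" "b p < 1" "\<And>x. x \<notin> Z \<Longrightarrow> \<exists>k::int. b x = b p powi k"
    using discrete_valD(2)[OF b] by blast
  have pZ: "p \<notin> Z" using p(1) val_eq_0[OF v, of p] by simp
  have p': "0 < b' p" "b' p < 1" using val_pos[OF b' pZ] sub p by auto
  have le: "b' x \<le> 1" if "b x = 1" for x
  proof (rule ccontr)
    assume "\<not> b' x \<le> 1"
    then obtain n where "b' x ^ n > 1 / b' p" using real_arch_pow[of "b' x" "1 / b' p"] by auto
    moreover have "b (x ^ n * p) < 1" using that p by (simp add: val_mult[OF v] val_power[OF v])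
    then have "b' x ^ n * b' p < 1" using sub by (fastforce simp: val_mult[OF b'] val_power[OF b'])
    ultimately show False using p' by (simp add: field_simps)
  qed
  have eq: "b' x = 1" if "b x = 1" for x
  proof -
    have x: "x \<notin> Z" using that val_eq_0[OF v, of x] by auto
    then have "b' (vinv x) \<le> 1" using that by (intro le) (simp add: val_vinv[OF v])
    then have "1 \<le> b' x" using x val_vinv[OF b' x] val_pos[OF b' x] by (simp add: field_simps)
    then show ?thesis using le[OF that] by simp
  qed
  define t where "t = ln (b' p) / ln (b p)"
  have t: "t > 0" "b p powr t = b' p" using p p' by (auto simp: t_def powr_def divide_neg_neg)
  have "b' x = b x powr t" for x
  proof (cases "x \<in> Z")
    case True
    then show ?thesis using val_eq_0[OF v, of x] val_eq_0[OF b', of x] by simp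
  next
    case False
    then obtain k where k: "b x = b p powi k" using p(3) by blast
    have "b (x * vpow p (- k)) = 1" using k p(1) by (simp add: val_mult[OF v] val_vpow[OF v pZ] power_int_minus)
    then have "b' x * b' p powi (- k) = 1" using eq by (fastforce simp: val_mult[OF b'] val_vpow[OF b' pZ])
    then have "b' x = b' p powi k" using p' by (simp add: power_int_minus field_simps)
    also have "\<dots> = (b p powi k) powr t"
      using p(1) p'(1) unfolding t(2)[symmetric] by (simp add: powr_powr powr_real_of_int' flip: powr_real_of_int' ) (simp add: powr_powr mult.commute)
    finally show ?thesis using k by simp
  qed
  then show ?thesis using t(1) by (auto simp: veq_def)
qed

lemma veq_less_1: "val Z b \<Longrightarrow> veq b b' \<Longrightarrow> b' x < 1 \<longleftrightarrow> b x < 1"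
  "val Z b \<Longrightarrow> veq b b' \<Longrightarrow> b' x \<le> 1 \<longleftrightarrow> b x \<le> 1"
  using val_nonneg[of b x] powr_less_mono2[of _ "b x" 1] powr_mono2[of _ 1 "b x"] powr_mono2[of _ "b x" 1]
    powr_less_mono2[of _ 1 "b x"]
  unfolding veq_def by (auto simp: not_less[symmetric]) (metis less_le_not_le linorder_not_le powr_one_eq_one)+

text \<open>Induction as for the Artin-Whaples theorem: \<open>x\<close> works for \<open>W\<close>,
  \<open>y\<close> separates \<open>b\<close> from \<open>b'\<close>, and \<open>y\<close> times a
  high power of \<open>x\<close>, or times \<open>x^n / (1 + x^n)\<close>, works for both.\<close>

lemma separate_one:
  assumes "discrete_val Z b" "finite W"
    and "\<And>b'. b' \<in> W \<Longrightarrow> discrete_val Z b' \<and> \<not> veq b b' \<and> \<not> veq b' b"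
  shows "\<exists>x. b x > 1 \<and> (\<forall>b'\<in>W. b' x < 1)"
  using assms(2,3)
proof (induction W rule: finite_induct)
  case empty
  note v = discrete_valD(1)[OF assms(1)]
  obtain x where x: "0 < b x" "b x < 1" using val_strict[OF v] by blast
  then have "b (vinv x) > 1" using val_vinv[OF v, of x] val_eq_0[OF v, of x] by (auto simp: one_less_inverse_iff)
  then show ?case by auto
next
  case (insert b' W)
  note v = discrete_valD(1)[OF assms(1)]
  have b': "discrete_val Z b'" "\<not> veq b b'" "\<not> veq b' b" using insert.prems by auto
  note v' = discrete_valD(1)[OF b'(1)]
  obtain x where x: "b x > 1" "\<And>d. d \<in> W \<Longrightarrow> d x < 1" using insert.IH insert.prems by auto
  obtain x1 where x1: "b x1 < 1" "b' x1 \<ge> 1" using veqI[OF assms(1) v'] b' by (metis linorder_not_le)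
  obtain x2 where x2: "b' x2 < 1" "b x2 \<ge> 1" using veqI[OF b'(1) v] b' by (metis linorder_not_le)
  have x1Z: "x1 \<notin> Z" using x1 val_eq_0[OF v', of x1] by auto
  define y where "y = x2 * vinv x1"
  have y: "b y > 1" "b' y < 1"
    using x1 x2 val_pos[OF v x1Z] val_nonneg[OF v', of x2]
    by (auto simp: y_def val_mult[OF v] val_mult[OF v'] val_vinv[OF v x1Z] val_vinv[OF v' x1Z] field_simps)
  have dval: "val Z d" if "d \<in> W" for d using insert.prems discrete_valD(1) that by blast
  have "\<forall>\<^sub>F n in sequentially. d x ^ n * d y < 1" if "d \<in> W" for d
  proof -
    have "(\<lambda>n. d x ^ n * d y) \<longlonglongrightarrow> 0 * d y"
      using x(2)[OF that] val_nonneg[OF dval[OF that], of x]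
      by (intro tendsto_mult LIMSEQ_realpow_zero tendsto_const) auto
    then show ?thesis by (intro order_tendstoD(2)) auto
  qed
  then have "\<forall>\<^sub>F n in sequentially. \<forall>d\<in>W. d x ^ n * d y < 1"
    using insert.hyps(1) by (intro eventually_ball_finite) auto
  then obtain n where n: "\<And>d. d \<in> W \<Longrightarrow> d x ^ n * d y < 1" "n \<ge> 1"
    by (metis (mono_tags, lifting) eventually_sequentially le_add2 le_add1)
  have xn: "b x ^ n > 1" using x(1) n(2) by (simp add: one_less_power)
  show ?case
  proof (cases "b' x \<le> 1")
    case True
    have "b (x ^ n * y) > 1" using xn y by (simp add: val_mult[OF v] val_power[OF v] less_1_mult)
    moreover have "b' (x ^ n * y) < 1"
      using True y val_nonneg[OF v'] power_le_one[of "b' x" n] mult_left_le_one_le[of "b' y" "b' x ^ n"]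
      by (force simp: val_mult[OF v'] val_power[OF v'])
    moreover have "d (x ^ n * y) < 1" if "d \<in> W" for d
      using n(1)[OF that] dval[OF that] by (simp add: val_mult val_power)
    ultimately show ?thesis by (intro exI[of _ "x ^ n * y"]) auto
  next
    case False
    \<comment> \<open>Now \<open>b' x > 1\<close>. The quotient \<open>x^n / u\<close> has value
      exactly 1 at \<open>b\<close> and \<open>b'\<close>, so multiplying by it keeps what
      \<open>y\<close> achieves there, while it is small on \<open>W\<close>.\<close>
    define u where "u = 1 + x ^ n"
    have u1: "d u = d x ^ n" if "val Z d" "d x ^ n > 1" for d
      using val_dominant[OF that(1), of 1 "x ^ n"] that val_one[OF that(1)] by (simp add: u_def val_power)
    have u2: "d u = 1" if "val Z d" "d x ^ n < 1" for d
      using val_dominant[OF that(1), of "x ^ n" 1] that val_one[OF that(1)] by (simp add: u_def val_power add.commute)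
    have "b u \<noteq> 0" using u1[OF v xn] xn by linarith
    then have uZ: "u \<notin> Z" using val_eq_0[OF v] by blast
    have xn': "b' x ^ n > 1" using False n(2) by (simp add: one_less_power)
    let ?z = "x ^ n * vinv u * y"
    have cancel: "r * inverse r = 1" if "r > 1" for r :: real
      using that by (intro right_inverse) linarith
    have "b ?z > 1" using y u1[OF v xn] cancel[OF xn] by (simp add: val_mult[OF v] val_power[OF v] val_vinv[OF v uZ])
    moreover have "b' ?z < 1" using y u1[OF v' xn'] cancel[OF xn'] by (simp add: val_mult[OF v'] val_power[OF v'] val_vinv[OF v' uZ])
    moreover have "d ?z < 1" if "d \<in> W" for d
    proof -
      note vd = dval[OF that]
      have "d x ^ n < 1" using x(2)[OF that] val_nonneg[OF vd, of x] n(2)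
        by (metis One_nat_def Suc_le_D power_Suc_less_one power_0 power_eq_0_iff less_eq_real_def zero_less_one power_strict_decreasing not_less_eq_eq zero_le le_zero_eq bot_nat_0.not_eq_extremum one_power2 zero_less_power)
      then show ?thesis using n(1)[OF that] u2[OF vd] by (simp add: val_mult[OF vd] val_power[OF vd] val_vinv[OF vd uZ])
    qed
    ultimately show ?thesis by (intro exI[of _ ?z]) auto
  qed
qed

text \<open>With \<open>x\<close> from \<open>separate_one\<close> and \<open>n\<close> large,
  \<open>x^n / (1 + x^n)\<close> is close to 1 at \<open>b\<close> and close to 0 on
  \<open>W\<close>.\<close>

lemma approx_idempotent:
  assumes "discrete_val Z b" "finite W"
    and "\<And>b'. b' \<in> W \<Longrightarrow> discrete_val Z b' \<and> \<not> veq b b' \<and> \<not> veq b' b" and \<epsilon>: "\<epsilon> > 0"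
  shows "\<exists>c. b (c - 1) < \<epsilon> \<and> (\<forall>b'\<in>W. b' c < \<epsilon>)"
proof -
  note v = discrete_valD(1)[OF assms(1)]
  have vW: "val Z d" if "d \<in> W" for d using assms(3) discrete_valD(1) that by blast
  obtain x where x: "b x > 1" "\<And>d. d \<in> W \<Longrightarrow> d x < 1" using separate_one[OF assms(1-3)] by blast
  have "\<forall>\<^sub>F n in sequentially. d x ^ n < min \<epsilon> 1" if "d \<in> W" for d
    using x(2)[OF that] val_nonneg[OF vW[OF that], of x] \<epsilon>
    by (intro order_tendstoD(2)[OF LIMSEQ_realpow_zero]) auto
  then have "\<forall>\<^sub>F n in sequentially. \<forall>d\<in>W. d x ^ n < min \<epsilon> 1"
    using assms(2) by (intro eventually_ball_finite) auto
  moreover have "\<forall>\<^sub>F n in sequentially. inverse (b x) ^ n < min \<epsilon> 1"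
    using x(1) \<epsilon> by (intro order_tendstoD(2)[OF LIMSEQ_realpow_zero]) (auto simp: inverse_less_1_iff)
  ultimately have "\<forall>\<^sub>F n in sequentially. (\<forall>d\<in>W. d x ^ n < min \<epsilon> 1) \<and> inverse (b x) ^ n < min \<epsilon> 1"
    by (rule eventually_conj)
  then obtain n where n: "\<And>d. d \<in> W \<Longrightarrow> d x ^ n < min \<epsilon> 1" "inverse (b x) ^ n < min \<epsilon> 1"
    unfolding eventually_sequentially by auto
  have "b x ^ n > 0" using x(1) by simp
  then have xn: "b x ^ n > 1" using n(2) by (simp add: power_inverse inverse_less_1_iff)
  define u where "u = 1 + x ^ n"
  have u1: "b u = b x ^ n"
    using val_dominant[OF v, of 1 "x ^ n"] xn val_one[OF v] by (simp add: u_def val_power[OF v])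
  have u2: "d u = 1" if "d \<in> W" for d
    using val_dominant[OF vW[OF that], of "x ^ n" 1] n(1)[OF that] val_one[OF vW[OF that]]
    by (simp add: u_def val_power[OF vW[OF that]] add.commute)
  have "b u \<noteq> 0" using u1 xn by linarith
  then have uZ: "u \<notin> Z" using val_eq_0[OF v] by blast
  let ?c = "x ^ n * vinv u"
  have eq: "(?c - 1) - (- vinv u) = u * vinv u - 1" by (simp add: u_def algebra_simps)
  have "b (?c - 1) = b (- vinv u)" using vinv[OF uZ] unfolding eq[symmetric] by (rule val_cong[OF v])
  also have "\<dots> < \<epsilon>" using n(2) by (simp add: val_minus[OF v] val_vinv[OF v uZ] u1 power_inverse)
  finally have "b (?c - 1) < \<epsilon>" .
  moreover have "d ?c < \<epsilon>" if "d \<in> W" for d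
    using n(1)[OF that] by (simp add: val_mult[OF vW[OF that]] val_power[OF vW[OF that]] val_vinv[OF vW[OF that] uZ] u2[OF that])
  ultimately show ?thesis by blast
qed

end

lemma max_ideal_zero: "max_ideal {0::'b::field}"
proof
  show "\<exists>y. x * y - 1 \<in> {0}" if "x \<notin> {0}" for x :: 'b
    using that by (intro exI[of _ "inverse x"]) auto
qed (auto simp: subgp_def)

section \<open>Finite extensions of valued fields\<close>

lemma veq_refl: "val Z b \<Longrightarrow> veq b b"
  unfolding veq_def val_def by (intro exI[of _ 1]) auto

text \<open>\<open>dep\<close> encodes that the extension has degree at most \<open>D\<close>,
  without choosing a basis.\<close>

locale finite_extension = max_ideal Z for Z :: "'r::comm_ring_1 set" +
  fixes emb :: "'b::field \<Rightarrow> 'r" and D :: nat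
  assumes emb_add: "emb (x + y) = emb x + emb y" and emb_mult: "emb (x * y) = emb x * emb y"
    and emb_one: "emb 1 = 1"
    and dep: "\<exists>c. (\<exists>i\<le>D. c i \<noteq> 0) \<and> (\<Sum>i\<le>D. emb (c i) * u i) \<in> Z"
begin

sublocale base: max_ideal "{0::'b}" by (rule max_ideal_zero)

lemma emb_zero: "emb 0 = 0" using emb_add[of 0 0] by simp

lemma emb_minus: "emb (- x) = - emb x" using emb_add[of x "- x"] emb_zero by (simp add: eq_neg_iff_add_eq_0 add.commute)

lemma emb_diff: "emb (x - y) = emb x - emb y" using emb_add[of x "- y"] emb_minus[of y] by simp

lemma emb_notin: assumes "c \<noteq> 0" shows "emb c \<notin> Z"
proof
  assume "emb c \<in> Z"
  from Z_mult[OF this, of "emb (inverse c)"] show False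
    using assms one_Z by (simp flip: emb_mult add: emb_one)
qed

text \<open>In a linear relation between the powers of \<open>x\<close>, two different terms have
  the same non-zero value; dividing them compares a power of \<open>x\<close> with a scalar.\<close>

lemma val_algebraic:
  assumes b: "val Z b" and x: "x \<notin> Z"
  shows "\<exists>e c. 1 \<le> e \<and> e \<le> D \<and> c \<noteq> 0 \<and> b x ^ e = b (emb c)"
proof -
  note val = val_mult[OF b] val_power[OF b]
  obtain c i0 where c: "i0 \<le> D" "c i0 \<noteq> 0" "(\<Sum>i\<le>D. emb (c i) * x ^ i) \<in> Z"
    using dep[of "\<lambda>i. x ^ i"] by blast
  have xpos: "b x > 0" using val_pos[OF b x] .
  have "b (emb (c i0) * x ^ i0) > 0" using xpos val_pos[OF b emb_notin[OF c(2)]] by (simp add: val)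
  then have "emb (c i0) * x ^ i0 \<notin> Z" using val_eq_0[OF b, of "emb (c i0) * x ^ i0"] by auto
  with c obtain i j where ij: "i \<le> D" "j \<le> D" "i \<noteq> j" "b (emb (c i) * x ^ i) = b (emb (c j) * x ^ j)"
      "b (emb (c i) * x ^ i) > 0"
    using two_maximal_terms[OF b, of "{..D}" "\<lambda>i. emb (c i) * x ^ i" i0] by auto
  have *: "\<exists>e c. 1 \<le> e \<and> e \<le> D \<and> c \<noteq> 0 \<and> b x ^ e = b (emb c)"
    if "i < j" "j \<le> D" "b (emb (c i) * x ^ i) = b (emb (c j) * x ^ j)" "b (emb (c j) * x ^ j) > 0" for i j
  proof -
    have nz: "c i \<noteq> 0" "c j \<noteq> 0" using that(3,4) val_eq_0[OF b, of 0] subgp_zero[OF Z_subgp] by (auto simp: emb_zero)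
    have "b x ^ j = b x ^ i * b x ^ (j - i)" using that(1) by (simp flip: power_add)
    then have "b (emb (c i)) = b (emb (c j)) * b x ^ (j - i)"
      using that(3) xpos by (simp add: val)
    moreover have "b (emb (c i)) = b (emb (c j)) * b (emb (c i / c j))"
      using nz by (simp flip: val_mult[OF b] emb_mult)
    ultimately have "b x ^ (j - i) = b (emb (c i / c j))" using val_pos[OF b emb_notin[OF nz(2)]] by simp
    then show ?thesis using that nz by (intro exI[of _ "j - i"] exI[of _ "c i / c j"]) auto
  qed
  show ?thesis using *[of i j] *[of j i] ij by (metis linorder_neqE_nat)
qed

text \<open>If the restriction were trivial, some power of each non-zero value would be 1 by
  \<open>val_algebraic\<close>.\<close>

lemma val_base: assumes b: "val Z b" shows "val {0} (\<lambda>c. b (emb c))"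
proof -
  have "\<exists>c. c \<noteq> 0 \<and> b (emb c) \<noteq> 1"
  proof (rule ccontr)
    assume "\<not> ?thesis"
    then have *: "b (emb c) = 1" if "c \<noteq> 0" for c using that by blast
    have "b x = 1" if x: "x \<notin> Z" for x
    proof -
      obtain e where "1 \<le> e" "b x ^ e = 1" using val_algebraic[OF b x] * by metis
      then show ?thesis using val_nonneg[OF b, of x] power_eq_imp_eq_base[of "b x" e 1] by simp
    qed
    then show False using b by (auto simp: val_def)
  qed
  moreover have "b (emb c) = 0 \<longleftrightarrow> c = 0" for c
    using val_eq_0[OF b, of "emb c"] emb_notin[of c] emb_zero subgp_zero[OF Z_subgp] by auto
  ultimately show ?thesis unfolding val_def
    using val_nonneg[OF b] val_mult[OF b] val_add[OF b] by (auto simp: emb_mult emb_add)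
qed

text \<open>Raised to a fixed power, all values lie in the discrete value group of the base. The
  exponents form a non-zero group of integers, generated by its least positive element.\<close>

lemma discrete_ext:
  assumes b: "val Z b" and a: "discrete_val {0} (\<lambda>c. b (emb c))"
  shows "discrete_val Z b"
proof -
  obtain p where p: "0 < b (emb p)" "b (emb p) < 1" "\<And>x. x \<noteq> 0 \<Longrightarrow> \<exists>k::int. b (emb x) = b (emb p) powi k"
    using base.discrete_valD(2)[OF a] by auto
  define \<rho> where "\<rho> = b (emb p)"
  have \<rho>: "0 < \<rho>" "\<rho> < 1" using p by (auto simp: \<rho>_def)
  \<comment> \<open>Each exponent \<open>e \<le> D\<close> provided by \<open>val_algebraic\<close>
    divides \<open>fact D\<close>.\<close>
  define F where "F = (fact D :: nat)"
  define G where "G = {k::int. \<exists>x. x \<notin> Z \<and> b x ^ F = \<rho> powi k}"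
  have F0: "F > 0" by (simp add: F_def)
  have GF: "int F \<in> G" unfolding G_def using p(1) val_eq_0[OF b, of "emb p"]
    by (auto intro!: exI[of _ "emb p"] simp: \<rho>_def)
  have G_diff: "k - l \<in> G" if "k \<in> G" "l \<in> G" for k l
  proof -
    obtain x y where *: "x \<notin> Z" "b x ^ F = \<rho> powi k" "y \<notin> Z" "b y ^ F = \<rho> powi l" using \<open>k \<in> G\<close> \<open>l \<in> G\<close> by (auto simp: G_def)
    have "b (x * vinv y) ^ F = b x ^ F / b y ^ F"
      by (simp add: val_mult[OF b] val_vinv[OF b *(3)] power_mult_distrib power_inverse divide_inverse)
    also have "\<dots> = \<rho> powi (k - l)" using * \<rho> by (simp add: power_int_diff)
    finally have "b (x * vinv y) ^ F = \<rho> powi (k - l)" .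
    moreover have "b (x * vinv y) \<noteq> 0" using val_pos[OF b *(1)] val_pos[OF b *(3)]
      by (simp add: val_mult[OF b] val_vinv[OF b *(3)])
    ultimately show ?thesis unfolding G_def using val_eq_0[OF b] by blast
  qed
  have G_mem: "\<exists>k\<in>G. b x ^ F = \<rho> powi k" if x: "x \<notin> Z" for x
  proof -
    obtain e c where e: "1 \<le> e" "e \<le> D" "c \<noteq> 0" "b x ^ e = b (emb c)" using val_algebraic[OF b x] by blast
    obtain k where k: "b (emb c) = \<rho> powi k" using p(3)[OF e(3)] by (auto simp: \<rho>_def)
    have "e dvd F" using e unfolding F_def by (intro dvd_fact) auto
    then obtain m where "F = e * m" by blast
    then have "b x ^ F = \<rho> powi (k * int m)" using e(4) k by (simp add: power_mult power_int_mult)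
    then show ?thesis using x unfolding G_def by blast
  qed
  define g where "g = (LEAST n. n > 0 \<and> int n \<in> G)"
  have g: "g > 0" "int g \<in> G" unfolding g_def
    using LeastI[of "\<lambda>n. n > 0 \<and> int n \<in> G" F] GF F0 by auto
  have G0: "0 \<in> G" using G_diff[OF g(2) g(2)] by simp
  have G_uminus: "- k \<in> G" if "k \<in> G" for k using G_diff[OF G0 that] by simp
  have G_mult_nat: "int m * int g \<in> G" for m
  proof (induction m)
    case (Suc m)
    have "int m * int g - (- int g) \<in> G" using Suc G_uminus[OF g(2)] G_diff by blast
    then show ?case by (simp add: algebra_simps)
  qed (use G0 in simp)
  have G_mult: "m * int g \<in> G" for m
    using G_mult_nat[of "nat m"] G_uminus[OF G_mult_nat[of "nat (- m)"]] by (cases "m \<ge> 0") auto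
  have gdvd: "int g dvd k" if "k \<in> G" for k
  proof -
    have "k mod int g \<in> G" using G_diff[OF that G_mult[of "k div int g"]] by (simp add: minus_div_mult_eq_mod)
    then have "int (nat (k mod int g)) \<in> G" using g(1) by simp
    moreover have "nat (k mod int g) < g" "k mod int g \<ge> 0"
      using g(1) pos_mod_bound[of "int g" k] by (auto simp: nat_less_iff)
    ultimately have "k mod int g = 0"
      using not_less_Least[of "nat (k mod int g)" "\<lambda>n. n > 0 \<and> int n \<in> G"]
      unfolding g_def[symmetric] by linarith
    then show ?thesis by (simp add: dvd_eq_mod_eq_0)
  qed
  obtain w where w: "w \<notin> Z" "b w ^ F = \<rho> powi int g" using g(2) by (auto simp: G_def)
  have wpos: "b w > 0" using val_pos[OF b w(1)] .
  have "b w ^ F < 1" using w(2) \<rho> g(1) by (simp add: power_less_one_iff)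
  then have w1: "b w < 1" using wpos by (metis linorder_not_le one_le_power)
  have "\<exists>k::int. b x = b w powi k" if x: "x \<notin> Z" for x
  proof -
    obtain k where k: "k \<in> G" "b x ^ F = \<rho> powi k" using G_mem[OF x] by blast
    obtain m where m: "k = int g * m" using gdvd[OF k(1)] by blast
    have "b x ^ F = (b w ^ F) powi m" using k(2) m w(2) by (simp add: power_int_mult)
    also have "\<dots> = (b w powi m) ^ F" by (simp add: power_int_mult mult.commute flip: power_int_mult power_int_of_nat)
    finally have "b x = b w powi m" using F0 val_nonneg[OF b, of x] wpos by (intro power_eq_imp_eq_base[of "b x" F "b w powi m"]) auto
    then show ?thesis by blast
  qed
  then show ?thesis unfolding discrete_val_def using b wpos w1 by blast
qed

end

lemma finite_residue_reps:
  "fin_idx (vring b) (vmax b) \<Longrightarrow> \<exists>F. finite F \<and> F \<subseteq> vring b \<and> (\<forall>x\<in>vring b. \<exists>y\<in>F. x - y \<in> vmax b)"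
  if "subgp (vmax b)"
proof (intro exI conjI ballI)
  let ?F = "crep (vring b) (vmax b) ` cosets (vring b) (vmax b)"
  assume "fin_idx (vring b) (vmax b)"
  then show "finite ?F" by blast
  show "?F \<subseteq> vring b" using crep(1) by blast
  fix x assume "x \<in> vring b"
  from crep_coset[OF that this] show "\<exists>y\<in>?F. x - y \<in> vmax b"
    using subgp_diff_comm[OF that] cosetsI[OF \<open>x \<in> vring b\<close>] by blast
qed

context finite_extension
begin

text \<open>After division by a coefficient of maximal value, the relation remains non-trivial in
  the residue field.\<close>

lemma scaled_dependence:
  assumes b: "val Z b"
  shows "\<exists>c. (\<forall>i\<le>D. b (emb (c i)) \<le> 1) \<and> (\<exists>i\<le>D. b (emb (c i)) = 1) \<and> (\<Sum>i\<le>D. emb (c i) * x i) \<in> Z"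
proof -
  obtain c i0 where c: "i0 \<le> D" "c i0 \<noteq> 0" "(\<Sum>i\<le>D. emb (c i) * x i) \<in> Z" using dep[of x] by blast
  have "Max ((\<lambda>i. b (emb (c i))) ` {..D}) \<in> (\<lambda>i. b (emb (c i))) ` {..D}" by (intro Max_in) auto
  then obtain k where "k \<in> {..D}" and k': "Max ((\<lambda>i. b (emb (c i))) ` {..D}) = b (emb (c k))" by blast
  then have k: "k \<le> D" "Max ((\<lambda>i. b (emb (c i))) ` {..D}) = b (emb (c k))" by (simp, intro k')
  have le: "b (emb (c i)) \<le> b (emb (c k))" if "i \<le> D" for i
    using k(2) that Max_ge[of "(\<lambda>i. b (emb (c i))) ` {..D}" "b (emb (c i))"] by simp
  have pos: "b (emb (c k)) > 0" using le[OF c(1)] val_pos[OF b emb_notin[OF c(2)]] by simp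
  then have ck: "c k \<noteq> 0" using val_eq_0[OF b, of 0] subgp_zero[OF Z_subgp] by (auto simp: emb_zero)
  have eq: "b (emb (c i / c k)) * b (emb (c k)) = b (emb (c i))" for i
    using ck by (simp flip: val_mult[OF b] emb_mult)
  have "(\<Sum>i\<le>D. emb (c i / c k) * x i) = emb (inverse (c k)) * (\<Sum>i\<le>D. emb (c i) * x i)"
    by (simp add: sum_distrib_left emb_mult divide_inverse algebra_simps)
  then have "(\<Sum>i\<le>D. emb (c i / c k) * x i) \<in> Z" using Z_mult[OF c(3)] by simp
  moreover have "b (emb (c i / c k)) \<le> 1" if "i \<le> D" for i
    using eq[of i] le[OF that] pos by (metis mult_le_cancel_right mult_1 not_less)
  moreover have "b (emb (c k / c k)) = 1" using ck val_one[OF b] by (simp add: emb_one)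
  ultimately show ?thesis using k(1) by (intro exI[of _ "\<lambda>i. c i / c k"]) auto
qed

text \<open>A family \<open>x\<close> of maximal length with linearly independent residues has at
  most \<open>D\<close> members. All residues are combinations of it with coefficients from the
  finite set \<open>F0\<close> of representatives below.\<close>

lemma residue_ext:
  assumes b: "val Z b" and a: "fin_idx (vring (\<lambda>c. b (emb c))) (vmax (\<lambda>c. b (emb c)))"
  shows "fin_idx (vring b) (vmax b)"
proof -
  let ?a = "\<lambda>c. b (emb c)"
  note va = val_base[OF b]
  obtain F0 where F0: "finite F0" "F0 \<subseteq> vring ?a" "\<And>x. x \<in> vring ?a \<Longrightarrow> \<exists>y\<in>F0. x - y \<in> vmax ?a"
    using finite_residue_reps[OF base.subgp_vmax[OF va] a] by blast
  \<comment> \<open>Linear independence of the residues of \<open>x 0\<close>, ...,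
    \<open>x (r - 1)\<close>, expressed by lifts.\<close>
  define indep where "indep r x \<longleftrightarrow> (\<forall>i<r. b (x i) \<le> 1) \<and>
     (\<forall>c. (\<forall>i<r. ?a (c i) \<le> 1) \<longrightarrow> b (\<Sum>i<r. emb (c i) * x i) < 1 \<longrightarrow> (\<forall>i<r. ?a (c i) < 1))" for r and x :: "nat \<Rightarrow> 'r"
  have bound: "r \<le> D" if "indep r x" for r x
  proof (rule ccontr)
    assume "\<not> r \<le> D"
    obtain c k where c: "\<And>i. i \<le> D \<Longrightarrow> ?a (c i) \<le> 1" "k \<le> D" "?a (c k) = 1" "(\<Sum>i\<le>D. emb (c i) * x i) \<in> Z"
      using scaled_dependence[OF b, of x] by blast
    let ?c = "\<lambda>i. if i \<le> D then c i else 0"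
    have "(\<Sum>i<r. emb (?c i) * x i) = (\<Sum>i\<le>D. emb (c i) * x i)"
      using \<open>\<not> r \<le> D\<close> by (intro sum.mono_neutral_cong_right) (auto simp: emb_zero)
    then have "b (\<Sum>i<r. emb (?c i) * x i) = 0" using c(4) val_eq_0[OF b] by metis
    then have "b (\<Sum>i<r. emb (?c i) * x i) < 1" by linarith
    moreover have "\<forall>i<r. ?a (?c i) \<le> 1" using c(1) val_eq_0[OF b, of 0] subgp_zero[OF Z_subgp] by (auto simp: emb_zero)
    moreover have "k < r" using c(2) \<open>\<not> r \<le> D\<close> by simp
    ultimately have "?a (?c k) < 1" using that[unfolded indep_def, THEN conjunct2, rule_format, of ?c k] by blast
    then show False using c by simp
  qed
  have "\<exists>x. indep 0 x" by (simp add: indep_def)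
  then obtain r where r: "\<exists>x. indep r x" "\<And>r'. \<exists>x. indep r' x \<Longrightarrow> r' \<le> r"
    using GreatestI_nat[of "\<lambda>r. \<exists>x. indep r x" 0 D] Greatest_le_nat[of "\<lambda>r. \<exists>x. indep r x" _ D] bound by metis
  then obtain x where x: "indep r x" by blast
  have xb: "b (x i) \<le> 1" if "i < r" for i using x that by (simp add: indep_def)
  show ?thesis
  proof (rule fin_idxI[OF subgp_vmax[OF b]])
    let ?F = "(\<lambda>g. \<Sum>i<r. emb (g i) * x i) ` ({..<r} \<rightarrow>\<^sub>E F0)"
    show "finite ?F" using F0(1) by (auto intro!: finite_imageI finite_PiE)
    fix y assume "y \<in> vring b"
    then have y: "b y \<le> 1" by simp
    have "\<not> indep (Suc r) (x(r := y))" using r(2)[of "Suc r"] by auto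
    then obtain c where c: "\<And>i. i \<le> r \<Longrightarrow> ?a (c i) \<le> 1" "b (\<Sum>i<Suc r. emb (c i) * (x(r := y)) i) < 1"
        "\<exists>i\<le>r. \<not> ?a (c i) < 1"
      using xb y unfolding indep_def by (auto simp: less_Suc_eq_le split: if_splits)
    have sum: "(\<Sum>i<Suc r. emb (c i) * (x(r := y)) i) = (\<Sum>i<r. emb (c i) * x i) + emb (c r) * y"
      by simp
    \<comment> \<open>The new element \<open>y\<close> really occurs in the relation; otherwise the
      first \<open>r\<close> residues would already be dependent.\<close>
    have "?a (c r) = 1"
    proof (rule ccontr)
      assume "?a (c r) \<noteq> 1"
      then have cr: "?a (c r) < 1" using c(1)[of r] by simp
      then have "b (emb (c r) * y) < 1" using y val_nonneg[OF b, of "emb (c r)"] mult_left_le[of "b y" "?a (c r)"]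
        by (simp add: val_mult[OF b])
      then have "b (\<Sum>i<r. emb (c i) * x i) < 1"
        using val_diff[OF b, of "(\<Sum>i<r. emb (c i) * x i) + emb (c r) * y" "emb (c r) * y"] c(2) sum by simp
      then have "\<forall>i<r. ?a (c i) < 1" using x c(1) unfolding indep_def by auto
      then show False using c(3) cr by (auto simp: le_less)
    qed
    then have cr: "c r \<noteq> 0" using val_eq_0[OF b, of 0] subgp_zero[OF Z_subgp] by (auto simp: emb_zero)
    define d where "d i = - (c i / c r)" for i
    have "?a (d i) * ?a (c r) = ?a (c i)" for i
      using cr by (simp add: d_def emb_minus val_minus[OF b] flip: val_mult[OF b] emb_mult)
    then have "?a (d i) \<le> 1" if "i < r" for i using c(1)[of i] that \<open>?a (c r) = 1\<close> by simp
    then have "\<exists>e\<in>F0. ?a (d i - e) < 1" if "i < r" for i using F0(3)[of "d i"] that by simp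
    then obtain e where e: "\<And>i. i < r \<Longrightarrow> e i \<in> F0" "\<And>i. i < r \<Longrightarrow> ?a (d i - e i) < 1" by metis
    define g where "g = restrict e {..<r}"
    have g: "g \<in> {..<r} \<rightarrow>\<^sub>E F0" using e(1) by (auto simp: g_def)
    have cd: "emb (c r) * emb (d i) = - emb (c i)" for i
      using cr by (simp flip: emb_mult emb_minus add: d_def)
    have "emb (c r) * (y - (\<Sum>i<r. emb (d i) * x i)) = (\<Sum>i<r. emb (c i) * x i) + emb (c r) * y"
      by (simp add: right_diff_distrib sum_distrib_left mult.assoc[symmetric] cd sum_negf)
    then have "b (emb (c r) * (y - (\<Sum>i<r. emb (d i) * x i))) < 1" using c(2) sum by simp
    then have 1: "b (y - (\<Sum>i<r. emb (d i) * x i)) < 1" using \<open>?a (c r) = 1\<close> by (simp add: val_mult[OF b])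
    have bs: "b (\<Sum>i<r. emb (d i - e i) * x i) < 1"
    proof (rule val_sum_less[OF b])
      show "b (emb (d i - e i) * x i) < 1" if "i \<in> {..<r}" for i
        using e(2)[of i] xb[of i] that val_nonneg[OF b, of "emb (d i - e i)"] mult_left_le[of "b (x i)" "?a (d i - e i)"]
        by (simp add: val_mult[OF b])
    qed auto
    have "b (y - (\<Sum>i<r. emb (d i) * x i) + (\<Sum>i<r. emb (d i - e i) * x i)) < 1"
      by (rule le_less_trans[OF val_add[OF b]]) (use 1 bs in simp)
    moreover have "y - (\<Sum>i<r. emb (d i) * x i) + (\<Sum>i<r. emb (d i - e i) * x i) = y - (\<Sum>i<r. emb (g i) * x i)"
      by (simp add: emb_diff left_diff_distrib sum_subtractf g_def)
    ultimately show "\<exists>z\<in>?F. y - z \<in> vmax b" using g by (intro bexI[of _ "\<Sum>i<r. emb (g i) * x i"]) auto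
  qed
qed

lemma local_ext:
  assumes "val Z b" "local_val {0} (\<lambda>c. b (emb c))" shows "local_val Z b"
  using assms discrete_ext residue_ext unfolding local_val_def by blast

text \<open>For \<open>D + 1\<close> inequivalent extensions choose \<open>x i\<close> large at the
  \<open>i\<close>-th one and small at the others. In a linear relation between the
  \<open>x i\<close>, the term whose coefficient \<open>c k\<close> is largest dominates strictly at
  the \<open>k\<close>-th extension, so the sum cannot vanish.\<close>

lemma card_extensions:
  assumes W: "finite W" "\<And>b. b \<in> W \<Longrightarrow> discrete_val Z b" "\<And>b. b \<in> W \<Longrightarrow> veq a (\<lambda>c. b (emb c))"
    and a: "val {0} a"
    and ne: "\<And>b b'. b \<in> W \<Longrightarrow> b' \<in> W \<Longrightarrow> b \<noteq> b' \<Longrightarrow> \<not> veq b b'"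
  shows "card W \<le> D"
proof (rule ccontr)
  assume "\<not> card W \<le> D"
  obtain h where h: "bij_betw h {..<card W} W" using ex_bij_betw_nat_finite[OF W(1)] by (auto simp: atLeast0LessThan)
  have hW: "h i \<in> W" if "i \<le> D" for i using h that \<open>\<not> card W \<le> D\<close> by (auto simp: bij_betw_def)
  have hinj: "h i \<noteq> h j" if "i \<noteq> j" "i \<le> D" "j \<le> D" for i j
    using h that \<open>\<not> card W \<le> D\<close> unfolding bij_betw_def inj_on_def by (metis lessThan_iff linorder_not_le le_less_trans)
  have "\<exists>y. h i y > 1 \<and> (\<forall>b'\<in>W - {h i}. b' y < 1)" if "i \<le> D" for i
    using hW[OF that] W ne by (intro separate_one) auto
  then obtain x where x: "\<And>i. i \<le> D \<Longrightarrow> h i (x i) > 1" "\<And>i b'. i \<le> D \<Longrightarrow> b' \<in> W - {h i} \<Longrightarrow> b' (x i) < 1"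
    by metis
  obtain c i0 where c: "i0 \<le> D" "c i0 \<noteq> 0" "(\<Sum>i\<le>D. emb (c i) * x i) \<in> Z" using dep[of x] by blast
  have "Max ((\<lambda>i. a (c i)) ` {..D}) \<in> (\<lambda>i. a (c i)) ` {..D}" by (intro Max_in) auto
  then obtain k where "k \<in> {..D}" and k': "Max ((\<lambda>i. a (c i)) ` {..D}) = a (c k)" by blast
  then have k: "k \<le> D" "Max ((\<lambda>i. a (c i)) ` {..D}) = a (c k)" by (simp, intro k')
  have le: "a (c i) \<le> a (c k)" if "i \<le> D" for i
    using k(2) that Max_ge[of "(\<lambda>i. a (c i)) ` {..D}" "a (c i)"] by simp
  have "a (c k) > 0" using le[OF c(1)] base.val_pos[OF a, of "c i0"] c(2) by simp
  then have ck: "c k \<noteq> 0" using base.val_eq_0[OF a, of "c k"] by auto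
  let ?b = "h k"
  note b = discrete_valD(1)[OF W(2)[OF hW[OF k(1)]]]
  obtain t where t: "t > 0" "\<And>z. ?b (emb z) = a z powr t" using W(3)[OF hW[OF k(1)]] by (auto simp: veq_def)
  have le': "?b (emb (c i)) \<le> ?b (emb (c k))" if "i \<le> D" for i
    using le[OF that] t base.val_nonneg[OF a] by (simp add: powr_mono2)
  have pos: "?b (emb (c k)) > 0" using val_pos[OF b emb_notin[OF ck]] .
  have "?b (\<Sum>i\<in>{..D} - {k}. emb (c i) * x i) < ?b (emb (c k))"
  proof (rule val_sum_less[OF b _ _ pos])
    fix i assume i: "i \<in> {..D} - {k}"
    then have "?b (x i) < 1" using x(2)[of i ?b] hW[OF k(1)] hinj[of k i] k(1) by auto
    then show "?b (emb (c i) * x i) < ?b (emb (c k))"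
      using le'[of i] i pos val_nonneg[OF b, of "x i"] val_nonneg[OF b, of "emb (c i)"] mult_left_le[of "?b (x i)" "?b (emb (c i))"]
      by (cases "?b (emb (c i)) = 0") (auto simp: val_mult[OF b] intro: mult_less_le_imp_less[of _ 1, simplified] less_le_trans[OF mult_strict_left_mono[of _ 1], simplified])
  qed auto
  also have "?b (emb (c k)) < ?b (emb (c k) * x k)" using x(1)[OF k(1)] pos by (simp add: val_mult[OF b])
  finally have "?b ((\<Sum>i\<in>{..D} - {k}. emb (c i) * x i) + emb (c k) * x k) > 0"
    using val_dominant[OF b] val_nonneg[OF b] by (metis le_less_trans)
  then show False using c(3) k(1) val_eq_0[OF b, of "\<Sum>i\<le>D. emb (c i) * x i"] by (simp add: sum.remove add.commute)
qed

end

text \<open>The prime below a place of the rationals, as the least positive integer of absolute value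
  less than one.\<close>

context
  fixes a :: "rat \<Rightarrow> real" assumes a: "val {0} a"
begin

interpretation R: max_ideal "{0::rat}" by (rule max_ideal_zero)

definition "below_prime = (LEAST n::nat. n > 0 \<and> a (of_nat n) < 1)"

text \<open>By minimality the positive integers below \<open>below_prime\<close> have value 1, and
  division with remainder decides all other integers.\<close>

lemma below_prime: "below_prime > 1" "a (of_nat below_prime) < 1" "Factorial_Ring.prime below_prime"
  "a (of_int m) < 1 \<longleftrightarrow> int below_prime dvd m"
proof -
  let ?P = "\<lambda>n::nat. n > 0 \<and> a (of_nat n) < 1"
  have "\<exists>n. ?P n"
  proof -
    obtain x where x: "0 < a x" "a x < 1" using R.val_strict[OF a] by blast
    obtain m n where q0: "quotient_of x = (m, n)" by (cases "quotient_of x")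
    have q: "x = of_int m / of_int n" "n > 0" using quotient_of_div[OF q0] quotient_of_denom_pos[OF q0] by auto
    have "a x * a (of_int n) = a (of_int m)" using q by (simp flip: R.val_mult[OF a])
    then have "a (of_int m) < 1" using x R.val_of_int[OF a, of n] R.val_nonneg[OF a, of "of_int n"] mult_left_le[of "a (of_int n)" "a x"] by simp
    moreover have "m \<noteq> 0" using x(1) q R.val_eq_0[OF a, of 0] by auto
    moreover have "a (of_nat (nat \<bar>m\<bar>)) = a (of_int m)"
    proof (cases "m \<ge> 0")
      case False
      then have "of_nat (nat \<bar>m\<bar>) = - (of_int m :: rat)" by simp
      then show ?thesis by (simp only: R.val_minus[OF a])
    qed simp
    ultimately have "a (of_nat (nat \<bar>m\<bar>)) < 1" "m \<noteq> 0" by linarith+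
    moreover have "nat \<bar>m\<bar> > 0" using \<open>m \<noteq> 0\<close> by simp
    ultimately show ?thesis by (intro exI[of _ "nat \<bar>m\<bar>"] conjI)
  qed
  from LeastI_ex[OF this] have P: "below_prime > 0" "a (of_nat below_prime) < 1" by (auto simp: below_prime_def)
  have least: "a (of_nat n) = 1" if "0 < n" "n < below_prime" for n
  proof -
    have "\<not> ?P n" using that(2) unfolding below_prime_def by (rule not_less_Least)
    then show ?thesis using that(1) R.val_of_nat[OF a, of n] by simp
  qed
  show P1: "below_prime > 1"
  proof (rule ccontr)
    assume "\<not> below_prime > 1"
    then have "below_prime = 1" using P(1) by simp
    then show False using P(2) R.val_one[OF a] by simp
  qed
  show "a (of_nat below_prime) < 1" by fact
  show "Factorial_Ring.prime below_prime"
  proof (rule prime_natI)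
    show "below_prime \<ge> 2" using P1 by simp
    fix m n assume *: "below_prime dvd m * n"
    show "below_prime dvd m \<or> below_prime dvd n"
    proof (rule ccontr)
      assume **: "\<not> ?thesis"
      have mod: "a (of_nat m) = 1" if "\<not> below_prime dvd m" for m
      proof -
        have 1: "a (of_nat (m mod below_prime)) = 1" using that P(1) by (intro least) (auto simp: dvd_eq_mod_eq_0)
        have "a (of_nat (m div below_prime * below_prime)) < 1"
          using P(2) R.val_of_nat[OF a, of "m div below_prime"] R.val_nonneg[OF a, of "of_nat (m div below_prime)"]
            R.val_nonneg[OF a, of "of_nat below_prime"] mult_left_le_one_le[of "a (of_nat below_prime)" "a (of_nat (m div below_prime))"]
          by (simp add: R.val_mult[OF a])
        then have "a (of_nat (m div below_prime * below_prime) + of_nat (m mod below_prime)) = 1"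
          using R.val_dominant[OF a] 1 by metis
        then show ?thesis by (metis div_mult_mod_eq of_nat_add)
      qed
      have "a (of_nat (m * n)) = 1" using mod[of m] mod[of n] ** by (simp add: R.val_mult[OF a])
      moreover obtain l where "m * n = below_prime * l" using * by blast
      ultimately have "a (of_nat below_prime) * a (of_nat l) = 1" by (simp add: R.val_mult[OF a])
      then show False using P(2) R.val_of_nat[OF a, of l] R.val_nonneg[OF a, of "of_nat below_prime"]
          mult_left_le[of "a (of_nat l)" "a (of_nat below_prime)"] by simp
    qed
  qed
  show "a (of_int m) < 1 \<longleftrightarrow> int below_prime dvd m"
  proof
    assume "int below_prime dvd m"
    then obtain l where "m = int below_prime * l" by blast
    then show "a (of_int m) < 1" using P(2) R.val_of_int[OF a, of l] R.val_nonneg[OF a, of "of_nat below_prime"]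
        mult_left_le[of "a (of_int l)" "a (of_nat below_prime)"] by (simp add: R.val_mult[OF a])
  next
    assume m: "a (of_int m) < 1"
    let ?B = "int below_prime"
    have "a (of_int (?B * (m div ?B))) < 1"
      using P(2) R.val_of_int[OF a, of "m div ?B"] R.val_nonneg[OF a, of "of_nat below_prime"]
        mult_left_le[of "a (of_int (m div ?B))" "a (of_nat below_prime)"] by (simp add: R.val_mult[OF a])
    then have "a (of_int m - of_int (?B * (m div ?B))) < 1"
      using m R.val_diff[OF a, of "of_int m" "of_int (?B * (m div ?B))"] by (simp add: max_def split: if_splits)
    then have "a (of_int (m mod ?B)) < 1" by (metis minus_mult_div_eq_mod of_int_diff)
    then have "a (of_nat (nat (m mod ?B))) < 1" using P(1) by simp
    moreover have "m mod ?B < ?B" "m mod ?B \<ge> 0" using P(1) by auto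
    ultimately have "m mod ?B = 0" using least[of "nat (m mod ?B)"] by (cases "m mod ?B = 0") (auto simp: nat_less_iff)
    then show "?B dvd m" by (simp add: dvd_eq_mod_eq_0)
  qed
qed

lemma not_unit: "\<not> is_unit (int below_prime)"
  using below_prime(1) by (simp add: zdvd1_eq)

lemma rat_less_1: "a (of_int m / of_int n) < 1 \<longleftrightarrow> int below_prime dvd m" if "coprime m n" "n > 0"
proof -
  have n: "a (of_int n) > 0" using R.val_pos[OF a, of "of_int n"] that by simp
  have eq: "a (of_int m / of_int n) * a (of_int n) = a (of_int m)" using that by (simp flip: R.val_mult[OF a])
  show ?thesis
  proof
    assume "int below_prime dvd m"
    then have "\<not> int below_prime dvd n" using coprime_common_divisor[OF that(1)] not_unit by blast
    then have "a (of_int n) = 1" using below_prime(4)[of n] R.val_of_int[OF a, of n] by simp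
    then show "a (of_int m / of_int n) < 1" using eq below_prime(4)[of m] \<open>int below_prime dvd m\<close> by simp
  next
    assume "a (of_int m / of_int n) < 1"
    then have "a (of_int m) < 1" using eq R.val_of_int[OF a, of n] n R.val_nonneg[OF a, of "of_int m / of_int n"]
        mult_left_le[of "a (of_int n)" "a (of_int m / of_int n)"] by simp
    then show "int below_prime dvd m" using below_prime(4) by simp
  qed
qed

lemma rat_local_val: "local_val {0} a"
proof -
  let ?p = "of_nat below_prime :: rat" and ?P = "int below_prime"
  have p0: "0 < a ?p" using R.val_pos[OF a, of ?p] below_prime(1) by simp
  have int_val: "\<exists>k::int. a (of_int m) = a ?p powi k" if "m \<noteq> 0" for m
  proof -
    from that not_unit obtain l where l: "m = ?P ^ multiplicity ?P m * l" "\<not> ?P dvd l"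
      by (rule multiplicity_decompose')
    have "a (of_int l) = 1" using below_prime(4)[of l] l(2) R.val_of_int[OF a, of l] by simp
    moreover have "of_int m = ?p ^ multiplicity ?P m * of_int l"
      using l(1) by (metis of_int_mult of_int_of_nat_eq of_int_power)
    ultimately have "a (of_int m) = a ?p powi int (multiplicity ?P m)"
      by (simp add: R.val_mult[OF a] R.val_power[OF a])
    then show ?thesis by blast
  qed
  have "\<exists>k::int. a x = a ?p powi k" if "x \<noteq> 0" for x
  proof -
    obtain m n where q0: "quotient_of x = (m, n)" by (cases "quotient_of x")
    have q: "x = of_int m / of_int n" "n > 0" using quotient_of_div[OF q0] quotient_of_denom_pos[OF q0] by auto
    then have "m \<noteq> 0" using that by auto
    obtain k l where "a (of_int m) = a ?p powi k" "a (of_int n) = a ?p powi l"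
      using int_val[OF \<open>m \<noteq> 0\<close>] int_val[of n] q by auto
    moreover have "a x * a (of_int n) = a (of_int m)" using q by (simp flip: R.val_mult[OF a])
    ultimately have "a x = a ?p powi (k - l)" using p0 by (simp add: power_int_diff field_simps)
    then show ?thesis by blast
  qed
  then have d: "discrete_val {0} a" unfolding discrete_val_def using a p0 below_prime(2) by auto
  have "fin_idx (vring a) (vmax a)"
  proof (rule fin_idxI[OF R.subgp_vmax[OF a]])
    show "finite (of_nat ` {..<below_prime} :: rat set)" by simp
    fix x assume x: "x \<in> vring a"
    obtain m n where q: "quotient_of x = (m, n)" by (cases "quotient_of x")
    have mn: "x = of_int m / of_int n" "coprime m n" "n > 0"
      using quotient_of_div[OF q] quotient_of_coprime[OF q] quotient_of_denom_pos[OF q] by auto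
    have nd: "\<not> ?P dvd n"
    proof
      assume dn: "?P dvd n"
      then have "\<not> ?P dvd m" using coprime_common_divisor[OF mn(2)] not_unit by blast
      then have "a (of_int m) = 1" using below_prime(4)[of m] R.val_of_int[OF a, of m] by simp
      moreover have "a (of_int n) < 1" using dn below_prime(4) by simp
      moreover have "a x * a (of_int n) = a (of_int m)" using mn by (simp flip: R.val_mult[OF a])
      ultimately show False using x R.val_nonneg[OF a, of "of_int n"] R.val_nonneg[OF a, of x]
          mult_left_le_one_le[of "a (of_int n)" "a x"] by simp
    qed
    then have an: "a (of_int n) = 1" using below_prime(4)[of n] R.val_of_int[OF a, of n] by simp
    have "Factorial_Ring.prime ?P" using below_prime(3) by simp
    then have "coprime ?P n" using nd prime_imp_coprime by blast
    then obtain u v where uv: "u * n + v * ?P = 1" using bezout_int[of n ?P] by (auto simp: coprime_iff_gcd_eq_1 gcd.commute)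
    \<comment> \<open>\<open>u\<close> inverts the denominator \<open>n\<close> modulo the prime, so
      \<open>k\<close> represents the residue of \<open>x\<close>.\<close>
    define k where "k = (m * u) mod ?P"
    have "k = m * u - ?P * (m * u div ?P)" by (simp add: k_def minus_mult_div_eq_mod)
    then have "m - n * k = m * (u * n + v * ?P) - n * (m * u - ?P * (m * u div ?P))" using uv by simp
    also have "\<dots> = ?P * (m * v + n * (m * u div ?P))" by (simp add: algebra_simps)
    finally have "?P dvd m - n * k" by simp
    then have "a (of_int (m - n * k)) < 1" using below_prime(4) by blast
    moreover have "of_int (m - n * k) = of_int n * (x - of_int k)" using mn by (simp add: field_simps)
    ultimately have "a (x - of_int k) < 1" using an by (simp add: R.val_mult[OF a])
    moreover have "0 \<le> k" "k < ?P" using below_prime(1) by (auto simp: k_def)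
    ultimately show "\<exists>y\<in>of_nat ` {..<below_prime}. x - y \<in> vmax a"
      by (intro bexI[of _ "of_nat (nat k)"] imageI) (auto simp: nat_less_iff)
  qed
  with d show ?thesis by (simp add: local_val_def)
qed

end

text \<open>The rationals of value below 1 are those whose reduced numerator is divisible by the
  prime below, so this prime determines the place.\<close>

lemma rat_veq:
  assumes "val {0} a" "val {0} a'" "below_prime a = below_prime a'"
  shows "veq a a'"
proof -
  interpret R: max_ideal "{0::rat}" by (rule max_ideal_zero)
  have "a' x < 1" if "a x < 1" for x
  proof -
    obtain m n where q: "quotient_of x = (m, n)" by (cases "quotient_of x")
    have "x = of_int m / of_int n" "coprime m n" "n > 0"
      using quotient_of_div[OF q] quotient_of_coprime[OF q] quotient_of_denom_pos[OF q] by auto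
    then show ?thesis using rat_less_1[OF assms(1)] rat_less_1[OF assms(2)] assms(3) that by metis
  qed
  then show ?thesis using R.veqI[OF _ assms(2)] rat_local_val[OF assms(1)] by (simp add: local_val_def)
qed

section \<open>Ideals of semilocal rings\<close>

text \<open>\<open>R\<close> represents, modulo \<open>Z\<close>, the intersection of finitely many discrete valuation rings.
  By weak approximation, its ideals of finite index are the sets \<open>ideal_of N\<close> of all elements whose
  valuations are bounded below by a prescribed exponent vector \<open>N\<close>.\<close>

locale semilocal = max_ideal Z for Z :: "'r::comm_ring_1 set" +
  fixes R :: "'r set" and W :: "('r \<Rightarrow> real) set"
  assumes R_subgp: "subgp R" and R_one: "1 \<in> R" and R_mult: "x \<in> R \<Longrightarrow> y \<in> R \<Longrightarrow> x * y \<in> R"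
    and finW: "finite W" and W_local: "b \<in> W \<Longrightarrow> local_val Z b"
    and W_ne: "b \<in> W \<Longrightarrow> b' \<in> W \<Longrightarrow> b \<noteq> b' \<Longrightarrow> \<not> veq b b'"
    and R_le: "x \<in> R \<Longrightarrow> b \<in> W \<Longrightarrow> b x \<le> 1"
    and R_full: "(\<And>b. b \<in> W \<Longrightarrow> b x \<le> 1) \<Longrightarrow> \<exists>y\<in>R. x - y \<in> Z"
    and of_nat_Z: "n > 0 \<Longrightarrow> of_nat n \<notin> Z"
begin

definition unif :: "('r \<Rightarrow> real) \<Rightarrow> 'r" where
  "unif b = (SOME p. 0 < b p \<and> b p < 1 \<and> (\<forall>x. x \<notin> Z \<longrightarrow> (\<exists>k::int. b x = b p powi k)))"

lemma W_discrete: "b \<in> W \<Longrightarrow> discrete_val Z b" and W_val: "b \<in> W \<Longrightarrow> val Z b"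
  using W_local local_val_def discrete_val_def by blast+

lemma unif: assumes "b \<in> W"
  shows "0 < b (unif b)" "b (unif b) < 1" "x \<notin> Z \<Longrightarrow> \<exists>k::int. b x = b (unif b) powi k" "unif b \<notin> Z"
proof -
  from someI_ex[OF discrete_valD(2)[OF W_discrete[OF assms]]]
  show *: "0 < b (unif b)" "b (unif b) < 1" "x \<notin> Z \<Longrightarrow> \<exists>k::int. b x = b (unif b) powi k"
    unfolding unif_def by blast+
  show "unif b \<notin> Z" using *(1) val_eq_0[OF W_val[OF assms], of "unif b"] by auto
qed

definition ideal_of :: "(('r \<Rightarrow> real) \<Rightarrow> nat) \<Rightarrow> 'r set" where
  "ideal_of N = {x \<in> R. \<forall>b\<in>W. b x \<le> b (unif b) ^ N b}"

definition res_card :: "('r \<Rightarrow> real) \<Rightarrow> nat" where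
  "res_card b = idx (vring b) (vmax b)"

lemma res_card: assumes "b \<in> W" shows "res_card b \<ge> 2"
proof -
  note v = W_val[OF assms]
  note sg = subgp_vring[OF v] subgp_vmax[OF v]
  have "idx (vring b) (vmax b) > 0" using W_local[OF assms] idx_pos[OF sg(1)] by (auto simp: local_val_def)
  moreover have "idx (vring b) (vmax b) \<noteq> 1"
  proof
    assume "idx (vring b) (vmax b) = 1"
    then have "vmax b = vring b" by (intro idx_eq_1D[OF sg]) auto
    moreover have "1 \<in> vring b" "1 \<notin> vmax b" using val_one[OF v] by auto
    ultimately show False by blast
  qed
  ultimately show ?thesis unfolding res_card_def by simp
qed

lemma val_steps:
  assumes "b \<in> W" "b x < b (unif b) ^ n" shows "b x \<le> b (unif b) ^ Suc n"
proof (cases "x \<in> Z")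
  case True
  then show ?thesis using val_eq_0[OF W_val[OF assms(1)], of x] unif(1)[OF assms(1)] by simp
next
  case False
  note u = unif[OF assms(1)]
  obtain k where k: "b x = b (unif b) powi k" using u(3)[OF False] by blast
  have "b (unif b) powi k < b (unif b) powi int n" using assms(2) k by simp
  then have "\<not> k \<le> int n" using power_int_decreasing[of k "int n" "b (unif b)"] u by force
  then have "int (Suc n) \<le> k" by simp
  then have "b (unif b) powi k \<le> b (unif b) powi int (Suc n)" using u by (intro power_int_decreasing) auto
  then show ?thesis unfolding k power_int_of_nat .
qed

lemma approx:
  assumes "b \<in> W" "\<epsilon> > 0" shows "\<exists>c. b (c - 1) < \<epsilon> \<and> (\<forall>b'\<in>W - {b}. b' c < \<epsilon>)"
  using W_discrete W_ne finW assms by (intro approx_idempotent) auto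

lemma ideal_of_Z: "R \<inter> Z \<subseteq> ideal_of N"
proof
  fix x assume x: "x \<in> R \<inter> Z"
  have "b x \<le> b (unif b) ^ N b" if "b \<in> W" for b
    using x val_eq_0[OF W_val[OF that], of x] unif(1)[OF that] by simp
  then show "x \<in> ideal_of N" using x by (simp add: ideal_of_def)
qed

lemma ideal_of_subgp: "subgp (ideal_of N)"
  unfolding subgp_def
proof (intro conjI ballI)
  show "0 \<in> ideal_of N" using ideal_of_Z subgp_zero[OF R_subgp] subgp_zero[OF Z_subgp] by blast
  show "x - y \<in> ideal_of N" if "x \<in> ideal_of N" "y \<in> ideal_of N" for x y
    using that subgp_diff[OF R_subgp] order_trans[OF val_diff[OF W_val]] by (auto simp: ideal_of_def)
qed

lemma ideal_of_mult: "r \<in> R \<Longrightarrow> x \<in> ideal_of N \<Longrightarrow> r * x \<in> ideal_of N"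
  using R_le val_nonneg[OF W_val] R_mult
  by (auto simp: ideal_of_def val_mult[OF W_val] intro!: order_trans[OF mult_left_le_one_le])

lemma R_Int_Z_mult: "x \<in> R \<Longrightarrow> y \<in> R \<Longrightarrow> x * y \<in> Z \<Longrightarrow> y \<notin> Z \<Longrightarrow> x \<in> Z"
proof -
  assume *: "x * y \<in> Z" "y \<notin> Z"
  have "vinv y * (x * y) - x * (y * vinv y - 1) \<in> Z"
    by (rule subgp_diff[OF Z_subgp Z_mult[OF *(1)] Z_mult[OF vinv[OF *(2)]]])
  then show "x \<in> Z" by (simp add: algebra_simps)
qed

text \<open>\<open>N b\<close> is the least exponent at \<open>b\<close> in \<open>J\<close>,
  attained at \<open>q b\<close>. Weak approximation provides \<open>c b\<close> close to 1 at
  \<open>b\<close> and small at the other places, and the sum \<open>y\<close> of all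
  \<open>c b * q b\<close> attains every least exponent at once. Hence \<open>y\<close> generates
  \<open>ideal_of N\<close> modulo \<open>Z\<close>.\<close>

lemma fin_ideal_structure:
  assumes J: "J \<in> fin_ideals R Z"
  shows "\<exists>N y. (\<forall>b. b \<notin> W \<longrightarrow> N b = 0) \<and> J = ideal_of N \<and> y \<in> J \<and> y \<notin> Z \<and> (\<forall>x\<in>J. \<exists>z\<in>R. x - z * y \<in> Z)"
proof -
  have J': "J \<subseteq> R" "subgp J" "\<And>r x. r \<in> R \<Longrightarrow> x \<in> J \<Longrightarrow> r * x \<in> J" "R \<inter> Z \<subseteq> J" "fin_idx R J"
    using J by (auto simp: fin_ideals_def)
  define m where "m = idx R J"
  have "m > 0" unfolding m_def by (rule idx_pos[OF R_subgp J'(5)])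
  \<comment> \<open>The index of \<open>J\<close>, as an element of \<open>R\<close>, lies in
    \<open>J\<close> but not in \<open>Z\<close>. So some finite exponent occurs in \<open>J\<close>
    at every place.\<close>
  have mJ: "of_nat m \<in> J" using idx_kills[OF R_subgp J'(2,1,5) R_one] by (simp add: m_def)
  have mZ: "of_nat m \<notin> Z" using of_nat_Z[OF \<open>m > 0\<close>] .
  have ex: "\<exists>n x. x \<in> J \<and> b x = b (unif b) ^ n" if b: "b \<in> W" for b
  proof -
    obtain k where k: "b (of_nat m) = b (unif b) powi k" using unif(3)[OF b mZ] by blast
    have "k \<ge> 0"
    proof (rule ccontr)
      assume "\<not> k \<ge> 0"
      then have "b (unif b) powi 0 < b (unif b) powi k" using unif[OF b] by (intro power_int_strict_decreasing) auto
      then show False using k val_of_nat[OF W_val[OF b], of m] by simp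
    qed
    then show ?thesis using k mJ by (intro exI[of _ "nat k"] exI[of _ "of_nat m"]) (simp add: power_int_def)
  qed
  define N where "N b = (if b \<in> W then LEAST n. \<exists>x. x \<in> J \<and> b x = b (unif b) ^ n else 0)" for b
  have "\<exists>x. x \<in> J \<and> b x = b (unif b) ^ N b" if "b \<in> W" for b
    using LeastI_ex[OF ex[OF that]] that by (simp add: N_def)
  then obtain q where q: "\<And>b. b \<in> W \<Longrightarrow> q b \<in> J" "\<And>b. b \<in> W \<Longrightarrow> b (q b) = b (unif b) ^ N b" by metis
  have le: "b x \<le> b (unif b) ^ N b" if "x \<in> J" "b \<in> W" for x b
  proof (cases "x \<in> Z")
    case True
    then show ?thesis using val_eq_0[OF W_val[OF that(2)], of x] unif(1)[OF that(2)] by simp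
  next
    case False
    note u = unif[OF that(2)]
    obtain k where k: "b x = b (unif b) powi k" using u(3)[OF False] by blast
    have "k \<ge> 0"
    proof (rule ccontr)
      assume "\<not> k \<ge> 0"
      then have "b (unif b) powi 0 < b (unif b) powi k" using u by (intro power_int_strict_decreasing) auto
      then show False using k R_le[of x b] J'(1) that by auto
    qed
    then have k': "b x = b (unif b) ^ nat k" using k by (simp add: power_int_def)
    then have "N b \<le> nat k" using that by (auto simp: N_def intro!: Least_le)
    then show ?thesis using k' u by (simp add: power_decreasing)
  qed
  have "\<exists>c\<in>R. b (c - 1) < 1 \<and> (\<forall>b'\<in>W - {b}. b' c < 1)" if b: "b \<in> W" for b
  proof -
    obtain c where c: "b (c - 1) < 1" "\<And>b'. b' \<in> W - {b} \<Longrightarrow> b' c < 1" using approx[OF b, of 1] by auto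
    have "b (c - 1 + 1) \<le> 1" using order_trans[OF val_add[OF W_val[OF b]], of "c - 1" 1 1] c(1) val_one[OF W_val[OF b]] by simp
    then have "b' c \<le> 1" if "b' \<in> W" for b' using c(2)[of b'] that by (cases "b' = b") auto
    then obtain d where d: "d \<in> R" "c - d \<in> Z" using R_full by blast
    have "b (d - 1) = b (c - 1)" "b' d = b' c" if "b' \<in> W" for b'
      using d(2) subgp_diff_comm[OF Z_subgp] val_cong[OF W_val[OF b], of "d - 1" "c - 1"] val_cong[OF W_val[OF that], of d c] by auto
    note e = this
    show ?thesis
    proof (intro bexI[of _ d] conjI ballI)
      show "b (d - 1) < 1" using e(1)[OF b] c(1) by simp
      show "b' d < 1" if "b' \<in> W - {b}" for b' using e(2)[of b'] c(2)[OF that] that by simp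
    qed (rule d(1))
  qed
  then obtain c where c: "\<And>b. b \<in> W \<Longrightarrow> c b \<in> R" "\<And>b. b \<in> W \<Longrightarrow> b (c b - 1) < 1" "\<And>b b'. b \<in> W \<Longrightarrow> b' \<in> W - {b} \<Longrightarrow> b' (c b) < 1"
    by metis
  \<comment> \<open>Without places, \<open>R\<close> is everything modulo \<open>Z\<close>, so 1 is
    a generator; the empty sum would be 0, which lies in \<open>Z\<close>.\<close>
  define y where "y = (if W = {} then 1 else \<Sum>b\<in>W. c b * q b)"
  have yJ: "y \<in> J"
  proof (cases "W = {}")
    case True
    then obtain z where "z \<in> R" "vinv (of_nat m) - z \<in> Z" using R_full[of "vinv (of_nat m)"] by blast
    then have "of_nat m * (vinv (of_nat m) - z) \<in> Z" by (intro Z_mult)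
    moreover have "of_nat m * z \<in> J" using J'(3)[OF \<open>z \<in> R\<close> mJ] by (simp add: mult.commute)
    ultimately have "(of_nat m * vinv (of_nat m) - 1) - of_nat m * (vinv (of_nat m) - z) \<in> Z" "of_nat m * z \<in> J"
      using vinv[OF mZ] subgp_diff[OF Z_subgp] by blast+
    then have "of_nat m * z - 1 \<in> Z" "of_nat m * z \<in> J" by (auto simp: algebra_simps)
    then have "of_nat m * z - 1 \<in> J" using J'(4) subgp_diff[OF R_subgp _ R_one] J'(1) by blast
    from subgp_diff[OF J'(2) \<open>of_nat m * z \<in> J\<close> this] show ?thesis using True by (simp add: y_def)
  next
    case False
    have "(\<Sum>b\<in>W. c b * q b) \<in> J" by (intro subgp_sum[OF J'(2)] J'(3) c(1) q(1))
    then show ?thesis using False by (simp add: y_def)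
  qed
  have yv: "b y = b (unif b) ^ N b" if b: "b \<in> W" for b
  proof -
    note v = W_val[OF b] and u = unif[OF b]
    have 1: "b (\<Sum>b'\<in>W - {b}. c b' * q b') < b (unif b) ^ N b"
    proof (rule val_sum_less[OF v])
      fix b' assume b': "b' \<in> W - {b}"
      have "b (c b') < 1" using c(3)[of b' b] b b' by auto
      have "b (q b') \<le> b (unif b) ^ N b" using le q b b' by auto
      have "b (c b') * b (q b') \<le> b (c b') * b (unif b) ^ N b"
        using \<open>b (q b') \<le> _\<close> val_nonneg[OF v] by (intro mult_left_mono)
      also have "\<dots> < 1 * b (unif b) ^ N b"
        using \<open>b (c b') < 1\<close> u by (intro mult_strict_right_mono) auto
      finally show "b (c b' * q b') < b (unif b) ^ N b" by (simp add: val_mult[OF v])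
    qed (use finW u in auto)
    have "b (c b - 1 + 1) = 1" using val_dominant[OF v, of "c b - 1" 1] c(2)[OF b] val_one[OF v] by simp
    then have 2: "b (c b * q b) = b (unif b) ^ N b" using q(2)[OF b] by (simp add: val_mult[OF v])
    have "y = (\<Sum>b'\<in>W - {b}. c b' * q b') + c b * q b" using finW b by (auto simp: y_def sum.remove add.commute)
    then show ?thesis using val_dominant[OF v, of "\<Sum>b'\<in>W - {b}. c b' * q b'" "c b * q b"] 1 2 by simp
  qed
  have yZ: "y \<notin> Z"
  proof (cases "W = {}")
    case False
    then obtain b where "b \<in> W" by blast
    then show ?thesis using yv[of b] unif(1)[of b] val_eq_0[OF W_val, of b y] by auto
  qed (simp add: y_def one_Z)
  have gen: "\<exists>z\<in>R. x - z * y \<in> Z" if "x \<in> ideal_of N" for x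
  proof -
    have "b (x * vinv y) \<le> 1" if "b \<in> W" for b
    proof -
      note v = W_val[OF that]
      have "b x \<le> b y" using \<open>x \<in> ideal_of N\<close> that yv[OF that] by (simp add: ideal_of_def)
      then show ?thesis using val_pos[OF v yZ] by (simp add: val_mult[OF v] val_vinv[OF v yZ] divide_inverse[symmetric])
    qed
    then obtain z where z: "z \<in> R" "x * vinv y - z \<in> Z" using R_full by blast
    have "y * (x * vinv y - z) - x * (y * vinv y - 1) \<in> Z"
      using subgp_diff[OF Z_subgp Z_mult[OF z(2)] Z_mult[OF vinv[OF yZ]]] .
    then show ?thesis using z(1) by (intro bexI[of _ z]) (auto simp: algebra_simps)
  qed
  have "J = ideal_of N"
  proof (intro subset_antisym subsetI)
    show "x \<in> ideal_of N" if "x \<in> J" for x using that le J'(1) by (auto simp: ideal_of_def)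
    show "x \<in> J" if x: "x \<in> ideal_of N" for x
    proof -
      obtain z where z: "z \<in> R" "x - z * y \<in> Z" using gen[OF x] by blast
      have "x \<in> R" "z * y \<in> J" using x J'(3)[OF z(1) yJ] by (auto simp: ideal_of_def)
      then have "x - z * y \<in> J" using z(2) J'(1,4) subgp_diff[OF R_subgp, of x "z * y"] by blast
      then show ?thesis using subgp_add[OF J'(2) _ \<open>z * y \<in> J\<close>, of "x - z * y"] by simp
    qed
  qed
  moreover have "N b = 0" if "b \<notin> W" for b using that by (simp add: N_def)
  ultimately show ?thesis using yJ yZ gen by blast
qed

lemma principal: "ideals_principal R Z"
  unfolding ideals_principal_def
proof
  fix J assume J: "J \<in> fin_ideals R Z"
  then obtain y where y: "y \<in> J" "y \<notin> Z" "\<forall>x\<in>J. \<exists>z\<in>R. x - z * y \<in> Z" using fin_ideal_structure by blast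
  then show "\<exists>b\<in>J. (\<forall>x\<in>J. \<exists>y\<in>R. x - y * b \<in> Z) \<and> (\<forall>x\<in>R. x * b \<in> Z \<longrightarrow> x \<in> Z)"
    using R_Int_Z_mult J by (intro bexI[of _ y]) (auto simp: fin_ideals_def)
qed

text \<open>Multiplication by \<open>t\<close>, an inverse of the \<open>N b\<close>-th power of the
  uniformizer, maps \<open>ideal_of N\<close> into the valuation ring of \<open>b\<close> and, by
  weak approximation, onto its residue field. The kernel consists of the elements with a larger
  exponent at \<open>b\<close>.\<close>

lemma ideal_of_step:
  assumes b: "b \<in> W"
  shows "fin_idx (ideal_of N) (ideal_of (N(b := Suc (N b))))"
    "idx (ideal_of N) (ideal_of (N(b := Suc (N b)))) = res_card b"
    "ideal_of (N(b := Suc (N b))) \<subseteq> ideal_of N"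
proof -
  let ?N' = "N(b := Suc (N b))" and ?p = "unif b"
  note v = W_val[OF b] and u = unif[OF b]
  define t where "t = vinv ?p ^ N b"
  have bt: "b t = inverse (b ?p ^ N b)" by (simp add: t_def val_power[OF v] val_vinv[OF v u(4)] power_inverse)
  have p: "b ?p ^ N b > 0" using u by simp
  have tx: "b (t * x) = b x / b ?p ^ N b" for x by (simp add: val_mult[OF v] bt divide_inverse)
  show sub: "ideal_of ?N' \<subseteq> ideal_of N"
  proof
    fix x assume x: "x \<in> ideal_of ?N'"
    have "b ?p ^ Suc (N b) \<le> b ?p ^ N b" using u by (intro power_decreasing) auto
    then show "x \<in> ideal_of N" using x b by (fastforce simp: ideal_of_def split: if_splits)
  qed
  have eq: "{x \<in> ideal_of N. t * x \<in> vmax b} = ideal_of ?N'"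
  proof (intro subset_antisym subsetI)
    fix x assume x: "x \<in> {x \<in> ideal_of N. t * x \<in> vmax b}"
    then have "b x < b ?p ^ N b" using p by (simp add: tx)
    from val_steps[OF b this] x show "x \<in> ideal_of ?N'" by (auto simp: ideal_of_def)
  next
    fix x assume x: "x \<in> ideal_of ?N'"
    have "b x \<le> b ?p ^ Suc (N b)" using x b by (auto simp: ideal_of_def)
    also have "\<dots> < b ?p ^ N b" using u p by simp
    finally show "x \<in> {x \<in> ideal_of N. t * x \<in> vmax b}" using x sub p by (auto simp: tx)
  qed
  have surj: "\<exists>x\<in>ideal_of N. y - t * x \<in> vmax b" if y: "y \<in> vring b" for y
  proof -
    define z where "z = y * ?p ^ N b"
    have bz: "b z \<le> b ?p ^ N b" using y p by (simp add: z_def val_mult[OF v] val_power[OF v])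
    \<comment> \<open>\<open>c\<close> must be so small at the other places that
      \<open>z * c\<close> stays in \<open>ideal_of N\<close>. The entry 1 makes \<open>c\<close> a
      unit at \<open>b\<close>, and \<open>1 + b' z\<close> avoids a zero denominator.\<close>
    define K where "K = insert 1 ((\<lambda>b'. b' (unif b') ^ N b' / (1 + b' z)) ` W)"
    have K: "finite K" "K \<noteq> {}" using finW by (auto simp: K_def)
    have Kpos: "Min K > 0"
    proof -
      have "0 < k" if "k \<in> K" for k
        using that unif(1) val_nonneg[OF W_val, of _ z]
        by (auto simp: K_def intro!: divide_pos_pos add_pos_nonneg)
      then show ?thesis using K by (simp add: Min_gr_iff)
    qed
    obtain c where c: "b (c - 1) < Min K" "\<And>b'. b' \<in> W - {b} \<Longrightarrow> b' c < Min K" using approx[OF b Kpos] by blast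
    have c1: "b (c - 1) < 1" using c(1) K by (auto simp: K_def)
    then have bc: "b c = 1" using val_dominant[OF v, of "c - 1" 1] val_one[OF v] by simp
    have le: "b' (z * c) \<le> b' (unif b') ^ N b'" if b': "b' \<in> W" for b'
    proof (cases "b' = b")
      case True
      then show ?thesis using bz bc by (simp add: val_mult[OF v])
    next
      case False
      note v' = W_val[OF b']
      have "Min K \<le> b' (unif b') ^ N b' / (1 + b' z)" using K(1) b' by (intro Min_le) (auto simp: K_def)
      then have "b' c \<le> b' (unif b') ^ N b' / (1 + b' z)" using c(2)[of b'] b' False by simp
      then have "b' c * (1 + b' z) \<le> b' (unif b') ^ N b'" using val_nonneg[OF v', of z] by (simp add: field_simps)
      moreover have "b' z * b' c \<le> b' c * (1 + b' z)" using val_nonneg[OF v', of c] by (simp add: algebra_simps)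
      ultimately show ?thesis by (simp add: val_mult[OF v'])
    qed
    have "b' (z * c) \<le> 1" if "b' \<in> W" for b'
      using le[OF that] unif[OF that] power_le_one[of "b' (unif b')" "N b'"] by simp
    then obtain x where x: "x \<in> R" "z * c - x \<in> Z" using R_full by blast
    have "b' x \<le> b' (unif b') ^ N b'" if "b' \<in> W" for b'
      using le[OF that] val_cong[OF W_val[OF that] x(2)] by simp
    then have "x \<in> ideal_of N" using x(1) by (simp add: ideal_of_def)
    moreover have "b (y - t * x) < 1"
    proof -
      have pt: "?p ^ N b * t - 1 \<in> Z"
      proof -
        have "(?p * vinv ?p) ^ n - 1 \<in> Z" for n
        proof (induction n)
          case (Suc n)
          have "(?p * vinv ?p) * ((?p * vinv ?p) ^ n - 1) + (?p * vinv ?p - 1) \<in> Z"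
            by (intro subgp_add[OF Z_subgp] Z_mult Suc vinv[OF u(4)])
          then show ?case by (simp add: algebra_simps)
        qed (simp add: subgp_zero[OF Z_subgp])
        then show ?thesis by (simp add: t_def power_mult_distrib)
      qed
      have "t * (z * c - x) - (c * y) * (?p ^ N b * t - 1) \<in> Z"
        by (intro subgp_diff[OF Z_subgp] Z_mult x(2) pt)
      then have "(y - t * x) - (y * (1 - c)) \<in> Z" by (simp add: z_def algebra_simps)
      then have "b (y - t * x) = b y * b (1 - c)" using val_cong[OF v] val_mult[OF v] by metis
      also have "b (1 - c) = b (c - 1)" using val_minus[OF v, of "c - 1"] by simp
      also have "b y * b (c - 1) \<le> b (c - 1)" using y val_nonneg[OF v] by (intro mult_left_le_one_le) auto
      finally show ?thesis using c1 by simp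
    qed
    ultimately show ?thesis by auto
  qed
  have im: "t * x \<in> vring b" if "x \<in> ideal_of N" for x
    using that b p by (auto simp: ideal_of_def tx)
  note * = idx_hom[OF ideal_of_subgp subgp_vmax[OF v], of N "\<lambda>x. t * x" "vring b", unfolded eq, OF right_diff_distrib im surj]
  show "fin_idx (ideal_of N) (ideal_of ?N')" using *(2) W_local[OF b] by (simp add: local_val_def)
  show "idx (ideal_of N) (ideal_of ?N') = res_card b" using *(3) by (simp add: res_card_def)
qed

lemma ideal_of_0: "ideal_of (\<lambda>_. 0) = R"
  using R_le by (auto simp: ideal_of_def)

lemma ideal_of_idx:
  assumes "\<And>b. b \<notin> W \<Longrightarrow> N b = 0"
  shows "fin_idx R (ideal_of N) \<and> idx R (ideal_of N) = (\<Prod>b\<in>W. res_card b ^ N b)"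
  using assms
proof (induction "\<Sum>b\<in>W. N b" arbitrary: N)
  case 0
  then have "N = (\<lambda>_. 0)" using finW by (auto simp: fun_eq_iff)
  then show ?case using idx_self[OF R_subgp] by (simp add: ideal_of_0)
next
  case (Suc n)
  then obtain b where b: "b \<in> W" "N b > 0" by (metis Suc_neq_Zero gr0I sum.neutral)
  define M where "M = N(b := N b - 1)"
  have NM: "N = M(b := Suc (M b))" using b by (auto simp: M_def)
  have "(\<Sum>b\<in>W. N b) = Suc (\<Sum>b\<in>W. M b)"
    using finW b by (simp add: sum.remove[of W b] M_def)
  then have "n = (\<Sum>b\<in>W. M b)" using Suc.hyps(2) by simp
  moreover have "M d = 0" if "d \<notin> W" for d using Suc.prems[OF that] that b(1) by (auto simp: M_def)
  ultimately have IH: "fin_idx R (ideal_of M)" "idx R (ideal_of M) = (\<Prod>b\<in>W. res_card b ^ M b)"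
    using Suc.hyps(1)[of M] by blast+
  note st = ideal_of_step[OF b(1), of M, folded NM]
  have MR: "ideal_of M \<subseteq> R" by (auto simp: ideal_of_def)
  note tw = idx_tower[OF ideal_of_subgp ideal_of_subgp R_subgp st(3) MR]
  have "(\<Prod>b\<in>W. res_card b ^ N b) = (\<Prod>b\<in>W. res_card b ^ M b) * res_card b"
    using finW b by (simp add: prod.remove[of W b] NM)
  then show ?case using tw IH st by simp
qed

text \<open>Raising one exponent shrinks the ideal strictly, because the index is the size of a
  residue field and thus at least 2.\<close>

lemma ideal_of_inj:
  assumes "\<And>b. b \<notin> W \<Longrightarrow> N b = 0" "\<And>b. b \<notin> W \<Longrightarrow> N' b = 0" "ideal_of N = ideal_of N'"
  shows "N = N'"
proof -
  have "\<not> N b < N' b" if b: "b \<in> W" and eq: "ideal_of N = ideal_of N'" for b N N'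
  proof
    assume less: "N b < N' b"
    note v = W_val[OF b] and u = unif[OF b] and st = ideal_of_step[OF b, of N]
    have "ideal_of N \<subseteq> ideal_of (N(b := Suc (N b)))"
    proof
      fix x assume x: "x \<in> ideal_of N"
      have "b x \<le> b (unif b) ^ N' b" using x b unfolding eq by (simp add: ideal_of_def)
      also have "\<dots> \<le> b (unif b) ^ Suc (N b)" using less u by (intro power_decreasing) auto
      finally show "x \<in> ideal_of (N(b := Suc (N b)))" using x by (auto simp: ideal_of_def)
    qed
    then have "ideal_of (N(b := Suc (N b))) = ideal_of N" using st(3) by blast
    then show False using st(2) idx_self(2)[OF ideal_of_subgp] res_card[OF b] by simp
  qed
  then have "\<not> N b < N' b \<and> \<not> N' b < N b" if "b \<in> W" for b using that assms(3) by metis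
  then show ?thesis using assms(1,2) by (metis ext linorder_neqE_nat)
qed

text \<open>Ideals correspond to exponent vectors on \<open>W\<close> and the index is
  multiplicative in the exponents, so the sum is a product of geometric series.\<close>

lemma has_zeta: "has_zeta R Z (\<lambda>s. \<Prod>b\<in>W. 1 / (1 - npow (res_card b) s))"
  unfolding has_zeta_def
proof (intro allI impI)
  fix s :: complex assume s: "Re s > 0"
  let ?P = "{N. \<forall>b. b \<notin> W \<longrightarrow> N b = (0::nat)}"
  have bij: "bij_betw ideal_of ?P (fin_ideals R Z)"
  proof (rule bij_betw_imageI)
    show "inj_on ideal_of ?P" using ideal_of_inj by (intro inj_onI) blast
    show "ideal_of ` ?P = fin_ideals R Z"
    proof (intro subset_antisym subsetI)
      fix J assume "J \<in> ideal_of ` ?P"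
      then obtain N where N: "J = ideal_of N" "\<And>b. b \<notin> W \<Longrightarrow> N b = 0" by blast
      have "ideal_of N \<subseteq> R" by (auto simp: ideal_of_def)
      moreover have "fin_idx R (ideal_of N)" using ideal_of_idx[of N] N(2) by simp
      ultimately show "J \<in> fin_ideals R Z" unfolding fin_ideals_def N(1)
        using ideal_of_subgp ideal_of_mult ideal_of_Z by blast
    next
      fix J assume "J \<in> fin_ideals R Z"
      then show "J \<in> ideal_of ` ?P" using fin_ideal_structure by blast
    qed
  qed
  let ?x = "\<lambda>b. npow (res_card b) s"
  have norm: "norm (?x b) < 1" if "b \<in> W" for b
  proof -
    have "norm (?x b) = real (res_card b) powr (- Re s)"
      using norm_powr_real_powr[of "of_nat (res_card b)" "- s"] res_card[OF that] by simp
    also have "\<dots> < 1" using res_card[OF that] s by (simp add: powr_less_one)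
    finally show ?thesis .
  qed
  have "((\<lambda>N. \<Prod>b\<in>V. ?x b ^ N b) has_sum (\<Prod>b\<in>V. 1 / (1 - ?x b))) {N. \<forall>b. b \<notin> V \<longrightarrow> N b = (0::nat)}"
    if "V \<subseteq> W" for V using finite_subset[OF that finW] that
  proof (induction V rule: finite_induct)
    case empty
    have "{N. \<forall>b. b \<notin> {} \<longrightarrow> N b = (0::nat)} = {\<lambda>_::'r \<Rightarrow> real. 0}" by auto
    then show ?case by (simp add: has_sum_finiteI)
  next
    case (insert b V)
    have b: "norm (?x b) < 1" using norm insert.prems by blast
    have "(\<lambda>n. ?x b ^ n) sums (1 / (1 - ?x b))" using b by (rule geometric_sums)
    moreover have "summable (\<lambda>n. norm (?x b ^ n))" using b by (simp add: norm_power)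
    ultimately have "((\<lambda>n. ?x b ^ n) has_sum (1 / (1 - ?x b))) UNIV" by (rule norm_summable_imp_has_sum[rotated])
    from has_sum_Times[OF this insert.IH]
    have *: "((\<lambda>(n, N). ?x b ^ n * (\<Prod>b\<in>V. ?x b ^ N b)) has_sum (\<Prod>b\<in>insert b V. 1 / (1 - ?x b)))
       (UNIV \<times> {N. \<forall>b. b \<notin> V \<longrightarrow> N b = (0::nat)})"
      using insert by simp
    have eq': "(\<Prod>b'\<in>V. ?x b' ^ (N(b := n)) b') = (\<Prod>b'\<in>V. ?x b' ^ N b')" for N n
      using insert.hyps(2) by (intro prod.cong) auto
    have "bij_betw (\<lambda>(n, N). N(b := n)) (UNIV \<times> {N. \<forall>b. b \<notin> V \<longrightarrow> N b = (0::nat)})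
        {N. \<forall>b'. b' \<notin> insert b V \<longrightarrow> N b' = (0::nat)}"
      by (rule bij_betw_byWitness[where f' = "\<lambda>N. (N b, N(b := 0))"]) (use insert.hyps(2) in \<open>auto simp: fun_upd_idem\<close>)
    from has_sum_reindex_bij_betw[OF this, of "\<lambda>N. \<Prod>b\<in>insert b V. ?x b ^ N b"] show ?case
      using * insert.hyps by (simp add: case_prod_unfold eq' del: fun_upd_apply) simp
  qed
  from this[of W] have "((\<lambda>N. \<Prod>b\<in>W. ?x b ^ N b) has_sum (\<Prod>b\<in>W. 1 / (1 - ?x b))) ?P" by simp
  moreover have "(\<Prod>b\<in>W. ?x b ^ N b) = npow (idx R (ideal_of N)) s" if "N \<in> ?P" for N
  proof -
    have pw: "npow (m ^ k) s = npow m s ^ k" for m k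
      by (induction k) (simp_all only: power_0 power_Suc npow_mult of_nat_1 powr_one_eq_one)
    have "npow (\<Prod>b\<in>V. res_card b ^ N b) s = (\<Prod>b\<in>V. ?x b ^ N b)" for V
      by (induction V rule: infinite_finite_induct)
        (simp_all add: npow_mult pw del: of_nat_mult of_nat_power of_nat_prod)
    then show ?thesis using ideal_of_idx that by simp
  qed
  ultimately have "((\<lambda>N. npow (idx R (ideal_of N)) s) has_sum (\<Prod>b\<in>W. 1 / (1 - ?x b))) ?P"
    by (rule iffD1[OF has_sum_cong, rotated])
  then show "((\<lambda>J. npow (idx R J) s) has_sum (\<Prod>b\<in>W. 1 / (1 - ?x b))) (fin_ideals R Z)"
    using has_sum_reindex_bij_betw[OF bij, of "\<lambda>J. npow (idx R J) s"] by simp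
qed

end

section \<open>Polynomials over a valuation ring\<close>

text \<open>A non-zero element \<open>g\<close> of least degree in the ideal of \<open>f\<close> and
  \<open>p\<close> divides both. As \<open>f\<close> is irreducible and does not divide
  \<open>p\<close>, \<open>g\<close> is a unit.\<close>

lemma bezout_irreducible:
  fixes f p :: "'k::field_char_0 poly"
  assumes f: "Factorial_Ring.irreducible f" and p: "\<not> f dvd p"
  shows "\<exists>u w. u * f + w * p = 1"
proof -
  let ?I = "{u * f + w * p | u w. True}"
  have f0: "f \<noteq> 0" using f by auto
  have fI: "f \<in> ?I" by (rule CollectI, intro exI[of _ 1] exI[of _ 0]) simp
  have pI: "p \<in> ?I" by (rule CollectI, intro exI[of _ 0] exI[of _ 1]) simp
  have I_mod: "x mod y \<in> ?I" if xy: "x \<in> ?I" "y \<in> ?I" for x y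
  proof -
    obtain u w u' w' where *: "x = u * f + w * p" "y = u' * f + w' * p" using xy by blast
    have "x mod y = x - x div y * y" by (simp add: minus_div_mult_eq_mod)
    also have "\<dots> = (u - x div y * u') * f + (w - x div y * w') * p"
      unfolding *(1)[symmetric] by (simp add: *(2) algebra_simps) (simp add: *(1) algebra_simps)
    finally show ?thesis by blast
  qed
  define n where "n = (LEAST n. \<exists>g\<in>?I. g \<noteq> 0 \<and> Polynomial.degree g = n)"
  have "\<exists>g\<in>?I. g \<noteq> 0 \<and> Polynomial.degree g = n" unfolding n_def
    by (rule LeastI_ex) (use fI f0 in blast)
  then obtain g where g: "g \<in> ?I" "g \<noteq> 0" "Polynomial.degree g = n" by blast
  have gdvd: "g dvd x" if "x \<in> ?I" for x
  proof (rule ccontr)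
    assume *: "\<not> g dvd x"
    then have "x mod g \<noteq> 0" by (simp add: dvd_eq_mod_eq_0)
    then have "Polynomial.degree (x mod g) < n" using degree_mod_less[OF g(2), of x] g(3) by auto
    then show False using not_less_Least[of "Polynomial.degree (x mod g)" "\<lambda>n. \<exists>g\<in>?I. g \<noteq> 0 \<and> Polynomial.degree g = n"]
        I_mod[OF that g(1)] \<open>x mod g \<noteq> 0\<close> unfolding n_def[symmetric] by blast
  qed
  obtain h where h: "f = g * h" using gdvd[OF fI] by blast
  have "\<not> h dvd 1"
  proof
    assume "h dvd 1"
    then obtain h' where "h * h' = 1" by (metis dvdE)
    then have "g = f * h'" using h by (simp add: mult.assoc)
    then show False using gdvd[OF pI] p by (metis dvd_trans dvd_triv_left)
  qed
  then have "g dvd 1" using f h Factorial_Ring.irreducibleD by blast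
  then obtain k where k: "1 = g * k" by blast
  obtain u w where "g = u * f + w * p" using g(1) by blast
  then have "(u * k) * f + (w * k) * p = 1" using k by (simp add: algebra_simps)
  then show ?thesis by blast
qed

lemma max_ideal_irreducible:
  fixes f :: "'k::field_char_0 poly"
  assumes "Factorial_Ring.irreducible f" shows "max_ideal {p. f dvd p}"
proof
  show "\<exists>y. x * y - 1 \<in> {p. f dvd p}" if "x \<notin> {p. f dvd p}" for x
  proof -
    have "\<not> f dvd x" using that by simp
    then obtain u w where "u * f + w * x = 1" using bezout_irreducible[OF assms] by blast
    then have "x * w - 1 = f * (- u)" by (simp add: algebra_simps)
    then show ?thesis by (intro exI[of _ w]) (simp only: mem_Collect_eq dvd_triv_left)
  qed
  show "1 \<notin> {p. f dvd p}" using assms by (auto simp: Factorial_Ring.irreducible_def)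
qed (auto simp: subgp_def)

text \<open>This is \<open>O[X]\<close>; \<open>mpolys a\<close> is the kernel of its reduction
  modulo the maximal ideal of \<open>O\<close>.\<close>

definition vpolys :: "('k::comm_ring_1 \<Rightarrow> real) \<Rightarrow> 'k poly set" where
  "vpolys a = {p. \<forall>i. a (Polynomial.coeff p i) \<le> 1}"

definition mpolys :: "('k::comm_ring_1 \<Rightarrow> real) \<Rightarrow> 'k poly set" where
  "mpolys a = {p. \<forall>i. a (Polynomial.coeff p i) < 1}"

context
  fixes a :: "'k::field_char_0 \<Rightarrow> real" assumes a: "val {0} a"
begin

interpretation K: max_ideal "{0::'k}" by (rule max_ideal_zero)

lemma a_0: "a 0 = 0" using K.val_eq_0[OF a, of 0] by simp

lemma vpolys_diff: "p \<in> vpolys a \<Longrightarrow> q \<in> vpolys a \<Longrightarrow> p - q \<in> vpolys a"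
  using order_trans[OF K.val_diff[OF a]] by (auto simp: vpolys_def)

lemma mpolys_diff: "p \<in> mpolys a \<Longrightarrow> q \<in> mpolys a \<Longrightarrow> p - q \<in> mpolys a"
  using le_less_trans[OF K.val_diff[OF a]] by (auto simp: mpolys_def)

lemma mpolys_subset: "mpolys a \<subseteq> vpolys a" by (auto simp: vpolys_def mpolys_def less_imp_le)

lemma subgp_vpolys: "subgp (vpolys a)" and subgp_mpolys: "subgp (mpolys a)"
  using vpolys_diff mpolys_diff a_0 unfolding subgp_def by (auto simp: vpolys_def mpolys_def)

lemmas vpolys_add = subgp_add[OF subgp_vpolys] and mpolys_add = subgp_add[OF subgp_mpolys]

lemma vpolys_mult: "p \<in> vpolys a \<Longrightarrow> q \<in> vpolys a \<Longrightarrow> p * q \<in> vpolys a"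
  by (auto intro!: K.val_sum[OF a] K.val_mult_le_1[OF a] simp: vpolys_def Polynomial.coeff_mult)

lemma mpolys_mult: "p \<in> vpolys a \<Longrightarrow> q \<in> mpolys a \<Longrightarrow> p * q \<in> mpolys a"
  by (auto intro!: K.val_sum_less[OF a] K.val_mult_less_1[OF a] simp: vpolys_def mpolys_def Polynomial.coeff_mult)

lemma vpolys_1: "1 \<in> vpolys a" and vpolys_const: "[:c:] \<in> vpolys a \<longleftrightarrow> a c \<le> 1"
  using K.val_one[OF a] a_0 by (auto simp: vpolys_def coeff_1 coeff_pCons split: nat.split)

lemma vpolys_smult: "a c \<le> 1 \<Longrightarrow> p \<in> vpolys a \<Longrightarrow> Polynomial.smult c p \<in> vpolys a"
  using vpolys_mult[of "[:c:]" p] vpolys_const by simp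

lemma vpolys_power: "p \<in> vpolys a \<Longrightarrow> p ^ n \<in> vpolys a"
  by (induction n) (auto intro: vpolys_1 vpolys_mult)

lemma vpolys_pderiv: "p \<in> vpolys a \<Longrightarrow> pderiv p \<in> vpolys a"
  using K.val_of_nat[OF a] by (auto simp: vpolys_def coeff_pderiv intro!: K.val_mult_le_1[OF a] simp del: of_nat_Suc)

lemma mpolys_pderiv: "p \<in> mpolys a \<Longrightarrow> pderiv p \<in> mpolys a"
  using K.val_of_nat[OF a] by (auto simp: mpolys_def coeff_pderiv intro!: K.val_mult_less_1[OF a] simp del: of_nat_Suc)

lemma vpolys_monom: "a c \<le> 1 \<Longrightarrow> Polynomial.monom c n \<in> vpolys a"
  using a_0 by (auto simp: vpolys_def)

lemma vpolys_divide:
  assumes g: "g \<in> vpolys a" "Polynomial.lead_coeff g = 1" and p: "p \<in> vpolys a"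
  shows "\<exists>q\<in>vpolys a. \<exists>r\<in>vpolys a. p = g * q + r \<and> (r = 0 \<or> Polynomial.degree r < Polynomial.degree g)"
  using p
proof (induction "Polynomial.degree p" arbitrary: p rule: less_induct)
  case less
  have z: "0 \<in> vpolys a" using subgp_zero[OF subgp_vpolys] .
  show ?case
  proof (cases "p = 0 \<or> Polynomial.degree p < Polynomial.degree g")
    case True
    then show ?thesis using z less.prems by (intro bexI[of _ 0] bexI[of _ p]) auto
  next
    case False
    let ?n = "Polynomial.degree p - Polynomial.degree g" and ?c = "Polynomial.lead_coeff p"
    define m where "m = Polynomial.monom ?c ?n"
    have m: "m \<in> vpolys a" using less.prems by (auto simp: m_def vpolys_def a_0)
    define p' where "p' = p - g * m"
    have p': "p' \<in> vpolys a" unfolding p'_def using less.prems g(1) m vpolys_diff vpolys_mult by blast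
    have c: "?c \<noteq> 0" and g0: "g \<noteq> 0" using False g(2) by auto
    have deg: "Polynomial.degree (g * m) = Polynomial.degree p"
      using c g0 False by (simp add: m_def degree_mult_eq degree_monom_eq monom_eq_0_iff)
    have lc: "Polynomial.coeff (g * m) (Polynomial.degree p) = ?c"
      using deg g(2) lead_coeff_mult[of g m] c by (simp add: m_def degree_monom_eq)
    show ?thesis
    proof (cases "p' = 0")
      case True
      then show ?thesis using m z by (intro bexI[of _ m] bexI[of _ 0]) (auto simp: p'_def)
    next
      case nz: False
      have "Polynomial.coeff p' (Polynomial.degree p) = 0" by (simp add: p'_def lc)
      moreover have "Polynomial.degree p' \<le> Polynomial.degree p"
        unfolding p'_def using degree_diff_le[of p "Polynomial.degree p" "g * m"] deg by simp
      ultimately have "Polynomial.degree p' < Polynomial.degree p"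
        using nz by (metis eq_zero_or_degree_less)
      from less.hyps[OF this p'] obtain q r where qr: "q \<in> vpolys a" "r \<in> vpolys a" "p' = g * q + r"
          "r = 0 \<or> Polynomial.degree r < Polynomial.degree g" by blast
      then have "p = g * (q + m) + r" by (simp add: p'_def algebra_simps)
      then show ?thesis using qr m vpolys_add by blast
    qed
  qed
qed

text \<open>Division with remainder by a monic polynomial stays inside \<open>O[X]\<close>.
  Consequently \<open>O[X]\<close> modulo the multiples of \<open>f\<close> in \<open>k[X]\<close>
  is the ring \<open>O[X] / (f)\<close>.\<close>

lemma vpolys_dvd:
  assumes g: "g \<in> vpolys a" "Polynomial.lead_coeff g = 1" and p: "p \<in> vpolys a"
  shows "g dvd p \<longleftrightarrow> (\<exists>q\<in>vpolys a. p = q * g)"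
proof
  assume "g dvd p"
  obtain q r where qr: "q \<in> vpolys a" "p = g * q + r" "r = 0 \<or> Polynomial.degree r < Polynomial.degree g"
    using vpolys_divide[OF g p] by blast
  have "g dvd r" using \<open>g dvd p\<close> qr(2) by (simp add: dvd_add_right_iff)
  then have "r = 0" using qr(3) dvd_imp_degree_le[of g r] by fastforce
  then show "\<exists>q\<in>vpolys a. p = q * g" using qr by (auto simp: mult.commute)
qed auto

text \<open>The index \<open>i\<close> is the degree of the reduction modulo the maximal
  ideal.\<close>

lemma top_unit_coeff:
  assumes "p \<in> vpolys a" "p \<notin> mpolys a"
  shows "\<exists>i. a (Polynomial.coeff p i) = 1 \<and> (\<forall>j>i. a (Polynomial.coeff p j) < 1)"
proof -
  let ?P = "\<lambda>i. a (Polynomial.coeff p i) = 1"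
  have ex: "\<exists>i. ?P i" using assms by (auto simp: vpolys_def mpolys_def not_less intro: antisym)
  have bd: "i \<le> Polynomial.degree p" if "?P i" for i using that a_0 le_degree[of p i] by fastforce
  define i where "i = Greatest ?P"
  have "?P i" unfolding i_def using GreatestI_ex_nat[OF ex] bd by blast
  moreover have "a (Polynomial.coeff p j) < 1" if "j > i" for j
  proof -
    have "\<not> ?P j" using that Greatest_le_nat[of ?P j "Polynomial.degree p"] bd unfolding i_def by force
    then show ?thesis using assms(1) by (auto simp: vpolys_def less_le)
  qed
  ultimately show ?thesis by blast
qed

text \<open>Degrees of reductions add if one factor is monic: in the coefficient sum only the
  product of the two top coefficients has value 1.\<close>

lemma monic_mult_top:
  assumes g: "g \<in> vpolys a" "Polynomial.lead_coeff g = 1"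
    and i: "a (Polynomial.coeff x i) = 1" "\<And>j. j > i \<Longrightarrow> a (Polynomial.coeff x j) < 1"
  shows "a (Polynomial.coeff (g * x) (Polynomial.degree g + i)) = 1"
proof -
  let ?d = "Polynomial.degree g"
  let ?t = "\<lambda>j. Polynomial.coeff g j * Polynomial.coeff x (?d + i - j)"
  have "a (\<Sum>j\<in>{..?d + i} - {?d}. ?t j) < 1"
  proof (rule K.val_sum_less[OF a])
    fix j assume j: "j \<in> {..?d + i} - {?d}"
    show "a (?t j) < 1"
    proof (cases "j < ?d")
      case True
      then have "a (Polynomial.coeff x (?d + i - j)) < 1" by (intro i(2)) simp
      then show ?thesis using g(1) by (intro K.val_mult_less_1[OF a]) (auto simp: vpolys_def)
    next
      case False
      then have "Polynomial.coeff g j = 0" using j by (intro coeff_eq_0) auto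
      then show ?thesis using a_0 by simp
    qed
  qed auto
  then have "a ((\<Sum>j\<in>{..?d + i} - {?d}. ?t j) + ?t ?d) = 1"
    using K.val_dominant[OF a] i(1) g(2) by simp
  moreover have "Polynomial.coeff (g * x) (?d + i) = ?t ?d + (\<Sum>j\<in>{..?d + i} - {?d}. ?t j)"
    unfolding Polynomial.coeff_mult by (rule sum.remove) auto
  ultimately show ?thesis by (simp add: add.commute)
qed

lemma mpolys_cancel:
  assumes g: "g \<in> vpolys a" "Polynomial.lead_coeff g = 1" and x: "x \<in> vpolys a" "g * x \<in> mpolys a"
  shows "x \<in> mpolys a"
proof (rule ccontr)
  assume "x \<notin> mpolys a"
  with x(1) obtain i where "a (Polynomial.coeff x i) = 1" "\<And>j. j > i \<Longrightarrow> a (Polynomial.coeff x j) < 1"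
    using top_unit_coeff by blast
  then have "a (Polynomial.coeff (g * x) (Polynomial.degree g + i)) = 1" by (rule monic_mult_top[OF g])
  moreover have "a (Polynomial.coeff (g * x) (Polynomial.degree g + i)) < 1" using x(2) unfolding mpolys_def by blast
  ultimately show False by simp
qed

end

text \<open>At such a place, \<open>f\<close> is integral and separable modulo the maximal ideal; these conditions
  hold almost everywhere, and guarantee that \<open>vpolys a\<close> is integrally closed modulo \<open>f\<close>.\<close>

locale good_place =
  fixes a :: "'k::field_char_0 \<Rightarrow> real" and f :: "'k poly"
  assumes a_local: "local_val {0} a" and f_irr: "Factorial_Ring.irreducible f"
    and f_monic: "Polynomial.lead_coeff f = 1" and f_int: "f \<in> vpolys a"
    and f_sep: "\<exists>u\<in>vpolys a. \<exists>w\<in>vpolys a. u * f + w * pderiv f = 1"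
begin

sublocale K: max_ideal "{0::'k}" by (rule max_ideal_zero)
sublocale Z: max_ideal "{p. f dvd p}" by (rule max_ideal_irreducible[OF f_irr])

lemma a_val: "val {0} a" and a_discrete: "discrete_val {0} a"
  using a_local by (auto simp: local_val_def discrete_val_def)

abbreviation "R \<equiv> vpolys a"
abbreviation "M \<equiv> mpolys a"

text \<open>The ideal generated by \<open>f\<close> and the maximal ideal of \<open>O\<close>. The
  quotient of \<open>R\<close> by it is a finite ring, and separability of \<open>f\<close> makes it
  reduced.\<close>

definition "red = {x \<in> R. \<exists>y\<in>R. x - y * f \<in> M}"

lemmas R_mult = vpolys_mult[OF a_val] and R_add = vpolys_add[OF a_val] and R_diff = vpolys_diff[OF a_val]
  and M_mult = mpolys_mult[OF a_val] and M_add = mpolys_add[OF a_val] and M_diff = mpolys_diff[OF a_val]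
  and R_1 = vpolys_1[OF a_val] and R_power = vpolys_power[OF a_val]
  and R_0 = subgp_zero[OF subgp_vpolys[OF a_val]] and M_0 = subgp_zero[OF subgp_mpolys[OF a_val]]
  and M_R = subsetD[OF mpolys_subset[OF a_val]]

lemma red_R: "x \<in> red \<Longrightarrow> x \<in> R" by (simp add: red_def)

lemma redI: "x \<in> R \<Longrightarrow> y \<in> R \<Longrightarrow> x - y * f \<in> M \<Longrightarrow> x \<in> red" by (auto simp: red_def)

lemma M_red: "x \<in> M \<Longrightarrow> x \<in> red" using redI[OF M_R R_0, of x] by simp

lemma red_diff: assumes "x \<in> red" "y \<in> red" shows "x - y \<in> red"
proof -
  obtain u v where "u \<in> R" "x - u * f \<in> M" "v \<in> R" "y - v * f \<in> M" using assms by (auto simp: red_def)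
  then have "(x - y) - (u - v) * f \<in> M" "u - v \<in> R" using M_diff[of "x - u * f" "y - v * f"] R_diff
    by (auto simp: algebra_simps)
  then show ?thesis using assms R_diff red_R by (intro redI) auto
qed

lemma red_subgp: "subgp red" using red_diff M_red[OF M_0] by (auto simp: subgp_def)

lemma red_mult: assumes "r \<in> R" "x \<in> red" shows "r * x \<in> red"
proof -
  obtain u where "u \<in> R" "x - u * f \<in> M" using assms by (auto simp: red_def)
  then have "r * x - (r * u) * f \<in> M" "r * u \<in> R" using M_mult[OF assms(1), of "x - u * f"] R_mult assms(1)
    by (auto simp: algebra_simps)
  then show ?thesis using assms R_mult red_R by (intro redI) auto
qed

lemma f_red: "r \<in> R \<Longrightarrow> r * f \<in> red"
  using redI[of "r * f" r] R_mult f_int M_0 by auto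

text \<open>Reducedness modulo the maximal ideal: if \<open>g\<close> generates the ideal \<open>(x, f)\<close> modulo \<open>M\<close> and
  \<open>f = g q\<close>, then \<open>q\<close> divides \<open>g\<close>, so \<open>q\<^sup>2\<close> divides \<open>f\<close>, and \<open>q\<close> is a unit by separability.\<close>

lemma red_reduced:
  assumes x: "x \<in> R" "x * x \<in> red" shows "x \<in> red"
proof -
  define J where "J = {z \<in> R. \<exists>y\<in>R. z - x * y \<in> red}"
  have red_J: "z \<in> J" if "z \<in> red" for z using that red_R R_0 by (auto simp: J_def intro!: bexI[of _ 0])
  have J_R: "z \<in> R" if "z \<in> J" for z using that by (simp add: J_def)
  have J_diff: "z - z' \<in> J" if z: "z \<in> J" "z' \<in> J" for z z'
  proof -
    obtain y y' where *: "y \<in> R" "y' \<in> R" "z - x * y \<in> red" "z' - x * y' \<in> red" using z by (auto simp: J_def)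
    then have "(z - z') - x * (y - y') \<in> red" using red_diff[OF *(3,4)] by (simp add: algebra_simps)
    then show ?thesis using * z R_diff by (auto simp: J_def)
  qed
  have J_mult: "r * z \<in> J" if "r \<in> R" "z \<in> J" for r z
  proof -
    from that(2) obtain y where *: "y \<in> R" "z - x * y \<in> red" by (auto simp: J_def)
    then have "r * z - x * (r * y) \<in> red" using red_mult[OF that(1) *(2)] by (simp add: algebra_simps)
    then show ?thesis using * that R_mult by (auto simp: J_def)
  qed
  let ?P = "\<lambda>n. \<exists>g\<in>J. Polynomial.lead_coeff g = 1 \<and> Polynomial.degree g = n"
  define n where "n = Least ?P"
  have fJ: "f \<in> J" using red_J f_red[OF R_1] by simp
  have "?P n" unfolding n_def by (rule LeastI[of ?P "Polynomial.degree f"]) (use fJ f_monic in blast)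
  then obtain g where g: "g \<in> J" "Polynomial.lead_coeff g = 1" "Polynomial.degree g = n" by blast
  have min: "\<not> ?P m" if "m < n" for m using that not_less_Least unfolding n_def by blast
  have gR: "g \<in> R" using g J_R by blast
  have gen: "\<exists>q\<in>R. z - g * q \<in> M" if z: "z \<in> J" for z
  proof -
    obtain q r where qr: "q \<in> R" "r \<in> R" "z = g * q + r" "r = 0 \<or> Polynomial.degree r < n"
      using vpolys_divide[OF a_val gR g(2) J_R[OF z]] g(3) by blast
    have rJ: "r \<in> J" using J_diff[OF z J_mult[OF qr(1) g(1)]] qr(3) by (simp add: mult.commute)
    have "r \<in> M"
    proof (rule ccontr)
      assume "r \<notin> M"
      with qr(2) obtain i where i: "a (Polynomial.coeff r i) = 1" "\<And>j. j > i \<Longrightarrow> a (Polynomial.coeff r j) < 1"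
        using top_unit_coeff[OF a_val] by blast
      have c0: "Polynomial.coeff r i \<noteq> 0" using i(1) a_0[OF a_val] by auto
      \<comment> \<open>Modulo \<open>M\<close> the remainder \<open>r\<close> has degree
        \<open>i\<close>. Cutting off the higher coefficients and dividing by the unit at
        \<open>i\<close> gives a monic element of \<open>J\<close> of degree
        \<open>i < n\<close>.\<close>
      define s where "s = poly_cutoff (Suc i) r"
      have "r - s \<in> M" using i(2) a_0[OF a_val] by (auto simp: mpolys_def s_def coeff_poly_cutoff)
      then have "s \<in> J" using J_diff[OF rJ red_J[OF M_red]] by fastforce
      define t where "t = Polynomial.smult (inverse (Polynomial.coeff r i)) s"
      have "a (inverse (Polynomial.coeff r i)) = 1"
        using K.val_mult[OF a_val, of "Polynomial.coeff r i" "inverse (Polynomial.coeff r i)"] i(1) c0 K.val_one[OF a_val] by simp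
      then have "t \<in> J" using J_mult[of "[:inverse (Polynomial.coeff r i):]" s] vpolys_const[OF a_val] \<open>s \<in> J\<close> by (simp add: t_def)
      moreover have ct: "Polynomial.coeff t i = 1" using c0 by (simp add: t_def s_def coeff_poly_cutoff)
      moreover have "Polynomial.coeff t j = 0" if "j > i" for j using that by (simp add: t_def s_def coeff_poly_cutoff)
      then have "Polynomial.degree t = i" using ct le_degree[of t i] by (metis degree_le le_antisym zero_neq_one)
      ultimately have "?P i" by auto
      moreover have "i < n" using qr(4) c0 le_degree[of r i] by auto
      ultimately show False using min by blast
    qed
    then show ?thesis using qr by (intro bexI[of _ q]) auto
  qed
  obtain q where q: "q \<in> R" "f - g * q \<in> M" using gen[OF fJ] by blast
  obtain y where y: "y \<in> R" "g - x * y \<in> red" using g(1) by (auto simp: J_def)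
  have "g * g = y * y * (x * x) + (g + x * y) * (g - x * y)" by (simp add: algebra_simps)
  moreover have "g + x * y \<in> R" using gR x(1) y(1) R_add R_mult by blast
  ultimately have "g * g \<in> red"
    using red_mult[OF R_mult[OF y(1) y(1)] x(2)] red_mult[OF _ y(2)] subgp_add[OF red_subgp] by metis
  then obtain t where t: "t \<in> R" "g * g - t * f \<in> M" by (auto simp: red_def)
  have "g * (g - q * t) = (g * g - t * f) + t * (f - g * q)" by (simp add: algebra_simps)
  then have "g * (g - q * t) \<in> M" using M_add[OF t(2) M_mult[OF t(1) q(2)]] by simp
  then have gq: "g - q * t \<in> M" by (rule mpolys_cancel[OF a_val gR g(2) R_diff[OF gR R_mult[OF q(1) t(1)]]])
  define m where "m = f - q * (q * t)"
  have "m = (f - g * q) + q * (g - q * t)" by (simp add: m_def algebra_simps)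
  then have m: "m \<in> M" using M_add[OF q(2) M_mult[OF q(1) gq]] by simp
  have f: "f = q * (q * t) + m" by (simp add: m_def)
  obtain u w where uw: "u \<in> R" "w \<in> R" "u * f + w * pderiv f = 1" using f_sep by blast
  \<comment> \<open>Modulo \<open>M\<close> both \<open>f\<close> and \<open>pderiv f\<close> are
    multiples of \<open>q\<close>; \<open>c\<close> collects the cofactors, weighted by
    \<open>u\<close> and \<open>w\<close>.\<close>
  define c where "c = u * (q * t) + w * (pderiv (q * t) + pderiv q * t)"
  have "1 - q * c = u * m + w * pderiv m"
    unfolding uw(3)[symmetric] by (simp add: f c_def pderiv_add pderiv_mult algebra_simps)
  then have one: "1 - q * c \<in> M" using M_add[OF M_mult[OF uw(1) m] M_mult[OF uw(2) mpolys_pderiv[OF a_val m]]] by simp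
  have cR: "c \<in> R" unfolding c_def by (intro R_add R_mult vpolys_pderiv[OF a_val] uw q(1) t(1))
  \<comment> \<open>Modulo \<open>M\<close>, \<open>f = g * q\<close> and \<open>q * c = 1\<close>,
    so \<open>g\<close> is congruent to \<open>c * f\<close>.\<close>
  have "g - c * f = g * (1 - q * c) - c * (f - g * q)" by (simp add: algebra_simps)
  then have "g - c * f \<in> M" using M_diff[OF M_mult[OF gR one] M_mult[OF cR q(2)]] by simp
  then have g_red: "g \<in> red" using redI[OF gR cR] by blast
  have "x \<in> J" using x(1) R_1 M_red[OF M_0] by (auto simp: J_def intro!: bexI[of _ 1])
  then obtain q' where q': "q' \<in> R" "x - g * q' \<in> M" using gen by blast
  have "x = (x - g * q') + q' * g" by simp
  then show ?thesis using subgp_add[OF red_subgp M_red[OF q'(2)] red_mult[OF q'(1) g_red]] by metis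
qed

lemma red_finite: "fin_idx R red"
proof -
  obtain F where F: "finite F" "F \<subseteq> vring a" "\<And>x. x \<in> vring a \<Longrightarrow> \<exists>y\<in>F. x - y \<in> vmax a"
    using finite_residue_reps[OF K.subgp_vmax[OF a_val]] a_local by (auto simp: local_val_def)
  let ?d = "Polynomial.degree f"
  let ?G = "(\<lambda>g. \<Sum>i<?d. Polynomial.monom (g i) i) ` ({..<?d} \<rightarrow>\<^sub>E F)"
  show ?thesis
  proof (rule fin_idxI[OF red_subgp, of ?G])
    show "finite ?G" using F(1) by (auto intro!: finite_imageI finite_PiE)
    fix x assume x: "x \<in> R"
    obtain q r where qr: "q \<in> R" "r \<in> R" "x = f * q + r" "r = 0 \<or> Polynomial.degree r < ?d"
      using vpolys_divide[OF a_val f_int f_monic x] by blast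
    have "\<exists>y\<in>F. a (Polynomial.coeff r i - y) < 1" for i using F(3)[of "Polynomial.coeff r i"] qr(2) by (auto simp: vpolys_def)
    then obtain y where y: "\<And>i. y i \<in> F" "\<And>i. a (Polynomial.coeff r i - y i) < 1" by metis
    define g where "g = restrict y {..<?d}"
    define s where "s = (\<Sum>i<?d. Polynomial.monom (g i) i)"
    have cs: "Polynomial.coeff s i = (if i < ?d then y i else 0)" for i
      by (simp add: s_def g_def coeff_sum if_distrib[of "\<lambda>x. x = _"] sum.delta)
    have "Polynomial.coeff r i = 0" if "\<not> i < ?d" for i using qr(4) that by (auto intro: coeff_eq_0)
    then have rs: "r - s \<in> M" using y(2) a_0[OF a_val] by (auto simp: mpolys_def cs)
    have "x - s = q * f + (r - s)" using qr(3) by (simp add: algebra_simps)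
    then have "x - s \<in> red" using subgp_add[OF red_subgp f_red[OF qr(1)] M_red[OF rs]] by metis
    moreover have "s \<in> ?G" unfolding s_def using y(1) by (intro imageI) (simp add: g_def PiE_iff extensional_def)
    ultimately show "\<exists>y\<in>?G. x - y \<in> red" by blast
  qed
qed

lemma degree_f: "Polynomial.degree f > 0"
proof (rule ccontr)
  assume "\<not> Polynomial.degree f > 0"
  then obtain c where "f = [:c:]" by (auto elim: degree_eq_zeroE)
  then show False using f_monic f_irr by (simp add: Factorial_Ring.irreducible_def flip: one_pCons)
qed

lemma one_not_red: "1 \<notin> red"
proof
  assume "1 \<in> red"
  then obtain y where y: "y \<in> R" "1 - y * f \<in> M" by (auto simp: red_def)
  show False
  proof (cases "y \<in> M")
    case True
    then have "1 \<in> M" using M_add[OF y(2) M_mult[OF f_int True]] by (simp add: mult.commute)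
    then have "a (Polynomial.coeff 1 0) < 1" unfolding mpolys_def by blast
    then show False using K.val_one[OF a_val] by simp
  next
    case False
    with y(1) obtain i where i: "a (Polynomial.coeff y i) = 1" "\<And>j. j > i \<Longrightarrow> a (Polynomial.coeff y j) < 1"
      using top_unit_coeff[OF a_val] by blast
    have "f * y - 1 \<in> M" using subgp_neg[OF subgp_mpolys[OF a_val] y(2)] by (simp add: algebra_simps)
    then have "a (Polynomial.coeff (f * y - 1) (Polynomial.degree f + i)) < 1" unfolding mpolys_def by blast
    moreover have "Polynomial.coeff (f * y - 1) (Polynomial.degree f + i) = Polynomial.coeff (f * y) (Polynomial.degree f + i)"
      using degree_f by (simp add: coeff_1)
    moreover have "a (Polynomial.coeff (f * y) (Polynomial.degree f + i)) = 1" by (rule monic_mult_top[OF a_val f_int f_monic i])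
    ultimately show False by (simp only:)
  qed
qed

end

section \<open>Extending the absolute value to the root field\<close>

context good_place
begin

definition unif :: 'k where
  "unif = (SOME p. 0 < a p \<and> a p < 1 \<and> (\<forall>x. x \<notin> {0} \<longrightarrow> (\<exists>k::int. a x = a p powi k)))"

lemma unif: "0 < a unif" "a unif < 1" "x \<noteq> 0 \<Longrightarrow> \<exists>k::int. a x = a unif powi k" "unif \<noteq> 0"
proof -
  from someI_ex[OF K.discrete_valD(2)[OF a_discrete]]
  show *: "0 < a unif" "a unif < 1" "x \<noteq> 0 \<Longrightarrow> \<exists>k::int. a x = a unif powi k"
    unfolding unif_def by auto
  show "unif \<noteq> 0" using *(1) a_0[OF a_val] by auto
qed

lemma a_inverse: "a (inverse c) = inverse (a c)"
proof (cases "c = 0")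
  case False
  then have "a c * a (inverse c) = 1" using K.val_one[OF a_val] by (simp flip: K.val_mult[OF a_val])
  then show ?thesis by (metis inverse_unique)
qed (simp add: a_0[OF a_val])

lemma a_powi: "a (unif powi k) = a unif powi k"
  by (simp add: power_int_def K.val_power[OF a_val] a_inverse)

lemma M_unif: assumes "p \<in> M" shows "\<exists>q\<in>R. p = Polynomial.smult unif q"
proof (intro bexI)
  show "p = Polynomial.smult unif (Polynomial.smult (inverse unif) p)" using unif(4) by simp
  have "a (inverse unif * c) \<le> 1" if "a c < 1" for c
  proof (cases "c = 0")
    case False
    then obtain k where k: "a c = a unif powi k" using unif(3) by blast
    have "\<not> k \<le> 0"
    proof
      assume "k \<le> 0"
      then have "a unif powi 0 \<le> a unif powi k" using unif by (intro power_int_decreasing) auto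
      then show False using k that by simp
    qed
    then have "a unif powi k \<le> a unif powi 1" using unif by (intro power_int_decreasing) auto
    then have "a c \<le> a unif" using k by simp
    moreover have "a (inverse unif) * a unif = 1" using unif(4) K.val_one[OF a_val] by (simp flip: K.val_mult[OF a_val])
    ultimately show ?thesis using unif(1)
      by (metis K.val_mult[OF a_val] K.val_nonneg[OF a_val] mult_left_mono)
  qed (simp add: a_0[OF a_val])
  then show "Polynomial.smult (inverse unif) p \<in> R" using assms by (auto simp: vpolys_def mpolys_def)
qed

lemma unif_M: "q \<in> R \<Longrightarrow> Polynomial.smult unif q \<in> M"
  using unif(2) K.val_mult_less_1[OF a_val, of _ unif] by (simp add: vpolys_def mpolys_def mult.commute[of unif])

text \<open>\<open>lat N\<close> is the preimage of the lattice \<open>\<pi>\<^sup>N (R / (f))\<close>.\<close>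

definition lat :: "int \<Rightarrow> 'k poly set" where
  "lat N = {x. \<exists>r\<in>R. f dvd x - Polynomial.smult (unif powi N) r}"

lemma lat_add: assumes "x \<in> lat N" "y \<in> lat N" shows "x + y \<in> lat N"
proof -
  obtain r s where *: "r \<in> R" "s \<in> R" "f dvd x - Polynomial.smult (unif powi N) r" "f dvd y - Polynomial.smult (unif powi N) s"
    using assms by (auto simp: lat_def)
  have "(x + y) - Polynomial.smult (unif powi N) (r + s) =
      (x - Polynomial.smult (unif powi N) r) + (y - Polynomial.smult (unif powi N) s)"
    by (simp add: Polynomial.smult_add_right)
  then have "f dvd (x + y) - Polynomial.smult (unif powi N) (r + s)" using dvd_add[OF *(3,4)] by metis
  then show ?thesis using R_add[OF *(1,2)] by (auto simp: lat_def)
qed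

lemma dvd_diff_mult:
  assumes "f dvd x - x'" "f dvd y - y'" shows "f dvd x * y - x' * y'"
proof -
  have "x * y - x' * y' = (x - x') * y + x' * (y - y')" by (simp add: algebra_simps)
  then show ?thesis using assms by simp
qed

lemma lat_mult: assumes "x \<in> lat N" "y \<in> lat N'" shows "x * y \<in> lat (N + N')"
proof -
  obtain r s where *: "r \<in> R" "s \<in> R" "f dvd x - Polynomial.smult (unif powi N) r" "f dvd y - Polynomial.smult (unif powi N') s"
    using assms by (auto simp: lat_def)
  have "f dvd x * y - Polynomial.smult (unif powi (N + N')) (r * s)"
    using dvd_diff_mult[OF *(3,4)] unif(4) by (simp add: power_int_add mult.commute)
  then show ?thesis using R_mult[OF *(1,2)] by (auto simp: lat_def)
qed

lemma lat_cong: assumes "f dvd x - y" "x \<in> lat N" shows "y \<in> lat N"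
proof -
  obtain r where "r \<in> R" "f dvd x - Polynomial.smult (unif powi N) r" using assms(2) by (auto simp: lat_def)
  moreover have "y - z = (x - z) - (x - y)" for z by simp
  ultimately show ?thesis using assms(1) dvd_diff by (metis (no_types, lifting) lat_def mem_Collect_eq)
qed

lemma R_lat: "x \<in> R \<Longrightarrow> x \<in> lat 0" by (auto simp: lat_def intro!: bexI[of _ x])

lemma lat_mono: assumes "N \<le> N'" "x \<in> lat N'" shows "x \<in> lat N"
proof -
  obtain r where r: "r \<in> R" "f dvd x - Polynomial.smult (unif powi N') r" using assms(2) by (auto simp: lat_def)
  have "unif powi N' = unif powi N * unif ^ nat (N' - N)"
    using assms(1) unif(4) power_int_add[of unif N "N' - N"] by (simp add: power_int_def)
  moreover have "a (unif ^ nat (N' - N)) \<le> 1" using unif by (simp add: K.val_power[OF a_val] power_le_one)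
  then have "Polynomial.smult (unif ^ nat (N' - N)) r \<in> R" using vpolys_smult[OF a_val] r(1) by blast
  ultimately show ?thesis using r(2) unfolding lat_def by (metis (mono_tags, lifting) mem_Collect_eq smult_smult)
qed

lemma lat_exists: "\<exists>N. x \<in> lat N"
proof -
  have "\<forall>\<^sub>F n in sequentially. a unif ^ n * a (Polynomial.coeff x i) < 1" for i
  proof -
    have "(\<lambda>n. a unif ^ n * a (Polynomial.coeff x i)) \<longlonglongrightarrow> 0 * a (Polynomial.coeff x i)"
      using unif by (intro tendsto_mult LIMSEQ_realpow_zero tendsto_const) auto
    then show ?thesis by (intro order_tendstoD(2)) auto
  qed
  then have "\<forall>\<^sub>F n in sequentially. \<forall>i\<in>{..Polynomial.degree x}. a unif ^ n * a (Polynomial.coeff x i) < 1"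
    by (intro eventually_ball_finite) auto
  then obtain n where n: "\<And>i. i \<le> Polynomial.degree x \<Longrightarrow> a unif ^ n * a (Polynomial.coeff x i) < 1"
    unfolding eventually_sequentially by auto
  have "a (unif ^ n * Polynomial.coeff x i) \<le> 1" for i
    using n[of i] coeff_eq_0[of x i] a_0[OF a_val]
    by (cases "i \<le> Polynomial.degree x") (auto simp: K.val_mult[OF a_val] K.val_power[OF a_val] less_imp_le)
  then have "Polynomial.smult (unif ^ n) x \<in> R" by (simp add: vpolys_def)
  moreover have "x - Polynomial.smult (unif powi (- int n)) (Polynomial.smult (unif ^ n) x) = 0"
    using unif(4) by (simp add: power_int_minus)
  ultimately have "x \<in> lat (- int n)" unfolding lat_def by (metis (mono_tags, lifting) dvd_0_right mem_Collect_eq)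
  then show ?thesis by blast
qed

text \<open>Together with \<open>red_lat\<close> this identifies the quotient of successive lattices
  with \<open>R\<close> modulo \<open>red\<close>.\<close>

lemma lat_red: assumes "r \<in> R" "Polynomial.smult (unif powi N) r \<in> lat (N + 1)" shows "r \<in> red"
proof -
  obtain s where s: "s \<in> R" "f dvd Polynomial.smult (unif powi N) r - Polynomial.smult (unif powi (N + 1)) s"
    using assms(2) by (auto simp: lat_def)
  have "Polynomial.smult (unif powi N) r - Polynomial.smult (unif powi (N + 1)) s =
      Polynomial.smult (unif powi N) (r - Polynomial.smult unif s)"
    using unif(4) by (simp add: power_int_add Polynomial.smult_diff_right)
  then have "f dvd r - Polynomial.smult unif s" using s(2) unif(4) by (simp add: dvd_smult_iff)
  moreover have us: "Polynomial.smult unif s \<in> M" by (rule unif_M[OF s(1)])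
  moreover have "r - Polynomial.smult unif s \<in> R" using R_diff[OF assms(1) M_R[OF us]] .
  ultimately obtain q where "q \<in> R" "r - Polynomial.smult unif s = q * f"
    using vpolys_dvd[OF a_val f_int f_monic] by blast
  then have "r - q * f = Polynomial.smult unif s" by (simp add: algebra_simps)
  then show ?thesis using redI[OF assms(1) \<open>q \<in> R\<close>] us by simp
qed

lemma red_lat: assumes "r \<in> red" shows "Polynomial.smult (unif powi N) r \<in> lat (N + 1)"
proof -
  obtain q where q: "q \<in> R" "r - q * f \<in> M" using assms by (auto simp: red_def)
  obtain s where s: "s \<in> R" "r - q * f = Polynomial.smult unif s" using M_unif[OF q(2)] by blast
  have "Polynomial.smult (unif powi N) r - Polynomial.smult (unif powi (N + 1)) s =
     Polynomial.smult (unif powi N) (r - Polynomial.smult unif s)"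
    using unif(4) by (simp add: power_int_add Polynomial.smult_diff_right)
  also have "\<dots> = Polynomial.smult (unif powi N) q * f" by (simp flip: s(2))
  finally have "f dvd Polynomial.smult (unif powi N) r - Polynomial.smult (unif powi (N + 1)) s"
    by (metis dvd_triv_right)
  then show ?thesis using s(1) by (auto simp: lat_def)
qed

text \<open>A minimal non-zero ideal of the finite reduced ring \<open>R / red\<close> inside the ideal generated by
  \<open>y\<close> is generated by an element \<open>h\<close> whose annihilator is a prime ideal not containing \<open>y\<close>.\<close>

lemma prime_annihilator:
  assumes y: "y \<in> R" "y \<notin> red"
  shows "\<exists>h\<in>R. h \<notin> red \<and> h * y \<notin> red \<and> (\<forall>p\<in>R. \<forall>q\<in>R. h * p \<notin> red \<longrightarrow> h * q \<notin> red \<longrightarrow> h * p * q \<notin> red)"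
proof -
  let ?C = "\<lambda>h. cosets ({h * r | r. r \<in> R} [+] red) red"
  have sub: "{h * r | r. r \<in> R} [+] red \<subseteq> R" if "h \<in> R" for h
    using that R_mult R_add red_R by (auto elim!: set_addE)
  have finC: "finite (?C h)" if "h \<in> R" for h
    using red_finite sub[OF that] unfolding cosets_def by (meson finite_subset image_mono)
  define P where "P h \<longleftrightarrow> h \<in> R \<and> h \<notin> red \<and> (\<exists>z\<in>R. h = y * z)" for h
  have "P y" using y R_1 by (auto simp: P_def intro!: bexI[of _ 1])
  \<comment> \<open>The size of the ideal generated by \<open>h\<close> modulo \<open>red\<close> is
    the measure of minimality.\<close>
  define h where "h = arg_min (\<lambda>h. card (?C h)) P"
  have h: "P h" "\<And>h'. P h' \<Longrightarrow> card (?C h) \<le> card (?C h')"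
    using arg_min_nat_lemma[of P y "\<lambda>h. card (?C h)", OF \<open>P y\<close>] unfolding h_def by blast+
  have hR: "h \<in> R" "h \<notin> red" using h(1) by (auto simp: P_def)
  obtain z where z: "z \<in> R" "h = y * z" using h(1) by (auto simp: P_def)
  have gen: "\<exists>c\<in>R. h - h * p * c \<in> red" if p: "p \<in> R" "h * p \<notin> red" for p
  proof -
    have hpR: "h * p \<in> R" using R_mult hR p by blast
    have "h * p = y * (z * p)" "z * p \<in> R" using z p R_mult by (auto simp: mult.assoc)
    then have "P (h * p)" using p hpR unfolding P_def by blast
    then have le: "card (?C h) \<le> card (?C (h * p))" by (rule h(2))
    have "{h * p * r | r. r \<in> R} [+] red \<subseteq> {h * r | r. r \<in> R} [+] red"
      using R_mult[OF p(1)] by (fastforce simp: set_add_def mult.assoc)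
    then have "?C (h * p) \<subseteq> ?C h" unfolding cosets_def by (rule image_mono)
    then have "?C (h * p) = ?C h" using le finC[OF hR(1)] by (intro card_seteq)
    moreover have "h * 1 + 0 \<in> {h * r | r. r \<in> R} [+] red"
      using R_1 M_red[OF M_0] by (intro set_addI) blast+
    ultimately have "(+) h ` red \<in> ?C (h * p)" using cosetsI[of h _ red] by simp
    then obtain x where x: "x \<in> {h * p * r | r. r \<in> R} [+] red" "(+) h ` red = (+) x ` red" by (auto simp: cosets_def)
    then have "h - x \<in> red" using coset_eq_iff[OF red_subgp] by blast
    moreover from x(1) obtain c i where c: "x = h * p * c + i" "c \<in> R" "i \<in> red" by (auto elim!: set_addE)
    ultimately have "h - h * p * c \<in> red" using subgp_add[OF red_subgp, of "h - x" i] by simp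
    then show ?thesis using c(2) by blast
  qed
  \<comment> \<open>As \<open>h = y * z\<close>, \<open>h * y \<in> red\<close> would imply
    \<open>h * h \<in> red\<close>, against reducedness.\<close>
  have "h * y \<notin> red"
  proof
    assume "h * y \<in> red"
    then have "z * (h * y) \<in> red" by (rule red_mult[OF z(1)])
    then have "h * h \<in> red" using z(2) by (simp add: mult_ac)
    then show False using red_reduced[OF hR(1)] hR(2) by blast
  qed
  moreover have "h * p * q \<notin> red" if p: "p \<in> R" "h * p \<notin> red" and q: "q \<in> R" "h * q \<notin> red" for p q
  proof
    assume pq: "h * p * q \<in> red"
    obtain c d where c: "c \<in> R" "h - h * p * c \<in> red" and d: "d \<in> R" "h - h * q * d \<in> red" using gen p q by metis
    have 1: "c * (d * (h * p * q)) \<in> red" using red_mult c d pq by blast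
    have 2: "(q * d) * (h - h * p * c) \<in> red" using red_mult[OF R_mult[OF q(1) d(1)] c(2)] .
    have "h = (h - h * q * d) + ((q * d) * (h - h * p * c) + c * (d * (h * p * q)))" by (simp add: algebra_simps)
    then have "h \<in> red" using subgp_add[OF red_subgp d(2) subgp_add[OF red_subgp 2 1]] by metis
    then show False using hR by blast
  qed
  ultimately show ?thesis using hR by blast
qed

context
  fixes h assumes h: "h \<in> R" "h \<notin> red"
    and prime: "\<And>p q. p \<in> R \<Longrightarrow> q \<in> R \<Longrightarrow> h * p \<notin> red \<Longrightarrow> h * q \<notin> red \<Longrightarrow> h * p * q \<notin> red"
begin

lemma h_power: "h ^ n \<notin> red"
proof -
  have "h * h ^ n \<notin> red" for n
  proof (induction n)
    case (Suc n)
    have "h * h \<notin> red" using red_reduced h by blast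
    then have "h * h ^ n * h \<notin> red" using prime[OF R_power[OF h(1)] h(1)] Suc by blast
    then show ?case by (simp add: mult_ac)
  qed (use h in simp)
  then show ?thesis using one_not_red by (cases n) auto
qed

text \<open>Non-vanishing in the localization of \<open>R / red\<close> at \<open>h\<close>, which
  is a non-zero domain by \<open>h_power\<close> and \<open>prime\<close>.\<close>

definition stable :: "'k poly \<Rightarrow> bool" where
  "stable r \<longleftrightarrow> r \<in> R \<and> (\<forall>j. h ^ j * r \<notin> red)"

lemma stable_mult: assumes "stable r" "stable s" shows "stable (r * s)"
  unfolding stable_def
proof (intro conjI allI)
  have rs: "r \<in> R" "s \<in> R" using assms by (auto simp: stable_def)
  then show "r * s \<in> R" by (rule R_mult)
  fix j
  show "h ^ j * (r * s) \<notin> red"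
  proof
    assume "h ^ j * (r * s) \<in> red"
    from red_mult[OF h(1) this] have "h * (h ^ j * r) * s \<in> red" by (simp add: mult_ac)
    moreover have "h * (h ^ j * r) \<notin> red" "h * s \<notin> red"
      using assms unfolding stable_def by (metis power_Suc mult.assoc) (metis assms(2) power_one_right stable_def)
    ultimately show False using prime[OF R_mult[OF R_power[OF h(1)] rs(1)] rs(2)] by blast
  qed
qed

lemma stable_power_mult: "stable r \<Longrightarrow> stable (h ^ j * r)"
  using R_mult R_power h(1) unfolding stable_def by (metis mult.assoc power_add)

lemma stable_const: assumes "a c = 1" shows "stable [:c:]"
  unfolding stable_def
proof (intro conjI allI)
  show "[:c:] \<in> R" using assms vpolys_const[OF a_val] by simp
  fix j
  have c: "c \<noteq> 0" using assms a_0[OF a_val] by auto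
  have "a (inverse c) = 1" using K.val_mult[OF a_val, of c "inverse c"] c assms K.val_one[OF a_val] by simp
  then have ic: "[:inverse c:] \<in> R" using vpolys_const[OF a_val] by simp
  have "[:inverse c:] * (h ^ j * [:c:]) = h ^ j" using c by (simp add: mult_ac)
  then show "h ^ j * [:c:] \<notin> red" using red_mult[OF ic, of "h ^ j * [:c:]"] h_power[of j] by metis
qed

text \<open>\<open>N\<close> is the order of \<open>y\<close> at the place belonging to
  \<open>h\<close>: there \<open>unif\<close> is a uniformizer, and both \<open>h\<close> and the
  stable polynomials are units.\<close>

definition lev :: "'k poly \<Rightarrow> int \<Rightarrow> bool" where
  "lev y N \<longleftrightarrow> (\<exists>m r. stable r \<and> f dvd h ^ m * y - Polynomial.smult (unif powi N) r)"

lemma h_lat: "x \<in> lat N \<Longrightarrow> h ^ j * x \<in> lat N"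
  using lat_mult[OF R_lat[OF R_power[OF h(1)]], of x N j] by simp

lemma lev_upper: assumes "lev y N" shows "h ^ j * y \<notin> lat (N + 1)"
proof
  assume y: "h ^ j * y \<in> lat (N + 1)"
  obtain m r where r: "stable r" "f dvd h ^ m * y - Polynomial.smult (unif powi N) r" using assms by (auto simp: lev_def)
  have "f dvd h ^ j * (h ^ m * y - Polynomial.smult (unif powi N) r)" using r(2) by (rule dvd_mult)
  moreover have "h ^ j * (h ^ m * y - Polynomial.smult (unif powi N) r) =
      h ^ m * (h ^ j * y) - Polynomial.smult (unif powi N) (h ^ j * r)" by (simp add: algebra_simps)
  ultimately have "Polynomial.smult (unif powi N) (h ^ j * r) \<in> lat (N + 1)" using lat_cong[OF _ h_lat[OF y]] by metis
  then have "h ^ j * r \<in> red" using lat_red stable_power_mult[OF r(1), of j] by (auto simp: stable_def)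
  then show False using r(1) by (auto simp: stable_def)
qed

lemma lev_lower: assumes "lev y N" shows "\<exists>m. h ^ m * y \<in> lat N"
  using assms by (auto simp: lev_def lat_def stable_def)

lemma lev_iff: assumes "lev y N" shows "(\<exists>m. h ^ m * y \<in> lat N') \<longleftrightarrow> N' \<le> N"
proof
  assume "\<exists>m. h ^ m * y \<in> lat N'"
  then obtain m where m: "h ^ m * y \<in> lat N'" by blast
  show "N' \<le> N"
  proof (rule ccontr)
    assume "\<not> N' \<le> N"
    then have "h ^ m * y \<in> lat (N + 1)" using lat_mono[OF _ m] by simp
    then show False using lev_upper[OF assms] by blast
  qed
qed (use lev_lower[OF assms] lat_mono in blast)

lemma lev_unique: "lev y N \<Longrightarrow> lev y N' \<Longrightarrow> N = N'"
  using lev_iff by (metis order.antisym order.refl)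

lemma lev_cong: assumes "f dvd x" shows "lev (x + y) N \<longleftrightarrow> lev y N"
proof -
  have "f dvd h ^ m * (x + y) - z \<longleftrightarrow> f dvd h ^ m * y - z" for m z
    using dvd_add_right_iff[of f "h ^ m * x" "h ^ m * y - z"] assms by (simp add: algebra_simps)
  then show ?thesis unfolding lev_def by simp
qed

lemma lev_mult: assumes "lev y N" "lev y' N'" shows "lev (y * y') (N + N')"
proof -
  obtain m r m' r' where *: "stable r" "f dvd h ^ m * y - Polynomial.smult (unif powi N) r"
    "stable r'" "f dvd h ^ m' * y' - Polynomial.smult (unif powi N') r'" using assms by (auto simp: lev_def)
  have "f dvd (h ^ m * y) * (h ^ m' * y') - Polynomial.smult (unif powi N) r * Polynomial.smult (unif powi N') r'"
    by (rule dvd_diff_mult[OF *(2,4)])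
  then have "f dvd h ^ (m + m') * (y * y') - Polynomial.smult (unif powi (N + N')) (r * r')"
    using unif(4) by (simp add: power_add power_int_add mult_ac)
  then show ?thesis unfolding lev_def using stable_mult[OF *(1,3)] by blast
qed

text \<open>The lattices reached by \<open>h ^ m * y\<close> are bounded, because an inverse of
  \<open>y\<close> modulo \<open>f\<close> lies in some lattice and powers of \<open>h\<close> stay
  outside \<open>red\<close>. At the last lattice reached no power of \<open>h\<close> moves the
  cofactor into \<open>red\<close>, so it is stable.\<close>

lemma lev_exists: assumes "\<not> f dvd y" shows "\<exists>N. lev y N"
proof -
  let ?S = "{N. \<exists>m. h ^ m * y \<in> lat N}"
  obtain y' where y': "f dvd y * y' - 1" using Z.Z_inv[of y] assms by auto
  obtain N' where N': "y' \<in> lat N'" using lat_exists by blast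
  have bound: "N \<le> - N'" if "N \<in> ?S" for N
  proof (rule ccontr)
    assume "\<not> N \<le> - N'"
    from that obtain m where "h ^ m * y \<in> lat N" by blast
    from lat_mult[OF this N'] have "h ^ m * y * y' \<in> lat (0 + 1)"
      using lat_mono[of "0 + 1" "N + N'"] \<open>\<not> N \<le> - N'\<close> by simp
    moreover have "f dvd h ^ m * y * y' - h ^ m"
    proof -
      have "h ^ m * y * y' - h ^ m = h ^ m * (y * y' - 1)" by (simp add: algebra_simps)
      then show ?thesis using y' by simp
    qed
    ultimately have "Polynomial.smult (unif powi 0) (h ^ m) \<in> lat (0 + 1)" using lat_cong by fastforce
    then have "h ^ m \<in> red" by (rule lat_red[OF R_power[OF h(1)]])
    then show False using h_power by blast
  qed
  obtain N0 where N0: "y \<in> lat N0" using lat_exists by blast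
  then have "N0 \<in> ?S" by (auto intro!: exI[of _ 0])
  have "\<exists>N\<in>?S. N + 1 \<notin> ?S"
  proof (rule ccontr)
    assume *: "\<not> ?thesis"
    have "N0 + int n \<in> ?S" for n
    proof (induction n)
      case (Suc n)
      then have "N0 + int n + 1 \<in> ?S" using * by blast
      then show ?case by (simp add: algebra_simps)
    qed (use \<open>N0 \<in> ?S\<close> in simp)
    from bound[OF this[of "nat (- N' - N0 + 1)"]] show False by linarith
  qed
  then obtain N m where N: "h ^ m * y \<in> lat N" "N + 1 \<notin> ?S" by blast
  then obtain r where r: "r \<in> R" "f dvd h ^ m * y - Polynomial.smult (unif powi N) r" by (auto simp: lat_def)
  have "h ^ j * r \<notin> red" for j
  proof
    assume "h ^ j * r \<in> red"
    then have 1: "Polynomial.smult (unif powi N) (h ^ j * r) \<in> lat (N + 1)" by (rule red_lat)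
    have "f dvd h ^ j * (h ^ m * y - Polynomial.smult (unif powi N) r)" using r(2) by (rule dvd_mult)
    moreover have "h ^ j * (h ^ m * y - Polynomial.smult (unif powi N) r) =
        h ^ (j + m) * y - Polynomial.smult (unif powi N) (h ^ j * r)" by (simp add: algebra_simps power_add)
    ultimately have "f dvd Polynomial.smult (unif powi N) (h ^ j * r) - h ^ (j + m) * y" by (simp add: dvd_diff_commute)
    from lat_cong[OF this 1] show False using N(2) by blast
  qed
  then have "stable r" using r by (simp add: stable_def)
  then show ?thesis using r(2) by (auto simp: lev_def)
qed

definition level :: "'k poly \<Rightarrow> int" where "level y = (THE N. lev y N)"

lemma level: "\<not> f dvd y \<Longrightarrow> lev y (level y)"
  unfolding level_def using lev_exists lev_unique by (metis (full_types) theI)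

lemma level_eq: "\<not> f dvd y \<Longrightarrow> lev y N \<Longrightarrow> level y = N"
  using level lev_unique by blast

definition ext_val :: "'k poly \<Rightarrow> real" where
  "ext_val y = (if f dvd y then 0 else a unif powi level y)"

lemma ext_val_const: "ext_val [:c:] = a c"
proof (cases "c = 0")
  case False
  then obtain k where k: "a c = a unif powi k" using unif(3) by blast
  define e where "e = c * unif powi (- k)"
  have "a e = 1" using k unif(1) by (simp add: e_def K.val_mult[OF a_val] a_inverse a_powi power_int_minus)
  have "c = unif powi k * e" using unif(4) by (simp add: e_def power_int_minus)
  then have "h ^ 0 * [:c:] - Polynomial.smult (unif powi k) [:e:] = 0" by simp
  then have lev: "lev [:c:] k" unfolding lev_def using stable_const[OF \<open>a e = 1\<close>] by (metis dvd_0_right)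
  have "\<not> f dvd [:c:]"
  proof
    assume "f dvd [:c:]"
    then have "f dvd 1" using False by (metis dvd_trans is_unit_triv)
    then show False using f_irr by (simp add: Factorial_Ring.irreducible_def)
  qed
  then show ?thesis using level_eq[OF _ lev] k by (simp add: ext_val_def)
qed (simp add: ext_val_def a_0[OF a_val])

lemma dvd_mult_iff: "f dvd x * y \<longleftrightarrow> f dvd x \<or> f dvd y"
proof
  assume *: "f dvd x * y"
  show "f dvd x \<or> f dvd y"
  proof (rule ccontr)
    assume **: "\<not> ?thesis"
    then obtain u w where "u * f + w * x = 1" using bezout_irreducible[OF f_irr] by blast
    then have "y = (u * y) * f + w * (x * y)" by (metis (no_types, opaque_lifting) mult.assoc mult.commute distrib_right mult_1)
    then have "f dvd y" using * by (metis dvd_add dvd_mult dvd_triv_right)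
    with ** show False by blast
  qed
qed auto

lemma val_ext_val: "val {p. f dvd p} ext_val"
  unfolding val_def
proof (intro conjI allI)
  fix x y :: "'k poly"
  show "0 \<le> ext_val x" using unif(1) by (simp add: ext_val_def)
  show "ext_val x = 0 \<longleftrightarrow> x \<in> {p. f dvd p}" using unif(1) by (simp add: ext_val_def)
  show "ext_val (x * y) = ext_val x * ext_val y"
  proof (cases "f dvd x \<or> f dvd y")
    case False
    then have xy: "\<not> f dvd x" "\<not> f dvd y" "\<not> f dvd x * y" using dvd_mult_iff by auto
    have "level (x * y) = level x + level y" by (rule level_eq[OF xy(3) lev_mult[OF level[OF xy(1)] level[OF xy(2)]]])
    then show ?thesis using xy unif(1) by (simp add: ext_val_def power_int_add)
  qed (auto simp: ext_val_def)
  show "ext_val (x + y) \<le> max (ext_val x) (ext_val y)"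
  proof (cases "f dvd x \<or> f dvd y \<or> f dvd x + y")
    case True
    then consider "f dvd x + y" | "f dvd x" "\<not> f dvd y" | "f dvd y" "\<not> f dvd x" by (metis dvd_add)
    then show ?thesis
    proof cases
      case 1
      then show ?thesis using unif(1) by (simp add: ext_val_def le_max_iff_disj)
    next
      case 2
      have "lev (x + y) N \<longleftrightarrow> lev y N" for N by (rule lev_cong[OF 2(1)])
      then have "level (x + y) = level y" by (simp add: level_def)
      moreover have "f dvd x + y \<longleftrightarrow> f dvd y" using 2 by (simp add: dvd_add_right_iff)
      ultimately show ?thesis by (simp add: ext_val_def)
    next
      case 3
      have "lev (x + y) N \<longleftrightarrow> lev x N" for N using lev_cong[OF 3(1)] by (simp add: add.commute)
      then have "level (x + y) = level x" by (simp add: level_def)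
      moreover have "f dvd x + y \<longleftrightarrow> f dvd x" using 3 by (simp add: dvd_add_left_iff)
      ultimately show ?thesis by (simp add: ext_val_def)
    qed
  next
    case False
    then have nd: "\<not> f dvd x" "\<not> f dvd y" "\<not> f dvd x + y" by auto
    define N where "N = min (level x) (level y)"
    obtain m where m: "h ^ m * x \<in> lat N" using lev_iff[OF level[OF nd(1)], of N] by (auto simp: N_def)
    obtain m' where m': "h ^ m' * y \<in> lat N" using lev_iff[OF level[OF nd(2)], of N] by (auto simp: N_def)
    have "h ^ m' * (h ^ m * x) + h ^ m * (h ^ m' * y) \<in> lat N" by (intro lat_add h_lat m m')
    then have "h ^ (m + m') * (x + y) \<in> lat N" by (simp add: algebra_simps power_add)
    then have "N \<le> level (x + y)" using lev_iff[OF level[OF nd(3)]] by blast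
    then have "a unif powi level (x + y) \<le> a unif powi N" using unif by (intro power_int_decreasing) auto
    also have "\<dots> = max (ext_val x) (ext_val y)"
      using nd unif power_int_decreasing[of "level x" "level y" "a unif"] power_int_decreasing[of "level y" "level x" "a unif"]
      by (auto simp: N_def ext_val_def min_def max_def)
    finally show ?thesis using nd by (simp add: ext_val_def)
  qed
next
  have "ext_val [:unif:] \<noteq> 1" "ext_val [:unif:] \<noteq> 0" unfolding ext_val_const using unif by auto
  then show "\<exists>x. x \<notin> {p. f dvd p} \<and> ext_val x \<noteq> 1" by (intro exI[of _ "[:unif:]"]) (auto simp: ext_val_def)
qed

lemma ext_val_1: assumes "y \<in> R" "h * y \<notin> red" shows "ext_val y = 1"
proof -
  have "stable y" unfolding stable_def
  proof (intro conjI allI)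
    fix j
    show "h ^ j * y \<notin> red"
    proof
      assume "h ^ j * y \<in> red"
      then have "h * h ^ j * y \<in> red" using red_mult[OF h(1)] by (simp add: mult.assoc)
      then show False using prime[OF R_power[OF h(1)] assms(1), of j] h_power[of "Suc j"] assms(2) by simp
    qed
  qed fact
  moreover have "h ^ 0 * y - Polynomial.smult (unif powi 0) y = 0" by simp
  ultimately have lev: "lev y 0" unfolding lev_def by (metis dvd_0_right)
  have "\<not> f dvd y"
  proof
    assume "f dvd y"
    then obtain q where "q \<in> R" "y = q * f" using vpolys_dvd[OF a_val f_int f_monic assms(1)] by blast
    then have "y \<in> red" using f_red by simp
    then show False using red_mult[OF h(1)] assms(2) by blast
  qed
  then show ?thesis using level_eq[OF _ lev] by (simp add: ext_val_def)
qed

end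

text \<open>If \<open>x\<close> is not congruent to an element of \<open>R\<close>, it is congruent
  to \<open>unif\<close> to a negative power \<open>N\<close> times some \<open>y\<close> outside
  \<open>red\<close>. The construction from \<open>prime_annihilator\<close> extends
  \<open>a\<close> with value 1 at \<open>y\<close>, and this extension exceeds 1 at
  \<open>x\<close>.\<close>

lemma integrally_closed:
  assumes "\<And>b. val {p. f dvd p} b \<Longrightarrow> (\<And>c. b [:c:] = a c) \<Longrightarrow> b x \<le> 1"
  shows "\<exists>y\<in>R. f dvd x - y"
proof (rule ccontr)
  assume "\<not> ?thesis"
  then have x0: "x \<notin> lat 0" by (auto simp: lat_def)
  obtain N0 where N0: "x \<in> lat N0" using lat_exists by blast
  have "\<exists>N. x \<in> lat N \<and> x \<notin> lat (N + 1)"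
  proof (rule ccontr)
    assume *: "\<not> ?thesis"
    have "x \<in> lat (N0 + int n)" for n
    proof (induction n)
      case (Suc n)
      then have "x \<in> lat (N0 + int n + 1)" using * by blast
      then show ?case by (simp add: algebra_simps)
    qed (use N0 in simp)
    moreover have "0 \<le> N0 + int (nat (- N0))" by simp
    ultimately show False using lat_mono x0 by blast
  qed
  then obtain N where N: "x \<in> lat N" "x \<notin> lat (N + 1)" by blast
  have "N < 0" using N(1) x0 lat_mono[of 0 N x] by (meson not_less)
  obtain y where y: "y \<in> R" "f dvd x - Polynomial.smult (unif powi N) y" using N(1) by (auto simp: lat_def)
  have "y \<notin> red"
  proof
    assume "y \<in> red"
    then have "Polynomial.smult (unif powi N) y \<in> lat (N + 1)" by (rule red_lat)
    then show False using lat_cong[of "Polynomial.smult (unif powi N) y" x] y(2) N(2) by (simp add: dvd_diff_commute)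
  qed
  then obtain h where h: "h \<in> R" "h \<notin> red" "h * y \<notin> red"
      "\<And>p q. p \<in> R \<Longrightarrow> q \<in> R \<Longrightarrow> h * p \<notin> red \<Longrightarrow> h * q \<notin> red \<Longrightarrow> h * p * q \<notin> red"
    using prime_annihilator[OF y(1)] by blast
  define b where "b = ext_val h"
  note b = val_ext_val[OF h(1,2,4), folded b_def] and bc = ext_val_const[OF h(1,2,4), folded b_def]
    and by1 = ext_val_1[OF h(1,2,4) y(1) h(3), folded b_def]
  have "b x = b (Polynomial.smult (unif powi N) y)" using Z.val_cong[OF b] y(2) by simp
  also have "\<dots> = a unif powi N" using Z.val_mult[OF b, of "[:unif powi N:]" y] bc[of "unif powi N"] by1 a_powi[of N] by simp
  also have "\<dots> > a unif powi 0" using \<open>N < 0\<close> unif by (intro power_int_strict_decreasing) auto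
  finally show False using assms[OF b bc] by simp
qed

end

section \<open>Places\<close>

definition place_rel :: "('a, 'b) ring_scheme \<Rightarrow> (('a \<Rightarrow> real) \<times> ('a \<Rightarrow> real)) set" where
  "place_rel F = {(a, b). nonarch_abs F a \<and> nonarch_abs F b \<and> (\<exists>t>0. \<forall>x\<in>carrier F. b x = a x powr t)}"

lemma equiv_place_rel:
  fixes F :: "('a, 'b) ring_scheme" shows "equiv {a. nonarch_abs F a} (place_rel F)"
  unfolding place_rel_def
proof -
  let ?A = "{a. nonarch_abs F a}"
  let ?r = "{(a, b). nonarch_abs F a \<and> nonarch_abs F b \<and> (\<exists>t>0. \<forall>x\<in>carrier F. b x = a x powr t)}"
  have nn: "0 \<le> a x" if "nonarch_abs F a" "x \<in> carrier F" for a x using that by (simp add: nonarch_abs_def)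
  show "equiv ?A ?r"
  proof (rule equivI)
    show "?r \<subseteq> ?A \<times> ?A" by auto
    show "refl_on ?A ?r" unfolding refl_on_def using nn by (auto intro!: exI[of _ "1::real"])
    have "\<exists>t>0. \<forall>x\<in>carrier F. a x = b x powr t"
      if a: "nonarch_abs F a" and ex: "\<exists>t>0. \<forall>x\<in>carrier F. b x = a x powr t" for a b :: "'a \<Rightarrow> real"
    proof -
      from ex obtain t where t: "t > 0" "\<forall>x\<in>carrier F. b x = a x powr t" by blast
      then have "\<forall>x\<in>carrier F. a x = b x powr (1 / t)" using nn[OF a] by (simp add: powr_powr)
      then show ?thesis using t(1) by (intro exI[of _ "1 / t"]) simp
    qed
    then show "sym ?r" unfolding sym_def by blast
    have "\<exists>t>0. \<forall>x\<in>carrier F. c x = a x powr t"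
      if exs: "\<exists>t>0. \<forall>x\<in>carrier F. b x = a x powr t" "\<exists>t>0. \<forall>x\<in>carrier F. c x = b x powr t" for a b c :: "'a \<Rightarrow> real"
    proof -
      from exs obtain t u where t: "t > 0" "\<forall>x\<in>carrier F. b x = a x powr t" "u > 0" "\<forall>x\<in>carrier F. c x = b x powr u"
        by blast
      then have "\<forall>x\<in>carrier F. c x = a x powr (t * u)" by (simp add: powr_powr)
      then show ?thesis using t(1,3) by (intro exI[of _ "t * u"]) simp
    qed
    then show "trans ?r" unfolding trans_def by blast
  qed
qed

lemma nonarch_places_quotient: "nonarch_places F = {a. nonarch_abs F a} // place_rel F"
  by (simp add: nonarch_places_def place_rel_def)

lemma nonarch_places:
  assumes v: "v \<in> nonarch_places F"
  shows "\<exists>a. a \<in> v"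
    "a \<in> v \<Longrightarrow> nonarch_abs F a"
    "a \<in> v \<Longrightarrow> b \<in> v \<Longrightarrow> \<exists>t>0. \<forall>x\<in>carrier F. b x = a x powr t"
    "a \<in> v \<Longrightarrow> nonarch_abs F b \<Longrightarrow> t > 0 \<Longrightarrow> (\<And>x. x \<in> carrier F \<Longrightarrow> b x = a x powr t) \<Longrightarrow> b \<in> v"
    "v' \<in> nonarch_places F \<Longrightarrow> a \<in> v \<Longrightarrow> a \<in> v' \<Longrightarrow> v = v'"
proof -
  note eq = equiv_place_rel[of F]
  have v': "v \<in> {a. nonarch_abs F a} // place_rel F" using v by (simp add: nonarch_places_quotient)
  show "\<exists>a. a \<in> v" using in_quotient_imp_non_empty[OF eq v'] by blast
  have abs: "nonarch_abs F a" if "a \<in> v" for a using in_quotient_imp_subset[OF eq v'] that by blast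
  then show "nonarch_abs F a" if "a \<in> v" for a using that .
  show "\<exists>t>0. \<forall>x\<in>carrier F. b x = a x powr t" if "a \<in> v" "b \<in> v" for a b
    using in_quotient_imp_in_rel[OF eq v', of a b] that by (simp add: place_rel_def)
  show "b \<in> v" if "a \<in> v" "nonarch_abs F b" "t > 0" "\<And>x. x \<in> carrier F \<Longrightarrow> b x = a x powr t" for a b t
  proof (rule in_quotient_imp_closed[OF eq v' that(1)])
    show "(a, b) \<in> place_rel F" using abs[OF that(1)] that(2-4) unfolding place_rel_def by blast
  qed
  show "v = v'" if "v' \<in> nonarch_places F" "a \<in> v" "a \<in> v'" for v' a
    using quotient_disj[OF eq v', of v'] that unfolding nonarch_places_quotient by blast
qed

lemma nonarch_places_exists:
  assumes "nonarch_abs F c" shows "\<exists>v\<in>nonarch_places F. c \<in> v"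
  using assms equiv_class_self[OF equiv_place_rel, of c] quotientI[of c "{a. nonarch_abs F a}" "place_rel F"]
  unfolding nonarch_places_quotient by blast

lemma place_abs_in: "v \<in> nonarch_places F \<Longrightarrow> place_abs v \<in> v"
  unfolding place_abs_def using nonarch_places(1) by (metis someI_ex)

lemma field_ring_simps:
  "carrier (ring_of_type_algebra :: 'k::field ring) = UNIV"
  "x \<otimes>\<^bsub>(ring_of_type_algebra :: 'k ring)\<^esub> y = x * y"
  "x \<oplus>\<^bsub>(ring_of_type_algebra :: 'k ring)\<^esub> y = x + y"
  "\<zero>\<^bsub>(ring_of_type_algebra :: 'k ring)\<^esub> = 0"
  "\<one>\<^bsub>(ring_of_type_algebra :: 'k ring)\<^esub> = 1"
  by (simp_all add: ring_of_type_algebra_def)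

lemma nonarch_abs_field: "nonarch_abs (ring_of_type_algebra :: 'k::field_char_0 ring) a \<longleftrightarrow> val {0} a"
  unfolding nonarch_abs_def val_def by (auto simp: field_ring_simps)

definition cls :: "'k::field_char_0 poly \<Rightarrow> 'k poly \<Rightarrow> 'k poly set" where
  "cls f p = PIdl\<^bsub>ring_of_type_algebra\<^esub> f +>\<^bsub>ring_of_type_algebra\<^esub> p"

context
  fixes f :: "'k::field_char_0 poly"
begin

interpretation P: cring "ring_of_type_algebra :: 'k poly ring" by (rule cring_from_type_algebra)

lemma poly_ring_simps:
  "carrier (ring_of_type_algebra :: 'k poly ring) = UNIV"
  "p \<otimes>\<^bsub>(ring_of_type_algebra :: 'k poly ring)\<^esub> q = p * q"
  "p \<oplus>\<^bsub>(ring_of_type_algebra :: 'k poly ring)\<^esub> q = p + q"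
  "\<zero>\<^bsub>(ring_of_type_algebra :: 'k poly ring)\<^esub> = 0"
  "\<one>\<^bsub>(ring_of_type_algebra :: 'k poly ring)\<^esub> = 1"
  by (simp_all add: ring_of_type_algebra_def)

lemma PIdl_eq: "PIdl\<^bsub>(ring_of_type_algebra :: 'k poly ring)\<^esub> f = {p. f dvd p}"
  unfolding cgenideal_def by (auto simp: poly_ring_simps dvd_def mult.commute)

lemma cls_eq: "cls f p = {q. f dvd q - p}"
proof -
  have "cls f p = (\<lambda>h. h + p) ` {q. f dvd q}"
    unfolding cls_def PIdl_eq a_r_coset_def' by (auto simp: poly_ring_simps)
  also have "\<dots> = {q. f dvd q - p}"
  proof (intro subset_antisym subsetI)
    show "q \<in> (\<lambda>h. h + p) ` {q. f dvd q}" if "q \<in> {q. f dvd q - p}" for q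
      by (rule image_eqI[of _ _ "q - p"]) (use that in auto)
  qed auto
  finally show ?thesis .
qed

lemma cls_eq_iff: "cls f p = cls f q \<longleftrightarrow> f dvd p - q"
proof
  assume "cls f p = cls f q"
  moreover have "p \<in> cls f p" by (simp add: cls_eq)
  ultimately show "f dvd p - q" by (simp add: cls_eq)
next
  assume *: "f dvd p - q"
  have "f dvd r - p \<longleftrightarrow> f dvd r - q" for r
    using dvd_add_left_iff[OF *, of "r - p"] by simp
  then show "cls f p = cls f q" by (simp add: cls_eq)
qed

lemma PIdl_ideal: "ideal (PIdl\<^bsub>(ring_of_type_algebra :: 'k poly ring)\<^esub> f) (ring_of_type_algebra :: 'k poly ring)"
  by (rule P.cgenideal_ideal) (simp add: poly_ring_simps)

lemma root_field_simps:
  "carrier (root_field f) = range (cls f)"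
  "cls f p \<otimes>\<^bsub>root_field f\<^esub> cls f q = cls f (p * q)"
  "cls f p \<oplus>\<^bsub>root_field f\<^esub> cls f q = cls f (p + q)"
  "\<zero>\<^bsub>root_field f\<^esub> = cls f 0"
  "\<one>\<^bsub>root_field f\<^esub> = cls f 1"
proof -
  interpret I: ideal "PIdl\<^bsub>(ring_of_type_algebra :: 'k poly ring)\<^esub> f" "ring_of_type_algebra :: 'k poly ring"
    by (rule PIdl_ideal)
  show "carrier (root_field f) = range (cls f)"
    by (auto simp: root_field_def FactRing_def A_RCOSETS_def' cls_def poly_ring_simps)
  show "cls f p \<otimes>\<^bsub>root_field f\<^esub> cls f q = cls f (p * q)"
    using I.rcoset_mult_add[of p q] by (simp add: root_field_def FactRing_def cls_def poly_ring_simps)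
  show "cls f p \<oplus>\<^bsub>root_field f\<^esub> cls f q = cls f (p + q)"
    using I.a_rcos_sum[of p q] by (simp add: root_field_def FactRing_def cls_def poly_ring_simps)
  show "\<zero>\<^bsub>root_field f\<^esub> = cls f 0"
    unfolding cls_eq by (simp add: root_field_def FactRing_def PIdl_eq)
  show "\<one>\<^bsub>root_field f\<^esub> = cls f 1"
    by (simp add: root_field_def FactRing_def cls_def poly_ring_simps)
qed

lemma root_field_emb_eq: "root_field_emb f c = cls f [:c:]"
  by (simp add: root_field_emb_def cls_def)

lemma nonarch_abs_root_field: "nonarch_abs (root_field f) b \<longleftrightarrow> val {p. f dvd p} (\<lambda>p. b (cls f p))"
  unfolding nonarch_abs_def val_def root_field_simps(1,4) by (auto simp: root_field_simps(2,3) cls_eq_iff)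

lemma root_field_field: assumes "Factorial_Ring.irreducible f" shows "field (root_field f)"
proof -
  interpret I: ideal "PIdl\<^bsub>(ring_of_type_algebra :: 'k poly ring)\<^esub> f" "ring_of_type_algebra :: 'k poly ring"
    by (rule PIdl_ideal)
  interpret M: max_ideal "{p. f dvd p}" by (rule max_ideal_irreducible[OF assms])
  have "cring (root_field f)" unfolding root_field_def by (rule I.quotient_is_cring[OF P.is_cring])
  then interpret R: cring "root_field f" .
  show ?thesis
  proof (rule R.cring_fieldI2)
    show "\<zero>\<^bsub>root_field f\<^esub> \<noteq> \<one>\<^bsub>root_field f\<^esub>"
      using M.one_Z by (simp add: root_field_simps cls_eq_iff)
    fix x assume "x \<in> carrier (root_field f)" "x \<noteq> \<zero>\<^bsub>root_field f\<^esub>"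
    then obtain p where p: "x = cls f p" "cls f p \<noteq> cls f 0" by (auto simp only: root_field_simps image_iff)
    have "\<not> f dvd p" using p(2) cls_eq_iff[of p 0] by simp
    then have "f dvd p * M.vinv p - 1" using M.vinv[of p] by simp
    then have "x \<otimes>\<^bsub>root_field f\<^esub> cls f (M.vinv p) = \<one>\<^bsub>root_field f\<^esub>"
      by (simp add: p(1) root_field_simps cls_eq_iff)
    then show "\<exists>b\<in>carrier (root_field f). x \<otimes>\<^bsub>root_field f\<^esub> b = \<one>\<^bsub>root_field f\<^esub>"
      by (auto simp: root_field_simps(1))
  qed
qed

end

section \<open>Degrees of number fields and of root fields\<close>

lemma (in vector_space) dependent_family:
  fixes y :: "nat \<Rightarrow> 'b"
  assumes "finite T" "\<And>i. i \<le> card T \<Longrightarrow> y i \<in> span T"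
  shows "\<exists>c. (\<exists>i\<le>card T. c i \<noteq> 0) \<and> (\<Sum>i\<le>card T. scale (c i) (y i)) = 0"
proof (cases "inj_on y {..card T}")
  case True
  let ?S = "y ` {..card T}"
  have "?S \<subseteq> span T" using assms(2) by auto
  then have "dependent ?S"
    using independent_span_bound[OF assms(1), of ?S] card_image[OF True] by auto
  then obtain u v where u: "v \<in> ?S" "u v \<noteq> 0" "(\<Sum>v\<in>?S. scale (u v) v) = 0"
    unfolding dependent_finite[OF finite_imageI[OF finite_atMost]] by blast
  have "(\<Sum>i\<le>card T. scale (u (y i)) (y i)) = 0" using u(3) by (simp add: sum.reindex[OF True])
  then show ?thesis using u(1,2) by (intro exI[of _ "\<lambda>i. u (y i)"]) auto
next
  case False
  then obtain i j where ij: "i \<le> card T" "j \<le> card T" "y i = y j" "i \<noteq> j" by (auto simp: inj_on_def)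
  \<comment> \<open>Two equal members satisfy the relation with coefficients 1 and -1.\<close>
  let ?c = "\<lambda>l. if l = i then 1 else if l = j then -1 else 0"
  have "(\<Sum>l\<le>card T. scale (?c l) (y l)) = (\<Sum>l\<in>{i, j}. scale (?c l) (y l))"
    using ij by (intro sum.mono_neutral_right) auto
  also have "\<dots> = 0" using ij by simp
  finally show ?thesis using ij(1) by (intro exI[of _ ?c]) auto
qed

lemma finite_extension_rat:
  assumes "is_number_field TYPE('k::field_char_0)"
  shows "\<exists>D. finite_extension {0::'k} of_rat D"
proof -
  obtain B :: "'k set" where B: "finite_dimensional_vector_space (\<lambda>(q::rat) x. of_rat q * x) B"
    using assms by (auto simp: is_number_field_def)
  interpret V: finite_dimensional_vector_space "\<lambda>(q::rat) (x::'k). of_rat q * x" B by fact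
  interpret M: max_ideal "{0::'k}" by (rule max_ideal_zero)
  have "finite_extension {0::'k} of_rat (card B)"
  proof
    fix u :: "nat \<Rightarrow> 'k"
    show "\<exists>c. (\<exists>i\<le>card B. c i \<noteq> 0) \<and> (\<Sum>i\<le>card B. of_rat (c i) * u i) \<in> {0}"
      using V.dependent_family[OF V.finite_Basis, of u] V.span_Basis by auto
  qed (auto simp: of_rat_add of_rat_mult)
  then show ?thesis by blast
qed

text \<open>Remainders modulo \<open>f\<close> lie in the span of the monomials of degree less than
  that of \<open>f\<close>.\<close>

lemma finite_extension_poly:
  fixes f :: "'k::field_char_0 poly"
  assumes f: "Factorial_Ring.irreducible f"
  shows "finite_extension {p. f dvd p} (\<lambda>c. [:c:]) (Polynomial.degree f)"
proof -
  interpret M: max_ideal "{p. f dvd p}" by (rule max_ideal_irreducible[OF f])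
  interpret V: vector_space "Polynomial.smult :: 'k \<Rightarrow> 'k poly \<Rightarrow> 'k poly"
    by unfold_locales (auto simp: Polynomial.smult_add_right Polynomial.smult_add_left)
  let ?d = "Polynomial.degree f"
  define T where "T = (\<lambda>i. Polynomial.monom (1::'k) i) ` {..<?d}"
  have inj: "inj_on (\<lambda>i. Polynomial.monom (1::'k) i) {..<?d}" by (auto simp: inj_on_def monom_eq_iff')
  have cT: "card T = ?d" unfolding T_def using card_image[OF inj] by simp
  have f0: "f \<noteq> 0" using f by auto
  show ?thesis
  proof
    fix u :: "nat \<Rightarrow> 'k poly"
    have "u i mod f \<in> V.span T" for i
    proof -
      have "u i mod f = (\<Sum>j\<le>Polynomial.degree (u i mod f). Polynomial.smult (Polynomial.coeff (u i mod f) j) (Polynomial.monom 1 j))"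
        by (simp add: poly_as_sum_of_monoms Polynomial.smult_monom)
      also have "\<dots> \<in> V.span T"
      proof (intro V.span_sum V.span_scale)
        fix j assume j: "j \<in> {..Polynomial.degree (u i mod f)}"
        show "Polynomial.monom 1 j \<in> V.span T"
        proof (cases "?d = 0")
          case True
          then have "is_unit f" using f0 by (simp add: is_unit_iff_degree)
          then show ?thesis using f by (simp add: Factorial_Ring.irreducible_def)
        next
          case False
          then have "Polynomial.degree (u i mod f) < ?d" using degree_mod_less[OF f0, of "u i"] by auto
          then show ?thesis using j by (intro V.span_base) (auto simp: T_def)
        qed
      qed
      finally show ?thesis .
    qed
    then obtain c where c: "\<exists>i\<le>?d. c i \<noteq> 0" "(\<Sum>i\<le>?d. Polynomial.smult (c i) (u i mod f)) = 0"
      using V.dependent_family[of T "\<lambda>i. u i mod f"] cT by (auto simp: T_def)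
    have "(\<Sum>i\<le>?d. [:c i:] * u i) = (\<Sum>i\<le>?d. Polynomial.smult (c i) (u i - u i mod f))"
      using c(2) by (simp add: Polynomial.smult_diff_right sum_subtractf)
    also have "f dvd \<dots>" by (intro dvd_sum dvd_smult) (simp add: minus_mod_eq_mult_div)
    finally show "\<exists>c. (\<exists>i\<le>?d. c i \<noteq> 0) \<and> (\<Sum>i\<le>?d. [:c i:] * u i) \<in> {p. f dvd p}" using c(1) by blast
  qed auto
qed

definition upper_val :: "'k::field_char_0 poly \<Rightarrow> ('k poly set \<Rightarrow> real) set \<Rightarrow> 'k poly \<Rightarrow> real" where
  "upper_val f w p = place_abs w (cls f p)"

section \<open>Places of a number field and the places above them\<close>

context
  fixes D :: nat
  assumes ext: "finite_extension {0::'k::field_char_0} of_rat D"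
begin

interpretation E: finite_extension "{0::'k}" of_rat D by (rule ext)

lemma number_field_local_val: "val {0::'k} a \<Longrightarrow> local_val {0} a"
  using E.local_ext rat_local_val[OF E.val_base] by blast

abbreviation (input) "kplaces \<equiv> nonarch_places (field_ring TYPE('k))"

text \<open>The prime below such a place divides \<open>p\<close>, which leaves finitely many
  primes. Places over the same prime restrict to equivalent absolute values of the rationals by
  \<open>rat_veq\<close>, so there are at most \<open>D\<close> of them.\<close>

lemma finite_places_over_prime:
  assumes p: "p \<noteq> 0" shows "finite {v \<in> kplaces. place_abs v (of_int p) < 1}"
proof -
  let ?V = "{v \<in> kplaces. place_abs v (of_int p) < 1}"
  let ?q = "\<lambda>v. below_prime (\<lambda>c. place_abs v (of_rat c))"
  have val: "val {0} (place_abs v)" if "v \<in> kplaces" for v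
    using nonarch_places(2)[OF that place_abs_in[OF that]] nonarch_abs_field by blast
  have fin: "finite {v \<in> kplaces. ?q v = q}" (is "finite ?Vq") for q
  proof (cases "?Vq = {}")
    case False
    then obtain v0 where v0: "v0 \<in> ?Vq" by blast
    let ?a = "\<lambda>c. place_abs v0 (of_rat c)"
    have va: "val {0} ?a" using E.val_base[OF val] v0 by blast
    have inj: "v = v'" if "v \<in> kplaces" "v' \<in> kplaces" "veq (place_abs v) (place_abs v')" for v v'
    proof -
      obtain t where "t > 0" "\<And>x. place_abs v' x = place_abs v x powr t" using \<open>veq _ _\<close> by (auto simp: veq_def)
      then have "place_abs v' \<in> v"
        using nonarch_places(4)[OF that(1) place_abs_in[OF that(1)], of "place_abs v'"] nonarch_places(2)[OF that(2) place_abs_in[OF that(2)]] by blast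
      then show ?thesis using nonarch_places(5)[OF that(1,2)] place_abs_in[OF that(2)] by blast
    qed
    have "card U \<le> D" if U: "U \<subseteq> ?Vq" "finite U" for U
    proof -
      have iU: "inj_on place_abs U"
      proof (rule inj_onI)
        fix v v' assume *: "v \<in> U" "v' \<in> U" "place_abs v = place_abs v'"
        then show "v = v'" using inj[of v v'] U(1) veq_refl[OF val, of v'] by auto
      qed
      have "card (place_abs ` U) \<le> D"
      proof (rule E.card_extensions[OF _ _ _ va])
        show "finite (place_abs ` U)" using U(2) by simp
        show "discrete_val {0} b" if "b \<in> place_abs ` U" for b
          using that U(1) number_field_local_val[OF val] by (auto simp: local_val_def)
        show "veq ?a (\<lambda>c. b (of_rat c))" if "b \<in> place_abs ` U" for b
          using that U(1) v0 by (auto intro!: rat_veq[OF va] E.val_base val)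
        show "\<not> veq b b'" if "b \<in> place_abs ` U" "b' \<in> place_abs ` U" "b \<noteq> b'" for b b'
          using that U(1) inj by blast
      qed
      then show ?thesis using card_image[OF iU] by simp
    qed
    then show ?thesis using finite_if_finite_subsets_card_bdd[of ?Vq D] by blast
  next
    case True
    show ?thesis unfolding True by simp
  qed
  have "?V \<subseteq> (\<Union>q\<in>{q. int q dvd p}. {v \<in> kplaces. ?q v = q})"
  proof safe
    fix v assume v: "v \<in> kplaces" "place_abs v (of_int p) < 1"
    then have "place_abs v (of_rat (of_int p)) < 1" by simp
    then have "int (?q v) dvd p" using below_prime(4)[OF E.val_base[OF val[OF v(1)]], of p] by simp
    then show "v \<in> (\<Union>q\<in>{q. int q dvd p}. {v \<in> kplaces. ?q v = q})" using v(1) by blast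
  qed
  moreover have "finite {q. int q dvd p}"
  proof (rule finite_subset)
    show "{q. int q dvd p} \<subseteq> {..nat \<bar>p\<bar>}"
    proof
      fix q assume "q \<in> {q. int q dvd p}"
      then have "\<bar>int q\<bar> \<le> \<bar>p\<bar>" using dvd_imp_le_int[OF p, of "int q"] by simp
      then show "q \<in> {..nat \<bar>p\<bar>}" by (simp add: le_nat_iff)
    qed
  qed simp
  then have "finite (\<Union>q\<in>{q. int q dvd p}. {v \<in> kplaces. ?q v = q})" using fin by (rule finite_UN_I)
  ultimately show ?thesis by (rule finite_subset)
qed

text \<open>An element with \<open>\<bar>x\<bar> > 1\<close> at some place is a root of an integer polynomial whose leading
  coefficient lies in the maximal ideal of that place.\<close>

lemma finite_bad_places:
  fixes x :: 'k shows "finite {v \<in> kplaces. place_abs v x > 1}"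
proof -
  obtain c i0 where c: "i0 \<le> D" "c i0 \<noteq> 0" "(\<Sum>i\<le>D. of_rat (c i) * x ^ i) = 0" using E.dep[of "\<lambda>i. x ^ i"] by auto
  \<comment> \<open>A common denominator; it turns the relation into one with integer coefficients
    \<open>z i\<close>.\<close>
  define N where "N = (\<Prod>i\<le>D. snd (quotient_of (c i)))"
  have N0: "N > 0" unfolding N_def by (intro prod_pos) (auto intro: quotient_of_denom_pos')
  have "\<exists>z. of_int N * c i = of_int z" if "i \<le> D" for i
  proof -
    obtain p q where q: "quotient_of (c i) = (p, q)" by (cases "quotient_of (c i)")
    have "q dvd N" unfolding N_def using that q by (metis atMost_iff dvd_prodI finite_atMost snd_conv)
    then obtain k where "N = q * k" by blast
    then have "of_int N * c i = of_int (k * p)" using quotient_of_div[OF q] quotient_of_denom_pos[OF q] by simp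
    then show ?thesis by blast
  qed
  then obtain z where z: "\<And>i. i \<le> D \<Longrightarrow> of_int N * c i = of_int (z i)" by metis
  have zr: "(of_int (z i) :: 'k) = of_int N * of_rat (c i)" if "i \<le> D" for i
    using arg_cong[OF z[OF that], of "of_rat :: rat \<Rightarrow> 'k"] by (simp add: of_rat_mult)
  have "(\<Sum>i\<le>D. of_int (z i) * x ^ i) = of_int N * (\<Sum>i\<le>D. of_rat (c i) * x ^ i)"
    unfolding sum_distrib_left by (intro sum.cong) (auto simp: zr)
  then have z0: "(\<Sum>i\<le>D. of_int (z i) * x ^ i) = 0" using c(3) by simp
  have "z i0 \<noteq> 0" using z[OF c(1)] c(2) N0 by auto
  \<comment> \<open>\<open>z j\<close> is the leading coefficient. If it had value 1 at a place
    where \<open>x\<close> exceeds 1, its term would dominate the vanishing sum.\<close>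
  define j where "j = Max {i. i \<le> D \<and> z i \<noteq> 0}"
  have j: "j \<le> D" "z j \<noteq> 0" "\<And>i. i \<le> D \<Longrightarrow> z i \<noteq> 0 \<Longrightarrow> i \<le> j"
  proof -
    have "finite {i. i \<le> D \<and> z i \<noteq> 0}" by simp
    moreover have "{i. i \<le> D \<and> z i \<noteq> 0} \<noteq> {}" using c(1) \<open>z i0 \<noteq> 0\<close> by blast
    ultimately have "j \<in> {i. i \<le> D \<and> z i \<noteq> 0}" unfolding j_def by (rule Max_in)
    then show "j \<le> D" "z j \<noteq> 0" by auto
    show "i \<le> j" if "i \<le> D" "z i \<noteq> 0" for i
      unfolding j_def by (rule Max_ge) (use that in auto)
  qed
  have "{v \<in> kplaces. place_abs v x > 1} \<subseteq> {v \<in> kplaces. place_abs v (of_int (z j)) < 1}"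
  proof safe
    fix v assume v: "v \<in> kplaces" "place_abs v x > 1"
    let ?b = "place_abs v"
    have b: "val {0} ?b" using nonarch_places(2)[OF v(1) place_abs_in[OF v(1)]] nonarch_abs_field by blast
    note bs = E.val_mult[OF b] E.val_power[OF b]
    show "?b (of_int (z j)) < 1"
    proof (rule ccontr)
      assume "\<not> ?b (of_int (z j)) < 1"
      then have zj: "?b (of_int (z j)) = 1" using E.val_of_int[OF b, of "z j"] by simp
      have "?b (\<Sum>i\<in>{..D} - {j}. of_int (z i) * x ^ i) < ?b x ^ j"
      proof (rule E.val_sum_less[OF b])
        fix i assume i: "i \<in> {..D} - {j}"
        show "?b (of_int (z i) * x ^ i) < ?b x ^ j"
        proof (cases "z i = 0")
          case True
          then show ?thesis using E.val_eq_0[OF b, of 0] v(2) by simp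
        next
          case False
          then have "i < j" using j(3)[of i] i by auto
          then have "?b x ^ i < ?b x ^ j" using v(2) by (rule power_strict_increasing)
          moreover have "?b (of_int (z i)) * ?b x ^ i \<le> ?b x ^ i"
            using E.val_of_int[OF b, of "z i"] E.val_nonneg[OF b] by (intro mult_left_le_one_le) auto
          ultimately show ?thesis by (simp add: bs)
        qed
      qed (use v(2) in auto)
      moreover have "?b (of_int (z j) * x ^ j) = ?b x ^ j" by (simp add: bs zj)
      ultimately have "?b ((\<Sum>i\<in>{..D} - {j}. of_int (z i) * x ^ i) + of_int (z j) * x ^ j) = ?b x ^ j"
        using E.val_dominant[OF b] by metis
      then have "?b (\<Sum>i\<le>D. of_int (z i) * x ^ i) = ?b x ^ j" using j(1) by (simp add: sum.remove add.commute)
      then show False using z0 E.val_eq_0[OF b, of 0] v(2) by simp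
    qed
  qed
  then show ?thesis using finite_places_over_prime[OF j(2)] finite_subset by blast
qed

text \<open>The valuation on \<open>k[X]\<close> belonging to a place of \<open>k[X]/(f)\<close>.\<close>

context
  fixes f :: "'k poly" and v
  assumes v: "v \<in> kplaces" and good: "good_place (place_abs v) f"
begin

interpretation G: good_place "place_abs v" f by (rule good)
interpretation X: finite_extension "{p. f dvd p}" "\<lambda>c. [:c:]" "Polynomial.degree f"
  by (rule finite_extension_poly[OF G.f_irr])

lemma upper_val:
  assumes w: "w \<in> places_above f v"
  shows "val {p. f dvd p} (upper_val f w)" "veq (place_abs v) (\<lambda>c. upper_val f w [:c:])"
    "local_val {p. f dvd p} (upper_val f w)"
proof -
  have wp: "w \<in> nonarch_places (root_field f)" "(\<lambda>c. place_abs w (cls f [:c:])) \<in> v"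
    using w place_abs_in by (auto simp: places_above_def comp_def root_field_emb_eq)
  show val: "val {p. f dvd p} (upper_val f w)"
    using nonarch_places(2)[OF wp(1) place_abs_in[OF wp(1)]] unfolding nonarch_abs_root_field upper_val_def .
  show "veq (place_abs v) (\<lambda>c. upper_val f w [:c:])"
    using nonarch_places(3)[OF v place_abs_in[OF v] wp(2)] by (simp add: veq_def upper_val_def field_ring_simps)
  show "local_val {p. f dvd p} (upper_val f w)"
    using X.local_ext[OF val number_field_local_val[OF X.val_base[OF val]]] .
qed

lemma upper_val_inj:
  assumes "w \<in> places_above f v" "w' \<in> places_above f v" "veq (upper_val f w) (upper_val f w')"
  shows "w = w'"
proof -
  have wp: "w \<in> nonarch_places (root_field f)" "w' \<in> nonarch_places (root_field f)"
    using assms by (auto simp: places_above_def)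
  obtain t where t: "t > 0" "\<And>p. place_abs w' (cls f p) = place_abs w (cls f p) powr t"
    using assms(3) by (auto simp: veq_def upper_val_def)
  have "place_abs w' \<in> w"
    using nonarch_places(4)[OF wp(1) place_abs_in[OF wp(1)] nonarch_places(2)[OF wp(2) place_abs_in[OF wp(2)]] t(1)] t(2)
    by (auto simp: root_field_simps(1))
  then show ?thesis using nonarch_places(5)[OF wp] place_abs_in[OF wp(2)] by blast
qed

lemma upper_val_inj_on: "inj_on (upper_val f) (places_above f v)"
proof (rule inj_onI)
  fix w w' assume *: "w \<in> places_above f v" "w' \<in> places_above f v" "upper_val f w = upper_val f w'"
  show "w = w'" using upper_val_inj[OF *(1,2)] veq_refl[OF upper_val(1)[OF *(2)]] *(3) by simp
qed

lemma finite_places_above: "finite (places_above f v)"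
proof -
  have "card U \<le> Polynomial.degree f" if U: "U \<subseteq> places_above f v" "finite U" for U
  proof -
    have "card (upper_val f ` U) \<le> Polynomial.degree f"
    proof (rule X.card_extensions[OF _ _ _ G.a_val])
      show "finite (upper_val f ` U)" using U(2) by simp
      show "discrete_val {p. f dvd p} b" if "b \<in> upper_val f ` U" for b
        using that U(1) upper_val(3) by (auto simp: local_val_def)
      show "veq (place_abs v) (\<lambda>c. b [:c:])" if "b \<in> upper_val f ` U" for b
        using that U(1) upper_val(2) by auto
      show "\<not> veq b b'" if "b \<in> upper_val f ` U" "b' \<in> upper_val f ` U" "b \<noteq> b'" for b b'
        using that U(1) upper_val_inj by blast
    qed
    then show ?thesis using card_image[OF inj_on_subset[OF upper_val_inj_on U(1)]] by simp
  qed
  then show ?thesis using finite_if_finite_subsets_card_bdd by blast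
qed

text \<open>\<open>b\<close> is constant on classes modulo \<open>f\<close> and so defines an
  absolute value \<open>\<beta>\<close> of the root field. All members of the place of
  \<open>\<beta>\<close> are powers of it on the carrier, hence restrict to members of
  \<open>v\<close>, as \<open>places_above\<close> demands.\<close>

lemma place_of_val:
  assumes b: "val {p. f dvd p} b" and bc: "\<And>c. b [:c:] = place_abs v c"
  shows "\<exists>w\<in>places_above f v. veq b (upper_val f w)"
proof -
  define \<beta> where "\<beta> c = b (SOME p. p \<in> c)" for c
  have \<beta>: "\<beta> (cls f p) = b p" for p
  proof -
    have "(SOME q. q \<in> cls f p) \<in> cls f p" by (rule someI[of _ p]) (simp add: cls_eq)
    then show ?thesis unfolding \<beta>_def using G.Z.val_cong[OF b] by (simp add: cls_eq)
  qed
  have "nonarch_abs (root_field f) \<beta>" unfolding nonarch_abs_root_field \<beta> using b by simp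
  then obtain w where w: "w \<in> nonarch_places (root_field f)" "\<beta> \<in> w" using nonarch_places_exists by blast
  have "b' \<circ> root_field_emb f \<in> v" if b': "b' \<in> w" for b'
  proof -
    obtain t where t: "t > 0" "\<And>p. b' (cls f p) = b p powr t"
      using nonarch_places(3)[OF w b'] by (auto simp: root_field_simps(1) \<beta>)
    have "val {p. f dvd p} (\<lambda>p. b' (cls f p))" using nonarch_places(2)[OF w(1) b'] nonarch_abs_root_field by blast
    from X.val_base[OF this] have "nonarch_abs (field_ring TYPE('k)) (b' \<circ> root_field_emb f)"
      by (simp add: nonarch_abs_field comp_def root_field_emb_eq)
    from nonarch_places(4)[OF v place_abs_in[OF v] this t(1)] show ?thesis
      by (simp add: root_field_emb_eq t(2) bc)
  qed
  then have w': "w \<in> places_above f v" using w(1) by (simp add: places_above_def)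
  obtain t where "t > 0" "\<And>p. place_abs w (cls f p) = b p powr t"
    using nonarch_places(3)[OF w place_abs_in[OF w(1)]] by (auto simp: root_field_simps(1) \<beta>)
  then have "veq b (upper_val f w)" by (auto simp: veq_def upper_val_def)
  then show ?thesis using w' by blast
qed

text \<open>Reduction modulo \<open>f\<close> bounds the value of all integral polynomials by one
  constant \<open>C\<close>. The powers of \<open>x\<close> are integral as well, and powers of a
  number above 1 are unbounded.\<close>

lemma upper_val_le_1:
  assumes w: "w \<in> places_above f v" and x: "x \<in> vpolys (place_abs v)"
  shows "upper_val f w x \<le> 1"
proof -
  let ?b = "upper_val f w" let ?d = "Polynomial.degree f"
  note b = upper_val(1)[OF w]
  define C where "C = (\<Sum>i<?d. ?b (Polynomial.monom 1 i))"
  have C0: "0 \<le> C" unfolding C_def by (intro sum_nonneg G.Z.val_nonneg[OF b])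
  have bound: "?b y \<le> C" if y: "y \<in> vpolys (place_abs v)" for y
  proof -
    obtain q r where qr: "r \<in> vpolys (place_abs v)" "y = f * q + r" "r = 0 \<or> Polynomial.degree r < ?d"
      using vpolys_divide[OF G.a_val G.f_int G.f_monic y] by blast
    have "?b y = ?b r" using qr(2) by (intro G.Z.val_cong[OF b]) simp
    moreover have "?b r \<le> C"
    proof -
      have "r = (\<Sum>i<?d. Polynomial.monom (Polynomial.coeff r i) i)"
        using qr(3) by (intro poly_eqI) (auto simp: coeff_sum if_distrib[of "\<lambda>x. x = _"] coeff_eq_0)
      also have "?b \<dots> \<le> C"
      proof (rule G.Z.val_sum[OF b _ C0])
        fix i assume i: "i \<in> {..<?d}"
        have "place_abs v (Polynomial.coeff r i) \<le> 1" using qr(1) by (simp add: vpolys_def)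
        then have "?b [:Polynomial.coeff r i:] \<le> 1"
          using E.veq_less_1(2)[OF G.a_val upper_val(2)[OF w]] by blast
        then have "?b ([:Polynomial.coeff r i:] * Polynomial.monom 1 i) \<le> ?b (Polynomial.monom 1 i)"
          using G.Z.val_nonneg[OF b] unfolding G.Z.val_mult[OF b] by (intro mult_left_le_one_le) auto
        also have "[:Polynomial.coeff r i:] * Polynomial.monom 1 i = Polynomial.monom (Polynomial.coeff r i) i"
          by (simp add: Polynomial.smult_monom)
        also have "?b (Polynomial.monom 1 i) \<le> C" unfolding C_def
          using i G.Z.val_nonneg[OF b] by (intro member_le_sum) auto
        finally show "?b (Polynomial.monom (Polynomial.coeff r i) i) \<le> C" .
      qed
      finally show ?thesis .
    qed
    ultimately show ?thesis by simp
  qed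
  show ?thesis
  proof (rule ccontr)
    assume "\<not> ?b x \<le> 1"
    then obtain n where "?b x ^ n > C" using real_arch_pow[of "?b x" C] by auto
    moreover have "?b (x ^ n) \<le> C" using bound vpolys_power[OF G.a_val x] by blast
    ultimately show False by (simp add: G.Z.val_power[OF b])
  qed
qed

lemma of_nat_not_dvd: "n > 0 \<Longrightarrow> \<not> f dvd of_nat n"
proof
  assume n: "n > 0" and "f dvd of_nat n"
  moreover have "(of_nat n :: 'k poly) * [:inverse (of_nat n):] = 1" using n by (simp add: of_nat_poly)
  ultimately have "f dvd 1" by (metis dvd_mult2)
  then show False using G.f_irr by (simp add: Factorial_Ring.irreducible_def)
qed

text \<open>That \<open>R\<close> contains, modulo \<open>f\<close>, everything integral at all
  places above \<open>v\<close> follows from \<open>integrally_closed\<close>, since by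
  \<open>place_of_val\<close> each extension of the absolute value belongs to such a place.\<close>

lemma semilocal_above: "semilocal {p. f dvd p} (vpolys (place_abs v)) (upper_val f ` places_above f v)"
proof
  show "subgp (vpolys (place_abs v))" by (rule subgp_vpolys[OF G.a_val])
  show "1 \<in> vpolys (place_abs v)" by (rule vpolys_1[OF G.a_val])
  show "x * y \<in> vpolys (place_abs v)" if "x \<in> vpolys (place_abs v)" "y \<in> vpolys (place_abs v)" for x y
    by (rule vpolys_mult[OF G.a_val that])
  show "finite (upper_val f ` places_above f v)" using finite_places_above by simp
  show "local_val {p. f dvd p} b" if "b \<in> upper_val f ` places_above f v" for b using that upper_val(3) by auto
  show "\<not> veq b b'" if "b \<in> upper_val f ` places_above f v" "b' \<in> upper_val f ` places_above f v" "b \<noteq> b'" for b b'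
    using that upper_val_inj by blast
  show "b x \<le> 1" if "x \<in> vpolys (place_abs v)" "b \<in> upper_val f ` places_above f v" for x b
    using that upper_val_le_1 by auto
  show "\<exists>y\<in>vpolys (place_abs v). x - y \<in> {p. f dvd p}" if x: "\<And>b. b \<in> upper_val f ` places_above f v \<Longrightarrow> b x \<le> 1" for x
  proof -
    have le: "b x \<le> 1" if b: "val {p. f dvd p} b" "\<And>c. b [:c:] = place_abs v c" for b
    proof -
      obtain w where w: "w \<in> places_above f v" "veq b (upper_val f w)" using place_of_val[OF b] by blast
      then show ?thesis using G.Z.veq_less_1(2)[OF b(1) w(2)] x by blast
    qed
    have "\<exists>y\<in>vpolys (place_abs v). f dvd x - y" by (rule G.integrally_closed, rule le)
    then show ?thesis by simp
  qed
  show "of_nat n \<notin> {p. f dvd p}" if "n > 0" for n using of_nat_not_dvd[OF that] by simp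
qed

text \<open>With a single place the semilocal theory also computes the zeta function of one
  valuation ring, hence the local factors.\<close>

lemma semilocal_upper:
  assumes w: "w \<in> places_above f v"
  shows "semilocal {p. f dvd p} (vring (upper_val f w)) {upper_val f w}"
proof
  note b = upper_val(1)[OF w]
  show "subgp (vring (upper_val f w))" by (rule G.Z.subgp_vring[OF b])
  show "1 \<in> vring (upper_val f w)" using G.Z.val_one[OF b] by simp
  show "x * y \<in> vring (upper_val f w)" if "x \<in> vring (upper_val f w)" "y \<in> vring (upper_val f w)" for x y
    using that G.Z.val_mult_le_1[OF b] by simp
  show "\<exists>y\<in>vring (upper_val f w). x - y \<in> {p. f dvd p}" if "\<And>b. b \<in> {upper_val f w} \<Longrightarrow> b x \<le> 1" for x
    using that by (intro bexI[of _ x]) auto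
  show "of_nat n \<notin> {p. f dvd p}" if "n > 0" for n using of_nat_not_dvd[OF that] by simp
qed (use upper_val(3)[OF w] in auto)

text \<open>The local factors are written as sums over ideals of valuation rings, the form that
  \<open>ideal_zeta_eq\<close> carries over to completions.\<close>

lemma above_zeta:
  "ideals_principal (vpolys (place_abs v)) {p. f dvd p}"
  "has_zeta (vpolys (place_abs v)) {p. f dvd p}
     (\<lambda>s. \<Prod>w\<in>places_above f v. infsum (\<lambda>J. npow (idx (vring (upper_val f w)) J) s)
        (fin_ideals (vring (upper_val f w)) {p. f dvd p}))"
proof -
  interpret S: semilocal "{p. f dvd p}" "vpolys (place_abs v)" "upper_val f ` places_above f v"
    by (rule semilocal_above)
  show "ideals_principal (vpolys (place_abs v)) {p. f dvd p}" by (rule S.principal)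
  have res: "S.res_card = (\<lambda>b. idx (vring b) (vmax b))" by (simp add: S.res_card_def fun_eq_iff)
  have "infsum (\<lambda>J. npow (idx (vring (upper_val f w)) J) s) (fin_ideals (vring (upper_val f w)) {p. f dvd p})
      = 1 / (1 - npow (idx (vring (upper_val f w)) (vmax (upper_val f w))) s)"
    if "w \<in> places_above f v" "Re s > 0" for w s
  proof -
    interpret T: semilocal "{p. f dvd p}" "vring (upper_val f w)" "{upper_val f w}" by (rule semilocal_upper[OF that(1)])
    show ?thesis using T.has_zeta that(2) unfolding has_zeta_def by (auto simp: T.res_card_def intro!: infsumI)
  qed
  then have "(\<Prod>w\<in>places_above f v. infsum (\<lambda>J. npow (idx (vring (upper_val f w)) J) s)
        (fin_ideals (vring (upper_val f w)) {p. f dvd p})) = (\<Prod>b\<in>upper_val f ` places_above f v. 1 / (1 - npow (S.res_card b) s))"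
    if "Re s > 0" for s using that unfolding res by (simp add: prod.reindex[OF upper_val_inj_on])
  then show "has_zeta (vpolys (place_abs v)) {p. f dvd p}
     (\<lambda>s. \<Prod>w\<in>places_above f v. infsum (\<lambda>J. npow (idx (vring (upper_val f w)) J) s)
        (fin_ideals (vring (upper_val f w)) {p. f dvd p}))"
    using S.has_zeta unfolding has_zeta_def by simp
qed

end

end

section \<open>Subgroups of finite index under completion\<close>

text \<open>If \<open>\<Gamma>\<close> is dense in \<open>\<Gamma>'\<close> for the \<open>m\<close>-divisible topology, then subgroups of index \<open>m\<close> of the two
  groups correspond, since they contain all multiples of \<open>m\<close>.\<close>

locale dense_pair = abelian_group Gh for Gh :: "('h, 'c) ring_scheme" (structure) +
  fixes G :: "'g::ab_group_add set" and \<phi> :: "'g \<Rightarrow> 'h" and E :: "('g \<Rightarrow> 'g) set" and Eh :: "('h \<Rightarrow> 'h) set"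
  assumes G: "subgp G" and \<phi>_closed: "x \<in> G \<Longrightarrow> \<phi> x \<in> carrier Gh"
    and \<phi>_add: "x \<in> G \<Longrightarrow> y \<in> G \<Longrightarrow> \<phi> (x + y) = \<phi> x \<oplus> \<phi> y"
    and dense: "c \<in> carrier Gh \<Longrightarrow> m \<ge> 1 \<Longrightarrow> \<exists>x\<in>G. \<exists>d\<in>carrier Gh. c = \<phi> x \<oplus> [(m::nat)] \<cdot> d"
    and pure: "x \<in> G \<Longrightarrow> d \<in> carrier Gh \<Longrightarrow> m \<ge> 1 \<Longrightarrow> \<phi> x = [(m::nat)] \<cdot> d \<Longrightarrow> \<exists>y\<in>G. x = (\<Sum>i<m. y)"
    and E_closed: "e \<in> E \<Longrightarrow> x \<in> G \<Longrightarrow> e x \<in> G"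
    and Eh_closed: "e' \<in> Eh \<Longrightarrow> c \<in> carrier Gh \<Longrightarrow> e' c \<in> carrier Gh"
    and Eh_add: "e' \<in> Eh \<Longrightarrow> c \<in> carrier Gh \<Longrightarrow> d \<in> carrier Gh \<Longrightarrow> e' (c \<oplus> d) = e' c \<oplus> e' d"
    and Eh_E: "e' \<in> Eh \<Longrightarrow> m \<ge> 1 \<Longrightarrow> \<exists>e\<in>E. \<forall>x\<in>G. \<exists>d\<in>carrier Gh. e' (\<phi> x) = \<phi> (e x) \<oplus> [(m::nat)] \<cdot> d"
    and E_Eh: "e \<in> E \<Longrightarrow> \<exists>e'\<in>Eh. \<forall>x\<in>G. e' (\<phi> x) = \<phi> (e x)"
begin

definition subs :: "nat \<Rightarrow> 'g set set" where
  "subs m = {H. subgp H \<and> H \<subseteq> G \<and> (\<forall>e\<in>E. \<forall>x\<in>H. e x \<in> H) \<and> fin_idx G H \<and> idx G H = m}"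

definition subs_h :: "nat \<Rightarrow> 'h set set" where
  "subs_h m = {H. subgroup H (add_monoid Gh) \<and> (\<forall>e\<in>Eh. \<forall>x\<in>H. e x \<in> H) \<and>
     finite (a_rcosets H) \<and> card (a_rcosets H) = m}"

lemma \<phi>_0: "\<phi> 0 = \<zero>"
proof -
  have "\<phi> 0 \<oplus> \<phi> 0 = \<phi> 0 \<oplus> \<zero>" using \<phi>_add[of 0 0] subgp_zero[OF G] \<phi>_closed by simp
  then show ?thesis using \<phi>_closed[OF subgp_zero[OF G]] by simp
qed

lemma add_minus_cancel: "x \<in> carrier Gh \<Longrightarrow> y \<in> carrier Gh \<Longrightarrow> (x \<oplus> y) \<ominus> x = y"
  by (simp add: minus_eq a_comm[of x y] a_assoc r_neg)

lemma \<phi>_diff: assumes "x \<in> G" "y \<in> G" shows "\<phi> (x - y) = \<phi> x \<ominus> \<phi> y"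
proof -
  have xy: "x - y \<in> G" using subgp_diff[OF G] assms by blast
  have "\<phi> x = \<phi> (x - y) \<oplus> \<phi> y" using \<phi>_add[OF xy assms(2)] by simp
  then show ?thesis using \<phi>_closed xy assms
    by (simp add: minus_eq a_assoc r_neg)
qed

context
  fixes H assumes H: "subgroup H (add_monoid Gh)"
begin

interpretation H: additive_subgroup H Gh by (rule additive_subgroup.intro[OF H])
interpretation H: abelian_subgroup H Gh
  by (rule abelian_subgroupI3[OF H.additive_subgroup_axioms abelian_group_axioms])

lemma H_diff: "x \<in> H \<Longrightarrow> y \<in> H \<Longrightarrow> x \<ominus> y \<in> H"
  by (simp add: minus_eq)

lemma H_cancel: assumes "x \<in> carrier Gh" "y \<in> H" "x \<oplus> y \<in> H" shows "x \<in> H"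
proof -
  have "x = (x \<oplus> y) \<ominus> y" using assms by (simp add: minus_eq a_assoc r_neg)
  then show ?thesis using H_diff assms by metis
qed

lemma H_coset_eq: assumes "x \<in> carrier Gh" "y \<in> carrier Gh" shows "H +> x = H +> y \<longleftrightarrow> x \<ominus> y \<in> H"
proof -
  have "x \<ominus> y \<in> H \<longleftrightarrow> x \<in> H +> y"
    using H.a_rcos_module[OF assms(2,1)] by (simp add: minus_eq)
  also have "\<dots> \<longleftrightarrow> H +> x = H +> y"
    using H.a_repr_independence'[OF _ assms(2), of x] H.a_rcos_self[OF assms(1)] by auto
  finally show ?thesis by simp
qed

text \<open>Lagrange's theorem in the quotient group.\<close>

lemma kills: assumes fin: "finite (a_rcosets H)" and x: "x \<in> carrier Gh"
  shows "[card (a_rcosets H)] \<cdot> x \<in> H"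
proof -
  let ?Q = "add_monoid Gh Mod H"
  interpret N: normal H "add_monoid Gh" by (rule H.a_normal)
  interpret Q: group ?Q by (rule N.factorgroup_is_group)
  have car: "carrier ?Q = a_rcosets H" by (simp add: FactGroup_def A_RCOSETS_def)
  have pow: "(H +> x) [^]\<^bsub>?Q\<^esub> (n::nat) = H +> ([n] \<cdot> x)" for n
  proof (induction n)
    case 0
    show ?case using H.a_rcos_const[OF H.zero_closed] by (simp add: FactGroup_def)
  next
    case (Suc n)
    have "(H +> x) [^]\<^bsub>?Q\<^esub> Suc n = (H +> ([n] \<cdot> x)) <+> (H +> x)"
      using Suc by (simp add: FactGroup_def AbelCoset.set_add_def)
    then show ?case using H.a_rcos_sum[of "[n] \<cdot> x" x] x by simp
  qed
  have "(H +> x) [^]\<^bsub>?Q\<^esub> order ?Q = \<one>\<^bsub>?Q\<^esub>"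
    using x by (intro Q.pow_order_eq_1) (simp add: car a_rcosetsI H.a_subset)
  then have "H +> ([card (a_rcosets H)] \<cdot> x) = \<one>\<^bsub>?Q\<^esub>" unfolding pow order_def car .
  then have "H +> ([card (a_rcosets H)] \<cdot> x) = H" by (simp add: FactGroup_def)
  then show ?thesis using H.a_rcos_self[of "[card (a_rcosets H)] \<cdot> x"] x by simp
qed

text \<open>Every coset of \<open>H\<close> meets the image of \<open>\<phi>\<close>: by
  \<open>dense\<close> the error is a multiple of the index, and \<open>H\<close> contains all of
  these.\<close>

lemma preimage:
  assumes inv: "\<forall>e\<in>Eh. \<forall>x\<in>H. e x \<in> H" and fin: "finite (a_rcosets H)" and card: "card (a_rcosets H) = m" and m: "m \<ge> 1"
  shows "{x \<in> G. \<phi> x \<in> H} \<in> subs m"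
proof -
  let ?K = "{x \<in> G. \<phi> x \<in> H}"
  have K: "subgp ?K" unfolding subgp_def
  proof (intro conjI ballI)
    show "0 \<in> ?K" using subgp_zero[OF G] \<phi>_0 by simp
    fix x y assume "x \<in> ?K" "y \<in> ?K"
    then have xy: "x \<in> G" "y \<in> G" "\<phi> x \<in> H" "\<phi> y \<in> H" by auto
    then have "\<phi> (x - y) \<in> H" unfolding \<phi>_diff[OF xy(1,2)] by (intro H_diff)
    with subgp_diff[OF G xy(1,2)] show "x - y \<in> ?K" by blast
  qed
  have K_iff: "H +> \<phi> x = H +> \<phi> y \<longleftrightarrow> x - y \<in> ?K" if "x \<in> G" "y \<in> G" for x y
    using H_coset_eq[OF \<phi>_closed[OF that(1)] \<phi>_closed[OF that(2)]] \<phi>_diff[OF that] subgp_diff[OF G that] by simp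
  let ?F = "\<lambda>C. H +> \<phi> (crep G ?K C)"
  have "bij_betw ?F (cosets G ?K) (a_rcosets H)"
  proof (rule bij_betw_imageI)
    show "inj_on ?F (cosets G ?K)"
    proof (rule inj_onI)
      fix C D assume CD: "C \<in> cosets G ?K" "D \<in> cosets G ?K" "?F C = ?F D"
      then have "crep G ?K C - crep G ?K D \<in> ?K" using K_iff crep(1) by blast
      then have "(+) (crep G ?K C) ` ?K = (+) (crep G ?K D) ` ?K" by (subst coset_eq_iff[OF K])
      then show "C = D" by (rule trans[OF crep(2)[OF CD(1)] trans[OF _ crep(2)[OF CD(2), symmetric]]])
    qed
    show "?F ` cosets G ?K = a_rcosets H"
    proof (intro subset_antisym subsetI)
      fix C assume "C \<in> ?F ` cosets G ?K"
      then show "C \<in> a_rcosets H" using crep(1) \<phi>_closed a_rcosetsI[OF H.a_subset] by blast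
    next
      fix C assume "C \<in> a_rcosets H"
      then obtain c where c: "c \<in> carrier Gh" "C = H +> c" unfolding A_RCOSETS_def' by blast
      obtain x d where x: "x \<in> G" "d \<in> carrier Gh" "c = \<phi> x \<oplus> [m] \<cdot> d" using dense[OF c(1) m] by blast
      have md: "[m] \<cdot> d \<in> H" using kills[OF fin x(2)] card by simp
      have "c \<ominus> \<phi> x = [m] \<cdot> d"
        unfolding x(3) using \<phi>_closed[OF x(1)] x(2) by (simp add: add_minus_cancel)
      then have 1: "C = H +> \<phi> x" using c H_coset_eq[OF c(1) \<phi>_closed[OF x(1)]] md by simp
      have "H +> \<phi> x = ?F ((+) x ` ?K)"
        using K_iff[OF x(1) crep_coset(1)[OF K x(1)]] crep_coset(2)[OF K x(1)] subgp_diff_comm[OF K] by blast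
      then show "C \<in> ?F ` cosets G ?K" using 1 cosetsI[OF x(1)] by blast
    qed
  qed
  then have "fin_idx G ?K" "idx G ?K = m" using fin card by (auto simp: bij_betw_finite idx_def bij_betw_same_card)
  moreover have "e x \<in> ?K" if ex: "e \<in> E" "x \<in> ?K" for e x
  proof -
    have x: "x \<in> G" "\<phi> x \<in> H" using ex by auto
    obtain e' where "e' \<in> Eh" "e' (\<phi> x) = \<phi> (e x)" using E_Eh[OF ex(1)] x(1) by blast
    then have "\<phi> (e x) \<in> H" using inv x(2) by metis
    then show ?thesis using E_closed[OF ex(1) x(1)] by simp
  qed
  ultimately show ?thesis using K by (auto simp: subs_def)
qed

end

text \<open>The inverse sends \<open>K\<close> to the image of \<open>K\<close> plus all multiples
  of \<open>m\<close>. By \<open>pure\<close>, a member of \<open>G\<close> whose image is a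
  multiple of \<open>m\<close> is a multiple of \<open>m\<close> in \<open>G\<close> and thus lies
  in \<open>K\<close>, so the preimage of this subgroup is \<open>K\<close> again.\<close>

lemma bij_subs:
  assumes m: "m \<ge> 1"
  shows "bij_betw (\<lambda>H. {x \<in> G. \<phi> x \<in> H}) (subs_h m) (subs m)"
proof (rule bij_betw_imageI)
  let ?P = "\<lambda>H. {x \<in> G. \<phi> x \<in> H}"
  have le: "H \<subseteq> H'" if H: "H \<in> subs_h m" "H' \<in> subs_h m" "?P H = ?P H'" for H H'
  proof
    fix c assume c: "c \<in> H"
    have sg: "subgroup H (add_monoid Gh)" "subgroup H' (add_monoid Gh)" using H by (auto simp: subs_h_def)
    have cc: "c \<in> carrier Gh" using subgroup.subset[OF sg(1)] c by auto
    obtain x d where x: "x \<in> G" "d \<in> carrier Gh" "c = \<phi> x \<oplus> [m] \<cdot> d" using dense[OF cc m] by blast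
    have md: "[m] \<cdot> d \<in> H" "[m] \<cdot> d \<in> H'" using kills[OF sg(1) _ x(2)] kills[OF sg(2) _ x(2)] H by (auto simp: subs_h_def)
    have "\<phi> x \<in> H" using H_cancel[OF sg(1) \<phi>_closed[OF x(1)] md(1)] c x(3) by simp
    then have "\<phi> x \<in> H'" using H(3) x(1) by blast
    then show "c \<in> H'" using subgroup.m_closed[OF sg(2) _ md(2)] x(3) by simp
  qed
  show "inj_on ?P (subs_h m)" by (intro inj_onI subset_antisym le) auto
  show "?P ` subs_h m = subs m"
  proof (intro subset_antisym subsetI)
    fix K assume "K \<in> ?P ` subs_h m"
    then obtain H where "H \<in> subs_h m" "K = ?P H" by blast
    then show "K \<in> subs m" using preimage[of H m] m by (auto simp: subs_h_def)
  next
    fix K assume "K \<in> subs m"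
    then have K: "subgp K" "K \<subseteq> G" "\<And>e x. e \<in> E \<Longrightarrow> x \<in> K \<Longrightarrow> e x \<in> K" "fin_idx G K" "idx G K = m" by (auto simp: subs_def)
    define H where "H = {\<phi> x \<oplus> [m] \<cdot> d | x d. x \<in> K \<and> d \<in> carrier Gh}"
    have HI: "\<phi> x \<oplus> [m] \<cdot> d \<in> H" if "x \<in> K" "d \<in> carrier Gh" for x d using that by (auto simp: H_def)
    have Kc: "\<phi> x \<in> carrier Gh" if "x \<in> K" for x using that K(2) \<phi>_closed by blast
    have PH: "?P H = K"
    proof (intro subset_antisym subsetI)
      fix x assume "x \<in> ?P H"
      then obtain h d where x: "x \<in> G" "h \<in> K" "d \<in> carrier Gh" "\<phi> x = \<phi> h \<oplus> [m] \<cdot> d" by (auto simp: H_def)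
      have hG: "h \<in> G" using x K by blast
      have "\<phi> (x - h) = [m] \<cdot> d"
        unfolding \<phi>_diff[OF x(1) hG] x(4) using Kc[OF x(2)] x(3) by (simp add: add_minus_cancel)
      then obtain y where "y \<in> G" "x - h = (\<Sum>i<m. y)" using pure[OF subgp_diff[OF G x(1) hG] x(3) m] by blast
      then have "x - h \<in> K" using idx_kills[OF G K(1,2,4)] K(5) by metis
      then show "x \<in> K" using subgp_add[OF K(1) _ x(2), of "x - h"] by simp
    next
      fix x assume "x \<in> K"
      then show "x \<in> ?P H" using HI[of x \<zero>] K(2) Kc[of x] by (auto simp: add.nat_pow_one)
    qed
    have sg: "subgroup H (add_monoid Gh)"
    proof (rule add.subgroupI)
      show "H \<subseteq> carrier Gh" using Kc by (auto simp: H_def)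
      show "H \<noteq> {}" using HI[OF subgp_zero[OF K(1)], of \<zero>] by blast
      fix c assume "c \<in> H"
      then obtain x d where c: "x \<in> K" "d \<in> carrier Gh" "c = \<phi> x \<oplus> [m] \<cdot> d" by (auto simp: H_def)
      have "\<phi> (0 - x) = \<ominus> \<phi> x" using \<phi>_diff[of 0 x] c K(2) subgp_zero[OF G] Kc[OF c(1)] by (auto simp: \<phi>_0 minus_eq)
      then have "\<ominus> c = \<phi> (- x) \<oplus> [m] \<cdot> (\<ominus> d)"
        using c Kc[OF c(1)] by (simp add: minus_add add.nat_pow_inv)
      then show "\<ominus> c \<in> H" using HI[OF subgp_neg[OF K(1) c(1)], of "\<ominus> d"] c(2) by simp
      fix c' assume "c' \<in> H"
      then obtain x' d' where c': "x' \<in> K" "d' \<in> carrier Gh" "c' = \<phi> x' \<oplus> [m] \<cdot> d'" by (auto simp: H_def)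
      have "c \<oplus> c' = \<phi> (x + x') \<oplus> [m] \<cdot> (d \<oplus> d')"
        using c(2,3) c'(2,3) Kc[OF c(1)] Kc[OF c'(1)] \<phi>_add[OF subsetD[OF K(2) c(1)] subsetD[OF K(2) c'(1)]]
        by (simp add: add.nat_pow_distrib a_ac)
      then show "c \<oplus> c' \<in> H" using HI[OF subgp_add[OF K(1) c(1) c'(1)], of "d \<oplus> d'"] c(2) c'(2) by simp
    qed
    \<comment> \<open>On \<open>\<phi> x\<close> an operator from \<open>Eh\<close> agrees with one
      from \<open>E\<close> up to multiples of \<open>m\<close>, which \<open>H\<close>
      contains.\<close>
    have inv: "e c \<in> H" if ec: "e \<in> Eh" "c \<in> H" for e c
    proof -
      from ec obtain x d where c: "x \<in> K" "d \<in> carrier Gh" "c = \<phi> x \<oplus> [m] \<cdot> d" by (auto simp: H_def)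
      obtain e' where e': "e' \<in> E" "\<forall>x\<in>G. \<exists>d\<in>carrier Gh. e (\<phi> x) = \<phi> (e' x) \<oplus> [m] \<cdot> d" using Eh_E[OF ec(1) m] by blast
      then obtain d' where d': "d' \<in> carrier Gh" "e (\<phi> x) = \<phi> (e' x) \<oplus> [m] \<cdot> d'" using c(1) K(2) by blast
      have e0: "e \<zero> = \<zero>"
      proof -
        have "e \<zero> \<oplus> e \<zero> = e \<zero> \<oplus> \<zero>" using Eh_add[OF ec(1), of \<zero> \<zero>] Eh_closed[OF ec(1)] by simp
        then show ?thesis using Eh_closed[OF ec(1)] by simp
      qed
      have pow: "e ([n] \<cdot> d) = [n] \<cdot> e d" for n :: nat
        using c(2) Eh_closed[OF ec(1)] Eh_add[OF ec(1)] by (induction n) (auto simp: e0)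
      have "e c = \<phi> (e' x) \<oplus> [m] \<cdot> (d' \<oplus> e d)"
        using c d' Kc Eh_add[OF ec(1)] Eh_closed[OF ec(1)] K(3)[OF e'(1) c(1)] by (simp add: pow add.nat_pow_distrib a_assoc)
      then show ?thesis using HI[OF K(3)[OF e'(1) c(1)], of "d' \<oplus> e d"] d' Eh_closed[OF ec(1)] c(2) by simp
    qed
    interpret H: additive_subgroup H Gh by (rule additive_subgroup.intro[OF sg])
    have eq: "H +> c = H +> \<phi> x" if "c \<in> carrier Gh" "x \<in> G" "d \<in> carrier Gh" "c = \<phi> x \<oplus> [m] \<cdot> d" for c x d
    proof -
      have "c \<ominus> \<phi> x = [m] \<cdot> d"
        unfolding that(4) using \<phi>_closed[OF that(2)] that(3) by (simp add: add_minus_cancel)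
      moreover have "[m] \<cdot> d \<in> H" using HI[OF subgp_zero[OF K(1)] that(3)] that(3) by (simp add: \<phi>_0)
      ultimately show ?thesis using H_coset_eq[OF sg that(1) \<phi>_closed[OF that(2)]] by simp
    qed
    have K_iff: "H +> \<phi> x = H +> \<phi> y \<longleftrightarrow> x - y \<in> K" if "x \<in> G" "y \<in> G" for x y
      using H_coset_eq[OF sg \<phi>_closed[OF that(1)] \<phi>_closed[OF that(2)]] \<phi>_diff[OF that] subgp_diff[OF G that] PH by auto
    let ?F = "\<lambda>C. H +> \<phi> (crep G K C)"
    have "bij_betw ?F (cosets G K) (a_rcosets H)"
    proof (rule bij_betw_imageI)
      show "inj_on ?F (cosets G K)"
      proof (rule inj_onI)
        fix C D assume CD: "C \<in> cosets G K" "D \<in> cosets G K" "?F C = ?F D"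
        then have "crep G K C - crep G K D \<in> K" using K_iff crep(1) by blast
        then have "(+) (crep G K C) ` K = (+) (crep G K D) ` K" by (subst coset_eq_iff[OF K(1)])
        then show "C = D" by (rule trans[OF crep(2)[OF CD(1)] trans[OF _ crep(2)[OF CD(2), symmetric]]])
      qed
      show "?F ` cosets G K = a_rcosets H"
      proof (intro subset_antisym subsetI)
        fix C assume "C \<in> ?F ` cosets G K"
        then show "C \<in> a_rcosets H" using crep(1) \<phi>_closed a_rcosetsI[OF H.a_subset] by blast
      next
        fix C assume "C \<in> a_rcosets H"
        then obtain c where c: "c \<in> carrier Gh" "C = H +> c" unfolding A_RCOSETS_def' by blast
        obtain x d where x: "x \<in> G" "d \<in> carrier Gh" "c = \<phi> x \<oplus> [m] \<cdot> d" using dense[OF c(1) m] by blast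
        have "H +> \<phi> x = ?F ((+) x ` K)"
          using K_iff[OF x(1) crep_coset(1)[OF K(1) x(1)]] crep_coset(2)[OF K(1) x(1)] subgp_diff_comm[OF K(1)] by blast
        then show "C \<in> ?F ` cosets G K" using c eq[OF c(1) x] cosetsI[OF x(1)] by blast
      qed
    qed
    then have "finite (a_rcosets H)" "card (a_rcosets H) = m" using K(4,5) by (auto simp: bij_betw_finite idx_def bij_betw_same_card)
    then have "H \<in> subs_h m" using sg inv by (auto simp: subs_h_def)
    then show "K \<in> ?P ` subs_h m" using PH by blast
  qed
qed

text \<open>The index of a preimage reveals \<open>m\<close>, so the bijections for different
  \<open>m\<close> can be combined.\<close>

lemma bij_subs_all:
  "bij_betw (\<lambda>H. {x \<in> G. \<phi> x \<in> H}) (\<Union>m\<in>{1..}. subs_h m) (\<Union>m\<in>{1..}. subs m)"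
  "H \<in> subs_h m \<Longrightarrow> m \<ge> 1 \<Longrightarrow> idx G {x \<in> G. \<phi> x \<in> H} = card (a_rcosets H)"
proof -
  let ?P = "\<lambda>H. {x \<in> G. \<phi> x \<in> H}"
  have idx: "idx G (?P H) = m" if "H \<in> subs_h m" "m \<ge> 1" for H m
    using bij_betw_apply[OF bij_subs[OF that(2)] that(1)] by (simp add: subs_def)
  then show "H \<in> subs_h m \<Longrightarrow> m \<ge> 1 \<Longrightarrow> idx G (?P H) = card (a_rcosets H)" by (simp add: subs_h_def)
  show "bij_betw ?P (\<Union>m\<in>{1..}. subs_h m) (\<Union>m\<in>{1..}. subs m)"
  proof (rule bij_betw_imageI)
    show "inj_on ?P (\<Union>m\<in>{1..}. subs_h m)"
    proof (rule inj_onI)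
      fix H H' assume "H \<in> (\<Union>m\<in>{1..}. subs_h m)" "H' \<in> (\<Union>m\<in>{1..}. subs_h m)" and eq: "?P H = ?P H'"
      then obtain m m' where *: "m \<ge> 1" "H \<in> subs_h m" "m' \<ge> 1" "H' \<in> subs_h m'" by auto
      then have "m = m'" using idx[of H m] idx[of H' m'] eq by simp
      then show "H = H'" using * eq bij_betw_imp_inj_on[OF bij_subs[OF *(1)]] unfolding inj_on_def by blast
    qed
    show "?P ` (\<Union>m\<in>{1..}. subs_h m) = (\<Union>m\<in>{1..}. subs m)"
      using bij_betw_imp_surj_on[OF bij_subs] by (simp add: image_UN)
  qed
qed

end

section \<open>Completions\<close>

text \<open>The field \<open>F\<close> is the quotient of the ring of type \<open>'r\<close> by \<open>Z\<close>, so that sequences in \<open>F\<close> can be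
  represented by sequences in \<open>'r\<close>.\<close>

locale valued_completion = field F + max_ideal Z
  for F :: "('a, 'b) ring_scheme" (structure) and Z :: "'r::comm_ring_1 set" +
  fixes \<alpha> :: "'a \<Rightarrow> real" and \<iota> :: "'r \<Rightarrow> 'a"
  assumes \<iota>_range: "carrier F = range \<iota>" and \<iota>_add: "\<iota> (x + y) = \<iota> x \<oplus> \<iota> y" and \<iota>_mult: "\<iota> (x * y) = \<iota> x \<otimes> \<iota> y"
    and \<iota>_one: "\<iota> 1 = \<one>" and b_val: "val Z (\<lambda>x. \<alpha> (\<iota> x))"
    and divisible: "n > 0 \<Longrightarrow> \<exists>y. x = of_nat n * y" and of_nat_Z: "n > 0 \<Longrightarrow> of_nat n \<notin> Z"
begin

abbreviation b :: "'r \<Rightarrow> real" where "b x \<equiv> \<alpha> (\<iota> x)"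
abbreviation "CR \<equiv> cauchy_ring F \<alpha>"
abbreviation "N \<equiv> null_seqs F \<alpha>"
abbreviation "Kh \<equiv> completion F \<alpha>"
abbreviation "Oh \<equiv> valuation_ring F \<alpha>"

definition cauchy :: "(nat \<Rightarrow> 'r) \<Rightarrow> bool" where
  "cauchy s \<longleftrightarrow> (\<forall>\<epsilon>>0. \<exists>N. \<forall>m\<ge>N. \<forall>n\<ge>N. b (s m - s n) < \<epsilon>)"

definition sq :: "(nat \<Rightarrow> 'r) \<Rightarrow> nat \<Rightarrow> 'a" where "sq s n = \<iota> (s n)"

lemma \<iota>_closed: "\<iota> x \<in> carrier F" using \<iota>_range by blast

lemma \<iota>_zero: "\<iota> 0 = \<zero>"
proof -
  have "\<iota> 0 \<oplus> \<iota> 0 = \<iota> 0 \<oplus> \<zero>" using \<iota>_add[of 0 0] \<iota>_closed by simp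
  then show ?thesis using \<iota>_closed by simp
qed

lemma \<iota>_minus: "\<iota> (- x) = \<ominus> \<iota> x"
  using \<iota>_add[of "- x" x] \<iota>_zero \<iota>_closed by (simp add: minus_equality)

lemma \<iota>_diff: "\<iota> (x - y) = \<iota> x \<ominus> \<iota> y"
  using \<iota>_add[of x "- y"] \<iota>_minus by (simp add: minus_eq)

lemma CR_carrier: "carrier CR = {sq s | s. cauchy s}"
proof (intro subset_antisym subsetI)
  fix x assume x: "x \<in> carrier CR"
  then have "\<forall>n. \<exists>y. x n = \<iota> y" using \<iota>_range by (auto simp: cauchy_ring_def)
  then obtain s where "\<And>n. x n = \<iota> (s n)" by metis
  then have "x = sq s" by (auto simp: sq_def)
  moreover have "cauchy s" using x unfolding \<open>x = sq s\<close> cauchy_def cauchy_ring_def by (simp add: sq_def \<iota>_diff)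
  ultimately show "x \<in> {sq s | s. cauchy s}" by blast
next
  fix x assume "x \<in> {sq s | s. cauchy s}"
  then show "x \<in> carrier CR" unfolding cauchy_def cauchy_ring_def by (auto simp: sq_def \<iota>_diff \<iota>_closed)
qed

lemma CR_ops:
  "x \<otimes>\<^bsub>CR\<^esub> y = (\<lambda>n. x n \<otimes> y n)" "x \<oplus>\<^bsub>CR\<^esub> y = (\<lambda>n. x n \<oplus> y n)" "\<one>\<^bsub>CR\<^esub> = sq (\<lambda>_. 1)" "\<zero>\<^bsub>CR\<^esub> = sq (\<lambda>_. 0)"
  by (simp_all add: cauchy_ring_def sq_def[abs_def] \<iota>_one \<iota>_zero)

lemma sq_ops: "sq s \<otimes>\<^bsub>CR\<^esub> sq t = sq (\<lambda>n. s n * t n)" "sq s \<oplus>\<^bsub>CR\<^esub> sq t = sq (\<lambda>n. s n + t n)"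
  unfolding CR_ops by (simp_all add: sq_def[abs_def] \<iota>_mult \<iota>_add)

lemma cauchy_const: "cauchy (\<lambda>_. x)"
  unfolding cauchy_def using val_eq_0[OF b_val, of 0] subgp_zero[OF Z_subgp] by simp

lemma cauchy_bounded: assumes "cauchy s" shows "\<exists>C>0. \<exists>N. \<forall>n\<ge>N. b (s n) \<le> C"
proof -
  obtain N where N: "\<And>m n. m \<ge> N \<Longrightarrow> n \<ge> N \<Longrightarrow> b (s m - s n) < 1" using assms[unfolded cauchy_def, THEN spec, of 1] by auto
  have "b (s n) \<le> max 1 (b (s N))" if "n \<ge> N" for n
    using val_add[OF b_val, of "s n - s N" "s N"] N[OF that order_refl] by (simp add: max_def split: if_splits)
  then show ?thesis by (intro exI[of _ "max 1 (b (s N))"]) auto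
qed

lemma cauchy_add: assumes "cauchy s" "cauchy t" shows "cauchy (\<lambda>n. s n + t n)"
  unfolding cauchy_def
proof (intro allI impI)
  fix \<epsilon> :: real assume "\<epsilon> > 0"
  then obtain N N' where N: "\<And>m n. m \<ge> N \<Longrightarrow> n \<ge> N \<Longrightarrow> b (s m - s n) < \<epsilon>" "\<And>m n. m \<ge> N' \<Longrightarrow> n \<ge> N' \<Longrightarrow> b (t m - t n) < \<epsilon>"
    using assms unfolding cauchy_def by meson
  have "b ((s m + t m) - (s n + t n)) < \<epsilon>" if "m \<ge> max N N'" "n \<ge> max N N'" for m n
    using val_add[OF b_val, of "s m - s n" "t m - t n"] N(1)[of m n] N(2)[of m n] that by (simp add: algebra_simps)
  then show "\<exists>N. \<forall>m\<ge>N. \<forall>n\<ge>N. b ((s m + t m) - (s n + t n)) < \<epsilon>" by blast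
qed

lemma cauchy_mult: assumes "cauchy s" "cauchy t" shows "cauchy (\<lambda>n. s n * t n)"
  unfolding cauchy_def
proof (intro allI impI)
  fix \<epsilon> :: real assume e: "\<epsilon> > 0"
  obtain C N0 where C: "C > 0" "\<And>n. n \<ge> N0 \<Longrightarrow> b (s n) \<le> C" using cauchy_bounded[OF assms(1)] by blast
  obtain C' N0' where C': "C' > 0" "\<And>n. n \<ge> N0' \<Longrightarrow> b (t n) \<le> C'" using cauchy_bounded[OF assms(2)] by blast
  have "\<epsilon> / C > 0" "\<epsilon> / C' > 0" using e C C' by auto
  then obtain N N' where N: "\<And>m n. m \<ge> N \<Longrightarrow> n \<ge> N \<Longrightarrow> b (s m - s n) < \<epsilon> / C'" "\<And>m n. m \<ge> N' \<Longrightarrow> n \<ge> N' \<Longrightarrow> b (t m - t n) < \<epsilon> / C"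
    using assms unfolding cauchy_def by meson
  let ?M = "max (max N N') (max N0 N0')"
  have "b (s m * t m - s n * t n) < \<epsilon>" if mn: "m \<ge> ?M" "n \<ge> ?M" for m n
  proof -
    have "b ((s m - s n) * t m) < \<epsilon>"
    proof -
      have "b ((s m - s n) * t m) \<le> b (s m - s n) * C'"
        unfolding val_mult[OF b_val] using C'(2)[of m] mn val_nonneg[OF b_val] by (intro mult_left_mono) auto
      also have "\<dots> < \<epsilon>" using N(1)[of m n] mn C'(1) by (simp add: field_simps)
      finally show ?thesis .
    qed
    moreover have "b (s n * (t m - t n)) < \<epsilon>"
    proof -
      have "b (s n * (t m - t n)) \<le> C * b (t m - t n)"
        unfolding val_mult[OF b_val] using C(2)[of n] mn val_nonneg[OF b_val] by (intro mult_right_mono) auto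
      also have "\<dots> < \<epsilon>" using N(2)[of m n] mn C(1) by (simp add: field_simps)
      finally show ?thesis .
    qed
    ultimately have "b ((s m - s n) * t m + s n * (t m - t n)) < \<epsilon>"
      by (intro le_less_trans[OF val_add[OF b_val]]) simp
    then show ?thesis by (simp add: algebra_simps)
  qed
  then show "\<exists>N. \<forall>m\<ge>N. \<forall>n\<ge>N. b (s m * t m - s n * t n) < \<epsilon>" by blast
qed

lemma cauchy_minus: "cauchy s \<Longrightarrow> cauchy (\<lambda>n. - s n)"
  using cauchy_mult[OF cauchy_const[of "- 1"], of s] by simp

lemma cauchy_diff: "cauchy s \<Longrightarrow> cauchy t \<Longrightarrow> cauchy (\<lambda>n. s n - t n)"
  using cauchy_add[OF _ cauchy_minus, of s t] by simp

lemma cring_CR: "cring CR"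
proof (rule cringI)
  show "abelian_group CR"
  proof (rule abelian_groupI)
    show "x \<oplus>\<^bsub>CR\<^esub> y \<in> carrier CR" if "x \<in> carrier CR" "y \<in> carrier CR" for x y
      using that cauchy_add unfolding CR_carrier by (force simp: sq_ops)
    show "\<zero>\<^bsub>CR\<^esub> \<in> carrier CR" unfolding CR_carrier CR_ops using cauchy_const by blast
    show "x \<oplus>\<^bsub>CR\<^esub> y \<oplus>\<^bsub>CR\<^esub> z = x \<oplus>\<^bsub>CR\<^esub> (y \<oplus>\<^bsub>CR\<^esub> z)" if "x \<in> carrier CR" "y \<in> carrier CR" "z \<in> carrier CR" for x y z
      using that unfolding CR_carrier by (auto simp: sq_ops add.assoc)
    show "x \<oplus>\<^bsub>CR\<^esub> y = y \<oplus>\<^bsub>CR\<^esub> x" if "x \<in> carrier CR" "y \<in> carrier CR" for x y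
      using that unfolding CR_carrier by (auto simp: sq_ops add.commute)
    show "\<zero>\<^bsub>CR\<^esub> \<oplus>\<^bsub>CR\<^esub> x = x" if "x \<in> carrier CR" for x
      using that unfolding CR_carrier CR_ops(4) by (auto simp: sq_ops)
    show "\<exists>y\<in>carrier CR. y \<oplus>\<^bsub>CR\<^esub> x = \<zero>\<^bsub>CR\<^esub>" if x: "x \<in> carrier CR" for x
    proof -
      obtain s where s: "x = sq s" "cauchy s" using x unfolding CR_carrier by blast
      then have "sq (\<lambda>n. - s n) \<oplus>\<^bsub>CR\<^esub> x = \<zero>\<^bsub>CR\<^esub>" by (simp only: sq_ops CR_ops(4)) simp
      then show ?thesis unfolding CR_carrier using cauchy_minus[OF s(2)] by blast
    qed
  qed
  show "Group.comm_monoid CR"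
  proof (rule comm_monoidI)
    show "x \<otimes>\<^bsub>CR\<^esub> y \<in> carrier CR" if "x \<in> carrier CR" "y \<in> carrier CR" for x y
      using that cauchy_mult unfolding CR_carrier by (force simp: sq_ops)
    show "\<one>\<^bsub>CR\<^esub> \<in> carrier CR" unfolding CR_carrier CR_ops using cauchy_const by blast
    show "x \<otimes>\<^bsub>CR\<^esub> y \<otimes>\<^bsub>CR\<^esub> z = x \<otimes>\<^bsub>CR\<^esub> (y \<otimes>\<^bsub>CR\<^esub> z)" if "x \<in> carrier CR" "y \<in> carrier CR" "z \<in> carrier CR" for x y z
      using that unfolding CR_carrier by (auto simp: sq_ops mult.assoc)
    show "x \<otimes>\<^bsub>CR\<^esub> y = y \<otimes>\<^bsub>CR\<^esub> x" if "x \<in> carrier CR" "y \<in> carrier CR" for x y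
      using that unfolding CR_carrier by (auto simp: sq_ops mult.commute)
    show "\<one>\<^bsub>CR\<^esub> \<otimes>\<^bsub>CR\<^esub> x = x" if "x \<in> carrier CR" for x
      using that unfolding CR_carrier CR_ops(3) by (auto simp: sq_ops)
  qed
  show "(x \<oplus>\<^bsub>CR\<^esub> y) \<otimes>\<^bsub>CR\<^esub> z = x \<otimes>\<^bsub>CR\<^esub> z \<oplus>\<^bsub>CR\<^esub> y \<otimes>\<^bsub>CR\<^esub> z"
    if "x \<in> carrier CR" "y \<in> carrier CR" "z \<in> carrier CR" for x y z
    using that unfolding CR_carrier by (auto simp: sq_ops distrib_right)
qed

lemma sq_carrier: "cauchy s \<Longrightarrow> sq s \<in> carrier CR"
  unfolding CR_carrier by blast

lemma N_eq: "N = {sq s | s. cauchy s \<and> (\<lambda>n. b (s n)) \<longlonglongrightarrow> 0}"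
  unfolding null_seqs_def CR_carrier by (auto simp: sq_def)

lemma sq_eqD: assumes "sq s = sq t" shows "b (s n - u) = b (t n - u)"
  using fun_cong[OF assms, of n] by (simp add: sq_def \<iota>_diff)

lemma sq_N: assumes "cauchy s" shows "sq s \<in> N \<longleftrightarrow> (\<lambda>n. b (s n)) \<longlonglongrightarrow> 0"
proof
  assume "sq s \<in> N"
  then obtain t where "sq s = sq t" "(\<lambda>n. b (t n)) \<longlonglongrightarrow> 0" by (auto simp: N_eq)
  then show "(\<lambda>n. b (s n)) \<longlonglongrightarrow> 0" using sq_eqD[of s t _ 0] by simp
qed (use assms N_eq in blast)

lemma tendsto_0_le:
  assumes "f \<longlonglongrightarrow> 0" "\<And>n. 0 \<le> g n" "\<And>n. g n \<le> (f n :: real)" shows "g \<longlonglongrightarrow> 0"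
  using tendsto_sandwich[of "\<lambda>_. 0" g sequentially f 0] assms by simp

lemma null_add: assumes "(\<lambda>n. b (s n)) \<longlonglongrightarrow> 0" "(\<lambda>n. b (t n)) \<longlonglongrightarrow> 0" shows "(\<lambda>n. b (s n + t n)) \<longlonglongrightarrow> 0"
proof (rule tendsto_0_le)
  show "(\<lambda>n. max (b (s n)) (b (t n))) \<longlonglongrightarrow> 0" using tendsto_max[OF assms] by simp
qed (use val_nonneg[OF b_val] val_add[OF b_val] in auto)

lemma null_mult: assumes "(\<lambda>n. b (s n)) \<longlonglongrightarrow> 0" "cauchy t" shows "(\<lambda>n. b (t n * s n)) \<longlonglongrightarrow> 0"
proof -
  obtain C M where C: "C > 0" "\<And>n. n \<ge> M \<Longrightarrow> b (t n) \<le> C" using cauchy_bounded[OF assms(2)] by blast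
  have "(\<lambda>n. C * b (s n)) \<longlonglongrightarrow> C * 0" by (intro tendsto_mult assms(1) tendsto_const)
  moreover have "\<forall>\<^sub>F n in sequentially. b (t n * s n) \<le> C * b (s n)"
    unfolding eventually_sequentially val_mult[OF b_val] using C val_nonneg[OF b_val] by (intro exI[of _ M]) (auto intro: mult_right_mono)
  ultimately show ?thesis
    using tendsto_sandwich[of "\<lambda>_. 0" "\<lambda>n. b (t n * s n)" sequentially "\<lambda>n. C * b (s n)" 0] val_nonneg[OF b_val] by simp
qed

sublocale CR: cring CR by (rule cring_CR)

lemma CR_minus: "cauchy s \<Longrightarrow> \<ominus>\<^bsub>CR\<^esub> sq s = sq (\<lambda>n. - s n)"
proof (rule CR.minus_equality)
  show "sq (\<lambda>n. - s n) \<oplus>\<^bsub>CR\<^esub> sq s = \<zero>\<^bsub>CR\<^esub>" if "cauchy s" by (simp only: sq_ops CR_ops(4)) simp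
qed (simp_all add: sq_carrier cauchy_minus)

lemma ideal_N: "ideal N CR"
proof (rule idealI)
  show "ring CR" by (rule CR.ring_axioms)
  show "subgroup N (add_monoid CR)"
  proof (rule CR.add.subgroupI)
    show "N \<subseteq> carrier CR" unfolding N_eq CR_carrier by blast
    have "sq (\<lambda>_. 0) \<in> N" using val_eq_0[OF b_val, of 0] subgp_zero[OF Z_subgp] by (simp add: sq_N[OF cauchy_const])
    then show "N \<noteq> {}" by blast
    fix x assume "x \<in> N"
    then obtain s where s: "x = sq s" "cauchy s" "(\<lambda>n. b (s n)) \<longlonglongrightarrow> 0" unfolding N_eq by blast
    show "\<ominus>\<^bsub>CR\<^esub> x \<in> N" using s by (simp add: CR_minus sq_N[OF cauchy_minus] val_minus[OF b_val])
    fix y assume "y \<in> N"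
    then obtain t where t: "y = sq t" "cauchy t" "(\<lambda>n. b (t n)) \<longlonglongrightarrow> 0" unfolding N_eq by blast
    show "x \<oplus>\<^bsub>CR\<^esub> y \<in> N" using s t by (simp add: sq_ops sq_N[OF cauchy_add] null_add)
  qed
  fix x y assume "x \<in> N" "y \<in> carrier CR"
  then obtain s t where "x = sq s" "cauchy s" "(\<lambda>n. b (s n)) \<longlonglongrightarrow> 0" "y = sq t" "cauchy t" unfolding N_eq CR_carrier by blast
  then show "y \<otimes>\<^bsub>CR\<^esub> x \<in> N" "x \<otimes>\<^bsub>CR\<^esub> y \<in> N"
    using null_mult[of s t] by (simp_all add: sq_ops sq_N[OF cauchy_mult] mult.commute)
qed

sublocale NI: ideal N CR by (rule ideal_N)

definition lim_class :: "(nat \<Rightarrow> 'r) \<Rightarrow> (nat \<Rightarrow> 'a) set" where "lim_class s = N +>\<^bsub>CR\<^esub> sq s"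

lemma Kh_carrier: "carrier Kh = {lim_class s | s. cauchy s}"
  unfolding completion_def FactRing_def A_RCOSETS_def' lim_class_def by (auto simp: CR_carrier)

lemma lim_class_ops:
  assumes "cauchy s" "cauchy t"
  shows "lim_class s \<oplus>\<^bsub>Kh\<^esub> lim_class t = lim_class (\<lambda>n. s n + t n)"
    "lim_class s \<otimes>\<^bsub>Kh\<^esub> lim_class t = lim_class (\<lambda>n. s n * t n)"
  using NI.a_rcos_sum[OF sq_carrier[OF assms(1)] sq_carrier[OF assms(2)]]
    NI.rcoset_mult_add[OF sq_carrier[OF assms(1)] sq_carrier[OF assms(2)]]
  by (simp_all add: completion_def FactRing_def lim_class_def sq_ops)

lemma lim_class_eq:
  assumes "cauchy s" "cauchy t"
  shows "lim_class s = lim_class t \<longleftrightarrow> (\<lambda>n. b (s n - t n)) \<longlonglongrightarrow> 0"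
proof -
  have "lim_class s = lim_class t \<longleftrightarrow> sq s \<in> N +>\<^bsub>CR\<^esub> sq t"
    using NI.a_repr_independence'[OF _ sq_carrier[OF assms(2)], of "sq s"] NI.a_rcos_self[OF sq_carrier[OF assms(1)]]
    by (auto simp: lim_class_def)
  also have "\<dots> \<longleftrightarrow> sq s \<oplus>\<^bsub>CR\<^esub> \<ominus>\<^bsub>CR\<^esub> sq t \<in> N" by (rule NI.a_rcos_module[OF sq_carrier[OF assms(2)] sq_carrier[OF assms(1)]])
  also have "sq s \<oplus>\<^bsub>CR\<^esub> \<ominus>\<^bsub>CR\<^esub> sq t = sq (\<lambda>n. s n - t n)" by (simp add: CR_minus[OF assms(2)] sq_ops)
  finally show ?thesis by (simp add: sq_N[OF cauchy_diff[OF assms]])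
qed

lemma Kh_consts: "\<zero>\<^bsub>Kh\<^esub> = lim_class (\<lambda>_. 0)" "\<one>\<^bsub>Kh\<^esub> = lim_class (\<lambda>_. 1)"
proof -
  have "sq (\<lambda>_. 0) \<in> N" using val_eq_0[OF b_val, of 0] subgp_zero[OF Z_subgp] by (simp add: sq_N[OF cauchy_const])
  then show "\<zero>\<^bsub>Kh\<^esub> = lim_class (\<lambda>_. 0)"
    using NI.a_rcos_const by (simp add: completion_def FactRing_def lim_class_def)
  show "\<one>\<^bsub>Kh\<^esub> = lim_class (\<lambda>_. 1)" by (simp add: completion_def FactRing_def lim_class_def CR_ops)
qed

lemma cring_Kh: "cring Kh"
  unfolding completion_def by (rule NI.quotient_is_cring[OF cring_CR])

sublocale Kh: cring Kh by (rule cring_Kh)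

lemma abs_diff_le: "\<bar>b x - b y\<bar> \<le> b (x - y)"
proof -
  have "b x \<le> b y + b (x - y)" for x y
    using val_add[OF b_val, of "x - y" y] val_nonneg[OF b_val, of "x - y"] val_nonneg[OF b_val, of y]
    by (auto simp: max_def split: if_splits)
  from this[of x y] this[of y x] show ?thesis using val_minus[OF b_val, of "x - y"] by (simp add: abs_le_iff)
qed

lemma cauchy_convergent: assumes "cauchy s" shows "\<exists>L. (\<lambda>n. b (s n)) \<longlonglongrightarrow> L"
proof -
  have "Cauchy (\<lambda>n. b (s n))"
  proof (rule CauchyI)
    fix e :: real assume "0 < e"
    then obtain M where "\<And>m n. m \<ge> M \<Longrightarrow> n \<ge> M \<Longrightarrow> b (s m - s n) < e" using assms unfolding cauchy_def by meson
    then show "\<exists>M. \<forall>m\<ge>M. \<forall>n\<ge>M. norm (b (s m) - b (s n)) < e"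
      using abs_diff_le by (metis le_less_trans real_norm_def)
  qed
  then show ?thesis using Cauchy_convergent convergent_def by blast
qed

text \<open>Representatives of a class differ by null sequences, and \<open>abs_diff_le\<close>
  transfers the limit between them; this justifies the \<open>THE\<close> in
  \<open>completion_abs\<close>.\<close>

lemma completion_abs: assumes "cauchy s" "(\<lambda>n. b (s n)) \<longlonglongrightarrow> L" shows "completion_abs \<alpha> (lim_class s) = L"
  unfolding completion_abs_def
proof (rule the_equality)
  show lim: "\<forall>x\<in>lim_class s. (\<lambda>n. \<alpha> (x n)) \<longlonglongrightarrow> L"
  proof
    fix x assume x: "x \<in> lim_class s"
    then have "x \<in> carrier CR" using CR.a_r_coset_subset_G[OF NI.a_subset sq_carrier[OF assms(1)]]
      unfolding lim_class_def by blast
    then obtain t where t: "x = sq t" "cauchy t" unfolding CR_carrier by blast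
    have "lim_class s = lim_class t" using x NI.a_repr_independence'[OF _ sq_carrier[OF assms(1)]] unfolding lim_class_def t(1) by blast
    then have "(\<lambda>n. b (s n - t n)) \<longlonglongrightarrow> 0" using lim_class_eq[OF assms(1) t(2)] by simp
    then have "(\<lambda>n. \<bar>b (s n) - b (t n)\<bar>) \<longlonglongrightarrow> 0" by (rule tendsto_0_le) (auto intro: abs_diff_le)
    then have "(\<lambda>n. b (s n) - b (t n)) \<longlonglongrightarrow> 0" by (rule tendsto_rabs_zero_cancel)
    from tendsto_diff[OF assms(2) this] show "(\<lambda>n. \<alpha> (x n)) \<longlonglongrightarrow> L" by (simp add: t(1) sq_def)
  qed
  fix r assume "\<forall>x\<in>lim_class s. (\<lambda>n. \<alpha> (x n)) \<longlonglongrightarrow> r"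
  moreover have "sq s \<in> lim_class s" unfolding lim_class_def by (rule NI.a_rcos_self[OF sq_carrier[OF assms(1)]])
  ultimately show "r = L" using lim LIMSEQ_unique by blast
qed

definition integral_seq :: "(nat \<Rightarrow> 'r) \<Rightarrow> bool" where
  "integral_seq s \<longleftrightarrow> cauchy s \<and> (\<exists>M. \<forall>n\<ge>M. b (s n) \<le> 1)"

text \<open>By the ultrametric inequality, absolute values along a Cauchy sequence eventually become
  constant unless they tend to zero.\<close>

lemma integral_seq_iff: assumes "cauchy s" shows "integral_seq s \<longleftrightarrow> completion_abs \<alpha> (lim_class s) \<le> 1"
proof -
  obtain L where L: "(\<lambda>n. b (s n)) \<longlonglongrightarrow> L" using cauchy_convergent[OF assms] by blast
  have "(\<exists>M. \<forall>n\<ge>M. b (s n) \<le> 1) \<longleftrightarrow> L \<le> 1"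
  proof
    assume "\<exists>M. \<forall>n\<ge>M. b (s n) \<le> 1"
    then show "L \<le> 1" using LIMSEQ_le_const2[OF L] by blast
  next
    assume "L \<le> 1"
    obtain M where M: "\<And>m n. m \<ge> M \<Longrightarrow> n \<ge> M \<Longrightarrow> b (s m - s n) < 1" using assms[unfolded cauchy_def, THEN spec, of 1] by auto
    have "b (s n) \<le> 1" if "n \<ge> M" for n
    proof (rule ccontr)
      assume *: "\<not> b (s n) \<le> 1"
      have "b (s m) = b (s n)" if "m \<ge> M" for m
        using val_dominant[OF b_val, of "s m - s n" "s n"] M[OF that \<open>n \<ge> M\<close>] * by simp
      then have "(\<lambda>m. b (s m)) \<longlonglongrightarrow> b (s n)"
        by (intro tendsto_eventually) (auto simp: eventually_sequentially)
      then show False using LIMSEQ_unique[OF L] \<open>L \<le> 1\<close> * by simp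
    qed
    then show "\<exists>M. \<forall>n\<ge>M. b (s n) \<le> 1" by blast
  qed
  then show ?thesis using assms by (simp add: integral_seq_def completion_abs[OF assms L])
qed

lemma Oh_carrier: "carrier Oh = {lim_class s | s. integral_seq s}"
proof -
  have "carrier Oh = {lim_class s | s. cauchy s \<and> completion_abs \<alpha> (lim_class s) \<le> 1}"
    unfolding valuation_ring_def by (auto simp: Kh_carrier)
  also have "\<dots> = {lim_class s | s. integral_seq s}"
    using integral_seq_iff by (metis integral_seq_def)
  finally show ?thesis .
qed

lemma Oh_simps: "x \<oplus>\<^bsub>Oh\<^esub> y = x \<oplus>\<^bsub>Kh\<^esub> y" "x \<otimes>\<^bsub>Oh\<^esub> y = x \<otimes>\<^bsub>Kh\<^esub> y" "\<zero>\<^bsub>Oh\<^esub> = \<zero>\<^bsub>Kh\<^esub>" "\<one>\<^bsub>Oh\<^esub> = \<one>\<^bsub>Kh\<^esub>"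
  by (simp_all add: valuation_ring_def)

lemma integral_seqD: "integral_seq s \<Longrightarrow> cauchy s" by (simp add: integral_seq_def)

lemma integral_const: "b x \<le> 1 \<Longrightarrow> integral_seq (\<lambda>_. x)"
  by (auto simp: integral_seq_def cauchy_const)

lemma integral_add: assumes "integral_seq s" "integral_seq t" shows "integral_seq (\<lambda>n. s n + t n)"
proof -
  obtain M M' where "\<And>n. n \<ge> M \<Longrightarrow> b (s n) \<le> 1" "\<And>n. n \<ge> M' \<Longrightarrow> b (t n) \<le> 1" using assms by (auto simp: integral_seq_def)
  then have "\<forall>n\<ge>max M M'. b (s n + t n) \<le> 1" using order_trans[OF val_add[OF b_val]] by auto
  then have "\<exists>M. \<forall>n\<ge>M. b (s n + t n) \<le> 1" by (rule exI)
  then show ?thesis using cauchy_add assms by (simp add: integral_seq_def)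
qed

lemma integral_mult: assumes "integral_seq s" "integral_seq t" shows "integral_seq (\<lambda>n. s n * t n)"
proof -
  obtain M M' where "\<And>n. n \<ge> M \<Longrightarrow> b (s n) \<le> 1" "\<And>n. n \<ge> M' \<Longrightarrow> b (t n) \<le> 1" using assms by (auto simp: integral_seq_def)
  then have "\<forall>n\<ge>max M M'. b (s n * t n) \<le> 1" using val_mult_le_1[OF b_val] by auto
  then have "\<exists>M. \<forall>n\<ge>M. b (s n * t n) \<le> 1" by (rule exI)
  then show ?thesis using cauchy_mult assms by (simp add: integral_seq_def)
qed

lemma cring_Oh: "cring Oh"
proof -
  have Oh: "Oh = Kh\<lparr>carrier := carrier Oh\<rparr>" by (simp add: valuation_ring_def)
  have "subring (carrier Oh) Kh"
  proof (rule Kh.subringI)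
    show "carrier Oh \<subseteq> carrier Kh" by (auto simp: valuation_ring_def)
    show "\<one>\<^bsub>Kh\<^esub> \<in> carrier Oh" unfolding Kh_consts Oh_carrier using integral_const[of 1] val_one[OF b_val] by auto
    fix x assume "x \<in> carrier Oh"
    then obtain s where s: "x = lim_class s" "integral_seq s" unfolding Oh_carrier by blast
    have m1: "integral_seq (\<lambda>n. - s n)" using integral_mult[OF integral_const[of "- 1"] s(2)] val_one[OF b_val] val_minus[OF b_val, of 1] by simp
    have "lim_class (\<lambda>n. - s n) \<oplus>\<^bsub>Kh\<^esub> x = \<zero>\<^bsub>Kh\<^esub>"
      using lim_class_ops(1)[OF integral_seqD[OF m1] integral_seqD[OF s(2)]] by (simp add: s(1) Kh_consts)
    then have "\<ominus>\<^bsub>Kh\<^esub> x = lim_class (\<lambda>n. - s n)"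
      using s m1 by (intro Kh.minus_equality) (auto simp: Kh_carrier integral_seq_def)
    then show "\<ominus>\<^bsub>Kh\<^esub> x \<in> carrier Oh" using m1 unfolding Oh_carrier by blast
    fix y assume "y \<in> carrier Oh"
    then obtain t where t: "y = lim_class t" "integral_seq t" unfolding Oh_carrier by blast
    show "x \<otimes>\<^bsub>Kh\<^esub> y \<in> carrier Oh" "x \<oplus>\<^bsub>Kh\<^esub> y \<in> carrier Oh"
      using lim_class_ops[OF integral_seqD[OF s(2)] integral_seqD[OF t(2)]] integral_add[OF s(2) t(2)] integral_mult[OF s(2) t(2)]
      unfolding s(1) t(1) Oh_carrier by auto
  qed
  then have "subcring (carrier Oh) Kh" by (rule Kh.subcringI')
  then show ?thesis using Kh.subcring_iff Oh subcring.axioms by (metis \<open>subring (carrier Oh) Kh\<close> subringE(1))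
qed

sublocale Oh: cring Oh by (rule cring_Oh)

abbreviation e :: "'r \<Rightarrow> (nat \<Rightarrow> 'a) set" where "e x \<equiv> completion_emb F \<alpha> (\<iota> x)"

lemma e_eq: "e x = lim_class (\<lambda>_. x)"
  by (simp add: completion_emb_def lim_class_def sq_def[abs_def])

lemma e_ops: "e (x + y) = e x \<oplus>\<^bsub>Oh\<^esub> e y" "e (x * y) = e x \<otimes>\<^bsub>Oh\<^esub> e y" "e 0 = \<zero>\<^bsub>Oh\<^esub>" "e 1 = \<one>\<^bsub>Oh\<^esub>"
  using lim_class_ops[OF cauchy_const cauchy_const] by (simp_all add: e_eq Oh_simps Kh_consts)

lemma e_Oh: "e x \<in> carrier Oh \<longleftrightarrow> b x \<le> 1"
  using integral_seq_iff[OF cauchy_const, of x] completion_abs[OF cauchy_const tendsto_const, of x]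
  by (auto simp: e_eq valuation_ring_def Kh_carrier intro: cauchy_const)

lemma Oh_nat_mult: assumes "d \<in> carrier Oh" shows "[(m::nat)] \<cdot>\<^bsub>Oh\<^esub> d = e (of_nat m) \<otimes>\<^bsub>Oh\<^esub> d"
proof (induction m)
  case (Suc m)
  have "e (of_nat m) \<in> carrier Oh" "e 1 \<in> carrier Oh"
    unfolding e_Oh using val_of_nat[OF b_val] val_one[OF b_val] by auto
  then show ?case using Suc assms by (simp add: e_ops Oh.l_distr Oh.a_comm)
qed (use assms in \<open>simp add: e_ops\<close>)

text \<open>\<open>x\<close> is a late term of a sequence \<open>s\<close> converging to
  \<open>c\<close>. The differences \<open>s n - x\<close> eventually have smaller value than
  \<open>m\<close>, so dividing them by \<open>m\<close> gives an integral Cauchy sequence.\<close>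

lemma Oh_dense:
  assumes c: "c \<in> carrier Oh" and m: "m \<ge> (1::nat)"
  shows "\<exists>x\<in>vring b. \<exists>d\<in>carrier Oh. c = e x \<oplus>\<^bsub>Oh\<^esub> [m] \<cdot>\<^bsub>Oh\<^esub> d"
proof -
  obtain s M where s: "c = lim_class s" "cauchy s" "\<And>n. n \<ge> M \<Longrightarrow> b (s n) \<le> 1" using c unfolding Oh_carrier integral_seq_def by blast
  have mZ: "(of_nat m :: 'r) \<notin> Z" using of_nat_Z[of m] m by simp
  have bm: "b (of_nat m) > 0" using val_pos[OF b_val mZ] .
  obtain M' where M': "\<And>k n. k \<ge> M' \<Longrightarrow> n \<ge> M' \<Longrightarrow> b (s k - s n) < b (of_nat m)" using s(2) bm unfolding cauchy_def by meson
  define x where "x = s (max M M')"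
  have bx: "b x \<le> 1" using s(3)[of "max M M'"] by (simp add: x_def)
  have "\<exists>y. s n - x = of_nat m * y" for n using divisible[of m] m by simp
  then obtain t where t: "\<And>n. s n - x = of_nat m * t n" by metis
  have bt: "b (of_nat m) * b (t n - t k) = b (s n - s k)" for n k
  proof -
    have "of_nat m * (t n - t k) = s n - s k" by (simp add: right_diff_distrib flip: t)
    then show ?thesis by (metis val_mult[OF b_val])
  qed
  have bt': "b (of_nat m) * b (t n) = b (s n - x)" for n by (simp add: t val_mult[OF b_val])
  have "cauchy t" unfolding cauchy_def
  proof (intro allI impI)
    fix \<epsilon> :: real assume "\<epsilon> > 0"
    then have "\<epsilon> * b (of_nat m) > 0" using bm by simp
    then obtain K where "\<And>k n. k \<ge> K \<Longrightarrow> n \<ge> K \<Longrightarrow> b (s k - s n) < \<epsilon> * b (of_nat m)" using s(2) unfolding cauchy_def by meson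
    then have "b (of_nat m) * b (t k - t n) < b (of_nat m) * \<epsilon>" if "k \<ge> K" "n \<ge> K" for k n
      using that by (simp add: bt mult.commute)
    then have "b (t k - t n) < \<epsilon>" if "k \<ge> K" "n \<ge> K" for k n using that bm by (simp add: mult_less_cancel_left_pos)
    then show "\<exists>N. \<forall>m\<ge>N. \<forall>n\<ge>N. b (t m - t n) < \<epsilon>" by blast
  qed
  moreover have "b (t n) \<le> 1" if "n \<ge> M'" for n
  proof -
    have "b (of_nat m) * b (t n) \<le> b (of_nat m) * 1" using M'[OF that, of "max M M'"] by (simp add: bt' x_def)
    then show ?thesis using bm by (simp add: mult_le_cancel_left_pos)
  qed
  ultimately have it: "integral_seq t" by (auto simp: integral_seq_def)
  then have d: "lim_class t \<in> carrier Oh" unfolding Oh_carrier by blast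
  have "e x \<oplus>\<^bsub>Oh\<^esub> [m] \<cdot>\<^bsub>Oh\<^esub> lim_class t = lim_class (\<lambda>n. x + of_nat m * t n)"
    unfolding Oh_nat_mult[OF d] Oh_simps e_eq
    using lim_class_ops cauchy_const \<open>cauchy t\<close> cauchy_mult by simp
  also have "(\<lambda>n. x + of_nat m * t n) = s" by (simp flip: t)
  finally show ?thesis using s(1) bx d by (intro bexI[of _ x] bexI[of _ "lim_class t"]) auto
qed

text \<open>Some \<open>of_nat m * s n\<close> with integral \<open>s n\<close> differs from
  \<open>x\<close> by less than the value of \<open>m\<close>. Hence the value of \<open>x\<close>
  is at most that of \<open>m\<close>, and \<open>x / m\<close> is integral.\<close>

lemma Oh_pure:
  assumes x: "b x \<le> 1" and d: "d \<in> carrier Oh" and m: "m \<ge> (1::nat)" and eq: "e x = [m] \<cdot>\<^bsub>Oh\<^esub> d"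
  shows "\<exists>y\<in>vring b. x = (\<Sum>i<m. y)"
proof -
  obtain y where y: "x = of_nat m * y" using divisible[of m x] m by auto
  have mZ: "(of_nat m :: 'r) \<notin> Z" using of_nat_Z[of m] m by simp
  obtain s M where s: "d = lim_class s" "cauchy s" "\<And>n. n \<ge> M \<Longrightarrow> b (s n) \<le> 1" using d unfolding Oh_carrier integral_seq_def by blast
  have "lim_class (\<lambda>_. x) = lim_class (\<lambda>n. of_nat m * s n)"
    using eq unfolding Oh_nat_mult[OF d] unfolding s(1) e_eq Oh_simps lim_class_ops(2)[OF cauchy_const s(2)] .
  then have "(\<lambda>n. b (x - of_nat m * s n)) \<longlonglongrightarrow> 0"
    using lim_class_eq[OF cauchy_const cauchy_mult[OF cauchy_const s(2)]] by blast
  then have "\<forall>\<^sub>F n in sequentially. b (x - of_nat m * s n) < b (of_nat m)"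
    using val_pos[OF b_val mZ] by (rule order_tendstoD(2))
  then obtain n where n: "n \<ge> M" "b (x - of_nat m * s n) < b (of_nat m)"
    unfolding eventually_sequentially by (metis le_cases)
  have "b (of_nat m * s n) \<le> b (of_nat m)"
    using s(3)[OF n(1)] val_nonneg[OF b_val] by (simp add: val_mult[OF b_val] mult_left_le)
  then have "b (x - of_nat m * s n + of_nat m * s n) \<le> b (of_nat m)"
    using n(2) by (intro order_trans[OF val_add[OF b_val]]) simp
  then have "b (of_nat m) * b y \<le> b (of_nat m) * 1" by (simp add: y val_mult[OF b_val])
  then have "b y \<le> 1" using val_pos[OF b_val mZ] by (simp add: mult_le_cancel_left_pos)
  then show ?thesis using y by (intro bexI[of _ y]) auto
qed

text \<open>A multiplier from the completion is replaced by an element of the dense ring that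
  differs from it by a multiple of \<open>m\<close>.\<close>

lemma dense_Oh: "dense_pair Oh (vring b) e {\<lambda>x. r * x | r. b r \<le> 1} {\<lambda>c. a \<otimes>\<^bsub>Oh\<^esub> c | a. a \<in> carrier Oh}"
proof (intro dense_pair.intro dense_pair_axioms.intro)
  show "abelian_group Oh" by (rule Oh.abelian_group_axioms)
  show "subgp (vring b)" by (rule subgp_vring[OF b_val])
  fix x y assume "x \<in> vring b" "y \<in> vring b"
  show "e x \<in> carrier Oh" using \<open>x \<in> vring b\<close> by (simp add: e_Oh)
  show "e (x + y) = e x \<oplus>\<^bsub>Oh\<^esub> e y" by (rule e_ops)
next
  show "\<exists>x\<in>vring b. \<exists>d\<in>carrier Oh. c = e x \<oplus>\<^bsub>Oh\<^esub> [m] \<cdot>\<^bsub>Oh\<^esub> d" if "c \<in> carrier Oh" "1 \<le> m" for c and m :: nat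
    using Oh_dense[OF that] .
  show "\<exists>y\<in>vring b. x = (\<Sum>i<m. y)" if "x \<in> vring b" "d \<in> carrier Oh" "1 \<le> m" "e x = [m] \<cdot>\<^bsub>Oh\<^esub> d" for x d and m :: nat
    using Oh_pure[OF _ that(2-4)] that(1) by simp
  show "f x \<in> vring b" if "f \<in> {\<lambda>x. r * x | r. b r \<le> 1}" "x \<in> vring b" for f x
    using that val_mult_le_1[OF b_val] by auto
  show "f c \<in> carrier Oh" if "f \<in> {\<lambda>c. a \<otimes>\<^bsub>Oh\<^esub> c | a. a \<in> carrier Oh}" "c \<in> carrier Oh" for f c
    using that by auto
  show "f (c \<oplus>\<^bsub>Oh\<^esub> d) = f c \<oplus>\<^bsub>Oh\<^esub> f d" if "f \<in> {\<lambda>c. a \<otimes>\<^bsub>Oh\<^esub> c | a. a \<in> carrier Oh}" "c \<in> carrier Oh" "d \<in> carrier Oh" for f c d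
    using that by (auto simp: Oh.r_distr)
  show "\<exists>f\<in>{\<lambda>x. r * x | r. b r \<le> 1}. \<forall>x\<in>vring b. \<exists>d\<in>carrier Oh. f' (e x) = e (f x) \<oplus>\<^bsub>Oh\<^esub> [m] \<cdot>\<^bsub>Oh\<^esub> d"
    if "f' \<in> {\<lambda>c. a \<otimes>\<^bsub>Oh\<^esub> c | a. a \<in> carrier Oh}" "1 \<le> m" for f' and m :: nat
  proof -
    note m = that(2)
    from that(1) obtain a where a: "f' = (\<lambda>c. a \<otimes>\<^bsub>Oh\<^esub> c)" "a \<in> carrier Oh" by blast
    obtain r d where r: "b r \<le> 1" "d \<in> carrier Oh" "a = e r \<oplus>\<^bsub>Oh\<^esub> [m] \<cdot>\<^bsub>Oh\<^esub> d" using Oh_dense[OF a(2) m] by blast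
    have r_x: "f' (e x) = e (r * x) \<oplus>\<^bsub>Oh\<^esub> [m] \<cdot>\<^bsub>Oh\<^esub> (d \<otimes>\<^bsub>Oh\<^esub> e x)" if "b x \<le> 1" for x
    proof -
      have c: "e x \<in> carrier Oh" "e r \<in> carrier Oh" "e (of_nat m) \<in> carrier Oh" using that r(1) val_of_nat[OF b_val] by (auto simp: e_Oh)
      then show ?thesis using r(2)
        by (simp add: a(1) r(3) e_ops Oh_nat_mult Oh.l_distr Oh.m_assoc)
    qed
    moreover have "d \<otimes>\<^bsub>Oh\<^esub> e x \<in> carrier Oh" if "b x \<le> 1" for x using that r(2) by (simp add: e_Oh)
    ultimately show ?thesis using r(1) by (intro bexI[of _ "\<lambda>x. r * x"]) auto
  qed
  show "\<exists>f'\<in>{\<lambda>c. a \<otimes>\<^bsub>Oh\<^esub> c | a. a \<in> carrier Oh}. \<forall>x\<in>vring b. f' (e x) = e (f x)"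
    if "f \<in> {\<lambda>x. r * x | r. b r \<le> 1}" for f
  proof -
    from that obtain r where r: "f = (\<lambda>x. r * x)" "b r \<le> 1" by blast
    then show ?thesis by (intro bexI[of _ "\<lambda>c. e r \<otimes>\<^bsub>Oh\<^esub> c"]) (auto simp: e_ops e_Oh)
  qed
qed

text \<open>With multiplications as operators, the stable subgroups of finite index are the ideals
  of finite index on both sides.\<close>

lemma ideal_zeta_eq: "ideal_zeta Oh s = infsum (\<lambda>J. npow (idx (vring b) J) s) (fin_ideals (vring b) Z)"
proof -
  interpret D: dense_pair Oh "vring b" e "{\<lambda>x. r * x | r. b r \<le> 1}" "{\<lambda>c. a \<otimes>\<^bsub>Oh\<^esub> c | a. a \<in> carrier Oh}"
    by (rule dense_Oh)
  have 1: "{I. ideal I Oh \<and> finite (a_rcosets\<^bsub>Oh\<^esub> I)} = (\<Union>m\<in>{1..}. D.subs_h m)"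
  proof (intro subset_antisym subsetI)
    fix I assume "I \<in> {I. ideal I Oh \<and> finite (a_rcosets\<^bsub>Oh\<^esub> I)}"
    then have I: "ideal I Oh" "finite (a_rcosets\<^bsub>Oh\<^esub> I)" by auto
    interpret I: ideal I Oh by (rule I(1))
    have "a_rcosets\<^bsub>Oh\<^esub> I \<noteq> {}" using Oh.zero_closed unfolding A_RCOSETS_def' by blast
    then have "card (a_rcosets\<^bsub>Oh\<^esub> I) \<ge> 1" using I(2) by (simp add: Suc_le_eq card_gt_0_iff)
    moreover have "I \<in> D.subs_h (card (a_rcosets\<^bsub>Oh\<^esub> I))"
      unfolding D.subs_h_def using I(2) I.a_subgroup I.I_l_closed by auto
    ultimately show "I \<in> (\<Union>m\<in>{1..}. D.subs_h m)" by auto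
  next
    fix I assume "I \<in> (\<Union>m\<in>{1..}. D.subs_h m)"
    then have I: "subgroup I (add_monoid Oh)" "\<And>a x. a \<in> carrier Oh \<Longrightarrow> x \<in> I \<Longrightarrow> a \<otimes>\<^bsub>Oh\<^esub> x \<in> I" "finite (a_rcosets\<^bsub>Oh\<^esub> I)"
      unfolding D.subs_h_def by auto
    have "ideal I Oh"
    proof (rule idealI[OF Oh.ring_axioms I(1)])
      fix a x assume "a \<in> I" "x \<in> carrier Oh"
      then show "x \<otimes>\<^bsub>Oh\<^esub> a \<in> I" using I(2) by blast
      moreover have "a \<in> carrier Oh" using \<open>a \<in> I\<close> subgroup.subset[OF I(1)] by auto
      ultimately show "a \<otimes>\<^bsub>Oh\<^esub> x \<in> I" using Oh.m_comm \<open>x \<in> carrier Oh\<close> by metis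
    qed
    then show "I \<in> {I. ideal I Oh \<and> finite (a_rcosets\<^bsub>Oh\<^esub> I)}" using I(3) by blast
  qed
  have 2: "(\<Union>m\<in>{1..}. D.subs m) = fin_ideals (vring b) Z"
  proof (intro subset_antisym subsetI)
    fix J assume "J \<in> (\<Union>m\<in>{1..}. D.subs m)"
    then have J: "subgp J" "J \<subseteq> vring b" "\<And>r x. b r \<le> 1 \<Longrightarrow> x \<in> J \<Longrightarrow> r * x \<in> J" "fin_idx (vring b) J"
      by (auto simp: D.subs_def)
    \<comment> \<open>\<open>z\<close> is the index of \<open>J\<close> times an element of value 0,
      and multiples of the index lie in \<open>J\<close>.\<close>
    have "z \<in> J" if z: "z \<in> Z" for z
    proof -
      let ?m = "idx (vring b) J"
      have m: "?m > 0" by (rule idx_pos[OF subgp_vring[OF b_val] J(4)])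
      obtain y where y: "z = of_nat ?m * y" using divisible[OF m] by blast
      have "b (of_nat ?m) * b y = 0" using y z val_eq_0[OF b_val, of z] by (simp add: val_mult[OF b_val])
      then have "b y = 0" using val_eq_0[OF b_val, of "of_nat ?m"] of_nat_Z[OF m] by simp
      then have "(\<Sum>i<?m. y) \<in> J" by (intro idx_kills[OF subgp_vring[OF b_val] J(1,2,4)]) simp
      then show ?thesis using y by simp
    qed
    then show "J \<in> fin_ideals (vring b) Z" using J unfolding fin_ideals_def by blast
  next
    fix J assume "J \<in> fin_ideals (vring b) Z"
    then have J: "J \<in> D.subs (idx (vring b) J)" "fin_idx (vring b) J" by (auto simp: fin_ideals_def D.subs_def)
    have "idx (vring b) J > 0" by (rule idx_pos[OF subgp_vring[OF b_val] J(2)])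
    then show "J \<in> (\<Union>m\<in>{1..}. D.subs m)" using J(1) by force
  qed
  have "infsum (\<lambda>J. npow (idx (vring b) J) s) (\<Union>m\<in>{1..}. D.subs m) =
      infsum (\<lambda>I. npow (idx (vring b) {x \<in> vring b. e x \<in> I}) s) (\<Union>m\<in>{1..}. D.subs_h m)"
    by (rule infsum_reindex_bij_betw[OF D.bij_subs_all(1), symmetric])
  also have "\<dots> = infsum (\<lambda>I. npow (card (a_rcosets\<^bsub>Oh\<^esub> I)) s) (\<Union>m\<in>{1..}. D.subs_h m)"
    by (rule infsum_cong) (use D.bij_subs_all(2) in auto)
  finally show ?thesis unfolding ideal_zeta_def 1 2 by simp
qed

end

section \<open>Row vectors\<close>

text \<open>Rows are functions, whose type is an additive group to which \<open>subgp\<close> and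
  \<open>idx\<close> apply; vanishing from \<open>n\<close> on makes the representation
  unique.\<close>

definition int_rows :: "('r::comm_ring_1 \<Rightarrow> real) \<Rightarrow> nat \<Rightarrow> (nat \<Rightarrow> 'r) set" where
  "int_rows a n = {x. (\<forall>i<n. a (x i) \<le> 1) \<and> (\<forall>i\<ge>n. x i = 0)}"

definition row_op :: "nat \<Rightarrow> (nat \<Rightarrow> nat \<Rightarrow> 'r::comm_ring_1) \<Rightarrow> (nat \<Rightarrow> 'r) \<Rightarrow> nat \<Rightarrow> 'r" where
  "row_op n B x = (\<lambda>j. if j < n then \<Sum>i<n. x i * B i j else 0)"

context max_ideal
begin

lemma subgp_int_rows: assumes "val Z b" shows "subgp (int_rows b n)"
  unfolding subgp_def int_rows_def
  using val_diff[OF assms] val_eq_0[OF assms, of 0] subgp_zero[OF Z_subgp] by (auto intro: order_trans[OF val_diff[OF assms]])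

lemma row_op_int_rows:
  assumes b: "val Z b" and B: "\<And>i j. i < n \<Longrightarrow> j < n \<Longrightarrow> b (B i j) \<le> 1" and x: "x \<in> int_rows b n"
  shows "row_op n B x \<in> int_rows b n"
  using x B by (auto simp: int_rows_def row_op_def intro!: val_sum[OF b] val_mult_le_1[OF b])

end

context valued_completion
begin

abbreviation "rowmod n \<equiv> row_module Oh n"

definition row_emb :: "nat \<Rightarrow> (nat \<Rightarrow> 'r) \<Rightarrow> (nat \<Rightarrow> 'a) set vec" where
  "row_emb n x = vec n (\<lambda>i. e (x i))"

lemma rowmod_carrier: "x \<in> carrier (rowmod n) \<longleftrightarrow> dim_vec x = n \<and> (\<forall>i<n. x $ i \<in> carrier Oh)"
  by (auto simp: row_module_def)

lemma rowmod_add: "x \<oplus>\<^bsub>rowmod n\<^esub> y = vec n (\<lambda>i. x $ i \<oplus>\<^bsub>Oh\<^esub> y $ i)"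
  by (simp add: row_module_def)

lemma rowmod_zero: "\<zero>\<^bsub>rowmod n\<^esub> = vec n (\<lambda>i. \<zero>\<^bsub>Oh\<^esub>)"
  by (simp add: row_module_def)

lemma rowmod_smult: "c \<odot>\<^bsub>rowmod n\<^esub> x = vec n (\<lambda>i. c \<otimes>\<^bsub>Oh\<^esub> x $ i)"
  by (simp add: row_module_def)

lemma abelian_group_rowmod: "abelian_group (rowmod n)"
proof (rule abelian_groupI)
  show "\<exists>y\<in>carrier (rowmod n). y \<oplus>\<^bsub>rowmod n\<^esub> x = \<zero>\<^bsub>rowmod n\<^esub>" if "x \<in> carrier (rowmod n)" for x
    using that by (intro bexI[of _ "vec n (\<lambda>i. \<ominus>\<^bsub>Oh\<^esub> x $ i)"])
      (auto simp: rowmod_carrier rowmod_add rowmod_zero Oh.l_neg)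
  show "x \<oplus>\<^bsub>rowmod n\<^esub> y \<oplus>\<^bsub>rowmod n\<^esub> z = x \<oplus>\<^bsub>rowmod n\<^esub> (y \<oplus>\<^bsub>rowmod n\<^esub> z)"
    if "x \<in> carrier (rowmod n)" "y \<in> carrier (rowmod n)" "z \<in> carrier (rowmod n)" for x y z
    using that by (intro eq_vecI) (auto simp: rowmod_carrier rowmod_add Oh.a_assoc)
qed (auto simp: rowmod_carrier rowmod_add rowmod_zero Oh.a_comm intro!: eq_vecI)

lemma rowmod_pow: "x \<in> carrier (rowmod n) \<Longrightarrow> [(m::nat)] \<cdot>\<^bsub>rowmod n\<^esub> x = vec n (\<lambda>i. [m] \<cdot>\<^bsub>Oh\<^esub> x $ i)"
proof (induction m)
  interpret M: abelian_group "rowmod n" by (rule abelian_group_rowmod)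
  case 0
  then show ?case by (simp add: rowmod_zero)
next
  interpret M: abelian_group "rowmod n" by (rule abelian_group_rowmod)
  case (Suc m)
  then show ?case by (auto simp: rowmod_add)
qed

lemma e_sum_mult:
  fixes n :: nat
  assumes "\<And>i. i < n \<Longrightarrow> b (x i) \<le> 1" "\<And>i. i < n \<Longrightarrow> b (y i) \<le> 1"
  shows "e (\<Sum>i<n. x i * y i) = (\<Oplus>\<^bsub>Oh\<^esub>i\<in>{..<n}. e (x i) \<otimes>\<^bsub>Oh\<^esub> e (y i))"
  using assms
proof (induction n)
  case (Suc n)
  have "(\<lambda>i. e (x i) \<otimes>\<^bsub>Oh\<^esub> e (y i)) \<in> {..<n} \<rightarrow> carrier Oh" "e (x n) \<otimes>\<^bsub>Oh\<^esub> e (y n) \<in> carrier Oh"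
    using Suc.prems by (auto simp: e_Oh)
  then show ?case using Suc
    by (simp add: lessThan_Suc e_ops Oh.a_comm Oh.finsum_closed)
qed (simp add: e_ops)

text \<open>Density and purity are checked coordinatewise. The matrix commutes with the embedding
  exactly, while scalars of the completion are approximated modulo \<open>m\<close> as in
  \<open>dense_Oh\<close>.\<close>

lemma dense_rows:
  assumes B: "\<And>i j. i < n \<Longrightarrow> j < n \<Longrightarrow> b (B i j) \<le> 1"
    and Ah: "\<And>i j. i < n \<Longrightarrow> j < n \<Longrightarrow> Ah $$ (i, j) = e (B i j)"
  shows "dense_pair (rowmod n) (int_rows b n) (row_emb n)
    (insert (row_op n B) {\<lambda>x i. r * x i | r. b r \<le> 1})
    (insert (\<lambda>x. row_mult Oh n x Ah) {\<lambda>x. c \<odot>\<^bsub>rowmod n\<^esub> x | c. c \<in> carrier Oh})"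
    (is "dense_pair _ _ _ ?E ?Eh")
proof -
  interpret M: abelian_group "rowmod n" by (rule abelian_group_rowmod)
  have emb: "row_emb n x \<in> carrier (rowmod n)" if "x \<in> int_rows b n" for x
    using that by (auto simp: rowmod_carrier row_emb_def int_rows_def e_Oh)
  have AhOh: "Ah $$ (i, j) \<in> carrier Oh" if "i < n" "j < n" for i j using that by (simp add: Ah B e_Oh)
  have op: "row_mult Oh n (row_emb n x) Ah = row_emb n (row_op n B x)" if x: "x \<in> int_rows b n" for x
  proof (rule eq_vecI)
    fix j assume "j < dim_vec (row_emb n (row_op n B x))"
    then have j: "j < n" by (simp add: row_emb_def)
    have "row_mult Oh n (row_emb n x) Ah $ j = (\<Oplus>\<^bsub>Oh\<^esub>i\<in>{..<n}. row_emb n x $ i \<otimes>\<^bsub>Oh\<^esub> Ah $$ (i, j))"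
      using j by (simp add: row_mult_def)
    also have "\<dots> = (\<Oplus>\<^bsub>Oh\<^esub>i\<in>{..<n}. e (x i) \<otimes>\<^bsub>Oh\<^esub> e (B i j))"
      using j x B by (intro Oh.finsum_cong') (auto simp: row_emb_def Ah int_rows_def e_Oh)
    also have "\<dots> = e (\<Sum>i<n. x i * B i j)"
      using x B j by (subst e_sum_mult) (auto simp: int_rows_def)
    finally show "row_mult Oh n (row_emb n x) Ah $ j = row_emb n (row_op n B x) $ j"
      using j by (simp add: row_emb_def row_op_def)
  qed (simp add: row_mult_def row_emb_def)
  show ?thesis
  proof (intro dense_pair.intro dense_pair_axioms.intro)
    show "abelian_group (rowmod n)" by (rule abelian_group_rowmod)
    show "subgp (int_rows b n)" by (rule subgp_int_rows[OF b_val])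
    show "row_emb n x \<in> carrier (rowmod n)" if "x \<in> int_rows b n" for x by (rule emb[OF that])
    show "row_emb n (x + y) = row_emb n x \<oplus>\<^bsub>rowmod n\<^esub> row_emb n y" for x y
      by (auto simp: row_emb_def rowmod_add e_ops)
    show "\<exists>x\<in>int_rows b n. \<exists>d\<in>carrier (rowmod n). c = row_emb n x \<oplus>\<^bsub>rowmod n\<^esub> [m] \<cdot>\<^bsub>rowmod n\<^esub> d"
      if c: "c \<in> carrier (rowmod n)" and m: "1 \<le> m" for c and m :: nat
    proof -
      have "\<forall>i\<in>{..<n}. \<exists>x d. b x \<le> 1 \<and> d \<in> carrier Oh \<and> c $ i = e x \<oplus>\<^bsub>Oh\<^esub> [m] \<cdot>\<^bsub>Oh\<^esub> d"
      proof
        fix i assume "i \<in> {..<n}"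
        then have "c $ i \<in> carrier Oh" using c by (simp add: rowmod_carrier)
        from Oh_dense[OF this m] show "\<exists>x d. b x \<le> 1 \<and> d \<in> carrier Oh \<and> c $ i = e x \<oplus>\<^bsub>Oh\<^esub> [m] \<cdot>\<^bsub>Oh\<^esub> d" by auto
      qed
      then obtain x d where xd: "\<And>i. i < n \<Longrightarrow> b (x i) \<le> 1 \<and> d i \<in> carrier Oh \<and> c $ i = e (x i) \<oplus>\<^bsub>Oh\<^esub> [m] \<cdot>\<^bsub>Oh\<^esub> d i"
        unfolding bchoice_iff by auto
      have d: "vec n d \<in> carrier (rowmod n)" using xd by (simp add: rowmod_carrier)
      have "c = row_emb n (\<lambda>i. if i < n then x i else 0) \<oplus>\<^bsub>rowmod n\<^esub> [m] \<cdot>\<^bsub>rowmod n\<^esub> vec n d"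
        using xd c unfolding rowmod_pow[OF d] by (auto simp: rowmod_add row_emb_def rowmod_carrier)
      moreover have "(\<lambda>i. if i < n then x i else 0) \<in> int_rows b n" using xd by (auto simp: int_rows_def)
      ultimately show ?thesis using d by blast
    qed
    show "\<exists>y\<in>int_rows b n. x = (\<Sum>i<m. y)"
      if x: "x \<in> int_rows b n" and d: "d \<in> carrier (rowmod n)" and m: "1 \<le> m" and eq: "row_emb n x = [m] \<cdot>\<^bsub>rowmod n\<^esub> d" for x d and m :: nat
    proof -
      have "e (x i) = [m] \<cdot>\<^bsub>Oh\<^esub> (d $ i)" if "i < n" for i
      proof -
        have "row_emb n x $ i = vec n (\<lambda>i. [m] \<cdot>\<^bsub>Oh\<^esub> d $ i) $ i" unfolding eq rowmod_pow[OF d] ..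
        then show ?thesis using that by (simp add: row_emb_def)
      qed
      then have "\<forall>i\<in>{..<n}. \<exists>y. b y \<le> 1 \<and> x i = of_nat m * y"
        using Oh_pure[OF _ _ m] x d by (fastforce simp: rowmod_carrier int_rows_def)
      then obtain y where y: "\<And>i. i < n \<Longrightarrow> b (y i) \<le> 1 \<and> x i = of_nat m * y i" unfolding bchoice_iff by auto
      have sum: "(\<Sum>i<m. z) k = of_nat m * z k" for z :: "nat \<Rightarrow> 'r" and k
        by (induction m) (auto simp: distrib_right)
      have "x = (\<Sum>i<m. (\<lambda>i. if i < n then y i else 0))"
        using y x by (intro ext) (auto simp: sum int_rows_def)
      moreover have "(\<lambda>i. if i < n then y i else 0) \<in> int_rows b n" using y by (auto simp: int_rows_def)
      ultimately show ?thesis by blast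
    qed
    show "f x \<in> int_rows b n" if "f \<in> ?E" "x \<in> int_rows b n" for f x
      using that row_op_int_rows[OF b_val B] by (auto simp: int_rows_def intro: val_mult_le_1[OF b_val])
    show "f c \<in> carrier (rowmod n)" if "f \<in> ?Eh" "c \<in> carrier (rowmod n)" for f c
      using that AhOh by (auto simp: rowmod_carrier rowmod_smult row_mult_def intro!: Oh.finsum_closed)
    show "f (c \<oplus>\<^bsub>rowmod n\<^esub> d) = f c \<oplus>\<^bsub>rowmod n\<^esub> f d"
      if f: "f \<in> ?Eh" and c: "c \<in> carrier (rowmod n)" and d: "d \<in> carrier (rowmod n)" for f c d
    proof -
      have "row_mult Oh n (c \<oplus>\<^bsub>rowmod n\<^esub> d) Ah = row_mult Oh n c Ah \<oplus>\<^bsub>rowmod n\<^esub> row_mult Oh n d Ah"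
      proof (rule eq_vecI)
        fix j assume "j < dim_vec (row_mult Oh n c Ah \<oplus>\<^bsub>rowmod n\<^esub> row_mult Oh n d Ah)"
        then have j: "j < n" by (simp add: rowmod_add)
        have "row_mult Oh n (c \<oplus>\<^bsub>rowmod n\<^esub> d) Ah $ j =
          (\<Oplus>\<^bsub>Oh\<^esub>i\<in>{..<n}. (c \<oplus>\<^bsub>rowmod n\<^esub> d) $ i \<otimes>\<^bsub>Oh\<^esub> Ah $$ (i, j))"
          using j by (simp add: row_mult_def)
        also have "\<dots> = (\<Oplus>\<^bsub>Oh\<^esub>i\<in>{..<n}. c $ i \<otimes>\<^bsub>Oh\<^esub> Ah $$ (i, j) \<oplus>\<^bsub>Oh\<^esub> d $ i \<otimes>\<^bsub>Oh\<^esub> Ah $$ (i, j))"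
          using j c d AhOh by (intro Oh.finsum_cong') (auto simp: rowmod_add rowmod_carrier Oh.l_distr)
        also have "\<dots> = (row_mult Oh n c Ah \<oplus>\<^bsub>rowmod n\<^esub> row_mult Oh n d Ah) $ j"
          using j c d AhOh by (subst Oh.finsum_addf) (auto simp: rowmod_carrier row_mult_def rowmod_add)
        finally show "row_mult Oh n (c \<oplus>\<^bsub>rowmod n\<^esub> d) Ah $ j = (row_mult Oh n c Ah \<oplus>\<^bsub>rowmod n\<^esub> row_mult Oh n d Ah) $ j" .
      qed (simp add: row_mult_def rowmod_add)
      then show ?thesis using f c d by (auto simp: rowmod_smult rowmod_add rowmod_carrier Oh.r_distr)
    qed
    show "\<exists>f\<in>?E. \<forall>x\<in>int_rows b n. \<exists>d\<in>carrier (rowmod n). f' (row_emb n x) = row_emb n (f x) \<oplus>\<^bsub>rowmod n\<^esub> [m] \<cdot>\<^bsub>rowmod n\<^esub> d"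
      if f': "f' \<in> ?Eh" and m: "1 \<le> m" for f' and m :: nat
    proof -
      consider "f' = (\<lambda>x. row_mult Oh n x Ah)" | c where "c \<in> carrier Oh" "f' = (\<lambda>x. c \<odot>\<^bsub>rowmod n\<^esub> x)" using f' by blast
      then show ?thesis
      proof cases
        case 1
        have "\<exists>d\<in>carrier (rowmod n). f' (row_emb n x) = row_emb n (row_op n B x) \<oplus>\<^bsub>rowmod n\<^esub> [m] \<cdot>\<^bsub>rowmod n\<^esub> d"
          if "x \<in> int_rows b n" for x
          using op[OF that] emb[OF row_op_int_rows[OF b_val B that]] unfolding 1 by (intro bexI[of _ "\<zero>\<^bsub>rowmod n\<^esub>"]) auto
        then show ?thesis by blast
      next
        case 2
        from dense_pair.Eh_E[OF dense_Oh, of "\<lambda>y. c \<otimes>\<^bsub>Oh\<^esub> y" m] 2(1) m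
        obtain r where r: "b r \<le> 1" "\<And>x. b x \<le> 1 \<Longrightarrow> \<exists>d\<in>carrier Oh. c \<otimes>\<^bsub>Oh\<^esub> e x = e (r * x) \<oplus>\<^bsub>Oh\<^esub> [m] \<cdot>\<^bsub>Oh\<^esub> d" by auto
        have "\<exists>d\<in>carrier (rowmod n). f' (row_emb n x) = row_emb n (\<lambda>i. r * x i) \<oplus>\<^bsub>rowmod n\<^esub> [m] \<cdot>\<^bsub>rowmod n\<^esub> d"
          if x: "x \<in> int_rows b n" for x
        proof -
          have "\<forall>i\<in>{..<n}. \<exists>d\<in>carrier Oh. c \<otimes>\<^bsub>Oh\<^esub> e (x i) = e (r * x i) \<oplus>\<^bsub>Oh\<^esub> [m] \<cdot>\<^bsub>Oh\<^esub> d"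
            using r(2) x by (auto simp: int_rows_def)
          then have "\<exists>d. \<forall>i\<in>{..<n}. d i \<in> carrier Oh \<and> c \<otimes>\<^bsub>Oh\<^esub> e (x i) = e (r * x i) \<oplus>\<^bsub>Oh\<^esub> [m] \<cdot>\<^bsub>Oh\<^esub> d i"
            by (intro bchoice) blast
          then obtain d where d: "\<And>i. i < n \<Longrightarrow> d i \<in> carrier Oh \<and> c \<otimes>\<^bsub>Oh\<^esub> e (x i) = e (r * x i) \<oplus>\<^bsub>Oh\<^esub> [m] \<cdot>\<^bsub>Oh\<^esub> d i" by auto
          have dc: "vec n d \<in> carrier (rowmod n)" using d by (simp add: rowmod_carrier)
          have "f' (row_emb n x) = row_emb n (\<lambda>i. r * x i) \<oplus>\<^bsub>rowmod n\<^esub> [m] \<cdot>\<^bsub>rowmod n\<^esub> vec n d"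
            unfolding rowmod_pow[OF dc] 2(2) using d by (auto simp: rowmod_smult rowmod_add row_emb_def)
          then show ?thesis using dc by blast
        qed
        then have "\<forall>x\<in>int_rows b n. \<exists>d\<in>carrier (rowmod n). f' (row_emb n x) = row_emb n (\<lambda>i. r * x i) \<oplus>\<^bsub>rowmod n\<^esub> [m] \<cdot>\<^bsub>rowmod n\<^esub> d"
          by blast
        moreover have "(\<lambda>x i. r * x i) \<in> ?E" using r(1) by blast
        ultimately show ?thesis by (rule bexI)
      qed
    qed
    show "\<exists>f'\<in>?Eh. \<forall>x\<in>int_rows b n. f' (row_emb n x) = row_emb n (f x)" if f: "f \<in> ?E" for f
    proof -
      consider "f = row_op n B" | r where "b r \<le> 1" "f = (\<lambda>x i. r * x i)" using f by blast
      then show ?thesis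
      proof cases
        case 1
        have "\<forall>x\<in>int_rows b n. row_mult Oh n (row_emb n x) Ah = row_emb n (f x)" using op 1 by simp
        then show ?thesis by (intro bexI[of _ "\<lambda>x. row_mult Oh n x Ah"]) auto
      next
        case 2
        have "e r \<odot>\<^bsub>rowmod n\<^esub> row_emb n x = row_emb n (f x)" for x
          by (auto simp: 2(2) rowmod_smult row_emb_def e_ops)
        moreover have "e r \<in> carrier Oh" using 2(1) by (simp add: e_Oh)
        ultimately show ?thesis by (intro bexI[of _ "\<lambda>x. e r \<odot>\<^bsub>rowmod n\<^esub> x"]) auto
      qed
    qed
  qed
qed

lemma inv_submodule_count_eq:
  assumes B: "\<And>i j. i < n \<Longrightarrow> j < n \<Longrightarrow> b (B i j) \<le> 1"
    and Ah: "\<And>i j. i < n \<Longrightarrow> j < n \<Longrightarrow> Ah $$ (i, j) = e (B i j)" and m: "m \<ge> 1"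
  shows "inv_submodule_count Oh n Ah m =
    card {H. subgp H \<and> H \<subseteq> int_rows b n \<and> (\<forall>r x. b r \<le> 1 \<longrightarrow> x \<in> H \<longrightarrow> (\<lambda>i. r * x i) \<in> H) \<and>
      (\<forall>x\<in>H. row_op n B x \<in> H) \<and> fin_idx (int_rows b n) H \<and> idx (int_rows b n) H = m}"
proof -
  let ?E = "insert (row_op n B) {\<lambda>x i. r * x i | r. b r \<le> 1}"
  let ?Eh = "insert (\<lambda>x. row_mult Oh n x Ah) {\<lambda>x. c \<odot>\<^bsub>rowmod n\<^esub> x | c. c \<in> carrier Oh}"
  interpret D: dense_pair "rowmod n" "int_rows b n" "row_emb n" ?E ?Eh by (rule dense_rows[OF B Ah])
  \<comment> \<open>An infinite set has \<open>card\<close> 0, so an index \<open>m \<ge> 1\<close>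
    already means finite index.\<close>
  have "{H. submodule H Oh (rowmod n) \<and> (\<forall>x\<in>H. row_mult Oh n x Ah \<in> H) \<and> card (a_rcosets\<^bsub>rowmod n\<^esub> H) = m} = D.subs_h m"
    using m unfolding D.subs_h_def submodule_def submodule_axioms_def
    by (auto intro: card_ge_0_finite)
  then have "inv_submodule_count Oh n Ah m = card (D.subs_h m)" by (simp add: inv_submodule_count_def)
  also have "\<dots> = card (D.subs m)" by (rule bij_betw_same_card[OF D.bij_subs[OF m]])
  also have "D.subs m = {H. subgp H \<and> H \<subseteq> int_rows b n \<and> (\<forall>r x. b r \<le> 1 \<longrightarrow> x \<in> H \<longrightarrow> (\<lambda>i. r * x i) \<in> H) \<and>
      (\<forall>x\<in>H. row_op n B x \<in> H) \<and> fin_idx (int_rows b n) H \<and> idx (int_rows b n) H = m}"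
    unfolding D.subs_def by (intro Collect_cong) auto
  finally show ?thesis .
qed

end

section \<open>Polynomials acting through a linear operator\<close>

definition smulf :: "'k \<Rightarrow> (nat \<Rightarrow> 'k::comm_ring_1) \<Rightarrow> nat \<Rightarrow> 'k" where
  "smulf c x = (\<lambda>i. c * x i)"

lemma smulf_simps:
  "smulf c (x + y) = smulf c x + smulf c y" "smulf (c + d) x = smulf c x + smulf d x"
  "smulf (c * d) x = smulf c (smulf d x)" "smulf 1 x = x" "smulf 0 x = 0" "smulf c 0 = 0" "smulf (- c) x = - smulf c x"
  by (auto simp: smulf_def algebra_simps)

lemma sum_apply: "(\<Sum>i\<in>I. g i) (j::nat) = (\<Sum>i\<in>I. g i j :: 'k::comm_ring_1)"
  by (induction I rule: infinite_finite_induct) auto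

locale linear_op =
  fixes T :: "(nat \<Rightarrow> 'k::field_char_0) \<Rightarrow> nat \<Rightarrow> 'k"
  assumes T_add: "T (x + y) = T x + T y" and T_smulf: "T (smulf c x) = smulf c (T x)"
begin

text \<open>The polynomial is evaluated at \<open>T\<close> by the Horner scheme, which suits
  induction over \<open>pCons\<close>.\<close>

definition act :: "'k poly \<Rightarrow> (nat \<Rightarrow> 'k) \<Rightarrow> nat \<Rightarrow> 'k" where
  "act p = fold_coeffs (\<lambda>a g x. smulf a x + T (g x)) p (\<lambda>_. 0)"

lemma T_0: "T 0 = 0"
  using T_add[of 0 0] by simp

lemma act_0: "act 0 x = 0"
  by (simp add: act_def)

lemma act_pCons: "act (pCons a p) x = smulf a x + T (act p x)"
  by (cases "a = 0 \<and> p = 0") (auto simp: act_def smulf_simps T_0 zero_fun_def[symmetric])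

lemma act_add_right: "act p (x + y) = act p x + act p y"
  by (induction p) (simp_all only: act_0 act_pCons smulf_simps T_add ac_simps add_0)

lemma act_add_left: "act (p + q) x = act p x + act q x"
  by (induction p q rule: poly_induct2) (simp_all only: act_0 act_pCons smulf_simps T_add ac_simps add_0 add_pCons)

lemma act_smult: "act (Polynomial.smult c p) x = smulf c (act p x)"
  by (induction p) (simp_all only: act_0 act_pCons smulf_simps T_smulf smult_pCons smult_0_right)

lemma act_mult: "act (p * q) x = act p (act q x)"
  by (induction p) (auto simp: act_0 act_pCons act_add_left act_smult smulf_simps T_0)

lemma act_const: "act [:c:] x = smulf c x"
  by (simp add: act_pCons act_0 T_0)

lemma act_1: "act 1 x = x"
  by (simp add: one_pCons act_const smulf_simps)

lemma module_act: "Modules.module act"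
  by unfold_locales (simp_all add: act_add_right act_add_left act_mult act_1)

lemma T_sum: "T (\<Sum>i\<in>I. g i) = (\<Sum>i\<in>I. T (g i))"
proof (induction I rule: infinite_finite_induct)
  case (insert i I)
  show ?case unfolding sum.insert[OF insert(1,2)] T_add insert(3) ..
next
  case (infinite I)
  show ?case unfolding sum.infinite[OF infinite] by (rule T_0)
qed (simp only: T_0 sum.empty)

lemma act_eq_sum: "(p = 0 \<or> Polynomial.degree p < d) \<Longrightarrow> act p x = (\<Sum>i<d. smulf (Polynomial.coeff p i) ((T ^^ i) x))"
proof (induction p arbitrary: d)
  case 0
  then show ?case by (simp add: act_0 smulf_simps)
next
  case (pCons a p)
  then obtain d' where d: "d = Suc d'" by (cases d) auto
  have "act p x = (\<Sum>i<d'. smulf (Polynomial.coeff p i) ((T ^^ i) x))"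
    using pCons d by (intro pCons.IH) (auto split: if_splits)
  then show ?case
    by (simp add: d act_pCons sum.lessThan_Suc_shift T_sum T_smulf del: sum.lessThan_Suc)
qed

lemma act_sum_monom: "act (\<Sum>i<d. Polynomial.monom (c i) i) x = (\<Sum>i<d. smulf (c i) ((T ^^ i) x))"
proof -
  have *: "Polynomial.coeff (\<Sum>i<d. Polynomial.monom (c i) i) j = (if j < d then c j else 0)" for j
    by (simp add: coeff_sum)
  have "Polynomial.degree (\<Sum>i<d. Polynomial.monom (c i) i) < d" if "(\<Sum>i<d. Polynomial.monom (c i) i) \<noteq> 0"
    by (rule ccontr) (use leading_coeff_neq_0[OF that] * in auto)
  from act_eq_sum[of "\<Sum>i<d. Polynomial.monom (c i) i" d x] this show ?thesis by (auto simp: * intro!: sum.cong)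
qed

end

lemma linear_op_row_op: "linear_op (row_op n B)"
  by unfold_locales (auto simp: row_op_def smulf_def fun_eq_iff distrib_right sum.distrib sum_distrib_left mult.assoc)

lemma sum_lessThan_add: "(\<Sum>i<m + d. g i) = (\<Sum>i<m. g i) + (\<Sum>j<d. g (m + j) :: 'x::comm_monoid_add)" for m d :: nat
  by (induction d) (auto simp: add.assoc)

lemma sum_blocks: "(\<Sum>i<(\<Sum>k<N. d k). g i) = (\<Sum>k<N. \<Sum>j<d k. g ((\<Sum>i<k. d i) + j) :: 'x::comm_monoid_add)" for d :: "nat \<Rightarrow> nat"
  by (induction N) (auto simp: sum_lessThan_add)

lemma block_less:
  fixes d :: "nat \<Rightarrow> nat"
  assumes "k < N" "j < d k" shows "(\<Sum>i<k. d i) + j < (\<Sum>i<N. d i)"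
proof -
  have "(\<Sum>i<k. d i) + j < (\<Sum>i<Suc k. d i)" using assms by simp
  also have "\<dots> \<le> (\<Sum>i<N. d i)" using assms(1) by (intro sum_mono2) auto
  finally show ?thesis .
qed

text \<open>Serves to read the coefficients of one polynomial per block as coordinates of a single
  row.\<close>

lemma block_function: "\<exists>c'. \<forall>k<N. \<forall>j<d k. c' ((\<Sum>i<k. d i) + j) = c k j" for d :: "nat \<Rightarrow> nat"
proof (induction N)
  case (Suc N)
  then obtain c' where c': "\<forall>k<N. \<forall>j<d k. c' ((\<Sum>i<k. d i) + j) = c k j" by blast
  let ?c = "\<lambda>i. if i < (\<Sum>i<N. d i) then c' i else c N (i - (\<Sum>i<N. d i))"
  have "?c ((\<Sum>i<k. d i) + j) = c k j" if "k < Suc N" "j < d k" for k j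
  proof (cases "k = N")
    case False
    then have "k < N" using that(1) by simp
    then have "c' ((\<Sum>i<k. d i) + j) = c k j" using c' that(2) by blast
    then show ?thesis unfolding if_P[OF block_less[of k N j d, OF \<open>k < N\<close> that(2)]] .
  qed simp
  then show ?case by (intro exI[of _ ?c]) blast
qed auto

definition row_fun :: "nat \<Rightarrow> (nat \<Rightarrow> nat \<Rightarrow> 'k::zero) \<Rightarrow> nat \<Rightarrow> nat \<Rightarrow> 'k" where
  "row_fun n Q i = (\<lambda>j. if j < n then Q i j else 0)"

context
  fixes a :: "'k::field_char_0 \<Rightarrow> real" and n :: nat and A P Q :: "nat \<Rightarrow> nat \<Rightarrow> 'k" and N :: nat and p :: "nat \<Rightarrow> 'k poly"
  assumes a: "val {0} a"
    and A_int: "\<And>i j. i < n \<Longrightarrow> j < n \<Longrightarrow> a (A i j) \<le> 1"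
begin

interpretation L: linear_op "row_op n A" by (rule linear_op_row_op)
interpretation K: max_ideal "{0::'k}" by (rule max_ideal_zero)

lemma subring_module_act: "subring_module_idom L.act (vpolys a)"
  unfolding subring_module_idom_def subring_module_def subring_module_axioms_def
  using L.module_act subgp_vpolys[OF a] vpolys_1[OF a] vpolys_mult[OF a] by blast

interpretation S: subring_module_idom L.act "vpolys a" by (rule subring_module_act)

lemma smulf_int_rows: "a c \<le> 1 \<Longrightarrow> x \<in> int_rows a n \<Longrightarrow> smulf c x \<in> int_rows a n"
  by (auto simp: int_rows_def smulf_def intro: K.val_mult_le_1[OF a])

text \<open>Constants and the indeterminate generate \<open>O[X]\<close>, and the indeterminate acts
  as the matrix.\<close>

lemma smod_act_iff:
  "S.smod H \<longleftrightarrow> subgp H \<and> (\<forall>c x. a c \<le> 1 \<longrightarrow> x \<in> H \<longrightarrow> (\<lambda>i. c * x i) \<in> H) \<and> (\<forall>x\<in>H. row_op n A x \<in> H)"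
proof (intro iffI conjI allI ballI impI)
  assume H: "S.smod H"
  show "subgp H" by (rule S.smod_subgp[OF H])
  fix x assume x: "x \<in> H"
  show "(\<lambda>i. c * x i) \<in> H" if "a c \<le> 1" for c
    using S.smod_scale[OF H _ x, of "[:c:]"] that vpolys_const[OF a] by (simp add: L.act_const smulf_def)
  have "[:0, 1:] \<in> vpolys a" using vpolys_monom[OF a, of 1 1] K.val_one[OF a] by (simp add: Polynomial.monom_Suc one_pCons)
  then show "row_op n A x \<in> H"
    using S.smod_scale[OF H _ x, of "[:0, 1:]"] by (simp add: L.act_pCons L.act_0 L.T_0 smulf_simps)
next
  assume H: "subgp H \<and> (\<forall>c x. a c \<le> 1 \<longrightarrow> x \<in> H \<longrightarrow> (\<lambda>i. c * x i) \<in> H) \<and> (\<forall>x\<in>H. row_op n A x \<in> H)"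
  have "r \<in> vpolys a \<Longrightarrow> L.act r x \<in> H" if x: "x \<in> H" for r x
  proof (induction r)
    case 0
    then show ?case unfolding L.act_0 using H subgp_zero by blast
  next
    case (pCons c r)
    have "a (Polynomial.coeff (pCons c r) (Suc i)) \<le> 1" "a (Polynomial.coeff (pCons c r) 0) \<le> 1" for i
      using pCons.prems unfolding vpolys_def by blast+
    then have "r \<in> vpolys a" "a c \<le> 1" by (auto simp: vpolys_def)
    then show ?case unfolding L.act_pCons smulf_def using pCons.IH H x subgp_add[of H] by blast
  qed
  then show "S.smod H" using H by (simp add: S.smod_def)
qed

abbreviation "qrow \<equiv> row_fun n Q"

text \<open>\<open>P\<close> and \<open>Q\<close> are integral and mutually inverse, so the rows of
  \<open>Q\<close> form a basis of the integral rows. Within block \<open>k\<close> the operator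
  moves each row to the next, and the last one returns according to the coefficients of
  \<open>p k\<close>. Hence the first row of the block generates a copy of
  \<open>O[X] / (p k)\<close>.\<close>

lemma cyclic_sum_blocks:
  assumes PQ: "\<And>i j. i < n \<Longrightarrow> j < n \<Longrightarrow> (\<Sum>m<n. P i m * Q m j) = (if i = j then 1 else 0)"
    and QP: "\<And>i j. i < n \<Longrightarrow> j < n \<Longrightarrow> (\<Sum>m<n. Q i m * P m j) = (if i = j then 1 else 0)"
    and P_int: "\<And>i j. i < n \<Longrightarrow> j < n \<Longrightarrow> a (P i j) \<le> 1" and Q_int: "\<And>i j. i < n \<Longrightarrow> j < n \<Longrightarrow> a (Q i j) \<le> 1"
    and n: "n = (\<Sum>k<N. Polynomial.degree (p k))"
    and p: "\<And>k. k < N \<Longrightarrow> Polynomial.lead_coeff (p k) = 1" "\<And>k. k < N \<Longrightarrow> p k \<in> vpolys a" "\<And>k. k < N \<Longrightarrow> Polynomial.degree (p k) > 0"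
    and start: "\<And>k. st k = (\<Sum>i<k. Polynomial.degree (p i))"
    and step: "\<And>k j. k < N \<Longrightarrow> Suc j < Polynomial.degree (p k) \<Longrightarrow> row_op n A (qrow (st k + j)) = qrow (st k + Suc j)"
    and last: "\<And>k. k < N \<Longrightarrow> row_op n A (qrow (st k + (Polynomial.degree (p k) - 1))) =
        - (\<Sum>j<Polynomial.degree (p k). smulf (Polynomial.coeff (p k) j) (qrow (st k + j)))"
  shows "S.cyclic_sum {..<N} (\<lambda>k. qrow (st k)) p (int_rows a n)"
proof -
  let ?T = "row_op n A" and ?d = "\<lambda>k. Polynomial.degree (p k)"
  have lt: "st k + j < n" if "k < N" "j < ?d k" for k j
    unfolding n start by (rule block_less[where d = ?d, OF that])
  have pow: "(?T ^^ j) (qrow (st k)) = qrow (st k + j)" if "k < N" "j < ?d k" for k j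
    using that(2)
  proof (induction j)
    case (Suc j)
    then show ?case using step[OF that(1) Suc.prems] by simp
  qed simp
  have blocks: "(\<Sum>i<n. smulf (c i) (qrow i)) = (\<Sum>k<N. \<Sum>j<?d k. smulf (c (st k + j)) ((?T ^^ j) (qrow (st k))))" for c
  proof -
    have "(\<Sum>i<n. smulf (c i) (qrow i)) = (\<Sum>k<N. \<Sum>j<?d k. smulf (c (st k + j)) (qrow (st k + j)))"
      unfolding start by (subst n) (rule sum_blocks)
    also have "\<dots> = (\<Sum>k<N. \<Sum>j<?d k. smulf (c (st k + j)) ((?T ^^ j) (qrow (st k))))"
      by (intro sum.cong refl) (simp add: pow)
    finally show ?thesis .
  qed
  have qrow_int: "qrow i \<in> int_rows a n" if "i < n" for i using that Q_int by (auto simp: int_rows_def row_fun_def)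
  have M: "S.smod (int_rows a n)"
    unfolding smod_act_iff using K.subgp_int_rows[OF a] smulf_int_rows K.row_op_int_rows[OF a A_int] by (auto simp: smulf_def)
  have st_n: "st k < n" if "k < N" for k using lt[OF that p(3)[OF that]] by simp
  have kill: "L.act (p k) (qrow (st k)) = 0" if k: "k < N" for k
  proof -
    obtain d where d: "?d k = Suc d" using p(3)[OF k] by (cases "?d k") auto
    have "(?T ^^ ?d k) (qrow (st k)) = ?T (qrow (st k + (?d k - 1)))"
      using pow[OF k, of d] d by simp
    then have "(?T ^^ ?d k) (qrow (st k)) = - (\<Sum>j<?d k. smulf (Polynomial.coeff (p k) j) (qrow (st k + j)))"
      using last[OF k] by simp
    also have "\<dots> = - (\<Sum>j<?d k. smulf (Polynomial.coeff (p k) j) ((?T ^^ j) (qrow (st k))))"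
      using pow[OF k] by simp
    finally have "(?T ^^ ?d k) (qrow (st k)) = - (\<Sum>j<?d k. smulf (Polynomial.coeff (p k) j) ((?T ^^ j) (qrow (st k))))" .
    then show ?thesis
      using L.act_eq_sum[of "p k" "Suc (?d k)" "qrow (st k)"] p(1)[OF k] by (simp add: smulf_simps)
  qed
  \<comment> \<open>Multiplying the relation by \<open>P\<close> isolates each coefficient.\<close>
  have indep: "c i = 0" if c: "(\<Sum>i<n. smulf (c i) (qrow i)) = 0" and i: "i < n" for c i
  proof -
    have z: "(\<Sum>m<n. c m * Q m j) = 0" if "j < n" for j
      using fun_cong[OF c, of j] that by (simp add: sum_apply smulf_def row_fun_def)
    have "c i = (\<Sum>m<n. c m * (\<Sum>j<n. Q m j * P j i))"
      using i by (simp add: QP if_distrib[of "\<lambda>x. c _ * x"] cong: if_cong)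
    also have "\<dots> = (\<Sum>j<n. (\<Sum>m<n. c m * Q m j) * P j i)"
      unfolding sum_distrib_left sum_distrib_right by (subst sum.swap) (simp add: mult.assoc)
    also have "\<dots> = 0" using z by simp
    finally show ?thesis .
  qed
  have span: "\<exists>c. (\<forall>i<n. a (c i) \<le> 1) \<and> x = (\<Sum>i<n. smulf (c i) (qrow i))" if x: "x \<in> int_rows a n" for x
  proof (intro exI conjI allI impI)
    \<comment> \<open>The coordinates of \<open>x\<close> in the rows of \<open>Q\<close> are the
      entries of the row \<open>x\<close> times \<open>P\<close>.\<close>
    let ?c = "\<lambda>i. \<Sum>m<n. x m * P m i"
    show "a (?c i) \<le> 1" if "i < n" for i
      using x P_int that by (auto simp: int_rows_def intro!: K.val_sum[OF a] K.val_mult_le_1[OF a])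
    show "x = (\<Sum>i<n. smulf (?c i) (qrow i))"
    proof
      fix j
      show "x j = (\<Sum>i<n. smulf (?c i) (qrow i)) j"
      proof (cases "j < n")
        case True
        have "x j = (\<Sum>m<n. x m * (\<Sum>i<n. P m i * Q i j))"
          using True by (simp add: PQ if_distrib[of "\<lambda>y. x _ * y"] cong: if_cong)
        also have "\<dots> = (\<Sum>i<n. ?c i * Q i j)"
          unfolding sum_distrib_left sum_distrib_right by (subst sum.swap) (simp add: mult.assoc)
        finally show ?thesis using True by (simp add: sum_apply smulf_def row_fun_def)
      next
        case False
        then show ?thesis using x by (simp add: sum_apply smulf_def row_fun_def int_rows_def)
      qed
    qed
  qed
  show ?thesis unfolding S.cyclic_sum_def
  proof (intro conjI allI impI ballI)
    show "int_rows a n = {\<Sum>k<N. L.act (g k) (qrow (st k)) | g. \<forall>k\<in>{..<N}. g k \<in> vpolys a}"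
    proof (intro subset_antisym subsetI)
      fix x assume "x \<in> int_rows a n"
      from span[OF this] obtain c where c: "\<And>i. i < n \<Longrightarrow> a (c i) \<le> 1" "x = (\<Sum>i<n. smulf (c i) (qrow i))" by blast
      let ?g = "\<lambda>k. \<Sum>j<?d k. Polynomial.monom (c (st k + j)) j"
      have 1: "x = (\<Sum>k<N. L.act (?g k) (qrow (st k)))" unfolding c(2) blocks L.act_sum_monom ..
      have 2: "?g k \<in> vpolys a" if "k < N" for k
      proof -
        have "Polynomial.coeff (?g k) j = (if j < ?d k then c (st k + j) else 0)" for j by (simp add: coeff_sum)
        moreover have "a (if j < ?d k then c (st k + j) else 0) \<le> 1" for j using c(1)[OF lt[OF that]] by (simp add: a_0[OF a])
        ultimately show ?thesis unfolding vpolys_def mem_Collect_eq by presburger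
      qed
      show "x \<in> {\<Sum>k<N. L.act (g k) (qrow (st k)) | g. \<forall>k\<in>{..<N}. g k \<in> vpolys a}"
        by (rule CollectI, rule exI[of _ ?g]) (use 1 2 in blast)
    next
      fix x assume "x \<in> {\<Sum>k<N. L.act (g k) (qrow (st k)) | g. \<forall>k\<in>{..<N}. g k \<in> vpolys a}"
      then obtain g where g: "x = (\<Sum>k<N. L.act (g k) (qrow (st k)))" "\<And>k. k < N \<Longrightarrow> g k \<in> vpolys a" by auto
      have "(\<Sum>k<m. L.act (g k) (qrow (st k))) \<in> int_rows a n" if "m \<le> N" for m
        using that
      proof (induction m)
        case (Suc m)
        then have m: "m < N" and *: "(\<Sum>k<m. L.act (g k) (qrow (st k))) \<in> int_rows a n" by auto
        show ?case unfolding sum.lessThan_Suc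
          by (rule subgp_add[OF K.subgp_int_rows[OF a] * S.smod_scale[OF M g(2)[OF m] qrow_int[OF st_n[OF m]]]])
      qed (simp add: subgp_zero[OF K.subgp_int_rows[OF a]])
      then show "x \<in> int_rows a n" using g(1) by simp
    qed
    show "p k \<in> vpolys a" "L.act (p k) (qrow (st k)) = 0" if "k \<in> {..<N}" for k using that p(2) kill by auto
    fix g k assume g: "\<forall>k\<in>{..<N}. g k \<in> vpolys a" "(\<Sum>k<N. L.act (g k) (qrow (st k))) = 0" and k: "k \<in> {..<N}"
    \<comment> \<open>Replacing \<open>g k\<close> by its remainder modulo \<open>p k\<close> does
      not change the sum. The coefficients of the remainders are then coordinates of 0 in a basis,
      so all remainders vanish.\<close>
    have "\<forall>k\<in>{..<N}. \<exists>q r. q \<in> vpolys a \<and> g k = q * p k + r \<and> (r = 0 \<or> Polynomial.degree r < ?d k)"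
      using vpolys_divide[OF a p(2,1)] g(1) by (metis lessThan_iff mult.commute)
    then obtain q r where qr: "\<And>k. k < N \<Longrightarrow> q k \<in> vpolys a \<and> g k = q k * p k + r k \<and> (r k = 0 \<or> Polynomial.degree (r k) < ?d k)"
      unfolding bchoice_iff by (metis lessThan_iff)
    obtain c where c: "\<forall>k<N. \<forall>j<?d k. c ((\<Sum>i<k. ?d i) + j) = Polynomial.coeff (r k) j"
      using block_function[where d = ?d and c = "\<lambda>k. Polynomial.coeff (r k)"] by blast
    have "(\<Sum>i<n. smulf (c i) (qrow i)) = (\<Sum>k<N. \<Sum>j<?d k. smulf (Polynomial.coeff (r k) j) ((?T ^^ j) (qrow (st k))))"
      unfolding blocks by (intro sum.cong refl) (use c in \<open>auto simp: start\<close>)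
    also have "\<dots> = (\<Sum>k<N. L.act (r k) (qrow (st k)))"
      using qr by (intro sum.cong refl L.act_eq_sum[symmetric]) auto
    also have "\<dots> = (\<Sum>k<N. L.act (g k) (qrow (st k)))"
    proof (intro sum.cong refl)
      fix k assume "k \<in> {..<N}"
      then have "g k = q k * p k + r k" "L.act (p k) (qrow (st k)) = 0" using qr kill by auto
      then show "L.act (r k) (qrow (st k)) = L.act (g k) (qrow (st k))"
        by (simp add: L.act_add_left L.act_mult S.scale_zero_right)
    qed
    finally have z: "(\<Sum>i<n. smulf (c i) (qrow i)) = 0" using g(2) by simp
    have "Polynomial.coeff (r k) j = 0" for j
    proof (cases "j < ?d k")
      case True
      then show ?thesis using indep[OF z lt[of k j]] c k by (auto simp: start)
    next
      case False
      then show ?thesis using qr[of k] k by (auto intro: coeff_eq_0)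
    qed
    then have "r k = 0" by (simp add: poly_eq_iff)
    then show "\<exists>y\<in>vpolys a. g k = y * p k" using qr[of k] k by auto
  qed simp
qed

end

section \<open>Elementary divisors\<close>

text \<open>Induction from the right splits off the last block and leaves the offsets of the earlier
  ones untouched.\<close>

lemma diag_block_mat_index:
  assumes "\<And>B. B \<in> set Bs \<Longrightarrow> dim_col B = dim_row B" "k < length Bs" "l < dim_row (Bs ! k)" "j < sum_list (map dim_row Bs)"
  shows "diag_block_mat Bs $$ ((\<Sum>i<k. dim_row (Bs ! i)) + l, j) =
    (if (\<Sum>i<k. dim_row (Bs ! i)) \<le> j \<and> j < (\<Sum>i<k. dim_row (Bs ! i)) + dim_row (Bs ! k)
     then Bs ! k $$ (l, j - (\<Sum>i<k. dim_row (Bs ! i))) else 0)"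
  using assms
proof (induction Bs rule: rev_induct)
  case (snoc B Bs)
  let ?D = "diag_block_mat Bs"
  have dims: "map dim_col Bs = map dim_row Bs" using snoc.prems(1) by simp
  have D: "dim_row ?D = sum_list (map dim_row Bs)" "dim_col ?D = sum_list (map dim_row Bs)"
    unfolding dim_diag_block_mat dims by auto
  have total: "sum_list (map dim_row Bs) = (\<Sum>i<length Bs. dim_row (Bs ! i))"
    by (simp add: sum_list_sum_nth atLeast0LessThan)
  have nth: "(\<Sum>i<k. dim_row ((Bs @ [B]) ! i)) = (\<Sum>i<k. dim_row (Bs ! i))"
    using snoc.prems(2) by (intro sum.cong) (auto simp: nth_append)
  have B: "dim_col B = dim_row B" using snoc.prems(1) by simp
  have j: "j < dim_col ?D + dim_col B" using snoc.prems(4) by (simp add: D B)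
  show ?case
  proof (cases "k < length Bs")
    case True
    then have Bk: "(Bs @ [B]) ! k = Bs ! k" by (simp add: nth_append)
    have l: "l < dim_row (Bs ! k)" using snoc.prems(3) Bk by simp
    have row: "(\<Sum>i<k. dim_row (Bs ! i)) + l < dim_row ?D"
      unfolding D total by (rule block_less[where d = "\<lambda>i. dim_row (Bs ! i)", OF True l])
    have "dim_row (Bs ! k) = Suc (dim_row (Bs ! k) - 1)" "dim_row (Bs ! k) - 1 < dim_row (Bs ! k)" using l by auto
    then have le: "(\<Sum>i<k. dim_row (Bs ! i)) + dim_row (Bs ! k) \<le> sum_list (map dim_row Bs)"
      unfolding total using block_less[where d = "\<lambda>i. dim_row (Bs ! i)", OF True, of "dim_row (Bs ! k) - 1"] by simp
    show ?thesis
    proof (cases "j < sum_list (map dim_row Bs)")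
      case True
      then show ?thesis
        using snoc.IH[OF _ \<open>k < length Bs\<close> l True] snoc.prems(1) row j
        by (simp add: diag_block_mat_last Let_def nth Bk D)
    next
      case False
      then show ?thesis using row j le by (simp add: diag_block_mat_last Let_def nth Bk D)
    qed
  next
    case False
    then have k: "k = length Bs" using snoc.prems(2) by simp
    then have "l < dim_row B" using snoc.prems(3) by simp
    then show ?thesis unfolding nth using j by (auto simp: diag_block_mat_last Let_def k D B total[symmetric])
  qed
qed simp

lemma sum_window:
  assumes "s + d \<le> (n::nat)"
  shows "(\<Sum>b<n. if s \<le> b \<and> b < s + d then h (b - s) else 0) = (\<Sum>j<d. h j :: 'x::comm_monoid_add)"
proof -
  let ?g = "\<lambda>b. if s \<le> b \<and> b < s + d then h (b - s) else 0"
  obtain r where r: "n = s + d + r" using assms le_Suc_ex by blast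
  have "(\<Sum>b<n. ?g b) = (\<Sum>b<s. ?g b) + (\<Sum>j<d. ?g (s + j)) + (\<Sum>j<r. ?g (s + d + j))"
    unfolding r sum_lessThan_add ..
  also have "\<dots> = (\<Sum>j<d. h j)" by simp
  finally show ?thesis .
qed

text \<open>\<open>A = P D Q\<close> gives \<open>Q A = D Q\<close>, so \<open>A\<close> acts on the
  rows of \<open>Q\<close> through the companion blocks: the ones above the diagonal shift a row to
  the next, and the last row of a block contributes the negated coefficients.\<close>

lemma companion_blocks:
  fixes A :: "'k::field_char_0 mat"
  assumes A: "A \<in> carrier_mat n n" and sim: "similar_mat A (diag_block_mat (map companion_matrix ps))"
  shows "\<exists>P Q. (\<forall>i<n. \<forall>j<n. (\<Sum>m<n. P i m * Q m j) = (if i = j then 1 else 0)) \<and>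
    (\<forall>i<n. \<forall>j<n. (\<Sum>m<n. Q i m * P m j) = (if i = j then 1 else 0)) \<and>
    n = (\<Sum>k<length ps. Polynomial.degree (ps ! k)) \<and>
    (\<forall>k<length ps. \<forall>j. Suc j < Polynomial.degree (ps ! k) \<longrightarrow>
      row_op n (\<lambda>i j. A $$ (i, j)) (row_fun n Q ((\<Sum>i<k. Polynomial.degree (ps ! i)) + j)) = row_fun n Q ((\<Sum>i<k. Polynomial.degree (ps ! i)) + Suc j)) \<and>
    (\<forall>k<length ps. Polynomial.degree (ps ! k) > 0 \<longrightarrow>
      row_op n (\<lambda>i j. A $$ (i, j)) (row_fun n Q ((\<Sum>i<k. Polynomial.degree (ps ! i)) + (Polynomial.degree (ps ! k) - 1))) =
      - (\<Sum>j<Polynomial.degree (ps ! k). smulf (Polynomial.coeff (ps ! k) j) (row_fun n Q ((\<Sum>i<k. Polynomial.degree (ps ! i)) + j))))"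
proof -
  let ?d = "\<lambda>k. Polynomial.degree (ps ! k)" and ?Bs = "map companion_matrix ps"
  define st where "st k = (\<Sum>i<k. ?d i)" for k
  let ?D = "diag_block_mat ?Bs"
  obtain P Q where PQ: "similar_mat_wit A ?D P Q" using sim by (auto simp: similar_mat_def)
  note w = similar_mat_witD2[OF A PQ]
  have dimB: "dim_row (companion_matrix p) = Polynomial.degree p" "dim_col (companion_matrix p) = Polynomial.degree p" for p :: "'k poly"
    by (simp_all add: companion_matrix_def Let_def)
  have n: "n = (\<Sum>k<length ps. ?d k)"
  proof -
    have "n = dim_row ?D" using w by simp
    also have "\<dots> = (\<Sum>k<length ps. ?d k)" by (simp add: dim_diag_block_mat comp_def dimB sum_list_sum_nth atLeast0LessThan)
    finally show ?thesis .
  qed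
  have mult: "(\<Sum>m<n. X1 $$ (i, m) * X2 $$ (m, j)) = (X1 * X2) $$ (i, j)"
    if "X1 \<in> carrier_mat n n" "X2 \<in> carrier_mat n n" "i < n" "j < n" for X1 X2 :: "'k mat" and i j
    using that by (simp add: scalar_prod_def atLeast0LessThan)
  let ?P = "\<lambda>i j. P $$ (i, j)" and ?Q = "\<lambda>i j. Q $$ (i, j)" and ?A = "\<lambda>i j. A $$ (i, j)"
  have PQ1: "(\<Sum>m<n. ?P i m * ?Q m j) = (if i = j then 1 else 0)" "(\<Sum>m<n. ?Q i m * ?P m j) = (if i = j then 1 else 0)"
    if "i < n" "j < n" for i j
    using that w by (simp_all add: mult)
  have "Q * A = ?D * Q"
  proof -
    have "Q * A = Q * (P * (?D * Q))" using w by (simp add: assoc_mult_mat[of _ n n _ n _ n])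
    also have "\<dots> = (Q * P) * (?D * Q)" using w by (intro assoc_mult_mat[symmetric, of _ n n _ n _ n] mult_carrier_mat) auto
    also have "\<dots> = ?D * Q" using w by simp
    finally show ?thesis .
  qed
  then have row: "row_op n ?A (row_fun n ?Q i) j = (\<Sum>b<n. ?D $$ (i, b) * ?Q b j)" if "i < n" "j < n" for i j
  proof -
    have "row_op n ?A (row_fun n ?Q i) j = (\<Sum>m<n. ?Q i m * ?A m j)" using that by (simp add: row_op_def row_fun_def)
    also have "\<dots> = (?D * Q) $$ (i, j)" using mult[of Q A i j] that w A \<open>Q * A = ?D * Q\<close> by metis
    also have "\<dots> = (\<Sum>b<n. ?D $$ (i, b) * ?Q b j)" using mult[of ?D Q i j] that w by metis
    finally show ?thesis .
  qed
  have D: "?D $$ (st k + l, j) = (if st k \<le> j \<and> j < st k + ?d k then companion_matrix (ps ! k) $$ (l, j - st k) else 0)"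
    if "k < length ps" "l < ?d k" "j < n" for k l j
  proof -
    have "sum_list (map dim_row ?Bs) = n" unfolding n by (simp add: comp_def dimB sum_list_sum_nth atLeast0LessThan)
    moreover have "(\<Sum>i<k. dim_row (?Bs ! i)) = st k" unfolding st_def using that(1) by (intro sum.cong) (auto simp: dimB)
    moreover have "dim_col B = dim_row B" if "B \<in> set ?Bs" for B using that by (auto simp: dimB)
    moreover have "k < length ?Bs" "l < dim_row (?Bs ! k)" "dim_row (?Bs ! k) = ?d k" "?Bs ! k = companion_matrix (ps ! k)"
      using that by (simp_all add: dimB)
    ultimately show ?thesis using diag_block_mat_index[of ?Bs k l j] that(3) by metis
  qed
  have lt: "st k + l < n" if "k < length ps" "l < ?d k" for k l
    unfolding n st_def by (rule block_less[where d = ?d, OF that])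
  have step: "row_op n ?A (row_fun n ?Q (st k + l)) = row_fun n ?Q (st k + Suc l)" if k: "k < length ps" and l: "Suc l < ?d k" for k l
  proof
    fix j
    have ll: "l < ?d k" using l by simp
    show "row_op n ?A (row_fun n ?Q (st k + l)) j = row_fun n ?Q (st k + Suc l) j"
    proof (cases "j < n")
      case True
      have "row_op n ?A (row_fun n ?Q (st k + l)) j = (\<Sum>b<n. if b = st k + Suc l then ?Q b j else 0)"
        unfolding row[OF lt[OF k ll] True]
      proof (rule sum.cong[OF refl])
        fix b assume "b \<in> {..<n}"
        then have b: "b < n" by simp
        have "?D $$ (st k + l, b) = (if b = st k + Suc l then 1 else 0)"
          unfolding D[OF k ll b] using l by (auto simp: companion_matrix_def Let_def)
        then show "?D $$ (st k + l, b) * ?Q b j = (if b = st k + Suc l then ?Q b j else 0)" by simp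
      qed
      also have "\<dots> = row_fun n ?Q (st k + Suc l) j" using lt[OF k l] True by (simp add: row_fun_def)
      finally show ?thesis .
    qed (simp add: row_op_def row_fun_def)
  qed
  have last: "row_op n ?A (row_fun n ?Q (st k + (?d k - 1))) = - (\<Sum>j<?d k. smulf (Polynomial.coeff (ps ! k) j) (row_fun n ?Q (st k + j)))"
    if k: "k < length ps" and d: "?d k > 0" for k
  proof
    fix j
    have l: "?d k - 1 < ?d k" using d by simp
    show "row_op n ?A (row_fun n ?Q (st k + (?d k - 1))) j = (- (\<Sum>j<?d k. smulf (Polynomial.coeff (ps ! k) j) (row_fun n ?Q (st k + j)))) j"
    proof (cases "j < n")
      case True
      have "row_op n ?A (row_fun n ?Q (st k + (?d k - 1))) j =
        (\<Sum>b<n. if st k \<le> b \<and> b < st k + ?d k then - (Polynomial.coeff (ps ! k) (b - st k) * ?Q (st k + (b - st k)) j) else 0)"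
        unfolding row[OF lt[OF k l] True]
      proof (rule sum.cong[OF refl])
        fix b assume "b \<in> {..<n}"
        then have b: "b < n" by simp
        have "?D $$ (st k + (?d k - 1), b) = (if st k \<le> b \<and> b < st k + ?d k then - Polynomial.coeff (ps ! k) (b - st k) else 0)"
          unfolding D[OF k l b] using d by (auto simp: companion_matrix_def Let_def)
        then show "?D $$ (st k + (?d k - 1), b) * ?Q b j =
          (if st k \<le> b \<and> b < st k + ?d k then - (Polynomial.coeff (ps ! k) (b - st k) * ?Q (st k + (b - st k)) j) else 0)" by simp
      qed
      also have "\<dots> = (\<Sum>l<?d k. - (Polynomial.coeff (ps ! k) l * ?Q (st k + l) j))"
        using lt[OF k l] d by (intro sum_window) simp
      also have "\<dots> = (- (\<Sum>l<?d k. smulf (Polynomial.coeff (ps ! k) l) (row_fun n ?Q (st k + l)))) j"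
        using True by (simp add: sum_negf sum_apply smulf_def row_fun_def)
      finally show ?thesis .
    qed (simp add: row_op_def row_fun_def sum_apply smulf_def)
  qed
  show ?thesis
    by (rule exI[of _ ?P], rule exI[of _ ?Q]) (use PQ1 n step last in \<open>auto simp: st_def\<close>)
qed

text \<open>Lists the companion blocks in their order on the diagonal, each with the index of its
  polynomial and its exponent.\<close>

definition parts :: "('k poly \<times> nat list) list \<Rightarrow> (nat \<times> nat) list" where
  "parts ed = concat (map (\<lambda>i. map (Pair i) (snd (ed ! i))) [0..<length ed])"

lemma concat_parts: "concat (map (\<lambda>(f, ls). map (h f) ls) ed) = map (\<lambda>(i, l). h (fst (ed ! i)) l) (parts ed)"
proof -
  have "concat (map (\<lambda>(f, ls). map (h f) ls) ed) = concat (map (\<lambda>(f, ls). map (h f) ls) (map ((!) ed) [0..<length ed]))"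
    by (simp only: map_nth)
  also have "\<dots> = map (\<lambda>(i, l). h (fst (ed ! i)) l) (parts ed)"
    unfolding parts_def map_concat map_map by (intro arg_cong[where f = concat] map_cong refl) (auto simp: split_beta)
  finally show ?thesis .
qed

lemma set_parts: "(i, l) \<in> set (parts ed) \<longleftrightarrow> i < length ed \<and> l \<in> set (snd (ed ! i))"
  by (auto simp: parts_def)

text \<open>Matches the layer sizes of \<open>cyclic_sum_zeta\<close>, which count blocks, with the
  entries of the dual partition.\<close>

lemma card_parts:
  assumes "i < length ed"
  shows "card {k \<in> {..<length (parts ed)}. fst (parts ed ! k) = i \<and> a \<le> snd (parts ed ! k)} =
    card {j. j < length (snd (ed ! i)) \<and> a \<le> snd (ed ! i) ! j}"
proof -
  have "card {k \<in> {..<length (parts ed)}. fst (parts ed ! k) = i \<and> a \<le> snd (parts ed ! k)} =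
    length (filter (\<lambda>x. fst x = i \<and> a \<le> snd x) (parts ed))"
    by (simp add: length_filter_conv_card)
  also have "\<dots> = (\<Sum>i'<length ed. length (filter (\<lambda>l. i' = i \<and> a \<le> l) (snd (ed ! i'))))"
    by (simp add: parts_def filter_concat length_concat filter_map comp_def interv_sum_list_conv_sum_set_nat atLeast0LessThan)
  also have "\<dots> = (\<Sum>i'<length ed. if i' = i then length (filter (\<lambda>l. a \<le> l) (snd (ed ! i))) else 0)"
    by (intro sum.cong) auto
  also have "\<dots> = card {j. j < length (snd (ed ! i)) \<and> a \<le> snd (ed ! i) ! j}"
    using assms by (simp add: length_filter_conv_card)
  finally show ?thesis .
qed

lemma partition_le_hd: assumes "is_partition ls" "j < length ls" shows "ls ! j \<le> hd ls"
proof (cases j)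
  case 0
  then show ?thesis using assms(2) by (simp add: hd_conv_nth)
next
  case (Suc i)
  then have "ls ! 0 \<ge> ls ! j" using assms by (intro sorted_wrt_nth_less[of "(\<ge>)"]) (auto simp: is_partition_def)
  then show ?thesis using assms(2) by (cases ls) auto
qed

text \<open>The cells of the Young diagram are counted by columns and by rows.\<close>

lemma sum_list_dual: assumes "is_partition ls" shows "sum_list (dual_partition ls) = sum_list ls"
proof -
  have "sum_list (dual_partition ls) = (\<Sum>i\<in>{1..<Suc (hd ls)}. card {j. j < length ls \<and> i \<le> ls ! j})"
    unfolding dual_partition_def by (simp only: interv_sum_list_conv_sum_set_nat set_upt)
  also have "\<dots> = (\<Sum>i\<in>{1..<Suc (hd ls)}. \<Sum>j<length ls. if i \<le> ls ! j then 1 else 0)"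
  proof (rule sum.cong[OF refl])
    fix i
    have "{j. j < length ls \<and> i \<le> ls ! j} = {..<length ls} \<inter> {j. i \<le> ls ! j}" by auto
    then show "card {j. j < length ls \<and> i \<le> ls ! j} = (\<Sum>j<length ls. if i \<le> ls ! j then 1 else 0)"
      by (simp add: sum.If_cases)
  qed
  also have "\<dots> = (\<Sum>j<length ls. \<Sum>i\<in>{1..<Suc (hd ls)}. if i \<le> ls ! j then 1 else 0)" by (rule sum.swap)
  also have "\<dots> = (\<Sum>j<length ls. ls ! j)"
  proof (rule sum.cong[OF refl])
    fix j assume "j \<in> {..<length ls}"
    then have "ls ! j \<le> hd ls" using partition_le_hd[OF assms] by simp
    then have "{1..<Suc (hd ls)} \<inter> {i. i \<le> ls ! j} = {1..ls ! j}" by auto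
    then show "(\<Sum>i\<in>{1..<Suc (hd ls)}. if i \<le> ls ! j then 1 else 0) = ls ! j"
      unfolding sum.If_cases[OF finite_atLeastLessThan] by simp
  qed
  finally show ?thesis by (simp add: sum_list_sum_nth atLeast0LessThan)
qed

lemma partition_inv_Cons:
  "j \<ge> 1 \<Longrightarrow> j \<le> m \<Longrightarrow> partition_inv (m # ms) j = 1"
  "j \<ge> 1 \<Longrightarrow> j \<le> sum_list ms \<Longrightarrow> partition_inv (m # ms) (m + j) = Suc (partition_inv ms j)"
  "j \<ge> 1 \<Longrightarrow> j \<le> sum_list ms \<Longrightarrow> partition_inv (m # ms) (j + m) = Suc (partition_inv ms j)"
proof -
  assume j: "j \<ge> 1" "j \<le> m"
  have "1 \<le> i" if "j \<le> sum_list (take i (m # ms))" for i using that j by (cases i) auto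
  then show "partition_inv (m # ms) j = 1" unfolding partition_inv_def using j
    by (intro Least_equality) auto
next
  assume j: "j \<ge> 1" "j \<le> sum_list ms"
  have "(LEAST i. m + j \<le> sum_list (take i (m # ms))) = Suc (LEAST i. m + j \<le> sum_list (take (Suc i) (m # ms)))"
    using j by (intro Least_Suc[of _ "Suc (length ms)"]) auto
  then show "partition_inv (m # ms) (m + j) = Suc (partition_inv ms j)" "partition_inv (m # ms) (j + m) = Suc (partition_inv ms j)"
    by (simp_all add: partition_inv_def add.commute)
qed

lemma prod_split: "(\<Prod>j=1..m + S. g j) = (\<Prod>j<m. g (Suc j)) * (\<Prod>j=1..S. g (m + j) :: complex)"
  by (induction S) (auto simp: prod.atLeast1_atMost_eq mult.assoc)

text \<open>The offsets record that \<open>i\<close> layers with \<open>J\<close> summands in total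
  have been removed, which makes the second variable \<open>i * s - J\<close>. The induction needs
  general offsets; the application has \<open>i = J = 0\<close>.\<close>

lemma zprod_partition:
  "zprod \<zeta> ms s (of_nat i * s - of_nat J) =
    (\<Prod>j=1..sum_list ms. \<zeta> (of_nat (i + partition_inv ms j) * s - of_nat (J + j) + 1))"
proof (induction ms arbitrary: i J)
  case (Cons m ms)
  have eq: "s + (of_nat i * s - of_nat J) - of_nat m = of_nat (Suc i) * s - of_nat (J + m)" by (simp add: algebra_simps)
  have "zprod \<zeta> (m # ms) s (of_nat i * s - of_nat J) =
      (\<Prod>j<m. \<zeta> (s + (of_nat i * s - of_nat J) - of_nat j)) *
      (\<Prod>j=1..sum_list ms. \<zeta> (of_nat (Suc i + partition_inv ms j) * s - of_nat (J + m + j) + 1))"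
    unfolding zprod.simps eq Cons.IH ..
  also have "\<dots> = (\<Prod>j<m. \<zeta> (of_nat (i + partition_inv (m # ms) (Suc j)) * s - of_nat (J + Suc j) + 1)) *
      (\<Prod>j=1..sum_list ms. \<zeta> (of_nat (i + partition_inv (m # ms) (m + j)) * s - of_nat (J + (m + j)) + 1))"
    by (intro arg_cong2[where f = "(*)"] prod.cong refl) (auto simp: partition_inv_Cons algebra_simps)
  finally show ?case by (simp only: sum_list.Cons prod_split)
qed simp

lemma zpos_partition:
  "(\<And>j. 1 \<le> j \<Longrightarrow> j \<le> sum_list ms \<Longrightarrow> 0 < real (i + partition_inv ms j) * s - real (J + j) + 1) \<Longrightarrow>
    zpos ms s (real i * s - real J)"
proof (induction ms arbitrary: i J)
  case (Cons m ms)
  have "s + (real i * s - real J) > real j" if "j < m" for j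
    using Cons.prems[of "Suc j"] that by (simp add: partition_inv_Cons algebra_simps)
  moreover have "s + (real i * s - real J) - real m = real (Suc i) * s - real (J + m)" by (simp add: algebra_simps)
  moreover have "0 < real (Suc i + partition_inv ms j) * s - real (J + m + j) + 1" if "1 \<le> j" "j \<le> sum_list ms" for j
    using Cons.prems[of "m + j"] that by (simp add: partition_inv_Cons algebra_simps)
  then have "zpos ms s (real (Suc i) * s - real (J + m))" by (rule Cons.IH)
  ultimately show ?case by (auto simp only: zpos.simps)
qed simp

section \<open>The zeta function at a good place\<close>

lemma irreducible_degree:
  fixes f :: "'k::field_char_0 poly"
  assumes "Factorial_Ring.irreducible f" shows "Polynomial.degree f > 0" "f \<noteq> 0"
  using assms is_unit_iff_degree[of f] by (auto simp: Factorial_Ring.irreducible_def)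

lemma field_field_ring: "field (field_ring TYPE('k::field_char_0))"
  by (rule field_from_type_algebra)

lemma valued_completion_field:
  assumes "val {0} a"
  shows "valued_completion (field_ring TYPE('k::field_char_0)) {0} a (\<lambda>x. x)"
  unfolding valued_completion_def valued_completion_axioms_def
proof (intro conjI allI impI)
  show "\<exists>y. x = of_nat n * y" if "0 < n" for x :: 'k and n :: nat
    using that by (intro exI[of _ "x / of_nat n"]) simp
qed (use assms max_ideal_zero field_field_ring in \<open>auto simp: field_ring_simps\<close>)

context
  fixes D :: nat
  assumes ext: "finite_extension {0::'k::field_char_0} of_rat D"
begin

lemma ideal_zeta_above:
  fixes f :: "'k poly"
  assumes v: "v \<in> nonarch_places (field_ring TYPE('k))" and good: "good_place (place_abs v) f" and w: "w \<in> places_above f v"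
  shows "ideal_zeta (place_ring (root_field f) w) s =
    infsum (\<lambda>J. npow (idx (vring (upper_val f w)) J) s) (fin_ideals (vring (upper_val f w)) {p. f dvd p})"
proof -
  have irr: "Factorial_Ring.irreducible f" using good by (simp add: good_place_def)
  have "valued_completion (root_field f) {p. f dvd p} (place_abs w) (cls f)"
    unfolding valued_completion_def valued_completion_axioms_def
  proof (intro conjI allI impI)
    show "field (root_field f)" by (rule root_field_field[OF irr])
    show "max_ideal {p. f dvd p}" by (rule max_ideal_irreducible[OF irr])
    show "val {p. f dvd p} (\<lambda>x. place_abs w (cls f x))"
      using upper_val(1)[OF ext v good w] by (simp add: upper_val_def[abs_def])
    show "\<exists>y. x = of_nat n * y" if "0 < n" for x :: "'k poly" and n :: nat
      using that by (intro exI[of _ "Polynomial.smult (1 / of_nat n) x"]) (simp add: of_nat_poly)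
    show "of_nat n \<notin> {p. f dvd p}" if "0 < n" for n using of_nat_not_dvd[OF ext v good that] by simp
  qed (simp_all add: root_field_simps)
  from valued_completion.ideal_zeta_eq[OF this] show ?thesis
    by (simp add: place_ring_def upper_val_def[abs_def])
qed

text \<open>The formula at one place, all conditions on the place being hypotheses. The count takes
  place over the valuation ring inside \<open>k\<close>; completions are exchanged for it by
  \<open>inv_submodule_count_eq\<close> on the left and \<open>ideal_zeta_above\<close> on the
  right.\<close>

lemma place_zeta:
  fixes A :: "'k mat" and ed :: "('k poly \<times> nat list) list" and s :: complex and v
  defines "a \<equiv> place_abs v"
  defines "ps \<equiv> map (\<lambda>(i, l). fst (ed ! i) ^ l) (parts ed)"
  assumes v: "v \<in> nonarch_places (field_ring TYPE('k))" and A: "A \<in> carrier_mat n n"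
    and A_int: "\<And>i j. i < n \<Longrightarrow> j < n \<Longrightarrow> a (A $$ (i, j)) \<le> 1"
    and good: "\<And>i. i < length ed \<Longrightarrow> good_place a (fst (ed ! i))"
    and part: "\<And>i. i < length ed \<Longrightarrow> is_partition (snd (ed ! i))"
    and co: "\<And>i j. i < length ed \<Longrightarrow> j < length ed \<Longrightarrow> i \<noteq> j \<Longrightarrow> \<exists>u\<in>vpolys a. \<exists>w\<in>vpolys a. u * fst (ed ! i) + w * fst (ed ! j) = 1"
    and PQ: "\<forall>i<n. \<forall>j<n. (\<Sum>m<n. P i m * Q m j) = (if i = j then 1 else 0)"
    and QP: "\<forall>i<n. \<forall>j<n. (\<Sum>m<n. Q i m * P m j) = (if i = j then 1 else 0)"
    and P_int: "\<And>i j. i < n \<Longrightarrow> j < n \<Longrightarrow> a (P i j) \<le> 1" and Q_int: "\<And>i j. i < n \<Longrightarrow> j < n \<Longrightarrow> a (Q i j) \<le> 1"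
    and n: "n = (\<Sum>k<length ps. Polynomial.degree (ps ! k))"
    and step: "\<forall>k<length ps. \<forall>j. Suc j < Polynomial.degree (ps ! k) \<longrightarrow>
      row_op n (\<lambda>i j. A $$ (i, j)) (row_fun n Q ((\<Sum>i<k. Polynomial.degree (ps ! i)) + j)) = row_fun n Q ((\<Sum>i<k. Polynomial.degree (ps ! i)) + Suc j)"
    and last: "\<forall>k<length ps. Polynomial.degree (ps ! k) > 0 \<longrightarrow>
      row_op n (\<lambda>i j. A $$ (i, j)) (row_fun n Q ((\<Sum>i<k. Polynomial.degree (ps ! i)) + (Polynomial.degree (ps ! k) - 1))) =
      - (\<Sum>j<Polynomial.degree (ps ! k). smulf (Polynomial.coeff (ps ! k) j) (row_fun n Q ((\<Sum>i<k. Polynomial.degree (ps ! i)) + j)))"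
    and pos: "\<And>i j. i < length ed \<Longrightarrow> j \<in> {1..sum_list (snd (ed ! i))} \<Longrightarrow>
       0 < Re (of_nat (partition_inv (dual_partition (snd (ed ! i))) j) * s - of_nat j + 1)"
  shows "(submodule_zeta_term (place_ring (field_ring TYPE('k)) v) n (map_mat (place_emb (field_ring TYPE('k)) v) A) s has_sum
      (\<Prod>i<length ed. \<Prod>j=1..sum_list (snd (ed ! i)). \<Prod>w\<in>places_above (fst (ed ! i)) v.
           ideal_zeta (place_ring (root_field (fst (ed ! i))) w)
             (of_nat (partition_inv (dual_partition (snd (ed ! i))) j) * s - of_nat j + 1))) {1..}"
proof -
  let ?A = "\<lambda>i j. A $$ (i, j)"
  define M where "M = int_rows a n"
  define N where "N = length (parts ed)"
  define f where "f i = fst (ed ! i)" for i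
  define c where "c k = fst (parts ed ! k)" for k
  define lam where "lam k = snd (parts ed ! k)" for k
  define ms where "ms i = dual_partition (snd (ed ! i))" for i
  define \<zeta> where "\<zeta> i s = (\<Prod>w\<in>places_above (f i) v. ideal_zeta (place_ring (root_field (f i)) w) s)" for i s
  have a: "val {0} a"
    using nonarch_places(2)[OF v place_abs_in[OF v]] by (simp add: a_def nonarch_abs_field)
  interpret S: subring_module_idom "linear_op.act (row_op n ?A)" "vpolys a"
    by (rule subring_module_act[OF a]) (rule A_int)
  interpret C: valued_completion "field_ring TYPE('k)" "{0}" a "\<lambda>x. x" by (rule valued_completion_field[OF a])
  have goodf: "good_place a (f i)" if "i < length ed" for i using good[OF that] by (simp add: f_def)
  have part_in: "c k < length ed" "lam k \<in> set (snd (ed ! c k))" if "k < N" for k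
    using nth_mem[of k "parts ed"] that set_parts[of "c k" "lam k" ed] by (auto simp: N_def c_def lam_def)
  have fs: "f i \<in> vpolys a" "Polynomial.lead_coeff (f i) = 1" "Polynomial.degree (f i) > 0" if "i < length ed" for i
    using goodf[OF that] irreducible_degree by (auto simp: good_place_def)
  have lam_pos: "lam k > 0" if "k < N" for k
    using part[OF part_in(1)[OF that]] part_in(2)[OF that] unfolding is_partition_def by (metis gr0I)
  have ps: "length ps = N" "\<And>k. k < N \<Longrightarrow> ps ! k = f (c k) ^ lam k"
    by (simp_all add: ps_def N_def f_def c_def lam_def split_beta)
  have p: "Polynomial.lead_coeff (ps ! k) = 1" "ps ! k \<in> vpolys a" "Polynomial.degree (ps ! k) > 0" if "k < N" for k
  proof -
    have "f (c k) \<noteq> 0" using fs(2)[OF part_in(1)[OF that]] by auto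
    show "Polynomial.lead_coeff (ps ! k) = 1"
      unfolding ps(2)[OF that] lead_coeff_power fs(2)[OF part_in(1)[OF that]] by simp
    from \<open>f (c k) \<noteq> 0\<close> show "ps ! k \<in> vpolys a" "Polynomial.degree (ps ! k) > 0"
      using fs[OF part_in(1)[OF that]] lam_pos[OF that] vpolys_power[OF a]
      by (auto simp: ps(2)[OF that] degree_power_eq)
  qed
  have "S.cyclic_sum {..<N} (\<lambda>k. row_fun n Q (\<Sum>i<k. Polynomial.degree (ps ! i))) (\<lambda>k. ps ! k) M"
    unfolding M_def
  proof (rule cyclic_sum_blocks[OF a A_int, where P = P and Q = Q])
    show "n = (\<Sum>k<N. Polynomial.degree (ps ! k))" using n by (simp add: ps(1))
    show "row_op n ?A (row_fun n Q ((\<Sum>i<k. Polynomial.degree (ps ! i)) + j)) = row_fun n Q ((\<Sum>i<k. Polynomial.degree (ps ! i)) + Suc j)"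
      if "k < N" "Suc j < Polynomial.degree (ps ! k)" for k j using step that unfolding ps(1) by blast
    show "row_op n ?A (row_fun n Q ((\<Sum>i<k. Polynomial.degree (ps ! i)) + (Polynomial.degree (ps ! k) - 1))) =
      - (\<Sum>j<Polynomial.degree (ps ! k). smulf (Polynomial.coeff (ps ! k) j) (row_fun n Q ((\<Sum>i<k. Polynomial.degree (ps ! i)) + j)))"
      if "k < N" for k using last that p(3) unfolding ps(1) by blast
  qed (use PQ QP P_int Q_int p in auto)
  then have cyc: "S.cyclic_sum {..<N} (\<lambda>k. row_fun n Q (\<Sum>i<k. Polynomial.degree (ps ! i))) (\<lambda>k. f (c k) ^ lam k) M"
    by (subst S.cyclic_sum_cong[where q = "\<lambda>k. ps ! k"]) (auto simp: ps(2))
  have has: "((\<lambda>H. npow (idx M H) s) has_sum (\<Prod>i<length ed. zprod (\<zeta> i) (ms i) s 0)) (S.smods M)"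
  proof (rule S.cyclic_sum_zeta[where f = f and Z = "\<lambda>i. {p. f i dvd p}" and r = "\<lambda>i. hd (snd (ed ! i))", OF _ _ _ _ _ _ _ _ _ _ cyc])
    show "c k < length ed" if "k \<in> {..<N}" for k using part_in(1) that by simp
    show "f i \<in> vpolys a" "f i \<noteq> 0" if "i < length ed" for i using fs[OF that] by auto
    show "S.comax (f i) (f j)" if "i < length ed" "j < length ed" "i \<noteq> j" for i j
      using co[OF that] by (simp add: S.comax_def f_def)
    show "r \<in> {p. f i dvd p} \<longleftrightarrow> (\<exists>y\<in>vpolys a. r = y * f i)" if "i < length ed" "r \<in> vpolys a" for i r
      using vpolys_dvd[OF a fs(1,2)[OF that(1)] that(2)] by simp
    show "ideals_principal (vpolys a) {p. f i dvd p}" if "i < length ed" for i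
      using above_zeta(1)[OF ext v goodf[OF that, unfolded a_def]] by (simp add: a_def)
    show "has_zeta (vpolys a) {p. f i dvd p} (\<zeta> i)" if "i < length ed" for i
      using above_zeta(2)[OF ext v goodf[OF that, unfolded a_def]] ideal_zeta_above[OF v goodf[OF that, unfolded a_def]]
      by (simp add: a_def \<zeta>_def[abs_def])
    show "lam k \<le> hd (snd (ed ! c k))" if "k \<in> {..<N}" for k
      using part_in[of k] that partition_le_hd[OF part] by (metis in_set_conv_nth lessThan_iff)
    show "ms i = map (\<lambda>x. card {k \<in> {..<N}. c k = i \<and> x \<le> lam k}) [1..<Suc (hd (snd (ed ! i)))]" if "i < length ed" for i
      unfolding ms_def dual_partition_def N_def c_def lam_def card_parts[OF that] ..
    show "zpos (ms i) (Re s) 0" if "i < length ed" for i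
    proof -
      have "zpos (ms i) (Re s) (real 0 * Re s - real 0)"
        using pos[OF that] sum_list_dual[OF part[OF that]] by (intro zpos_partition) (auto simp: ms_def)
      then show ?thesis by simp
    qed
  qed
  have pos_idx: "idx M H \<in> {1..}" if "H \<in> S.smods M" for H
    using that idx_pos[OF C.subgp_int_rows[OF a], of n H] by (simp add: S.smods_def M_def)
  \<comment> \<open>Submodules of equal index are collected into the coefficients of the Dirichlet
    series.\<close>
  have sums: "((\<lambda>m. of_nat (card {H \<in> S.smods M. idx M H = m}) * npow m s) has_sum (\<Prod>i<length ed. zprod (\<zeta> i) (ms i) s 0)) {1..}"
    by (rule has_sum_group_fibres[OF has pos_idx]) auto
  have term_eq: "submodule_zeta_term (place_ring (field_ring TYPE('k)) v) n (map_mat (place_emb (field_ring TYPE('k)) v) A) s m =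
      of_nat (card {H \<in> S.smods M. idx M H = m}) * npow m s" if "m \<in> {1..}" for m
  proof -
    have "inv_submodule_count (place_ring (field_ring TYPE('k)) v) n (map_mat (place_emb (field_ring TYPE('k)) v) A) m =
      card {H. subgp H \<and> H \<subseteq> int_rows a n \<and> (\<forall>r x. a r \<le> 1 \<longrightarrow> x \<in> H \<longrightarrow> (\<lambda>i. r * x i) \<in> H) \<and>
      (\<forall>x\<in>H. row_op n ?A x \<in> H) \<and> fin_idx (int_rows a n) H \<and> idx (int_rows a n) H = m}"
    proof -
      have "map_mat C.e A $$ (i, j) = C.e (A $$ (i, j))" if "i < n" "j < n" for i j using that A by simp
      then show ?thesis unfolding place_ring_def place_emb_def a_def[symmetric] using that A_int
        by (intro C.inv_submodule_count_eq) simp_all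
    qed
    also have "{H. subgp H \<and> H \<subseteq> int_rows a n \<and> (\<forall>r x. a r \<le> 1 \<longrightarrow> x \<in> H \<longrightarrow> (\<lambda>i. r * x i) \<in> H) \<and>
      (\<forall>x\<in>H. row_op n ?A x \<in> H) \<and> fin_idx (int_rows a n) H \<and> idx (int_rows a n) H = m} = {H \<in> S.smods M. idx M H = m}"
      unfolding S.smods_def M_def using smod_act_iff[OF a A_int] by auto
    finally show ?thesis by (simp add: submodule_zeta_term_def)
  qed
  have "zprod (\<zeta> i) (ms i) s 0 = (\<Prod>j=1..sum_list (snd (ed ! i)). \<Prod>w\<in>places_above (fst (ed ! i)) v.
           ideal_zeta (place_ring (root_field (fst (ed ! i))) w)
             (of_nat (partition_inv (dual_partition (snd (ed ! i))) j) * s - of_nat j + 1))" if "i < length ed" for i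
    using zprod_partition[of "\<zeta> i" "ms i" s 0 0] sum_list_dual[OF part[OF that]]
    by (simp add: ms_def \<zeta>_def f_def)
  then have prod_eq: "(\<Prod>i<length ed. zprod (\<zeta> i) (ms i) s 0) =
      (\<Prod>i<length ed. \<Prod>j=1..sum_list (snd (ed ! i)). \<Prod>w\<in>places_above (fst (ed ! i)) v.
           ideal_zeta (place_ring (root_field (fst (ed ! i))) w)
             (of_nat (partition_inv (dual_partition (snd (ed ! i))) j) * s - of_nat j + 1))"
    by (intro prod.cong) auto
  show ?thesis unfolding prod_eq[symmetric] by (rule iffD2[OF has_sum_cong[OF term_eq] sums])
qed

end

section \<open>The theorem\<close>

text \<open>The cofactor would be a unit, hence constant, and comparing leading coefficients makes
  it 1.\<close>

lemma not_dvd_monic_irreducible: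
  fixes f g :: "'k::field_char_0 poly"
  assumes "Factorial_Ring.irreducible f" "Factorial_Ring.irreducible g"
    and "Polynomial.lead_coeff f = 1" "Polynomial.lead_coeff g = 1" "f \<noteq> g"
  shows "\<not> f dvd g"
proof
  assume "f dvd g"
  then obtain h where h: "g = f * h" by blast
  then have "is_unit h" using Factorial_Ring.irreducibleD[OF assms(2) h] assms(1) by (auto simp: Factorial_Ring.irreducible_def)
  then obtain c where c: "h = [:c:]" by (auto simp: is_unit_poly_iff)
  have "Polynomial.lead_coeff h = 1" using lead_coeff_mult[of f h] assms(3,4) h by simp
  then have "c = 1" using c by simp
  then show False using assms(5) h c by simp
qed

theorem theorem5p1:
  fixes A :: "'k::field_char_0 mat"
    and n :: nat
    and S :: "('k \<Rightarrow> real) set set"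
    and ed :: "('k poly \<times> nat list) list"
  assumes "is_number_field TYPE('k)"
    and "n \<ge> 1"
    and "finite S" and "S \<subseteq> nonarch_places (field_ring TYPE('k))"
    and "A \<in> carrier_mat n n"
    and "\<And>i j. i < n \<Longrightarrow> j < n \<Longrightarrow> A $$ (i, j) \<in> S_integers (field_ring TYPE('k)) S"
    and "elementary_divisor_vector A ed"
  shows "\<exists>T. finite T \<and> (\<forall>v \<in> nonarch_places (field_ring TYPE('k)) - T. \<forall>s::complex.
    (\<forall>(f, ls)\<in>set ed. \<forall>j\<in>{1..sum_list ls}.
       0 < Re (of_nat (partition_inv (dual_partition ls) j) * s - of_nat j + 1)) \<longrightarrow>
    submodule_zeta_term (place_ring (field_ring TYPE('k)) v) n (map_mat (place_emb (field_ring TYPE('k)) v) A) s summable_on {1..} \<and>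
    submodule_zeta (place_ring (field_ring TYPE('k)) v) n (map_mat (place_emb (field_ring TYPE('k)) v) A) s =
      (\<Prod>i<length ed. let f = fst (ed ! i); ls = snd (ed ! i) in
         \<Prod>j=1..sum_list ls. \<Prod>w\<in>places_above f v.
           ideal_zeta (place_ring (root_field f) w)
             (of_nat (partition_inv (dual_partition ls) j) * s - of_nat j + 1)))"
proof -
  let ?N = "length ed" and ?f = "\<lambda>i. fst (ed ! i)" and ?ls = "\<lambda>i. snd (ed ! i)"
  let ?ps = "map (\<lambda>(i, l). fst (ed ! i) ^ l) (parts ed)"
  obtain D where ext: "finite_extension {0::'k} of_rat D" using finite_extension_rat[OF assms(1)] by blast
  have div: "Polynomial.lead_coeff (?f i) = 1" "Factorial_Ring.irreducible (?f i)" "is_partition (?ls i)" if "i < ?N" for i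
    using assms(7) nth_mem[OF that] unfolding elementary_divisor_vector_def by (auto simp: split_beta)
  have dist: "?f i \<noteq> ?f j" if "i < ?N" "j < ?N" "i \<noteq> j" for i j
    using assms(7) that unfolding elementary_divisor_vector_def by (auto simp: distinct_conv_nth)
  have "concat (map (\<lambda>(f, ls). map (\<lambda>l. companion_matrix (f ^ l)) ls) ed) = map companion_matrix ?ps"
    unfolding concat_parts[where h = "\<lambda>f l. companion_matrix (f ^ l)"] by (simp add: split_beta)
  then have sim: "similar_mat A (diag_block_mat (map companion_matrix ?ps))"
    using assms(7) by (simp add: elementary_divisor_vector_def)
  obtain P Q where PQ: "\<forall>i<n. \<forall>j<n. (\<Sum>m<n. P i m * Q m j) = (if i = j then 1 else 0)"
    "\<forall>i<n. \<forall>j<n. (\<Sum>m<n. Q i m * P m j) = (if i = j then 1 else 0)"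
    "n = (\<Sum>k<length ?ps. Polynomial.degree (?ps ! k))"
    "\<forall>k<length ?ps. \<forall>j. Suc j < Polynomial.degree (?ps ! k) \<longrightarrow>
      row_op n (\<lambda>i j. A $$ (i, j)) (row_fun n Q ((\<Sum>i<k. Polynomial.degree (?ps ! i)) + j)) = row_fun n Q ((\<Sum>i<k. Polynomial.degree (?ps ! i)) + Suc j)"
    "\<forall>k<length ?ps. Polynomial.degree (?ps ! k) > 0 \<longrightarrow>
      row_op n (\<lambda>i j. A $$ (i, j)) (row_fun n Q ((\<Sum>i<k. Polynomial.degree (?ps ! i)) + (Polynomial.degree (?ps ! k) - 1))) =
      - (\<Sum>j<Polynomial.degree (?ps ! k). smulf (Polynomial.coeff (?ps ! k) j) (row_fun n Q ((\<Sum>i<k. Polynomial.degree (?ps ! i)) + j)))"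
    using companion_blocks[OF assms(5) sim] by blast
  \<comment> \<open>In characteristic 0 an irreducible polynomial is coprime to its derivative. The
    Bezout coefficients are chosen over \<open>k\<close>, before any place is considered.\<close>
  have "\<exists>u w. u * ?f i + w * pderiv (?f i) = 1" if "i < ?N" for i
    using bezout_irreducible[OF div(2)[OF that] not_dvd_pderiv] irreducible_degree[OF div(2)[OF that]] by blast
  then obtain u w where uw: "\<And>i. i < ?N \<Longrightarrow> u i * ?f i + w i * pderiv (?f i) = 1" by metis
  have "\<exists>u w. u * ?f i + w * ?f j = 1" if "i < ?N" "j < ?N" "i \<noteq> j" for i j
    using bezout_irreducible[OF div(2)[OF that(1)]] not_dvd_monic_irreducible[OF div(2)[OF that(1)] div(2)[OF that(2)] div(1)[OF that(1)] div(1)[OF that(2)] dist[OF that]]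
    by blast
  then obtain u' w' where uw': "\<And>i j. i < ?N \<Longrightarrow> j < ?N \<Longrightarrow> i \<noteq> j \<Longrightarrow> u' i j * ?f i + w' i j * ?f j = 1" by metis
  define polys where "polys = ?f ` {..<?N} \<union> u ` {..<?N} \<union> w ` {..<?N} \<union>
    (\<lambda>(i, j). u' i j) ` ({..<?N} \<times> {..<?N}) \<union> (\<lambda>(i, j). w' i j) ` ({..<?N} \<times> {..<?N})"
  \<comment> \<open>If these finitely many elements are integral at \<open>v\<close>, then
    \<open>A\<close>, \<open>P\<close>, \<open>Q\<close> and all Bezout relations are integral
    there, which gives the conditions of \<open>place_zeta\<close>.\<close>
  define elems where "elems = (\<Union>p\<in>polys. set (Polynomial.coeffs p)) \<union> (\<lambda>(i, j). A $$ (i, j)) ` ({..<n} \<times> {..<n}) \<union>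
    (\<lambda>(i, j). P i j) ` ({..<n} \<times> {..<n}) \<union> (\<lambda>(i, j). Q i j) ` ({..<n} \<times> {..<n})"
  define T where "T = (\<Union>x\<in>elems. {v \<in> nonarch_places (field_ring TYPE('k)). place_abs v x > 1})"
  have "finite T"
    unfolding T_def elems_def polys_def using finite_bad_places[OF ext] by (intro finite_UN_I finite_UnI finite_imageI) auto
  moreover have "submodule_zeta_term (place_ring (field_ring TYPE('k)) v) n (map_mat (place_emb (field_ring TYPE('k)) v) A) s summable_on {1..} \<and>
    submodule_zeta (place_ring (field_ring TYPE('k)) v) n (map_mat (place_emb (field_ring TYPE('k)) v) A) s =
      (\<Prod>i<length ed. let f = fst (ed ! i); ls = snd (ed ! i) in
         \<Prod>j=1..sum_list ls. \<Prod>w\<in>places_above f v.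
           ideal_zeta (place_ring (root_field f) w)
             (of_nat (partition_inv (dual_partition ls) j) * s - of_nat j + 1))"
    if v: "v \<in> nonarch_places (field_ring TYPE('k)) - T" and pos: "\<forall>(f, ls)\<in>set ed. \<forall>j\<in>{1..sum_list ls}.
       0 < Re (of_nat (partition_inv (dual_partition ls) j) * s - of_nat j + 1)" for v s
  proof -
    let ?a = "place_abs v"
    have vp: "v \<in> nonarch_places (field_ring TYPE('k))" using v by blast
    have a: "val {0} ?a"
      using nonarch_places(2)[OF vp place_abs_in[OF vp]] by (simp add: nonarch_abs_field)
    have el: "?a x \<le> 1" if "x \<in> elems" for x using v that by (auto simp: T_def not_less)
    have po: "p \<in> vpolys ?a" if p: "p \<in> polys" for p
    proof -
      \<comment> \<open>The 0 accounts for the coefficients beyond the degree, which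
        \<open>coeffs\<close> omits.\<close>
      have "?a x \<le> 1" if "x \<in> insert 0 (set (Polynomial.coeffs p))" for x
        using that p el[of x] by (auto simp: elems_def a_0[OF a])
      moreover have "Polynomial.coeff p i \<in> insert 0 (set (Polynomial.coeffs p))" for i
        unfolding range_coeff[symmetric] by blast
      ultimately show ?thesis by (simp add: vpolys_def)
    qed
    have "(submodule_zeta_term (place_ring (field_ring TYPE('k)) v) n (map_mat (place_emb (field_ring TYPE('k)) v) A) s has_sum
      (\<Prod>i<length ed. \<Prod>j=1..sum_list (snd (ed ! i)). \<Prod>w\<in>places_above (fst (ed ! i)) v.
           ideal_zeta (place_ring (root_field (fst (ed ! i))) w)
             (of_nat (partition_inv (dual_partition (snd (ed ! i))) j) * s - of_nat j + 1))) {1..}"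
    proof (rule place_zeta[OF ext vp assms(5) _ _ div(3) _ PQ(1,2) _ _ PQ(3-5)])
      show "?a (A $$ (i, j)) \<le> 1" "?a (P i j) \<le> 1" "?a (Q i j) \<le> 1" if "i < n" "j < n" for i j
        using that by (auto simp: elems_def intro!: el)
      show "good_place ?a (?f i)" if "i < ?N" for i
        unfolding good_place_def
      proof (intro conjI)
        show "\<exists>u\<in>vpolys ?a. \<exists>w\<in>vpolys ?a. u * ?f i + w * pderiv (?f i) = 1"
          using uw[OF that] po[of "u i"] po[of "w i"] that unfolding polys_def by blast
      qed (use that div number_field_local_val[OF ext a] po in \<open>auto simp: polys_def\<close>)
      show "\<exists>u\<in>vpolys ?a. \<exists>w\<in>vpolys ?a. u * ?f i + w * ?f j = 1" if "i < ?N" "j < ?N" "i \<noteq> j" for i j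
      proof -
        have "u' i j \<in> polys" "w' i j \<in> polys" using that unfolding polys_def by force+
        then show ?thesis using po uw'[OF that] by blast
      qed
      show "0 < Re (of_nat (partition_inv (dual_partition (?ls i)) j) * s - of_nat j + 1)"
        if "i < ?N" "j \<in> {1..sum_list (?ls i)}" for i j
        using pos nth_mem[OF that(1)] that(2) by (auto simp: split_beta)
    qed
    then show ?thesis unfolding submodule_zeta_def Let_def has_sum_iff by blast
  qed
  ultimately show ?thesis by blast
qed

end
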